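(* Let $\Omega$ be a bounded connected domain with $k\ge1$ holes as in the standing setting and $B\in C^\infty(\overline\Omega)$. Then there exists $C>0$ such that for every $\Phi\in\mathbb R^k$, every real ${\bf A}\in C^1(\overline\Omega;\mathbb R^2)$ with $\operatorname{curl}{\bf A}=B$ and circulations $\Phi$, and every $h>0$, \[ \lambda^D_{P_-}(h,{\bf A},B,\Omega)\ \ge\ h^2\lambda^D(\Omega)\exp\Big(-\frac Ch\,d\big(\Phi,\Phi_0+2\pi h\mathbb Z^k\big)\Big)\exp\Big(-\frac{2\operatorname{Osc}(\psi_0)}{h}\Big). \] If moreover $B>0$, then \[ \lambda^D_{P_-}(h,{\bf A},B,\Omega)\ \ge\ h^2\lambda^D(\Omega)\exp\Big(-\frac Ch\,d\big(\Phi,\Phi_0+2\pi h\mathbb Z^k\big)\Big)\exp\Big(\frac{2\inf\psi_0}{h}\Big). \]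
   Context: Standing setting: $\Omega=\widetilde\Omega\setminus\bigcup_{j=1}^k\overline{\Omega_j}$, where $\widetilde\Omega\subset\mathbb R^2$ is a bounded simply connected smooth domain and $\Omega_1,\dots,\Omega_k$ are bounded simply connected smooth domains with pairwise disjoint closures contained in $\widetilde\Omega$; $\Omega$ is connected; each $\partial\Omega_j$ is oriented counterclockwise; circulations of ${\bf A}$: $\Phi_j=\oint_{\partial\Omega_j}{\bf A}\cdot dx$. $\operatorname{curl}{\bf A}=\partial_{x_1}A_2-\partial_{x_2}A_1$. $\lambda^D_{P_-}(h,{\bf A},B,\Omega)=\inf_{u\in H^1_0(\Omega)\setminus\{0\}}\big(\|(hD-{\bf A})u\|^2-h\int_\Omega B|u|^2\big)/\|u\|^2$, $D=-i\nabla$; $\lambda^D(\Omega)$ is the lowest Dirichlet Laplacian eigenvalue. $\psi_0$ solves $\Delta\psi_0=B$ in $\Omega$, $\psi_0=0$ on $\partial\Omega$; $\Phi_0\in\mathbb R^k$ is the vector of circulations of $(-\partial_{x_2}\psi_0,\partial_{x_1}\psi_0)$ along $\partial\Omega_1,\dots,\partial\Omega_k$. $d(\Phi,S)$ is the Euclidean distance from $\Phi$ to the set $S\subset\mathbb R^k$. $\operatorname{Osc}(\psi)=\sup\psi-\inf\psi$. *)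

theory Defs
  imports "HOL-Analysis.Analysis"
begin

type_synonym pt = "real \<times> real"

definition pd1 :: "(pt \<Rightarrow> 'b::real_normed_vector) \<Rightarrow> pt \<Rightarrow> 'b" where
  "pd1 f x = vector_derivative (\<lambda>t. f (t, snd x)) (at (fst x))"

definition pd2 :: "(pt \<Rightarrow> 'b::real_normed_vector) \<Rightarrow> pt \<Rightarrow> 'b" where
  "pd2 f x = vector_derivative (\<lambda>t. f (fst x, t)) (at (snd x))"

text \<open>C^infinity: all iterated partial derivatives exist (and f is differentiable) on S,
  and all of them extend continuously to T.  C^inf(U) for open U is Cinf U U;
  C^inf(closure S) is Cinf S (closure S).\<close>
definition Cinf :: "pt set \<Rightarrow> pt set \<Rightarrow> (pt \<Rightarrow> 'b::real_normed_vector) \<Rightarrow> bool" where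
  "Cinf S T f \<longleftrightarrow> (\<exists>F. f \<in> F \<and>
     (\<forall>g\<in>F. continuous_on T g \<and> (\<forall>x\<in>S. g differentiable (at x)) \<and>
        (\<exists>g1\<in>F. \<exists>g2\<in>F. \<forall>x\<in>S. pd1 g x = g1 x \<and> pd2 g x = g2 x)))"

definition C1cl :: "pt set \<Rightarrow> (pt \<Rightarrow> real) \<Rightarrow> bool" where
  "C1cl S f \<longleftrightarrow> continuous_on (closure S) f \<and> (\<forall>x\<in>S. f differentiable (at x)) \<and>
     (\<exists>g1 g2. continuous_on (closure S) g1 \<and> continuous_on (closure S) g2 \<and>
        (\<forall>x\<in>S. pd1 f x = g1 x \<and> pd2 f x = g2 x))"

definition C1field :: "pt set \<Rightarrow> (pt \<Rightarrow> pt) \<Rightarrow> bool" where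
  "C1field S A \<longleftrightarrow> C1cl S (\<lambda>x. fst (A x)) \<and> C1cl S (\<lambda>x. snd (A x))"

definition curl :: "(pt \<Rightarrow> pt) \<Rightarrow> pt \<Rightarrow> real" where
  "curl A x = pd1 (\<lambda>y. snd (A y)) x - pd2 (\<lambda>y. fst (A y)) x"

definition lap :: "(pt \<Rightarrow> real) \<Rightarrow> pt \<Rightarrow> real" where
  "lap f x = pd1 (pd1 f) x + pd2 (pd2 f) x"

definition smooth_sc_domain :: "pt set \<Rightarrow> bool" where
  "smooth_sc_domain D \<longleftrightarrow> open D \<and> D \<noteq> {} \<and> bounded D \<and> connected D \<and> simply_connected D \<and>
     (\<forall>p\<in>frontier D. \<exists>r>0. \<exists>\<rho>::pt \<Rightarrow> real. Cinf (ball p r) (ball p r) \<rho> \<and>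
        (\<forall>x\<in>ball p r. (pd1 \<rho> x, pd2 \<rho> x) \<noteq> 0) \<and>
        D \<inter> ball p r = {x \<in> ball p r. \<rho> x < 0})"

definition rot :: "pt \<Rightarrow> pt" where
  "rot v = (- snd v, fst v)"

text \<open>Regular C^1 1-periodic parametrisation of the boundary of D, simple, traversed so
  that D lies to the left (counterclockwise).\<close>
definition ccw_param :: "pt set \<Rightarrow> (real \<Rightarrow> pt) \<Rightarrow> bool" where
  "ccw_param D \<gamma> \<longleftrightarrow> \<gamma> C1_differentiable_on UNIV \<and> (\<forall>t. \<gamma> (t + 1) = \<gamma> t) \<and>
     inj_on \<gamma> {0..<1} \<and> \<gamma> ` {0..1} = frontier D \<and>
     (\<forall>t. vector_derivative \<gamma> (at t) \<noteq> 0) \<and>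
     (\<forall>t. \<exists>\<epsilon>>0. \<forall>s. 0 < s \<and> s < \<epsilon> \<longrightarrow> \<gamma> t + s *\<^sub>R rot (vector_derivative \<gamma> (at t)) \<in> D)"

definition circulation :: "pt set \<Rightarrow> (pt \<Rightarrow> pt) \<Rightarrow> real" where
  "circulation D F = (THE c. \<exists>\<gamma>. ccw_param D \<gamma> \<and>
      c = integral {0..1} (\<lambda>t. inner (F (\<gamma> t)) (vector_derivative \<gamma> (at t))))"

definition cgrad :: "pt set \<Rightarrow> (pt \<Rightarrow> real) \<Rightarrow> pt \<Rightarrow> pt" where
  "cgrad S f x = Lim (at x within S) (\<lambda>y. (pd1 f y, pd2 f y))"

definition Phi0 :: "pt set \<Rightarrow> ('k \<Rightarrow> pt set) \<Rightarrow> (pt \<Rightarrow> real) \<Rightarrow> real ^ 'k" where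
  "Phi0 S Hs \<psi> = (\<chi> j. circulation (Hs j) (\<lambda>x. (- snd (cgrad S \<psi> x), fst (cgrad S \<psi> x))))"

definition latt :: "real ^ 'k \<Rightarrow> real \<Rightarrow> (real ^ 'k) set" where
  "latt P h = {P + v | v. \<forall>j. \<exists>n::int. v $ j = 2 * pi * h * of_int n}"

definition osc :: "pt set \<Rightarrow> (pt \<Rightarrow> real) \<Rightarrow> real" where
  "osc S f = (SUP x\<in>S. f x) - (INF x\<in>S. f x)"

text \<open>Sobolev space H^1_0(S): u with gradient (g1,g2) is an H^1-limit of test functions.\<close>
definition L2 :: "pt set \<Rightarrow> (pt \<Rightarrow> 'b::{real_normed_vector, second_countable_topology}) \<Rightarrow> bool" where
  "L2 S f \<longleftrightarrow> f \<in> borel_measurable lborel \<and> set_integrable lborel S (\<lambda>x. (norm (f x))\<^sup>2)"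

definition L2sq :: "pt set \<Rightarrow> (pt \<Rightarrow> 'b::real_normed_vector) \<Rightarrow> real" where
  "L2sq S f = (LINT x:S|lborel. (norm (f x))\<^sup>2)"

definition test_fun :: "pt set \<Rightarrow> (pt \<Rightarrow> 'b::real_normed_vector) \<Rightarrow> bool" where
  "test_fun S \<phi> \<longleftrightarrow> Cinf UNIV UNIV \<phi> \<and> compact (closure {x. \<phi> x \<noteq> 0}) \<and>
     closure {x. \<phi> x \<noteq> 0} \<subseteq> S"

definition H10 :: "pt set \<Rightarrow> (pt \<Rightarrow> 'b::{real_normed_vector, second_countable_topology})
    \<Rightarrow> (pt \<Rightarrow> 'b) \<Rightarrow> (pt \<Rightarrow> 'b) \<Rightarrow> bool" where
  "H10 S u g1 g2 \<longleftrightarrow> L2 S u \<and> L2 S g1 \<and> L2 S g2 \<and>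
     (\<exists>\<phi>. (\<forall>n. test_fun S (\<phi> n)) \<and>
        (\<lambda>n. L2sq S (\<lambda>x. \<phi> n x - u x)) \<longlonglongrightarrow> 0 \<and>
        (\<lambda>n. L2sq S (\<lambda>x. pd1 (\<phi> n) x - g1 x)) \<longlonglongrightarrow> 0 \<and>
        (\<lambda>n. L2sq S (\<lambda>x. pd2 (\<phi> n) x - g2 x)) \<longlonglongrightarrow> 0)"

definition lamP :: "real \<Rightarrow> (pt \<Rightarrow> pt) \<Rightarrow> (pt \<Rightarrow> real) \<Rightarrow> pt set \<Rightarrow> real" where
  "lamP h A B S = Inf {(LINT x:S|lborel.
        (cmod (- \<i> * of_real h * g1 x - of_real (fst (A x)) * u x))\<^sup>2
      + (cmod (- \<i> * of_real h * g2 x - of_real (snd (A x)) * u x))\<^sup>2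
      - h * B x * (cmod (u x))\<^sup>2) / L2sq S u
     | u g1 g2. H10 S (u :: pt \<Rightarrow> complex) g1 g2 \<and> L2sq S u \<noteq> 0}"

definition lamD :: "pt set \<Rightarrow> real" where
  "lamD S = Inf {ev. \<exists>u g1 g2 :: pt \<Rightarrow> real. H10 S u g1 g2 \<and> L2sq S u \<noteq> 0 \<and>
      (\<forall>\<phi>::pt \<Rightarrow> real. test_fun S \<phi> \<longrightarrow>
         (LINT x:S|lborel. g1 x * pd1 \<phi> x + g2 x * pd2 \<phi> x) = ev * (LINT x:S|lborel. u x * \<phi> x))}"

end

theory Submission
  imports Defs "HOL-Complex_Analysis.Complex_Analysis"
begin

text \<open>Put \<open>\<psi> = \<psi>\<^sub>0 + \<Sum>\<^sub>j c\<^sub>j ln |x - a\<^sub>j|\<close> with \<open>a\<^sub>j\<close> in the \<open>j\<close>-th hole. Then \<open>\<Delta>\<psi> = B\<close> still holds, so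
  \<open>E = A - (-\<partial>\<^sub>2\<psi>, \<partial>\<^sub>1\<psi>)\<close> is closed, and for any point of the lattice \<open>\<Phi>\<^sub>0 + 2\<pi>h\<int>\<^sup>k\<close> the \<open>c\<^sub>j\<close> can be chosen, bounded by
  the distance of \<open>\<Phi>\<close> to that point, such that all circulations of \<open>E\<close> lie in \<open>2\<pi>h\<int>\<close>. Hence there is a
  unimodular \<open>g\<close> with \<open>\<nabla>g = \<i>Eg/h\<close>, and \<open>w = e\<^bsup>\<psi>/h\<^esup> g\<^sup>* u\<close> satisfies
  \<open>|(p\<^sub>1 + \<i>p\<^sub>2)u| = h e\<^bsup>-\<psi>/h\<^esup> |(\<partial>\<^sub>1 + \<i>\<partial>\<^sub>2)w|\<close> for \<open>p = hD - A\<close>. The quadratic form is the squared norm of \<open>(p\<^sub>1 + \<i>p\<^sub>2)u\<close>, and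
  that of \<open>(\<partial>\<^sub>1 + \<i>\<partial>\<^sub>2)w\<close> is the Dirichlet energy of \<open>w\<close>, so comparing the extreme values of \<open>e\<^bsup>\<psi>/h\<^esup>\<close> bounds the
  form below. If \<open>B > 0\<close>, the maximum principle gives \<open>\<psi>\<^sub>0 \<le> 0\<close>, so \<open>Osc \<psi>\<^sub>0 \<le> - inf \<psi>\<^sub>0\<close>.\<close>

section \<open>Partial derivatives and integration by parts\<close>

text \<open>Three notions shape the proof. \<open>lamD\<close> is an infimum over weak eigenvalues,
  so a Rayleigh bound for it needs an actual minimiser, hence compactness and completeness in L^2.
  \<open>circulation\<close> is a definite description over boundary parametrisations, so one
  counterclockwise parametrisation has to be built from the implicit boundary charts, and all of
  them have to give the same integral. \<open>E\<close> is a closed form only inside the domain,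
  whereas its circulations live on the boundary; boundary curves are therefore pushed into the
  domain and circulations recovered as limits. Periods of chains with equal winding numbers are
  compared by pairing the form with a regularised winding function, without triangulations or
  homotopies. \<open>w\<close> inherits only finite smoothness from \<open>A\<close>, so the bound
  for smooth test functions reaches it by mollification. The constant is 4 k L, where L bounds every
  \<open>ln |x - a_j|\<close> on the closure: the logarithms move \<open>psi\<close> by at most k L
  times the distance to the lattice point, upwards or downwards, and twice the oscillation enters
  the exponent.\<close>

lemma pd1_eq:
  assumes "(f has_derivative f') (at x)" shows "pd1 f x = f' (1, 0)"
proof -
  have "((\<lambda>t. (t, snd x)) has_derivative (\<lambda>t. (t, 0))) (at (fst x))"
    by (auto intro!: derivative_eq_intros)
  then have "((\<lambda>t. f (t, snd x)) has_derivative (\<lambda>t. f' (t, 0))) (at (fst x))"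
    using has_derivative_compose[of "\<lambda>t. (t, snd x)" _ "fst x" UNIV f f'] assms by simp
  moreover have "f' (t, 0) = t *\<^sub>R f' (1, 0)" for t
    using linear_scale[OF has_derivative_linear[OF assms], of t "(1,0)"] by simp
  then have "(\<lambda>t. f' (t, 0)) = (\<lambda>t. t *\<^sub>R f' (1, 0))" by blast
  ultimately have "((\<lambda>t. f (t, snd x)) has_vector_derivative f' (1, 0)) (at (fst x))"
    unfolding has_vector_derivative_def by metis
  then show ?thesis unfolding pd1_def by (rule vector_derivative_at)
qed

lemma pd2_eq:
  assumes "(f has_derivative f') (at x)" shows "pd2 f x = f' (0, 1)"
proof -
  have "((\<lambda>t. (fst x, t)) has_derivative (\<lambda>t. (0, t))) (at (snd x))"
    by (auto intro!: derivative_eq_intros)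
  then have "((\<lambda>t. f (fst x, t)) has_derivative (\<lambda>t. f' (0, t))) (at (snd x))"
    using has_derivative_compose[of "\<lambda>t. (fst x, t)" _ "snd x" UNIV f f'] assms by simp
  moreover have "f' (0, t) = t *\<^sub>R f' (0, 1)" for t
    using linear_scale[OF has_derivative_linear[OF assms], of t "(0,1)"] by simp
  then have "(\<lambda>t. f' (0, t)) = (\<lambda>t. t *\<^sub>R f' (0, 1))" by blast
  ultimately have "((\<lambda>t. f (fst x, t)) has_vector_derivative f' (0, 1)) (at (snd x))"
    unfolding has_vector_derivative_def by metis
  then show ?thesis unfolding pd2_def by (rule vector_derivative_at)
qed

text \<open>Frechet differentiability with the two partial derivatives as explicit data.
  \<open>pd1\<close> and \<open>pd2\<close> see only coordinate slices and carry no chain rule; this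
  predicate has one and determines both by \<open>has_grad_pd\<close>.\<close>

definition has_grad :: "(pt \<Rightarrow> 'b::real_normed_vector) \<Rightarrow> 'b \<Rightarrow> 'b \<Rightarrow> pt \<Rightarrow> bool" where
  "has_grad f a b x \<longleftrightarrow> (f has_derivative (\<lambda>v. fst v *\<^sub>R a + snd v *\<^sub>R b)) (at x)"

lemma has_grad_pd: "has_grad f a b x \<Longrightarrow> pd1 f x = a \<and> pd2 f x = b"
  unfolding has_grad_def by (auto dest: pd1_eq pd2_eq)

lemma has_grad_differentiable: "has_grad f a b x \<Longrightarrow> f differentiable (at x)"
  unfolding has_grad_def differentiable_def by blast

lemma differentiable_has_grad:
  assumes "f differentiable (at x)" shows "has_grad f (pd1 f x) (pd2 f x) x"
proof -
  obtain f' where f': "(f has_derivative f') (at x)" using assms differentiable_def by blast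
  have l: "linear f'" using f' has_derivative_linear by blast
  have "f' v = fst v *\<^sub>R f' (1,0) + snd v *\<^sub>R f' (0,1)" for v
    using linear_add[OF l, of "fst v *\<^sub>R (1,0)" "snd v *\<^sub>R (0,1)"]
      linear_scale[OF l, of "fst v" "(1,0)"] linear_scale[OF l, of "snd v" "(0,1)"] by simp
  then have "f' = (\<lambda>v. fst v *\<^sub>R pd1 f x + snd v *\<^sub>R pd2 f x)"
    unfolding pd1_eq[OF f'] pd2_eq[OF f'] by blast
  then show ?thesis using f' unfolding has_grad_def by metis
qed

lemma has_grad_isCont: "has_grad f a b x \<Longrightarrow> isCont f x"
  by (meson has_grad_def has_derivative_continuous)

lemma has_grad_transform:
  assumes "has_grad f a b x" "open U" "x \<in> U" "\<And>y. y \<in> U \<Longrightarrow> f y = g y"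
  shows "has_grad g a b x"
  using has_derivative_transform_within_open[of f _ x UNIV U g] assms unfolding has_grad_def by auto

lemma has_grad_const: "has_grad (\<lambda>_. c) 0 0 x"
  unfolding has_grad_def by (auto intro!: derivative_eq_intros)

lemma has_grad_add: "has_grad f a b x \<Longrightarrow> has_grad g c d x \<Longrightarrow> has_grad (\<lambda>x. f x + g x) (a + c) (b + d) x"
  unfolding has_grad_def by (auto intro!: derivative_eq_intros simp: algebra_simps)

lemma has_grad_diff: "has_grad f a b x \<Longrightarrow> has_grad g c d x \<Longrightarrow> has_grad (\<lambda>x. f x - g x) (a - c) (b - d) x"
  unfolding has_grad_def by (auto intro!: derivative_eq_intros simp: algebra_simps)

lemma has_grad_sum: "(\<And>i. i \<in> I \<Longrightarrow> has_grad (f i) (a i) (b i) x) \<Longrightarrow>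
    has_grad (\<lambda>x. \<Sum>i\<in>I. f i x) (\<Sum>i\<in>I. a i) (\<Sum>i\<in>I. b i) x"
  by (induction I rule: infinite_finite_induct) (auto intro: has_grad_const has_grad_add)

lemma has_grad_mult:
  fixes f g :: "pt \<Rightarrow> 'a::real_normed_algebra"
  shows "has_grad f a b x \<Longrightarrow> has_grad g c d x \<Longrightarrow>
    has_grad (\<lambda>x. f x * g x) (a * g x + f x * c) (b * g x + f x * d) x"
  unfolding has_grad_def by (auto intro!: derivative_eq_intros simp: algebra_simps)

lemma has_grad_bounded_linear:
  assumes "has_grad f a b x" "bounded_linear L"
  shows "has_grad (\<lambda>x. L (f x)) (L a) (L b) x"
  using bounded_linear.has_derivative[OF assms(2) assms(1)[unfolded has_grad_def]]
  unfolding has_grad_def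
  by (simp add: linear_add[OF bounded_linear.linear[OF assms(2)]] linear_scale[OF bounded_linear.linear[OF assms(2)]])

lemma has_grad_compose:
  fixes f :: "pt \<Rightarrow> real" and g :: "real \<Rightarrow> 'b::real_normed_vector"
  assumes "has_grad f a b x" "(g has_vector_derivative g') (at (f x))"
  shows "has_grad (\<lambda>x. g (f x)) (a *\<^sub>R g') (b *\<^sub>R g') x"
proof -
  have "((\<lambda>x. g (f x)) has_derivative (\<lambda>v. (fst v *\<^sub>R a + snd v *\<^sub>R b) *\<^sub>R g')) (at x)"
    using has_derivative_compose[of f _ x UNIV g "\<lambda>t. t *\<^sub>R g'"] assms
    unfolding has_grad_def has_vector_derivative_def by simp
  then show ?thesis unfolding has_grad_def by (simp add: algebra_simps)
qed

lemma has_grad_along: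
  assumes "has_grad f a b (c t)" "(c has_vector_derivative v) (at t within S)"
  shows "((\<lambda>t. f (c t)) has_vector_derivative (fst v *\<^sub>R a + snd v *\<^sub>R b)) (at t within S)"
proof -
  have "((\<lambda>t. f (c t)) has_derivative (\<lambda>s. fst (s *\<^sub>R v) *\<^sub>R a + snd (s *\<^sub>R v) *\<^sub>R b)) (at t within S)"
    using has_derivative_compose[OF assms(2)[unfolded has_vector_derivative_def] assms(1)[unfolded has_grad_def]] .
  then show ?thesis unfolding has_vector_derivative_def by (simp add: algebra_simps)
qed

lemma has_grad_slice1:
  assumes "has_grad f a b (s, t)" shows "((\<lambda>s. f (s, t)) has_vector_derivative a) (at s within X)"
proof -
  have "((\<lambda>s. (s, t)) has_vector_derivative (1, 0)) (at s within X)"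
    unfolding has_vector_derivative_def by (auto intro!: derivative_eq_intros)
  from has_grad_along[of f a b "\<lambda>s. (s,t)" s, OF assms this] show ?thesis by simp
qed

lemma has_grad_slice2:
  assumes "has_grad f a b (s, t)" shows "((\<lambda>t. f (s, t)) has_vector_derivative b) (at t within X)"
proof -
  have "((\<lambda>t. (s, t)) has_vector_derivative (0, 1)) (at t within X)"
    unfolding has_vector_derivative_def by (auto intro!: derivative_eq_intros)
  from has_grad_along[of f a b "\<lambda>t. (s,t)" t, OF assms this] show ?thesis by simp
qed

lemma has_grad_zero_outside:
  assumes "closed K" "x \<notin> K" "\<And>y. y \<notin> K \<Longrightarrow> f y = 0"
  shows "has_grad f 0 0 x"
  using has_grad_transform[OF has_grad_const, of "- K" x 0 f] assms by auto

lemma has_grad_unique: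
  assumes "has_grad f a b x" "has_grad f c d x" shows "a = c" "b = d"
  using assms has_grad_pd by metis+

section \<open>Integration by parts for compactly supported functions on the plane\<close>

lemma integrable_cont_compact:
  fixes f :: "'a::euclidean_space \<Rightarrow> 'b::euclidean_space"
  assumes "continuous_on UNIV f" "compact K" "\<And>x. x \<notin> K \<Longrightarrow> f x = 0"
  shows "integrable lborel f"
proof -
  have "integrable lborel (\<lambda>x. indicator K x *\<^sub>R f x)"
    using borel_integrable_compact[OF assms(2)] continuous_on_subset[OF assms(1)] by auto
  moreover have "(\<lambda>x. indicator K x *\<^sub>R f x) = f"
    using assms(3) by (auto simp: indicator_def)
  ultimately show ?thesis by simp
qed

lemma integral_deriv_zero:
  fixes F g :: "real \<Rightarrow> real"
  assumes "\<And>x. (F has_vector_derivative g x) (at x)" "continuous_on UNIV g"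
    "\<And>x. \<bar>x\<bar> > R \<Longrightarrow> F x = 0"
  shows "integral\<^sup>L lborel g = 0"
proof -
  \<comment> \<open>\<open>F\<close> vanishes only strictly beyond \<open>R\<close>, and
    \<open>R\<close> may be negative; both end points \<open>r\<close> and \<open>-r\<close> are
    safely outside.\<close>
  define r where "r = \<bar>R\<bar> + 1"
  have g0: "g x = 0" if "x \<notin> {-r..r}" for x
  proof -
    have "\<bar>x\<bar> > R" using that unfolding r_def by auto
    moreover have "open {y::real. R < \<bar>y\<bar>}"
      by (intro open_Collect_less continuous_intros)
    ultimately have "open {y. \<bar>y\<bar> > R}" "x \<in> {y. \<bar>y\<bar> > R}" by auto
    then have "(F has_vector_derivative 0) (at x)"
      using assms(3) has_vector_derivative_transform_within_open[of "\<lambda>_. 0" 0 x "{y. \<bar>y\<bar> > R}" F] by auto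
    then show ?thesis using assms(1)[of x] vector_derivative_unique_at by blast
  qed
  have "integral\<^sup>L lborel g = (\<integral>x. indicator {-r..r} x *\<^sub>R g x \<partial>lborel)"
    using g0 by (intro Bochner_Integration.integral_cong) (auto simp: indicator_def)
  also have "\<dots> = F r - F (-r)"
    by (rule integral_FTC_Icc) (use assms in \<open>auto simp: r_def intro: has_vector_derivative_at_within continuous_on_subset\<close>)
  also have "\<dots> = 0" using assms(3)[of r] assms(3)[of "-r"] by (simp add: r_def)
  finally show ?thesis .
qed

lemma compact_slices:
  assumes "compact (K :: pt set)" "\<And>x. x \<notin> K \<Longrightarrow> f x = 0"
  shows "\<exists>R. \<forall>x y. \<bar>x\<bar> > R \<or> \<bar>y\<bar> > R \<longrightarrow> f (x, y) = 0"
proof -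
  obtain R where R: "\<And>x. x \<in> K \<Longrightarrow> norm x \<le> R" using assms(1) compact_imp_bounded bounded_iff by metis
  have "f (x, y) = 0" if "\<bar>x\<bar> > R \<or> \<bar>y\<bar> > R" for x y
  proof -
    have "norm (x, y) \<ge> \<bar>x\<bar>" "norm (x,y) \<ge> \<bar>y\<bar>" using norm_fst_le[of x y] norm_snd_le[of y x] by auto
    then show ?thesis using R[of "(x,y)"] that assms(2)[of "(x,y)"] by fastforce
  qed
  then show ?thesis by blast
qed

lemma slice1_zero_outside:
  fixes f f1 :: "pt \<Rightarrow> real"
  assumes g: "\<And>x y. ((\<lambda>x. f (x, y)) has_vector_derivative f1 (x, y)) (at x)"
    and K: "closed K" "\<And>x. x \<notin> K \<Longrightarrow> f x = 0" "x \<notin> K"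
  shows "f1 x = 0"
proof -
  have o: "open ((\<lambda>s. (s, snd x)) -` (- K))" by (intro open_vimage open_Compl K continuous_intros)
  have "((\<lambda>s. f (s, snd x)) has_vector_derivative 0) (at (fst x))"
    by (rule has_vector_derivative_transform_within_open[of "\<lambda>_. 0" 0 _ "(\<lambda>s. (s, snd x)) -` (- K)"]) (use K o in auto)
  from vector_derivative_unique_at[OF g[of "snd x" "fst x"] this] show ?thesis by simp
qed

lemma slice2_zero_outside:
  fixes f f1 :: "pt \<Rightarrow> real"
  assumes g: "\<And>x y. ((\<lambda>y. f (x, y)) has_vector_derivative f1 (x, y)) (at y)"
    and K: "closed K" "\<And>x. x \<notin> K \<Longrightarrow> f x = 0" "x \<notin> K"
  shows "f1 x = 0"
proof -
  have o: "open ((\<lambda>s. (fst x, s)) -` (- K))" by (intro open_vimage open_Compl K continuous_intros)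
  have "((\<lambda>s. f (fst x, s)) has_vector_derivative 0) (at (snd x))"
    by (rule has_vector_derivative_transform_within_open[of "\<lambda>_. 0" 0 _ "(\<lambda>s. (fst x, s)) -` (- K)"]) (use K o in auto)
  from vector_derivative_unique_at[OF g[of "fst x" "snd x"] this] show ?thesis by simp
qed

text \<open>Fubini and the one-dimensional fundamental theorem. Differentiability is asked for along
  slices in one direction, so the lemma applies when a single partial derivative is known to be
  continuous.\<close>

lemma ibp_slice1:
  fixes f f1 :: "pt \<Rightarrow> real"
  assumes g: "\<And>x y. ((\<lambda>x. f (x, y)) has_vector_derivative f1 (x, y)) (at x)"
    and c1: "continuous_on UNIV f1" and K: "compact K" "\<And>x. x \<notin> K \<Longrightarrow> f x = 0"
  shows "integrable lborel f1" "integral\<^sup>L lborel f1 = 0"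
proof -
  show i1: "integrable lborel f1"
    by (rule integrable_cont_compact[OF c1 K(1)]) (rule slice1_zero_outside[OF g compact_imp_closed[OF K(1)] K(2)])
  obtain R where fz: "\<forall>x y. \<bar>x\<bar> > R \<or> \<bar>y\<bar> > R \<longrightarrow> f (x, y) = 0"
    using compact_slices[of K f, OF K] by auto
  have "integral\<^sup>L lborel f1 = integral\<^sup>L (lborel \<Otimes>\<^sub>M lborel) f1" by (simp add: lborel_prod)
  also have "\<dots> = (\<integral>y. (\<integral>x. f1 (x, y) \<partial>lborel) \<partial>lborel)"
    using lborel_pair.integral_snd[of "\<lambda>x y. f1 (x, y)"] i1 by (simp add: lborel_prod)
  also have "\<dots> = (\<integral>y. 0 \<partial>(lborel::real measure))"
  proof (rule Bochner_Integration.integral_cong[OF refl])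
    fix y
    show "(\<integral>x. f1 (x, y) \<partial>lborel) = 0"
      by (rule integral_deriv_zero[of "\<lambda>x. f (x, y)" _ R])
        (use fz g in \<open>auto intro!: continuous_on_compose2[OF c1] continuous_intros\<close>)
  qed
  finally show "integral\<^sup>L lborel f1 = 0" by simp
qed

lemma ibp_slice2:
  fixes f f2 :: "pt \<Rightarrow> real"
  assumes g: "\<And>x y. ((\<lambda>y. f (x, y)) has_vector_derivative f2 (x, y)) (at y)"
    and c2: "continuous_on UNIV f2" and K: "compact K" "\<And>x. x \<notin> K \<Longrightarrow> f x = 0"
  shows "integrable lborel f2" "integral\<^sup>L lborel f2 = 0"
proof -
  show i2: "integrable lborel f2"
    by (rule integrable_cont_compact[OF c2 K(1)]) (rule slice2_zero_outside[OF g compact_imp_closed[OF K(1)] K(2)])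
  obtain R where fz: "\<forall>x y. \<bar>x\<bar> > R \<or> \<bar>y\<bar> > R \<longrightarrow> f (x, y) = 0"
    using compact_slices[of K f, OF K] by auto
  have "integral\<^sup>L lborel f2 = integral\<^sup>L (lborel \<Otimes>\<^sub>M lborel) f2" by (simp add: lborel_prod)
  also have "\<dots> = (\<integral>x. (\<integral>y. f2 (x, y) \<partial>lborel) \<partial>lborel)"
    using lborel_pair.integral_fst'[of f2] i2 by (simp add: lborel_prod)
  also have "\<dots> = (\<integral>x. 0 \<partial>(lborel::real measure))"
  proof (rule Bochner_Integration.integral_cong[OF refl])
    fix x
    show "(\<integral>y. f2 (x, y) \<partial>lborel) = 0"
      by (rule integral_deriv_zero[of "\<lambda>y. f (x, y)" _ R])
        (use fz g in \<open>auto intro!: continuous_on_compose2[OF c2] continuous_intros\<close>)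
  qed
  finally show "integral\<^sup>L lborel f2 = 0" by simp
qed

lemma has_grad_integral:
  fixes f :: "pt \<Rightarrow> 'a::euclidean_space \<Rightarrow> real"
  assumes g: "\<And>x t. t \<in> cbox a b \<Longrightarrow> has_grad (\<lambda>x. f x t) (p x t) (q x t) x"
    and f: "\<And>x. continuous_on (cbox a b) (f x)"
    and p: "continuous_on (UNIV \<times> cbox a b) (\<lambda>z. p (fst z) (snd z))"
    and q: "continuous_on (UNIV \<times> cbox a b) (\<lambda>z. q (fst z) (snd z))"
  shows "has_grad (\<lambda>x. integral (cbox a b) (f x)) (integral (cbox a b) (p x)) (integral (cbox a b) (q x)) x"
proof -
  \<comment> \<open>The Leibniz rule takes derivatives given as bounded linear maps; the gradient is
    encoded as a combination of the two coordinate projections.\<close>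
  define fx where "fx x t = p x t *\<^sub>R (fst_blinfun :: pt \<Rightarrow>\<^sub>L real) + q x t *\<^sub>R snd_blinfun" for x t
  have fx: "blinfun_apply (fx x t) = (\<lambda>v. fst v *\<^sub>R p x t + snd v *\<^sub>R q x t)" for x t
    by (auto simp: fx_def blinfun.add_left blinfun.scaleR_left fun_eq_iff)
  have cp: "continuous_on (cbox a b) (p x)" "continuous_on (cbox a b) (q x)" for x
  proof -
    have P: "continuous_on (cbox a b) (\<lambda>t. (x, t))" by (intro continuous_intros)
    show "continuous_on (cbox a b) (p x)" "continuous_on (cbox a b) (q x)"
      using continuous_on_compose2[OF p P] continuous_on_compose2[OF q P] by auto
  qed
  have "((\<lambda>x. integral (cbox a b) (f x)) has_derivative integral (cbox a b) (fx x)) (at x within UNIV)"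
  proof (rule leibniz_rule)
    show "continuous_on (UNIV \<times> cbox a b) (\<lambda>(x, t). fx x t)"
      unfolding fx_def split_def using p q by (intro continuous_intros) auto
    show "((\<lambda>x. f x t) has_derivative blinfun_apply (fx x t)) (at x within UNIV)" if "t \<in> cbox a b" for x t
      using g[of t x] that unfolding fx has_grad_def by auto
    show "f x integrable_on cbox a b" for x
      using integrable_continuous[OF f[of x]] by simp
  qed auto
  moreover have "integral (cbox a b) (fx x) = integral (cbox a b) (p x) *\<^sub>R fst_blinfun + integral (cbox a b) (q x) *\<^sub>R snd_blinfun"
    unfolding fx_def using cp[of x]
    by (intro integral_unique has_integral_add has_integral_scaleR_left) (auto intro!: integrable_integral integrable_continuous)
  ultimately show ?thesis unfolding has_grad_def
    by (auto simp: blinfun.add_left blinfun.scaleR_left elim!: has_derivative_eq_rhs)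
qed

lemma lborel_integral_cbox:
  fixes f :: "'a::euclidean_space \<Rightarrow> 'b::euclidean_space"
  assumes "continuous_on UNIV f" "\<And>x. x \<notin> cbox a b \<Longrightarrow> f x = 0"
  shows "integral\<^sup>L lborel f = integral (cbox a b) f"
proof -
  have "integral\<^sup>L lborel f = integral UNIV f"
    using integral_lborel integrable_cont_compact[OF assms(1) compact_cbox assms(2)] by metis
  also have "\<dots> = integral UNIV (\<lambda>x. if x \<in> cbox a b then f x else 0)"
    using assms(2) by (intro integral_cong) auto
  finally show ?thesis by (simp only: integral_restrict_UNIV)
qed

section \<open>Test functions and mollification\<close>

text \<open>With \<open>p\<close> ranging over all polynomials these functions are closed under
  differentiation, so smoothness of the classical flat function exp(-1/x) reduces to one first-order
  computation.\<close>

definition flat :: "real poly \<Rightarrow> real \<Rightarrow> real" where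
  "flat p x = (if x > 0 then poly p (1 / x) * exp (- (1 / x)) else 0)"

text \<open>In the variable s = 1/x one has ds/dx = - s^2, and the derivative of p(s) e^(-s) in s is
  (p' - p)(s) e^(-s); the factor \<open>[:0, 0, 1:]\<close> is s^2.\<close>

definition flat_deriv :: "real poly \<Rightarrow> real poly" where
  "flat_deriv p = [:0, 0, 1:] * (p - pderiv p)"

text \<open>The power \<open>s ^ k\<close> is there for the induction: passing from \<open>p\<close>
  to \<open>pCons a p\<close> raises \<open>k\<close> by one and adds a monomial.\<close>

lemma poly_exp_tendsto: "((\<lambda>s. s ^ k * poly p s * exp (- s)) \<longlongrightarrow> 0) (at_top :: real filter)"
proof (induction p arbitrary: k)
  case (pCons a p)
  have "((\<lambda>s. a * (s ^ k / exp s) + s ^ Suc k * poly p s * exp (- s)) \<longlongrightarrow> a * 0 + 0) at_top"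
    by (intro tendsto_intros tendsto_power_div_exp_0 pCons.IH)
  then show ?case by (simp add: algebra_simps exp_minus divide_inverse)
qed simp

lemma flat_derivative: "(flat p has_real_derivative flat (flat_deriv p) x) (at x)"
proof (cases x "0::real" rule: linorder_cases)
  case less
  have "(flat p has_real_derivative 0) (at x)"
    by (rule has_field_derivative_transform_within_open[of "\<lambda>_. 0" _ _ "{..<0}"]) (use less in \<open>auto simp: flat_def\<close>)
  then show ?thesis using less by (simp add: flat_def)
next
  case greater
  have "((\<lambda>x. poly p (1 / x) * exp (- (1 / x))) has_real_derivative
      poly (pderiv p) (1 / x) * (- 1 / x\<^sup>2) * exp (- (1 / x)) + poly p (1 / x) * (exp (- (1 / x)) * (1 / x\<^sup>2))) (at x)"
    using greater by (auto intro!: derivative_eq_intros DERIV_chain2[OF poly_DERIV] simp: power2_eq_square)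
  then have "(flat p has_real_derivative
      poly (pderiv p) (1 / x) * (- 1 / x\<^sup>2) * exp (- (1 / x)) + poly p (1 / x) * (exp (- (1 / x)) * (1 / x\<^sup>2))) (at x)"
    by (rule has_field_derivative_transform_within_open[of _ _ _ "{0<..}"]) (use greater in \<open>auto simp: flat_def\<close>)
  moreover have "poly (pderiv p) (1 / x) * (- 1 / x\<^sup>2) * exp (- (1 / x)) + poly p (1 / x) * (exp (- (1 / x)) * (1 / x\<^sup>2))
      = flat (flat_deriv p) x"
    using greater by (simp add: flat_def flat_deriv_def power2_eq_square algebra_simps)
  ultimately show ?thesis by simp
next
  case equal
  have "((\<lambda>h. flat p h / h) \<longlongrightarrow> 0) (at_right 0)"
  proof -
    \<comment> \<open>The difference quotient contributes one more factor 1/h, whence the exponent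
      1.\<close>
    have "((\<lambda>s. s ^ 1 * poly p s * exp (- s)) \<longlongrightarrow> 0) (at_top :: real filter)" by (rule poly_exp_tendsto)
    then have "((\<lambda>h. inverse h ^ 1 * poly p (inverse h) * exp (- inverse h)) \<longlongrightarrow> (0::real)) (at_right 0)"
      by (rule filterlim_compose[OF _ filterlim_inverse_at_top_right])
    then show ?thesis
      by (rule Lim_transform_eventually) (auto simp: eventually_at_right_field flat_def divide_inverse mult_ac intro!: exI[of _ 1])
  qed
  moreover have "((\<lambda>h. flat p h / h) \<longlongrightarrow> 0) (at_left 0)"
    by (rule Lim_transform_eventually[OF tendsto_const]) (auto simp: eventually_at_left_field flat_def intro!: exI[of _ "-1"])
  ultimately have "((\<lambda>h. flat p h / h) \<longlongrightarrow> 0) (at 0)" by (intro filterlim_split_at_real)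
  then show ?thesis using equal by (simp add: flat_def DERIV_def)
qed

text \<open>An algebra that contains the building blocks of the mollifier and is closed under both
  partial derivatives. It serves as the family demanded by \<open>Cinf\<close>; the coefficient
  \<open>c\<close> produces the factors 1 + x and 1 - x and their counterparts in the other
  coordinate.\<close>

inductive_set smooth_fns :: "(pt \<Rightarrow> real) set" where
  coordinate: "(\<lambda>x. flat p (1 + c * fst x)) \<in> smooth_fns"
| coordinate': "(\<lambda>x. flat p (1 + c * snd x)) \<in> smooth_fns"
| const: "(\<lambda>x. c) \<in> smooth_fns"
| add: "f \<in> smooth_fns \<Longrightarrow> g \<in> smooth_fns \<Longrightarrow> (\<lambda>x. f x + g x) \<in> smooth_fns"
| mult: "f \<in> smooth_fns \<Longrightarrow> g \<in> smooth_fns \<Longrightarrow> (\<lambda>x. f x * g x) \<in> smooth_fns"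

lemma has_grad_affine: "has_grad (\<lambda>x. 1 + c * fst x) c 0 x" "has_grad (\<lambda>x. 1 + c * snd x) 0 c x"
  unfolding has_grad_def by (auto intro!: derivative_eq_intros)

lemma smooth_fns_grad: "g \<in> smooth_fns \<Longrightarrow> \<exists>g1\<in>smooth_fns. \<exists>g2\<in>smooth_fns. \<forall>x. has_grad g (g1 x) (g2 x) x"
proof (induction rule: smooth_fns.induct)
  case (coordinate p c)
  have "has_grad (\<lambda>x. flat p (1 + c * fst x)) (c * flat (flat_deriv p) (1 + c * fst x)) (0 * flat (flat_deriv p) (1 + c * fst x)) x" for x
    using has_grad_compose[OF has_grad_affine(1) flat_derivative[unfolded has_real_derivative_iff_has_vector_derivative]] by simp
  then show ?case
    by (intro bexI[of _ "\<lambda>x. c * flat (flat_deriv p) (1 + c * fst x)"] bexI[of _ "\<lambda>x. 0"] smooth_fns.intros) auto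
next
  case (coordinate' p c)
  have "has_grad (\<lambda>x. flat p (1 + c * snd x)) (0 * flat (flat_deriv p) (1 + c * snd x)) (c * flat (flat_deriv p) (1 + c * snd x)) x" for x
    using has_grad_compose[OF has_grad_affine(2) flat_derivative[unfolded has_real_derivative_iff_has_vector_derivative]] by simp
  then show ?case
    by (intro bexI[of _ "\<lambda>x. 0"] bexI[of _ "\<lambda>x. c * flat (flat_deriv p) (1 + c * snd x)"] smooth_fns.intros) auto
next
  case (const c)
  show ?case by (intro bexI[of _ "\<lambda>x. 0"] smooth_fns.intros) (auto intro: has_grad_const)
next
  case (add f g)
  then obtain f1 f2 g1 g2 where "f1 \<in> smooth_fns" "f2 \<in> smooth_fns" "g1 \<in> smooth_fns" "g2 \<in> smooth_fns"
    "\<forall>x. has_grad f (f1 x) (f2 x) x" "\<forall>x. has_grad g (g1 x) (g2 x) x" by blast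
  then show ?case
    by (intro bexI[of _ "\<lambda>x. f1 x + g1 x"] bexI[of _ "\<lambda>x. f2 x + g2 x"] smooth_fns.intros) (auto intro: has_grad_add)
next
  case (mult f g)
  then obtain f1 f2 g1 g2 where "f1 \<in> smooth_fns" "f2 \<in> smooth_fns" "g1 \<in> smooth_fns" "g2 \<in> smooth_fns"
    "\<forall>x. has_grad f (f1 x) (f2 x) x" "\<forall>x. has_grad g (g1 x) (g2 x) x" by blast
  with mult.hyps show ?case
    by (intro bexI[of _ "\<lambda>x. f1 x * g x + f x * g1 x"] bexI[of _ "\<lambda>x. f2 x * g x + f x * g2 x"] smooth_fns.intros)
      (auto intro: has_grad_mult)
qed

lemma smooth_fns_cont: "g \<in> smooth_fns \<Longrightarrow> continuous_on UNIV g"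
  using smooth_fns_grad has_grad_isCont by (blast intro: continuous_at_imp_continuous_on)

text \<open>Positive exactly on the open square (-1,1)^2: a product of one-variable factors is
  easier to differentiate than a radial bump. Its shape is used through two discs, positivity on
  radius 1 and vanishing outside radius 2.\<close>

definition mol :: "pt \<Rightarrow> real" where
  "mol x = flat 1 (1 + 1 * fst x) * flat 1 (1 + (-1) * fst x) * (flat 1 (1 + 1 * snd x) * flat 1 (1 + (-1) * snd x))"

lemma mol_smooth: "mol \<in> smooth_fns" unfolding mol_def[abs_def] by (intro smooth_fns.intros)

lemma flat_nonneg: "flat 1 x \<ge> 0" by (simp add: flat_def)

lemma mol_nonneg: "mol x \<ge> 0" unfolding mol_def by (intro mult_nonneg_nonneg flat_nonneg)

lemma mol_pos: "norm x < 1 \<Longrightarrow> mol x > 0"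
  using norm_fst_le[of "fst x" "snd x"] norm_snd_le[of "snd x" "fst x"]
  unfolding mol_def flat_def by (auto simp: abs_less_iff)

lemma mol_zero: "norm x \<ge> 2 \<Longrightarrow> mol x = 0"
proof -
  assume "norm x \<ge> 2"
  moreover have "norm x \<le> \<bar>fst x\<bar> + \<bar>snd x\<bar>" using norm_Pair_le[of "fst x" "snd x"] by simp
  ultimately have "\<bar>fst x\<bar> \<ge> 1 \<or> \<bar>snd x\<bar> \<ge> 1" by linarith
  then show "mol x = 0" unfolding mol_def flat_def by (auto simp: abs_if split: if_splits)
qed

lemma CinfI_family:
  assumes "f \<in> F" "\<And>g. g \<in> F \<Longrightarrow> \<exists>g1\<in>F. \<exists>g2\<in>F. \<forall>x. has_grad g (g1 x) (g2 x) x"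
  shows "Cinf UNIV UNIV f"
  unfolding Cinf_def
proof (intro exI[of _ F] conjI assms(1) ballI)
  fix g assume "g \<in> F"
  then obtain g1 g2 where g: "g1 \<in> F" "g2 \<in> F" "\<forall>x. has_grad g (g1 x) (g2 x) x" using assms(2) by blast
  then show "continuous_on UNIV g" using has_grad_isCont by (blast intro: continuous_at_imp_continuous_on)
  show "g differentiable (at x)" for x using g(3) has_grad_differentiable by blast
  show "\<exists>g1\<in>F. \<exists>g2\<in>F. \<forall>x\<in>UNIV. pd1 g x = g1 x \<and> pd2 g x = g2 x" using g has_grad_pd by blast
qed

lemma has_grad_scale_shift:
  assumes "has_grad f a b (r *\<^sub>R (x - y))"
  shows "has_grad (\<lambda>x. f (r *\<^sub>R (x - y))) (r *\<^sub>R a) (r *\<^sub>R b) x"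
proof -
  have "((\<lambda>x. r *\<^sub>R (x - y)) has_derivative (\<lambda>v. r *\<^sub>R v)) (at x)" by (auto intro!: derivative_eq_intros)
  from has_derivative_compose[OF this assms[unfolded has_grad_def]]
  show ?thesis unfolding has_grad_def by (simp add: algebra_simps)
qed

lemma has_grad_cmult: "has_grad f a b x \<Longrightarrow> has_grad (\<lambda>x. c * f x) (c * a) (c * b) x" for f :: "pt \<Rightarrow> real"
  using has_grad_mult[OF has_grad_const[of c]] by fastforce

lemma test_fun_ex:
  assumes "open S" "S \<noteq> {}"
  obtains phi :: "pt \<Rightarrow> real" and p r where "test_fun S phi" "r > 0" "\<And>x. x \<in> ball p r \<Longrightarrow> phi x > 0" "ball p r \<subseteq> S"
proof -
  obtain p e where p: "e > 0" "cball p e \<subseteq> S" using assms open_contains_cball by blast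
  \<comment> \<open>\<open>mol\<close> vanishes from norm 2 on, so the scale is half the radius of
    the disc inside \<open>S\<close>.\<close>
  define r where "r = e / 2"
  have r: "r > 0" using p by (simp add: r_def)
  define phi where "phi x = mol ((1 / r) *\<^sub>R (x - p))" for x
  have out: "phi x = 0" if "x \<notin> cball p e" for x
    unfolding phi_def using that p(1)
    by (intro mol_zero) (unfold norm_scaleR mem_cball dist_norm norm_minus_commute[of p], simp add: pos_le_divide_eq r_def)
  have cl: "closure {x. phi x \<noteq> 0} \<subseteq> cball p e"
    using out by (intro closure_minimal) (blast, simp)
  have "Cinf UNIV UNIV phi"
  proof (rule CinfI_family[where F="{\<lambda>x. c * g ((1 / r) *\<^sub>R (x - p)) | c g. g \<in> smooth_fns}"])
    show "phi \<in> {\<lambda>x. c * g ((1 / r) *\<^sub>R (x - p)) | c g. g \<in> smooth_fns}"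
      using mol_smooth by (auto simp: phi_def[abs_def] intro!: exI[of _ 1])
    fix f assume "f \<in> {\<lambda>x. c * g ((1 / r) *\<^sub>R (x - p)) | c g. g \<in> smooth_fns}"
    then obtain c g where f: "f = (\<lambda>x. c * g ((1 / r) *\<^sub>R (x - p)))" "g \<in> smooth_fns" by blast
    obtain g1 g2 where g: "g1 \<in> smooth_fns" "g2 \<in> smooth_fns" "\<forall>x. has_grad g (g1 x) (g2 x) x" using smooth_fns_grad[OF f(2)] by blast
    have "has_grad f (c * (1 / r) * g1 ((1 / r) *\<^sub>R (x - p))) (c * (1 / r) * g2 ((1 / r) *\<^sub>R (x - p))) x" for x
      unfolding f(1) using has_grad_cmult[OF has_grad_scale_shift[OF g(3)[rule_format, of "(1 / r) *\<^sub>R (x - p)"]], of c] by simp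
    then show "\<exists>g1\<in>{\<lambda>x. c * g ((1 / r) *\<^sub>R (x - p)) | c g. g \<in> smooth_fns}. \<exists>g2\<in>{\<lambda>x. c * g ((1 / r) *\<^sub>R (x - p)) | c g. g \<in> smooth_fns}. \<forall>x. has_grad f (g1 x) (g2 x) x"
      using g(1,2) by (intro bexI[of _ "\<lambda>x. c * (1 / r) * g1 ((1 / r) *\<^sub>R (x - p))"] bexI[of _ "\<lambda>x. c * (1 / r) * g2 ((1 / r) *\<^sub>R (x - p))"]) blast+
  qed
  then have "test_fun S phi"
    unfolding test_fun_def using cl p(2) compact_closure bounded_subset[OF bounded_cball] closure_subset
    by (meson bounded_closure_image bounded_subset compact_eq_bounded_closed closed_closure subset_trans bounded_cball)
  moreover have "phi x > 0" if "x \<in> ball p r" for x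
    unfolding phi_def using that r by (intro mol_pos) (simp add: dist_norm norm_minus_commute)
  moreover have "ball p r \<subseteq> cball p e" using p(1) unfolding r_def by (intro order_trans[OF subset_ball ball_subset_cball]) simp
  then have "ball p r \<subseteq> S" using p(2) by blast
  ultimately show thesis using that r by blast
qed

text \<open>The derivative is moved from the mollifier to \<open>f\<close> by integration by parts.\<close>
lemma mollify:
  fixes f f1 f2 :: "pt \<Rightarrow> real"
  assumes f: "\<And>x. has_grad f (f1 x) (f2 x) x" "continuous_on UNIV f1" "continuous_on UNIV f2"
    and K: "compact K" "K \<subseteq> S" "\<And>x. x \<notin> K \<Longrightarrow> f x = 0" and S: "open S" and \<omega>: "\<omega> > 0"
  obtains phi where "test_fun S phi" "\<And>x. \<bar>phi x - f x\<bar> \<le> \<omega>" "\<And>x. \<bar>pd1 phi x - f1 x\<bar> \<le> \<omega>" "\<And>x. \<bar>pd2 phi x - f2 x\<bar> \<le> \<omega>"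
proof -
  obtain e where e: "e > 0" "(\<Union>x\<in>K. cball x e) \<subseteq> S"
    using compact_subset_open_imp_cball_epsilon_subset[OF K(1) S K(2)] .
  \<comment> \<open>This closed neighbourhood of \<open>K\<close> will hold the support of the
    mollified function and still lies inside \<open>S\<close>.\<close>
  define K1 where "K1 = (\<Union>x\<in>K. \<Union>y\<in>cball 0 e. {x + y})"
  have K1: "compact K1" unfolding K1_def by (rule compact_sums'[OF K(1) compact_cball])
  have inK1: "y \<in> K1" if "x \<in> K" "dist x y \<le> e" for x y
    unfolding K1_def using that by (intro UN_I[of x] UN_I[of "y - x"]) (auto simp: dist_norm norm_minus_commute)
  have K1S: "K1 \<subseteq> S" using e(2) by (force simp: K1_def dist_norm)
  have cf: "continuous_on UNIV f" using f(1) has_grad_isCont by (blast intro: continuous_at_imp_continuous_on)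
  have z: "f1 x = 0 \<and> f2 x = 0" if "x \<notin> K" for x
    using has_grad_unique[OF f(1)[of x] has_grad_zero_outside[OF compact_imp_closed[OF K(1)] that K(3)]] by auto
  have uc: "\<exists>d>0. \<forall>x y. dist x y < d \<longrightarrow> \<bar>g x - g y\<bar> \<le> \<omega>" if g: "continuous_on UNIV g" "\<And>x. x \<notin> K \<Longrightarrow> g x = 0" for g :: "pt \<Rightarrow> real"
  proof -
    have "uniformly_continuous_on K1 g" by (rule compact_uniformly_continuous[OF continuous_on_subset[OF g(1)] K1]) auto
    then obtain d where d: "d > 0" "\<And>x y. x \<in> K1 \<Longrightarrow> y \<in> K1 \<Longrightarrow> dist y x < d \<Longrightarrow> dist (g y) (g x) < \<omega>"
      unfolding uniformly_continuous_on_def using \<omega> by metis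
    have "\<bar>g x - g y\<bar> \<le> \<omega>" if "dist x y < min d e" for x y
    proof (cases "x \<in> K \<or> y \<in> K")
      case True
      then have "x \<in> K1" "y \<in> K1" using inK1[of x x] inK1[of x y] inK1[of y y] inK1[of y x] that e(1) by (auto simp: dist_commute)
      then show ?thesis using d(2)[of y x] that by (simp add: dist_real_def)
    next
      case False then show ?thesis using g(2) \<omega> by simp
    qed
    then show ?thesis using d(1) e(1) by (intro exI[of _ "min d e"]) auto
  qed
  obtain d0 where d0: "d0 > 0" "\<And>x y. dist x y < d0 \<Longrightarrow> \<bar>f x - f y\<bar> \<le> \<omega>" using uc[of f] cf K(3) by blast
  obtain d1 where d1: "d1 > 0" "\<And>x y. dist x y < d1 \<Longrightarrow> \<bar>f1 x - f1 y\<bar> \<le> \<omega>" using uc[of f1] f(2) z by blast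
  obtain d2 where d2: "d2 > 0" "\<And>x y. dist x y < d2 \<Longrightarrow> \<bar>f2 x - f2 y\<bar> \<le> \<omega>" using uc[of f2] f(3) z by blast
  \<comment> \<open>The kernel at scale \<open>eps\<close> reaches to distance
    \<open>2 * eps\<close>, hence the half.\<close>
  define eps where "eps = min e (min d0 (min d1 d2)) / 2"
  have eps: "eps > 0" "2 * eps \<le> e" "2 * eps \<le> d0" "2 * eps \<le> d1" "2 * eps \<le> d2"
    using e(1) d0(1) d1(1) d2(1) by (auto simp: eps_def)
  define k where "k g x y = g ((1 / eps) *\<^sub>R (x - y))" for g :: "pt \<Rightarrow> real" and x y
  have kz: "k mol x y = 0" if "dist x y \<ge> 2 * eps" for x y
    unfolding k_def using that eps(1) by (intro mol_zero) (unfold norm_scaleR dist_norm, simp add: pos_le_divide_eq)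
  have ck: "continuous_on UNIV (k g x)" "continuous_on A (\<lambda>z. k g (fst z) (snd z))" if "g \<in> smooth_fns" for g x and A :: "(pt \<times> pt) set"
    unfolding k_def by (intro continuous_on_compose2[OF smooth_fns_cont[OF that]] continuous_intros; simp)+
  \<comment> \<open>\<open>k mol\<close> is not normalised; its mass \<open>M\<close> is divided out
    in \<open>phi\<close>.\<close>
  define M where "M = integral\<^sup>L lborel (k mol 0)"
  have ki: "integrable lborel (k mol x)" for x
    by (rule integrable_cont_compact[OF ck(1)[OF mol_smooth] compact_cball[of x "2 * eps"]]) (use kz in auto)
  have kM: "integral\<^sup>L lborel (k mol x) = M" for x
  proof -
    have "M = integral\<^sup>L (distr lborel borel ((+) (- x))) (k mol 0)" by (simp add: M_def lborel_distr_plus)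
    also have "\<dots> = integral\<^sup>L lborel (\<lambda>y. k mol 0 (- x + y))"
      by (rule integral_distr) (use borel_measurable_continuous_onI[OF ck(1)[OF mol_smooth]] in auto)
    also have "(\<lambda>y. k mol 0 (- x + y)) = k mol x" by (auto simp: k_def)
    finally show ?thesis by simp
  qed
  have M: "M > 0"
  proof -
    have nn: "k mol 0 y \<ge> 0" for y unfolding k_def by (rule mol_nonneg)
    have "M \<noteq> 0"
    proof
      assume "M = 0"
      then have "AE y in lborel. k mol 0 y = 0"
        using integral_nonneg_eq_0_iff_AE[OF ki[of 0]] nn unfolding M_def by auto
      then have "AE y in lborel. y \<notin> ball (0::pt) eps"
      proof (rule AE_mp, intro AE_I2 impI)
        fix y assume "k mol 0 y = 0"
        then show "y \<notin> ball 0 eps" using mol_pos[of "(1 / eps) *\<^sub>R (0 - y)"] eps(1) unfolding k_def by (auto simp: field_simps)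
      qed
      then have "emeasure lborel (ball (0::pt) eps) = 0" by (subst (asm) AE_iff_measurable[of "ball 0 eps"]) auto
      then have "measure lborel (ball (0::pt) eps) = 0" by (simp add: measure_def)
      then show False using content_ball_pos[OF eps(1), of "0::pt"] by simp
    qed
    moreover have "M \<ge> 0" unfolding M_def using nn by (intro integral_nonneg_AE) auto
    ultimately show ?thesis by simp
  qed
  obtain a b where ab: "K \<subseteq> cbox a b" using K(1) compact_imp_bounded bounded_subset_cbox_symmetric by metis
  \<comment> \<open>An integral over a box, so that the Leibniz rule
    \<open>has_grad_integral\<close> applies; \<open>cvL\<close> identifies it with the Lebesgue
    integral used in the estimates.\<close>
  define cv where "cv g x = integral (cbox a b) (\<lambda>y. f y * k g x y)" for g x
  have cvL: "cv g x = integral\<^sup>L lborel (\<lambda>y. f y * k g x y)" if "g \<in> smooth_fns" for g x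
    unfolding cv_def by (rule lborel_integral_cbox[symmetric]) (use K(3) ab in \<open>auto intro!: continuous_on_mult cf ck(1)[OF that]\<close>)
  have kg: "has_grad (\<lambda>x. k g x y) (1 / eps * k g1 x y) (1 / eps * k g2 x y) x" if "\<And>x. has_grad g (g1 x) (g2 x) x" for g g1 g2 x y
    unfolding k_def using has_grad_scale_shift[OF that[of "(1 / eps) *\<^sub>R (x - y)"]] by simp
  have cvg: "has_grad (cv g) (1 / eps * cv g1 x) (1 / eps * cv g2 x) x"
    if "g \<in> smooth_fns" "g1 \<in> smooth_fns" "g2 \<in> smooth_fns" and gr: "\<And>x. has_grad g (g1 x) (g2 x) x" for g g1 g2 x
  proof -
    have "has_grad (cv g) (integral (cbox a b) (\<lambda>y. f y * (1 / eps * k g1 x y))) (integral (cbox a b) (\<lambda>y. f y * (1 / eps * k g2 x y))) x"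
      unfolding cv_def[abs_def]
    proof (rule has_grad_integral)
      show "has_grad (\<lambda>x. f t * k g x t) (f t * (1 / eps * k g1 x t)) (f t * (1 / eps * k g2 x t)) x" for x t
        by (intro has_grad_cmult kg gr)
      show "continuous_on (cbox a b) (\<lambda>y. f y * k g x y)" for x
        by (intro continuous_on_mult continuous_on_subset[OF cf] continuous_on_subset[OF ck(1)[OF that(1)]]) auto
      have cfs: "continuous_on (UNIV \<times> cbox a b) (\<lambda>z::pt\<times>pt. f (snd z))"
        by (intro continuous_on_compose2[OF cf] continuous_intros) auto
      show "continuous_on (UNIV \<times> cbox a b) (\<lambda>z. f (snd z) * (1 / eps * k g1 (fst z) (snd z)))"
        "continuous_on (UNIV \<times> cbox a b) (\<lambda>z. f (snd z) * (1 / eps * k g2 (fst z) (snd z)))"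
        by (intro continuous_on_mult continuous_on_const cfs ck(2) that)+
    qed
    then show ?thesis by (simp add: cv_def mult.left_commute)
  qed
  define phi where "phi x = (1 / M) * cv mol x" for x
  obtain m1 m2 where m: "m1 \<in> smooth_fns" "m2 \<in> smooth_fns" "\<And>x. has_grad mol (m1 x) (m2 x) x" using smooth_fns_grad[OF mol_smooth] by blast
  have phig: "has_grad phi ((1 / M) * (1 / eps * cv m1 x)) ((1 / M) * (1 / eps * cv m2 x)) x" for x
    unfolding phi_def[abs_def] by (rule has_grad_cmult[OF cvg[OF mol_smooth m]])
  have out: "phi x = 0" if "x \<notin> K1" for x
  proof -
    have "f y * k mol x y = 0" for y
    proof (cases "y \<in> K")
      case True
      then have "dist x y \<ge> 2 * eps" using inK1[OF True, of x] that eps(2) by (force simp: dist_commute)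
      then show ?thesis using kz by simp
    next
      case False then show ?thesis using K(3) by simp
    qed
    then have "(\<lambda>y. f y * k mol x y) = (\<lambda>_. 0)" by (rule ext)
    then show ?thesis by (simp add: phi_def cv_def)
  qed
  \<comment> \<open>Each derivative falls on the kernel and costs a factor 1/eps, which the
    coefficient \<open>c\<close> of the family absorbs.\<close>
  have "Cinf UNIV UNIV phi"
  proof (rule CinfI_family[where F="{\<lambda>x. c * cv g x | c g. g \<in> smooth_fns}"])
    show "phi \<in> {\<lambda>x. c * cv g x | c g. g \<in> smooth_fns}" using mol_smooth unfolding phi_def[abs_def] by blast
    fix u assume "u \<in> {\<lambda>x. c * cv g x | c g. g \<in> smooth_fns}"
    then obtain c g where u: "u = (\<lambda>x. c * cv g x)" "g \<in> smooth_fns" by blast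
    obtain g1 g2 where g: "g1 \<in> smooth_fns" "g2 \<in> smooth_fns" "\<And>x. has_grad g (g1 x) (g2 x) x" using smooth_fns_grad[OF u(2)] by blast
    have "has_grad u (c * (1 / eps) * cv g1 x) (c * (1 / eps) * cv g2 x) x" for x
      unfolding u(1) using has_grad_cmult[OF cvg[OF u(2) g], of c] by simp
    then show "\<exists>g1\<in>{\<lambda>x. c * cv g x | c g. g \<in> smooth_fns}. \<exists>g2\<in>{\<lambda>x. c * cv g x | c g. g \<in> smooth_fns}. \<forall>x. has_grad u (g1 x) (g2 x) x"
      using g(1,2) by (intro bexI[of _ "\<lambda>x. c * (1 / eps) * cv g1 x"] bexI[of _ "\<lambda>x. c * (1 / eps) * cv g2 x"]) blast+
  qed
  moreover have "closure {x. phi x \<noteq> 0} \<subseteq> K1"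
    using out compact_imp_closed[OF K1] by (intro closure_minimal) blast+
  then have c: "closure {x. phi x \<noteq> 0} \<subseteq> K1" "bounded (closure {x. phi x \<noteq> 0})"
    using bounded_subset[OF compact_imp_bounded[OF K1]] by blast+
  then have "compact (closure {x. phi x \<noteq> 0})" "closure {x. phi x \<noteq> 0} \<subseteq> S"
    using K1S compact_eq_bounded_closed[of "closure {x. phi x \<noteq> 0}"] by auto
  ultimately have tf: "test_fun S phi" by (simp add: test_fun_def)
  have approx: "\<bar>(1 / M) * integral\<^sup>L lborel (\<lambda>y. g y * k mol x y) - g x\<bar> \<le> \<omega>"
    if g: "continuous_on UNIV g" "\<And>x. x \<notin> K \<Longrightarrow> g x = 0" "\<And>x y. dist x y < 2 * eps \<Longrightarrow> \<bar>g x - g y\<bar> \<le> \<omega>" for g x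
  proof -
    have ig: "integrable lborel (\<lambda>y. g y * k mol x y)"
      by (rule integrable_cont_compact[OF _ K(1)]) (use g(2) in \<open>auto intro!: continuous_on_mult g(1) ck(1)[OF mol_smooth]\<close>)
    have "integral\<^sup>L lborel (\<lambda>y. g y * k mol x y) - g x * M = integral\<^sup>L lborel (\<lambda>y. g y * k mol x y - g x * k mol x y)"
      using ig ki[of x] by (subst Bochner_Integration.integral_diff) (auto simp: kM)
    also have "\<bar>\<dots>\<bar> \<le> integral\<^sup>L lborel (\<lambda>y. \<omega> * k mol x y)"
    proof (rule integral_abs_bound_integral)
      show "integrable lborel (\<lambda>y. g y * k mol x y - g x * k mol x y)" using ig ki[of x] by auto
      show "integrable lborel (\<lambda>y. \<omega> * k mol x y)" using ki[of x] by auto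
      fix y
      have k0: "k mol x y \<ge> 0" unfolding k_def by (rule mol_nonneg)
      have "\<bar>g y * k mol x y - g x * k mol x y\<bar> = \<bar>g y - g x\<bar> * k mol x y"
        using k0 by (simp add: left_diff_distrib[symmetric] abs_mult)
      also have "\<dots> \<le> \<omega> * k mol x y"
      proof (cases "dist x y < 2 * eps")
        case True then show ?thesis using g(3)[of y x] k0 by (intro mult_right_mono) (auto simp: dist_commute)
      next
        case False then show ?thesis using kz[of x y] by simp
      qed
      finally show "\<bar>g y * k mol x y - g x * k mol x y\<bar> \<le> \<omega> * k mol x y" .
    qed
    also have "\<dots> = \<omega> * M" by (simp add: kM)
    finally have "\<bar>integral\<^sup>L lborel (\<lambda>y. g y * k mol x y) - g x * M\<bar> / M \<le> \<omega>" using M by (simp add: divide_le_eq)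
    then have "\<bar>(integral\<^sup>L lborel (\<lambda>y. g y * k mol x y) - g x * M) / M\<bar> \<le> \<omega>" using M by simp
    then show ?thesis using M by (simp add: diff_divide_distrib)
  qed
  have parts: "1 / eps * cv m1 x = integral\<^sup>L lborel (\<lambda>y. f1 y * k mol x y)"
    "1 / eps * cv m2 x = integral\<^sup>L lborel (\<lambda>y. f2 y * k mol x y)" for x
  proof -
    \<comment> \<open>As a function of \<open>y\<close> the kernel is reflected; this gives the
      minus sign that integration by parts cancels.\<close>
    have kr: "has_grad (\<lambda>y. k mol x y) (- (1 / eps) * k m1 x y) (- (1 / eps) * k m2 x y) y" for y
    proof -
      have "((\<lambda>y. (1 / eps) *\<^sub>R (x - y)) has_derivative (\<lambda>v. - (1 / eps) *\<^sub>R v)) (at y)" by (auto intro!: derivative_eq_intros)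
      from has_derivative_compose[OF this m(3)[of "(1 / eps) *\<^sub>R (x - y)", unfolded has_grad_def]]
      show ?thesis unfolding has_grad_def k_def by (simp add: algebra_simps)
    qed
    have g: "has_grad (\<lambda>y. f y * k mol x y) (f1 y * k mol x y + f y * (- (1 / eps) * k m1 x y)) (f2 y * k mol x y + f y * (- (1 / eps) * k m2 x y)) y" for y
      by (rule has_grad_mult[OF f(1) kr])
    have i: "integrable lborel (\<lambda>y. f1 y * k mol x y)" "integrable lborel (\<lambda>y. f2 y * k mol x y)"
      "integrable lborel (\<lambda>y. f y * k m1 x y)" "integrable lborel (\<lambda>y. f y * k m2 x y)"
      by (rule integrable_cont_compact[OF _ K(1)]; use z K(3) in \<open>auto intro!: continuous_on_mult f(2,3) cf ck(1) mol_smooth m(1,2)\<close>)+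
    have c1: "continuous_on UNIV (\<lambda>y. f1 y * k mol x y + f y * (- (1 / eps) * k m1 x y))"
      and c2: "continuous_on UNIV (\<lambda>y. f2 y * k mol x y + f y * (- (1 / eps) * k m2 x y))"
      by (intro continuous_on_add continuous_on_mult continuous_on_const f(2,3) cf ck(1) mol_smooth m(1,2))+
    have s1: "((\<lambda>s. f (s, t) * k mol x (s, t)) has_vector_derivative (f1 (s, t) * k mol x (s, t) + f (s, t) * (- (1 / eps) * k m1 x (s, t)))) (at s)" for s t
      using has_grad_slice1[OF g[of "(s, t)"]] .
    have s2: "((\<lambda>t. f (s, t) * k mol x (s, t)) has_vector_derivative (f2 (s, t) * k mol x (s, t) + f (s, t) * (- (1 / eps) * k m2 x (s, t)))) (at t)" for s t
      using has_grad_slice2[OF g[of "(s, t)"]] .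
    have "integral\<^sup>L lborel (\<lambda>y. f1 y * k mol x y + (- (1 / eps)) * (f y * k m1 x y)) = 0"
      using ibp_slice1(2)[of "\<lambda>y. f y * k mol x y", OF s1 c1 K(1)] K(3) by (simp add: mult.left_commute)
    then show "1 / eps * cv m1 x = integral\<^sup>L lborel (\<lambda>y. f1 y * k mol x y)"
      using i by (subst (asm) Bochner_Integration.integral_add) (auto simp: cvL[OF m(1)])
    have "integral\<^sup>L lborel (\<lambda>y. f2 y * k mol x y + (- (1 / eps)) * (f y * k m2 x y)) = 0"
      using ibp_slice2(2)[of "\<lambda>y. f y * k mol x y", OF s2 c2 K(1)] K(3) by (simp add: mult.left_commute)
    then show "1 / eps * cv m2 x = integral\<^sup>L lborel (\<lambda>y. f2 y * k mol x y)"
      using i by (subst (asm) Bochner_Integration.integral_add) (auto simp: cvL[OF m(2)])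
  qed
  show thesis
  proof (rule that[OF tf])
    fix x
    show "\<bar>phi x - f x\<bar> \<le> \<omega>" using approx[of f x] cf K(3) d0(2) eps(3) by (simp add: phi_def cvL[OF mol_smooth])
    have p: "pd1 phi x = (1 / M) * integral\<^sup>L lborel (\<lambda>y. f1 y * k mol x y)"
      "pd2 phi x = (1 / M) * integral\<^sup>L lborel (\<lambda>y. f2 y * k mol x y)"
      using has_grad_pd[OF phig[unfolded parts]] by blast+
    show "\<bar>pd1 phi x - f1 x\<bar> \<le> \<omega>" unfolding p(1) by (rule approx) (use f(2) z d1(2) eps(4) in auto)
    show "\<bar>pd2 phi x - f2 x\<bar> \<le> \<omega>" unfolding p(2) by (rule approx) (use f(3) z d2(2) eps(5) in auto)
  qed
qed

section \<open>Square-integrable functions\<close>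

definition sq_int :: "'a measure \<Rightarrow> ('a \<Rightarrow> 'b::{banach, second_countable_topology}) \<Rightarrow> bool" where
  "sq_int M f \<longleftrightarrow> f \<in> borel_measurable M \<and> integrable M (\<lambda>x. (norm (f x))\<^sup>2)"

lemma sq_intD: "sq_int M f \<Longrightarrow> f \<in> borel_measurable M" "sq_int M f \<Longrightarrow> integrable M (\<lambda>x. (norm (f x))\<^sup>2)"
  by (auto simp: sq_int_def)

lemma norm_add_sq: "(norm (a + b))\<^sup>2 \<le> 2 * (norm a)\<^sup>2 + 2 * (norm b)\<^sup>2" for a b :: "'b::real_normed_vector"
proof -
  have "(norm (a + b))\<^sup>2 \<le> (norm a + norm b)\<^sup>2" by (intro power_mono norm_triangle_ineq) simp
  also have "\<dots> \<le> 2 * (norm a)\<^sup>2 + 2 * (norm b)\<^sup>2"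
    using sum_squares_bound[of "norm a" "norm b"] by (simp add: power2_sum)
  finally show ?thesis .
qed

lemma norm_diff_sq: "(norm (a - b))\<^sup>2 \<le> 2 * (norm a)\<^sup>2 + 2 * (norm b)\<^sup>2" for a b :: "'b::real_normed_vector"
  using norm_add_sq[of a "- b"] by simp

lemma sq_int_add:
  assumes "sq_int M f" "sq_int M g" shows "sq_int M (\<lambda>x. f x + g x)"
proof -
  note m[measurable] = sq_intD(1)[OF assms(1)] sq_intD(1)[OF assms(2)]
  have "integrable M (\<lambda>x. 2 * (norm (f x))\<^sup>2 + 2 * (norm (g x))\<^sup>2)" using sq_intD(2)[OF assms(1)] sq_intD(2)[OF assms(2)] by simp
  then have "integrable M (\<lambda>x. (norm (f x + g x))\<^sup>2)"
    by (rule Bochner_Integration.integrable_bound) (use norm_add_sq in auto)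
  then show ?thesis by (simp add: sq_int_def)
qed

lemma sq_int_scaleR: "sq_int M f \<Longrightarrow> sq_int M (\<lambda>x. (c::real) *\<^sub>R f x)"
  unfolding sq_int_def by (auto simp: power_mult_distrib)

lemma sq_int_diff: "sq_int M f \<Longrightarrow> sq_int M g \<Longrightarrow> sq_int M (\<lambda>x. f x - g x)"
  using sq_int_add[of M f "\<lambda>x. (-1) *\<^sub>R g x"] sq_int_scaleR[of M g "-1"] by simp

lemma sq_int_mult:
  fixes f g :: "'a \<Rightarrow> real"
  assumes "sq_int M f" "sq_int M g" shows "integrable M (\<lambda>x. f x * g x)"
proof -
  note m[measurable] = sq_intD(1)[OF assms(1)] sq_intD(1)[OF assms(2)]
  have "integrable M (\<lambda>x. (norm (f x))\<^sup>2 + (norm (g x))\<^sup>2)" using sq_intD(2)[OF assms(1)] sq_intD(2)[OF assms(2)] by simp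
  then show ?thesis
  proof (rule Bochner_Integration.integrable_bound)
    have "norm (f x * g x) \<le> norm ((norm (f x))\<^sup>2 + (norm (g x))\<^sup>2)" for x
    proof -
      have "2 * \<bar>f x\<bar> * \<bar>g x\<bar> \<le> \<bar>f x\<bar>\<^sup>2 + \<bar>g x\<bar>\<^sup>2" by (rule sum_squares_bound)
      moreover have "0 \<le> \<bar>f x\<bar> * \<bar>g x\<bar>" by simp
      moreover have "\<bar>f x * g x\<bar> = \<bar>f x\<bar> * \<bar>g x\<bar>" by (rule abs_mult)
      ultimately show ?thesis by simp
    qed
    then show "AE x in M. norm (f x * g x) \<le> norm ((norm (f x))\<^sup>2 + (norm (g x))\<^sup>2)" by simp
  qed simp
qed

text \<open>Stands in for Cauchy-Schwarz in the L^2 limits: by Young's inequality 2 d q \<le>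
  d^2/eta + eta q^2 the error splits into a multiple of \<open>D n\<close>, which tends to 0 for
  fixed eta, and a remainder of order eta. \<open>G + 1\<close> avoids a division by zero.\<close>

lemma tendsto_eta:
  fixes X D :: "nat \<Rightarrow> real"
  assumes D: "D \<longlonglongrightarrow> 0" and b: "\<And>eta n. eta > 0 \<Longrightarrow> \<bar>X n - x\<bar> \<le> A eta * D n + eta * G" and G: "G \<ge> 0"
  shows "X \<longlonglongrightarrow> x"
proof (rule LIMSEQ_I)
  fix e :: real assume e: "e > 0"
  define eta where "eta = (e / 2) / (G + 1)"
  have eta: "eta > 0" "eta * G < e"
  proof -
    show "eta > 0" using e G by (simp add: eta_def)
    have "eta * G \<le> eta * (G + 1)" using \<open>eta > 0\<close> by simp
    also have "\<dots> = e / 2" using G by (intro iffD1[OF nonzero_eq_divide_eq eta_def]) simp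
    finally show "eta * G < e" using e by simp
  qed
  have "(\<lambda>n. A eta * D n + eta * G) \<longlonglongrightarrow> A eta * 0 + eta * G" by (intro tendsto_intros D)
  then have "\<forall>\<^sub>F n in sequentially. A eta * D n + eta * G < e" using eta(2) order_tendstoD(2) by fastforce
  then obtain N where N: "\<And>n. n \<ge> N \<Longrightarrow> A eta * D n + eta * G < e" unfolding eventually_sequentially by blast
  have "norm (X n - x) < e" if "n \<ge> N" for n
  proof -
    have "norm (X n - x) \<le> A eta * D n + eta * G" using b[OF eta(1), of n] by simp
    also have "\<dots> < e" by (rule N[OF that])
    finally show ?thesis .
  qed
  then show "\<exists>N. \<forall>n\<ge>N. norm (X n - x) < e" by blast
qed

text \<open>The weight \<open>b\<close> is constantly 1 for norms and the magnetic field for the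
  potential term of the form.\<close>

lemma sq_int_norm_tendsto:
  fixes f :: "nat \<Rightarrow> 'a::euclidean_space \<Rightarrow> 'b::{banach, second_countable_topology}" and b :: "'a \<Rightarrow> real"
  assumes f: "\<And>n. sq_int M (f n)" "sq_int M g" and l: "(\<lambda>n. \<integral>x. (norm (f n x - g x))\<^sup>2 \<partial>M) \<longlonglongrightarrow> 0"
    and b: "b \<in> borel_measurable M" "\<And>x. x \<in> space M \<Longrightarrow> \<bar>b x\<bar> \<le> B"
  shows "(\<lambda>n. \<integral>x. b x * (norm (f n x))\<^sup>2 \<partial>M) \<longlonglongrightarrow> (\<integral>x. b x * (norm (g x))\<^sup>2 \<partial>M)"
    "\<And>n. integrable M (\<lambda>x. b x * (norm (f n x))\<^sup>2)" "integrable M (\<lambda>x. b x * (norm (g x))\<^sup>2)"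
proof -
  have ib: "integrable M (\<lambda>x. b x * (norm (h x))\<^sup>2)" if h: "sq_int M h" for h :: "'a \<Rightarrow> 'b"
  proof -
    note [measurable] = sq_intD(1)[OF h] b(1)
    have "integrable M (\<lambda>x. B * (norm (h x))\<^sup>2)" using sq_intD(2)[OF h] by simp
    then show ?thesis
    proof (rule Bochner_Integration.integrable_bound)
      have "norm (b x * (norm (h x))\<^sup>2) \<le> norm (B * (norm (h x))\<^sup>2)" if "x \<in> space M" for x
      proof -
        have "\<bar>b x\<bar> * (norm (h x))\<^sup>2 \<le> \<bar>B\<bar> * (norm (h x))\<^sup>2" using b(2)[OF that] by (intro mult_right_mono) auto
        then show ?thesis by (simp add: abs_mult)
      qed
      then show "AE x in M. norm (b x * (norm (h x))\<^sup>2) \<le> norm (B * (norm (h x))\<^sup>2)" by simp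
    qed simp
  qed
  show "integrable M (\<lambda>x. b x * (norm (f n x))\<^sup>2)" for n using ib[OF f(1)] .
  show "integrable M (\<lambda>x. b x * (norm (g x))\<^sup>2)" using ib[OF f(2)] .
  define D where "D n = (\<integral>x. (norm (f n x - g x))\<^sup>2 \<partial>M)" for n
  define G where "G = (\<integral>x. (norm (g x))\<^sup>2 \<partial>M)"
  show "(\<lambda>n. \<integral>x. b x * (norm (f n x))\<^sup>2 \<partial>M) \<longlonglongrightarrow> (\<integral>x. b x * (norm (g x))\<^sup>2 \<partial>M)"
  proof (rule tendsto_eta[of D _ _ "\<lambda>eta. \<bar>B\<bar> * (1 + 1 / eta)" "\<bar>B\<bar> * G"])
    show "D \<longlonglongrightarrow> 0" using l by (simp add: D_def[abs_def])
    show "\<bar>B\<bar> * G \<ge> 0" by (simp add: G_def)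
    fix eta :: real and n assume eta: "eta > 0"
    have "(\<integral>x. b x * (norm (f n x))\<^sup>2 \<partial>M) - (\<integral>x. b x * (norm (g x))\<^sup>2 \<partial>M) = (\<integral>x. b x * (norm (f n x))\<^sup>2 - b x * (norm (g x))\<^sup>2 \<partial>M)"
      using ib f by (subst Bochner_Integration.integral_diff) auto
    also have "\<bar>\<dots>\<bar> \<le> (\<integral>x. \<bar>B\<bar> * ((1 + 1 / eta) * (norm (f n x - g x))\<^sup>2 + eta * (norm (g x))\<^sup>2) \<partial>M)"
    proof (rule integral_abs_bound_integral)
      show "integrable M (\<lambda>x. b x * (norm (f n x))\<^sup>2 - b x * (norm (g x))\<^sup>2)" using ib f by auto
      show "integrable M (\<lambda>x. \<bar>B\<bar> * ((1 + 1 / eta) * (norm (f n x - g x))\<^sup>2 + eta * (norm (g x))\<^sup>2))"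
        using sq_intD(2)[OF f(2)] sq_intD(2)[OF sq_int_diff[OF f(1)[of n] f(2)]] by simp
      fix x assume x: "x \<in> space M"
      define p where "p = norm (f n x)"
      define q where "q = norm (g x)"
      define d where "d = norm (f n x - g x)"
      have pq: "\<bar>p - q\<bar> \<le> d" unfolding p_def q_def d_def by (rule norm_triangle_ineq3)
      have n0: "p \<ge> 0" "q \<ge> 0" "d \<ge> 0" by (auto simp: p_def q_def d_def)
      have "\<bar>p\<^sup>2 - q\<^sup>2\<bar> = \<bar>p - q\<bar> * (p + q)" using n0 by (simp add: power2_eq_square square_diff_square_factored abs_mult mult.commute)
      also have "\<dots> \<le> d * (d + 2 * q)" using pq n0 by (intro mult_mono) auto
      also have "\<dots> = d\<^sup>2 + 2 * d * q" by (simp add: power2_eq_square algebra_simps)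
      also have "2 * d * q \<le> d\<^sup>2 / eta + eta * q\<^sup>2"
      proof -
        have "0 \<le> (d - eta * q)\<^sup>2 / eta" using eta by simp
        also have "\<dots> = d\<^sup>2 / eta + eta * q\<^sup>2 - 2 * d * q" using eta by (simp add: power2_eq_square field_simps)
        finally show ?thesis by simp
      qed
      finally have "\<bar>p\<^sup>2 - q\<^sup>2\<bar> \<le> (1 + 1 / eta) * d\<^sup>2 + eta * q\<^sup>2" by (simp add: algebra_simps)
      then have "\<bar>b x\<bar> * \<bar>p\<^sup>2 - q\<^sup>2\<bar> \<le> \<bar>B\<bar> * ((1 + 1 / eta) * d\<^sup>2 + eta * q\<^sup>2)"
        using b(2)[OF x] by (intro mult_mono) auto
      then show "\<bar>b x * (norm (f n x))\<^sup>2 - b x * (norm (g x))\<^sup>2\<bar> \<le> \<bar>B\<bar> * ((1 + 1 / eta) * (norm (f n x - g x))\<^sup>2 + eta * (norm (g x))\<^sup>2)"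
        by (simp add: p_def q_def d_def right_diff_distrib[symmetric] abs_mult)
    qed
    also have "\<dots> = \<bar>B\<bar> * (1 + 1 / eta) * D n + eta * (\<bar>B\<bar> * G)"
      using sq_intD(2)[OF f(2)] sq_intD(2)[OF sq_int_diff[OF f(1)[of n] f(2)]] by (simp add: D_def G_def algebra_simps)
    finally show "\<bar>(\<integral>x. b x * (norm (f n x))\<^sup>2 \<partial>M) - (\<integral>x. b x * (norm (g x))\<^sup>2 \<partial>M)\<bar> \<le> \<bar>B\<bar> * (1 + 1 / eta) * D n + eta * (\<bar>B\<bar> * G)" .
  qed
qed

lemma sq_int_inner_tendsto:
  fixes f :: "nat \<Rightarrow> 'a::euclidean_space \<Rightarrow> real"
  assumes f: "\<And>n. sq_int M (f n)" "sq_int M g" and l: "(\<lambda>n. \<integral>x. (norm (f n x - g x))\<^sup>2 \<partial>M) \<longlonglongrightarrow> 0" and h: "sq_int M h"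
  shows "(\<lambda>n. \<integral>x. f n x * h x \<partial>M) \<longlonglongrightarrow> (\<integral>x. g x * h x \<partial>M)"
proof (rule tendsto_eta[OF l, of _ _ "\<lambda>eta. 1 / eta" "\<integral>x. (norm (h x))\<^sup>2 \<partial>M"])
  fix eta :: real and n assume eta: "eta > 0"
  note i = sq_int_mult[OF f(1)[of n] h] sq_int_mult[OF f(2) h] sq_intD(2)[OF h] sq_intD(2)[OF sq_int_diff[OF f(1)[of n] f(2)]]
  have "(\<integral>x. f n x * h x \<partial>M) - (\<integral>x. g x * h x \<partial>M) = (\<integral>x. f n x * h x - g x * h x \<partial>M)"
    using i by (subst Bochner_Integration.integral_diff) auto
  also have "\<bar>\<dots>\<bar> \<le> (\<integral>x. 1 / eta * (norm (f n x - g x))\<^sup>2 + eta * (norm (h x))\<^sup>2 \<partial>M)"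
  proof (rule integral_abs_bound_integral)
    show "integrable M (\<lambda>x. f n x * h x - g x * h x)" using i by simp
    show "integrable M (\<lambda>x. 1 / eta * (norm (f n x - g x))\<^sup>2 + eta * (norm (h x))\<^sup>2)" using i by simp
    fix x
    define d where "d = \<bar>f n x - g x\<bar>"
    define q where "q = \<bar>h x\<bar>"
    have "0 \<le> (d - eta * q)\<^sup>2 / eta" using eta by simp
    also have "\<dots> = 1 / eta * d\<^sup>2 + eta * q\<^sup>2 - 2 * d * q" using eta by (simp add: power2_eq_square field_simps)
    finally have "2 * (d * q) \<le> 1 / eta * d\<^sup>2 + eta * q\<^sup>2" by simp
    moreover have "0 \<le> d * q" by (simp add: d_def q_def)
    ultimately have "d * q \<le> 1 / eta * d\<^sup>2 + eta * q\<^sup>2" by linarith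
    then show "\<bar>f n x * h x - g x * h x\<bar> \<le> 1 / eta * (norm (f n x - g x))\<^sup>2 + eta * (norm (h x))\<^sup>2"
      by (simp add: d_def q_def left_diff_distrib[symmetric] abs_mult)
  qed
  also have "\<dots> = 1 / eta * (\<integral>x. (norm (f n x - g x))\<^sup>2 \<partial>M) + eta * (\<integral>x. (norm (h x))\<^sup>2 \<partial>M)" using i by simp
  finally show "\<bar>(\<integral>x. f n x * h x \<partial>M) - (\<integral>x. g x * h x \<partial>M)\<bar> \<le> 1 / eta * (\<integral>x. (norm (f n x - g x))\<^sup>2 \<partial>M) + eta * (\<integral>x. (norm (h x))\<^sup>2 \<partial>M)" .
qed simp

text \<open>Riesz-Fischer: a fast subsequence converges almost everywhere, and Fatou's lemma turns
  the Cauchy estimates into L^2 convergence of the whole sequence.\<close>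

lemma sq_int_complete:
  fixes f :: "nat \<Rightarrow> 'a \<Rightarrow> real"
  assumes M: "finite_measure M" and f: "\<And>n. sq_int M (f n)"
    and C: "\<And>e. e > 0 \<Longrightarrow> \<exists>N. \<forall>m\<ge>N. \<forall>n\<ge>N. (\<integral>x. (f m x - f n x)\<^sup>2 \<partial>M) < e"
  obtains g where "sq_int M g" "(\<lambda>n. \<integral>x. (f n x - g x)\<^sup>2 \<partial>M) \<longlonglongrightarrow> 0"
proof -
  interpret finite_measure M by (rule M)
  have [measurable]: "f n \<in> borel_measurable M" for n using sq_intD(1)[OF f] .
  have id: "integrable M (\<lambda>x. (f m x - f n x)\<^sup>2)" for m n using sq_intD(2)[OF sq_int_diff[OF f f]] by simp
  \<comment> \<open>The rate 1/8^k survives the loss of 2^k below: 2^k/8^k = 1/4^k is at most 1/2^k,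
    so the differences are summable in L^1.\<close>
  have "\<forall>k. \<exists>N. \<forall>m\<ge>N. \<forall>n\<ge>N. (\<integral>x. (f m x - f n x)\<^sup>2 \<partial>M) < (1/8)^k" using C by simp
  then obtain N where N: "\<And>k m n. m \<ge> N k \<Longrightarrow> n \<ge> N k \<Longrightarrow> (\<integral>x. (f m x - f n x)\<^sup>2 \<partial>M) < (1/8)^k" by metis
  \<comment> \<open>Partial sums make the indices increase while dominating both \<open>N k\<close>
    and \<open>k\<close>.\<close>
  define r where "r k = (\<Sum>i\<le>k. N i + 1)" for k
  have rN: "r k \<ge> N k" for k unfolding r_def using member_le_sum[of k "{..k}" "\<lambda>i. N i + 1"] by simp
  have rS: "r (Suc k) \<ge> N k" for k using rN[of k] by (simp add: r_def)
  have rk: "r k \<ge> k" for k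
  proof -
    have "(\<Sum>i\<le>k. 1) \<le> r k" unfolding r_def by (intro sum_mono) auto
    then show ?thesis by simp
  qed
  define d where "d k x = f (r (Suc k)) x - f (r k) x" for k x
  have [measurable]: "d k \<in> borel_measurable M" for k unfolding d_def by simp
  have d8: "(\<integral>x. (d k x)\<^sup>2 \<partial>M) < (1/8)^k" for k unfolding d_def by (rule N[OF rS rN])
  have id2: "integrable M (\<lambda>x. (d k x)\<^sup>2)" for k unfolding d_def by (rule id)
  \<comment> \<open>Expand the square of 2^(-k) - |d|. On a finite measure space this converts L^2
    smallness into L^1 summability.\<close>
  have le: "\<bar>d k x\<bar> \<le> (1/2)^k + 2^k * (d k x)\<^sup>2" for k x
  proof -
    have "0 \<le> ((1/2)^k - \<bar>d k x\<bar>)\<^sup>2" by simp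
    then have "2 * (1/2)^k * \<bar>d k x\<bar> \<le> ((1/2)^k)\<^sup>2 + (d k x)\<^sup>2" by (simp add: power2_diff)
    moreover have "(1/2)^k * \<bar>d k x\<bar> \<ge> 0" by simp
    ultimately have "(1/2)^k * \<bar>d k x\<bar> \<le> ((1/2)^k)\<^sup>2 + (d k x)\<^sup>2" by linarith
    then have "2^k * ((1/2)^k * \<bar>d k x\<bar>) \<le> 2^k * (((1/2)^k)\<^sup>2 + (d k x)\<^sup>2)" by (intro mult_left_mono) auto
    moreover have "(2::real)^k * (1/2)^k = 1" by (simp add: power_mult_distrib[symmetric])
    ultimately show ?thesis by (simp add: distrib_left power2_eq_square mult.assoc[symmetric])
  qed
  have nnd: "(\<integral>\<^sup>+x. ennreal \<bar>d k x\<bar> \<partial>M) \<le> ennreal ((1/2)^k * (measure M (space M) + 1))" for k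
  proof -
    have ii: "integrable M (\<lambda>x. (1/2)^k + 2^k * (d k x)\<^sup>2)" using id2 by simp
    have "(\<integral>\<^sup>+x. ennreal \<bar>d k x\<bar> \<partial>M) \<le> (\<integral>\<^sup>+x. ennreal ((1/2)^k + 2^k * (d k x)\<^sup>2) \<partial>M)"
      by (intro nn_integral_mono ennreal_leI le)
    also have "\<dots> = ennreal (\<integral>x. (1/2)^k + 2^k * (d k x)\<^sup>2 \<partial>M)"
      by (rule nn_integral_eq_integral[OF ii]) simp
    also have "(\<integral>x. (1/2)^k + 2^k * (d k x)\<^sup>2 \<partial>M) = (1/2)^k * measure M (space M) + 2^k * (\<integral>x. (d k x)\<^sup>2 \<partial>M)"
      using id2 by simp
    also have "\<dots> \<le> (1/2)^k * measure M (space M) + 2^k * (1/8)^k"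
      using d8[of k] by (intro add_left_mono mult_left_mono) auto
    also have "(2::real)^k * (1/8)^k = (1/4)^k" by (simp add: power_mult_distrib[symmetric])
    also have "(1/4::real)^k \<le> (1/2)^k" by (intro power_mono) auto
    finally show ?thesis by (simp add: distrib_left ennreal_leI)
  qed
  have "(\<integral>\<^sup>+x. (\<Sum>k. ennreal \<bar>d k x\<bar>) \<partial>M) = (\<Sum>k. \<integral>\<^sup>+x. ennreal \<bar>d k x\<bar> \<partial>M)"
    by (rule nn_integral_suminf) simp
  also have "\<dots> \<le> (\<Sum>k. ennreal ((1/2)^k * (measure M (space M) + 1)))"
    by (intro suminf_le nnd) auto
  also have "\<dots> = ennreal (\<Sum>k. (1/2)^k * (measure M (space M) + 1))"
    by (rule suminf_ennreal2) (auto intro: summable_mult2 summable_geometric)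
  also have "\<dots> < \<infinity>" by simp
  finally have "AE x in M. (\<Sum>k. ennreal \<bar>d k x\<bar>) \<noteq> \<infinity>"
    by (intro nn_integral_PInf_AE) auto
  then have conv: "AE x in M. convergent (\<lambda>k. f (r k) x)"
  proof (rule AE_mp, intro AE_I2 impI)
    fix x assume "(\<Sum>k. ennreal \<bar>d k x\<bar>) \<noteq> \<infinity>"
    then have "summable (\<lambda>k. \<bar>d k x\<bar>)" by (intro summable_suminf_not_top) auto
    then have "summable (\<lambda>k. d k x)" by (rule summable_rabs_cancel)
    then have "(\<lambda>n. \<Sum>k<n. d k x) \<longlonglongrightarrow> (\<Sum>k. d k x)" by (rule summable_LIMSEQ)
    moreover have "(\<Sum>k<n. d k x) = f (r n) x - f (r 0) x" for n
      unfolding d_def by (rule sum_lessThan_telescope)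
    ultimately have "(\<lambda>n. (f (r n) x - f (r 0) x) + f (r 0) x) \<longlonglongrightarrow> (\<Sum>k. d k x) + f (r 0) x"
      by (intro tendsto_add) auto
    then show "convergent (\<lambda>k. f (r k) x)" by (auto simp: convergent_def)
  qed
  define g where "g x = lim (\<lambda>k. f (r k) x)" for x
  have [measurable]: "g \<in> borel_measurable M" unfolding g_def by (rule borel_measurable_lim_metric) simp
  have conv': "AE x in M. (\<lambda>k. f (r k) x) \<longlonglongrightarrow> g x"
    using conv by eventually_elim (simp add: g_def convergent_LIMSEQ_iff)
  have fatou: "integrable M (\<lambda>x. (f n x - g x)\<^sup>2) \<and> (\<integral>x. (f n x - g x)\<^sup>2 \<partial>M) \<le> e"
    if e: "e > 0" and n: "\<And>m. m \<ge> K \<Longrightarrow> (\<integral>x. (f m x - f n x)\<^sup>2 \<partial>M) < e" for e n K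
  proof -
    have "(\<integral>\<^sup>+x. ennreal ((f n x - g x)\<^sup>2) \<partial>M) = (\<integral>\<^sup>+x. liminf (\<lambda>k. ennreal ((f (r k) x - f n x)\<^sup>2)) \<partial>M)"
    proof (rule nn_integral_cong_AE)
      show "AE x in M. ennreal ((f n x - g x)\<^sup>2) = liminf (\<lambda>k. ennreal ((f (r k) x - f n x)\<^sup>2))"
        using conv'
      proof eventually_elim
        fix x assume "(\<lambda>k. f (r k) x) \<longlonglongrightarrow> g x"
        then have "(\<lambda>k. ennreal ((f (r k) x - f n x)\<^sup>2)) \<longlonglongrightarrow> ennreal ((g x - f n x)\<^sup>2)"
          by (intro tendsto_ennrealI tendsto_intros)
        then show "ennreal ((f n x - g x)\<^sup>2) = liminf (\<lambda>k. ennreal ((f (r k) x - f n x)\<^sup>2))"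
          using lim_imp_Liminf by (metis power2_commute sequentially_bot)
      qed
    qed
    also have "\<dots> \<le> liminf (\<lambda>k. \<integral>\<^sup>+x. ennreal ((f (r k) x - f n x)\<^sup>2) \<partial>M)" by (rule nn_integral_liminf) simp
    also have "\<dots> \<le> ennreal e"
    proof (rule Liminf_le)
      have "(\<integral>\<^sup>+x. ennreal ((f (r k) x - f n x)\<^sup>2) \<partial>M) \<le> ennreal e" if "k \<ge> K" for k
      proof -
        have "(\<integral>\<^sup>+x. ennreal ((f (r k) x - f n x)\<^sup>2) \<partial>M) = ennreal (\<integral>x. (f (r k) x - f n x)\<^sup>2 \<partial>M)"
          by (rule nn_integral_eq_integral[OF id]) simp
        then show ?thesis using n[of "r k"] rk[of k] that by (simp add: ennreal_leI less_imp_le)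
      qed
      then show "\<forall>\<^sub>F k in sequentially. (\<integral>\<^sup>+x. ennreal ((f (r k) x - f n x)\<^sup>2) \<partial>M) \<le> ennreal e"
        unfolding eventually_sequentially by blast
    qed simp
    finally have le: "(\<integral>\<^sup>+x. ennreal ((f n x - g x)\<^sup>2) \<partial>M) \<le> ennreal e" .
    then have "(\<integral>\<^sup>+x. ennreal (norm ((f n x - g x)\<^sup>2)) \<partial>M) < \<infinity>" by (simp add: le_less_trans)
    then have i: "integrable M (\<lambda>x. (f n x - g x)\<^sup>2)" by (intro integrableI_bounded) auto
    have "ennreal (\<integral>x. (f n x - g x)\<^sup>2 \<partial>M) \<le> ennreal e"
      using le nn_integral_eq_integral[OF i] by simp
    then show ?thesis using i e by simp
  qed
  have lim: "\<exists>K. \<forall>n\<ge>K. integrable M (\<lambda>x. (f n x - g x)\<^sup>2) \<and> (\<integral>x. (f n x - g x)\<^sup>2 \<partial>M) \<le> e" if "e > 0" for e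
    using C[OF that] fatou[OF that] by meson
  obtain n0 where n0: "integrable M (\<lambda>x. (f n0 x - g x)\<^sup>2)" using lim[of 1] by auto
  then have "sq_int M (\<lambda>x. f n0 x - g x)" by (simp add: sq_int_def)
  from sq_int_diff[OF f[of n0] this] have g: "sq_int M g" by simp
  have "(\<lambda>n. \<integral>x. (f n x - g x)\<^sup>2 \<partial>M) \<longlonglongrightarrow> 0"
  proof (rule LIMSEQ_I)
    fix e :: real assume "e > 0"
    then obtain K where K: "\<forall>n\<ge>K. (\<integral>x. (f n x - g x)\<^sup>2 \<partial>M) \<le> e / 2" using lim[of "e/2"] by auto
    have "norm ((\<integral>x. (f n x - g x)\<^sup>2 \<partial>M) - 0) < e" if "n \<ge> K" for n
    proof -
      have "0 \<le> (\<integral>x. (f n x - g x)\<^sup>2 \<partial>M)" by simp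
      then show ?thesis using K that \<open>e > 0\<close> by fastforce
    qed
    then show "\<exists>K. \<forall>n\<ge>K. norm ((\<integral>x. (f n x - g x)\<^sup>2 \<partial>M) - 0) < e" by blast
  qed
  then show thesis using that g by blast
qed

section \<open>Rellich compactness\<close>

text \<open>The first part is the variance of \<open>g\<close> about its mean; its nonnegativity is
  Cauchy-Schwarz against the constant function.\<close>

lemma integral_square_le:
  fixes g :: "real \<Rightarrow> real"
  assumes "a < b" "continuous_on {a..b} g"
  shows "integral {a..b} (\<lambda>x. (g x - integral {a..b} g / (b - a))\<^sup>2) = integral {a..b} (\<lambda>x. (g x)\<^sup>2) - (integral {a..b} g)\<^sup>2 / (b - a)"
    "(integral {a..b} g)\<^sup>2 \<le> (b - a) * integral {a..b} (\<lambda>x. (g x)\<^sup>2)"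
proof -
  define m where "m = integral {a..b} g / (b - a)"
  have i: "(\<lambda>x. (g x)\<^sup>2) integrable_on {a..b}" "g integrable_on {a..b}"
    by (intro integrable_continuous_real continuous_intros assms(2))+
  have "((\<lambda>x. (g x)\<^sup>2 - 2 * m * g x + m\<^sup>2) has_integral (integral {a..b} (\<lambda>x. (g x)\<^sup>2) - 2 * m * integral {a..b} g + (b - a) *\<^sub>R m\<^sup>2)) {a..b}"
    using assms(1) has_integral_const_real[of "m\<^sup>2" a b]
    by (intro has_integral_add has_integral_diff has_integral_mult_right integrable_integral i) simp
  then have "integral {a..b} (\<lambda>x. (g x - m)\<^sup>2) = integral {a..b} (\<lambda>x. (g x)\<^sup>2) - 2 * m * integral {a..b} g + (b - a) * m\<^sup>2"
    by (intro integral_unique) (simp add: power2_diff algebra_simps)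
  also have "\<dots> = integral {a..b} (\<lambda>x. (g x)\<^sup>2) - (integral {a..b} g)\<^sup>2 / (b - a)"
  proof -
    have I: "integral {a..b} g = m * (b - a)" using assms(1) by (simp add: m_def)
    show ?thesis using assms(1) unfolding I by (simp add: power2_eq_square)
  qed
  finally show eq: "integral {a..b} (\<lambda>x. (g x - integral {a..b} g / (b - a))\<^sup>2) = integral {a..b} (\<lambda>x. (g x)\<^sup>2) - (integral {a..b} g)\<^sup>2 / (b - a)"
    by (simp add: m_def)
  have "0 \<le> integral {a..b} (\<lambda>x. (g x - integral {a..b} g / (b - a))\<^sup>2)"
    by (intro Henstock_Kurzweil_Integration.integral_nonneg integrable_continuous_real continuous_intros assms(2)) auto
  then show "(integral {a..b} g)\<^sup>2 \<le> (b - a) * integral {a..b} (\<lambda>x. (g x)\<^sup>2)"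
    using assms(1) unfolding eq by (simp add: pos_divide_le_eq mult.commute)
qed

text \<open>\<open>f\<close> attains its mean at some \<open>c\<close>, by the mean value theorem
  for its integral; Cauchy-Schwarz for \<open>f'\<close> between \<open>c\<close> and
  \<open>x\<close> then bounds the deviation of f(x) from the mean pointwise.\<close>

lemma poincare_interval:
  fixes f f' :: "real \<Rightarrow> real"
  assumes ab: "a < b" and f: "\<And>x. x \<in> {a..b} \<Longrightarrow> (f has_vector_derivative f' x) (at x within {a..b})" "continuous_on {a..b} f'"
  shows "integral {a..b} (\<lambda>x. (f x)\<^sup>2) \<le> (b - a)\<^sup>2 * integral {a..b} (\<lambda>x. (f' x)\<^sup>2) + (integral {a..b} f)\<^sup>2 / (b - a)"
proof -
  define m where "m = integral {a..b} f / (b - a)"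
  define D where "D = integral {a..b} (\<lambda>x. (f' x)\<^sup>2)"
  have cf: "continuous_on {a..b} f"
    unfolding continuous_on_eq_continuous_within using f(1) has_vector_derivative_continuous by blast
  have "((\<lambda>x. integral {a..x} f) has_derivative (\<lambda>h. h *\<^sub>R f x)) (at x within {a..b})" if "a \<le> x" "x \<le> b" for x
    using integral_has_vector_derivative[OF cf, of x] that by (auto simp: has_vector_derivative_def)
  from mvt_simple[OF ab this] obtain c where c: "c \<in> {a<..<b}" "integral {a..b} f - integral {a..a} f = (b - a) *\<^sub>R f c" by blast
  then have fc: "f c = m" using ab by (simp add: m_def)
  have D0: "D \<ge> 0" unfolding D_def
    by (intro Henstock_Kurzweil_Integration.integral_nonneg integrable_continuous_real continuous_intros f(2)) auto
  have half: "(f v - f u)\<^sup>2 \<le> (b - a) * D" if uv: "a \<le> u" "u < v" "v \<le> b" for u v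
  proof -
    have c': "continuous_on {u..v} f'" using continuous_on_subset[OF f(2)] uv by auto
    have "(f' has_integral f v - f u) {u..v}"
      by (rule fundamental_theorem_of_calculus) (use uv in \<open>auto intro!: has_vector_derivative_within_subset[OF f(1)]\<close>)
    then have "(f v - f u)\<^sup>2 = (integral {u..v} f')\<^sup>2" by (simp add: integral_unique)
    also have "\<dots> \<le> (v - u) * integral {u..v} (\<lambda>x. (f' x)\<^sup>2)" by (rule integral_square_le(2)[OF uv(2) c'])
    also have "\<dots> \<le> (b - a) * D" unfolding D_def
    proof (intro mult_mono integral_subset_le)
      show "(\<lambda>x. (f' x)\<^sup>2) integrable_on {u..v}" "(\<lambda>x. (f' x)\<^sup>2) integrable_on {a..b}"
        by (intro integrable_continuous_real continuous_intros c' f(2))+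
      show "0 \<le> integral {u..v} (\<lambda>x. (f' x)\<^sup>2)"
        by (intro Henstock_Kurzweil_Integration.integral_nonneg integrable_continuous_real continuous_intros c') auto
    qed (use uv ab in auto)
    finally show ?thesis .
  qed
  have pt: "(f x - m)\<^sup>2 \<le> (b - a) * D" if "x \<in> {a..b}" for x
  proof (cases x c rule: linorder_cases)
    case less then show ?thesis using half[of x c] that c(1) fc by (simp add: power2_commute)
  next
    case greater then show ?thesis using half[of c x] that c(1) fc by simp
  next
    case equal then show ?thesis using fc ab D0 by simp
  qed
  have "integral {a..b} (\<lambda>x. (f x - m)\<^sup>2) \<le> integral {a..b} (\<lambda>x. (b - a) * D)"
    by (intro integral_le integrable_continuous_real continuous_intros cf pt) auto
  then have "integral {a..b} (\<lambda>x. (f x)\<^sup>2) - (integral {a..b} f)\<^sup>2 / (b - a) \<le> (b - a) * ((b - a) * D)"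
    using integral_square_le(1)[OF ab cf] ab by (simp add: m_def)
  then show ?thesis by (simp add: D_def power2_eq_square mult.assoc)
qed

section \<open>Averages over squares\<close>

definition cell :: "real \<Rightarrow> real \<Rightarrow> real \<Rightarrow> (pt \<Rightarrow> real) \<Rightarrow> real" where
  "cell a b d f = integral {a..a+d} (\<lambda>x. integral {b..b+d} (\<lambda>y. f (x, y)))"

lemma cont_slices:
  fixes f :: "pt \<Rightarrow> real"
  assumes "continuous_on UNIV f"
  shows "continuous_on S (\<lambda>y. f (x, y))" "continuous_on S (\<lambda>x. integral {b..c} (\<lambda>y. f (x, y)))"
    "continuous_on (S \<times> T) f"
proof -
  show "continuous_on S (\<lambda>y. f (x, y))" by (intro continuous_on_compose2[OF assms] continuous_intros) auto
  show "continuous_on (S \<times> T) f" using continuous_on_subset[OF assms] by auto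
  have "continuous_on (S \<times> cbox b c) (\<lambda>(x, y). f (x, y))" using continuous_on_subset[OF assms] by auto
  from integral_continuous_on_param[OF this] show "continuous_on S (\<lambda>x. integral {b..c} (\<lambda>y. f (x, y)))" by simp
qed

lemma cell_mono:
  assumes "continuous_on UNIV f" "continuous_on UNIV g" "\<And>x. f x \<le> g x"
  shows "cell a b d f \<le> cell a b d g"
  unfolding cell_def
  by (intro integral_le integrable_continuous_real cont_slices assms)

lemma cell_add:
  assumes "continuous_on UNIV f" "continuous_on UNIV g"
  shows "cell a b d (\<lambda>x. f x + g x) = cell a b d f + cell a b d g"
proof -
  have "integral {b..b+d} (\<lambda>y. f (x, y) + g (x, y)) = integral {b..b+d} (\<lambda>y. f (x, y)) + integral {b..b+d} (\<lambda>y. g (x, y))" for x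
    by (intro Henstock_Kurzweil_Integration.integral_add integrable_continuous_real cont_slices assms)
  then show ?thesis unfolding cell_def
    by (simp add: Henstock_Kurzweil_Integration.integral_add integrable_continuous_real cont_slices assms)
qed

lemma cell_cmult: "cell a b d (\<lambda>x. c * f x) = c * cell a b d f"
  by (simp add: cell_def)

text \<open>The interval inequality is applied on each vertical slice and once more to the function
  \<open>\<Phi>\<close> of slice integrals, whose derivative is bounded by Cauchy-Schwarz. The last
  term is the squared mean of \<open>f\<close> times the area.\<close>

lemma poincare_cell:
  fixes f p q :: "pt \<Rightarrow> real"
  assumes d: "d > 0" and g: "\<And>x. has_grad f (p x) (q x) x" and c: "continuous_on UNIV p" "continuous_on UNIV q"
  shows "cell a b d (\<lambda>x. (f x)\<^sup>2) \<le> d\<^sup>2 * (cell a b d (\<lambda>x. (p x)\<^sup>2) + cell a b d (\<lambda>x. (q x)\<^sup>2)) + (cell a b d f)\<^sup>2 / d\<^sup>2"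
proof -
  have cf: "continuous_on UNIV f" using g has_grad_isCont by (blast intro: continuous_at_imp_continuous_on)
  have sq: "continuous_on UNIV (\<lambda>x. (f x)\<^sup>2)" "continuous_on UNIV (\<lambda>x. (p x)\<^sup>2)" "continuous_on UNIV (\<lambda>x. (q x)\<^sup>2)"
    by (intro continuous_intros cf c)+
  define \<Phi> where "\<Phi> x = integral {b..b+d} (\<lambda>y. f (x, y))" for x
  define \<Phi>' where "\<Phi>' x = integral {b..b+d} (\<lambda>y. p (x, y))" for x
  have c\<Phi>: "continuous_on S \<Phi>" "continuous_on S \<Phi>'" for S
    unfolding \<Phi>_def \<Phi>'_def by (intro cont_slices cf c)+
  have 1: "integral {b..b+d} (\<lambda>y. (f (x, y))\<^sup>2) \<le> d\<^sup>2 * integral {b..b+d} (\<lambda>y. (q (x, y))\<^sup>2) + (\<Phi> x)\<^sup>2 / d" for x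
    using poincare_interval[of b "b + d" "\<lambda>y. f (x, y)" "\<lambda>y. q (x, y)"] d has_grad_slice2[OF g] cont_slices(1)[OF c(2)]
    by (simp add: \<Phi>_def)
  have d\<Phi>: "(\<Phi> has_vector_derivative \<Phi>' x) (at x within {a..a+d})" if "x \<in> {a..a+d}" for x
  proof -
    have "((\<lambda>x. integral (cbox b (b+d)) (\<lambda>y. f (x, y))) has_vector_derivative integral (cbox b (b+d)) (\<lambda>y. p (x, y))) (at x within {a..a+d})"
    proof (rule leibniz_rule_vector_derivative)
      show "((\<lambda>x. f (x, t)) has_vector_derivative p (x, t)) (at x within {a..a+d})" for x t
        using has_grad_slice1[OF g] .
      show "(\<lambda>y. f (x, y)) integrable_on cbox b (b+d)" for x
        using integrable_continuous_real[OF cont_slices(1)[OF cf]] by simp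
      show "continuous_on ({a..a+d} \<times> cbox b (b+d)) (\<lambda>(x, t). p (x, t))" using cont_slices(3)[OF c(1)] by simp
    qed (use that in auto)
    then show ?thesis by (simp add: \<Phi>_def[abs_def] \<Phi>'_def)
  qed
  have 2: "integral {a..a+d} (\<lambda>x. (\<Phi> x)\<^sup>2) \<le> d\<^sup>2 * integral {a..a+d} (\<lambda>x. (\<Phi>' x)\<^sup>2) + (integral {a..a+d} \<Phi>)\<^sup>2 / d"
    using poincare_interval[of a "a + d" \<Phi> \<Phi>', OF _ d\<Phi> c\<Phi>(2)] d by simp
  have 3: "(\<Phi>' x)\<^sup>2 \<le> d * integral {b..b+d} (\<lambda>y. (p (x, y))\<^sup>2)" for x
    using integral_square_le(2)[of b "b + d" "\<lambda>y. p (x, y)"] d cont_slices(1)[OF c(1)] by (simp add: \<Phi>'_def)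
  have "integral {a..a+d} (\<lambda>x. (\<Phi>' x)\<^sup>2) \<le> integral {a..a+d} (\<lambda>x. d * integral {b..b+d} (\<lambda>y. (p (x, y))\<^sup>2))"
    by (intro integral_le integrable_continuous_real continuous_intros c\<Phi> 3 cont_slices(2)[OF sq(2)])
  then have 4: "integral {a..a+d} (\<lambda>x. (\<Phi>' x)\<^sup>2) \<le> d * cell a b d (\<lambda>x. (p x)\<^sup>2)" by (simp add: cell_def)
  have "cell a b d (\<lambda>x. (f x)\<^sup>2) \<le> integral {a..a+d} (\<lambda>x. d\<^sup>2 * integral {b..b+d} (\<lambda>y. (q (x, y))\<^sup>2) + (\<Phi> x)\<^sup>2 / d)"
    unfolding cell_def using d
    by (intro integral_le integrable_continuous_real continuous_intros c\<Phi> 1 cont_slices(2)[OF sq(1)] cont_slices(2)[OF sq(3)]) auto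
  also have "\<dots> = d\<^sup>2 * cell a b d (\<lambda>x. (q x)\<^sup>2) + integral {a..a+d} (\<lambda>x. (\<Phi> x)\<^sup>2) / d"
  proof -
    have "((\<lambda>x. d\<^sup>2 * integral {b..b+d} (\<lambda>y. (q (x, y))\<^sup>2) + (\<Phi> x)\<^sup>2 / d) has_integral d\<^sup>2 * cell a b d (\<lambda>x. (q x)\<^sup>2) + integral {a..a+d} (\<lambda>x. (\<Phi> x)\<^sup>2) / d) {a..a+d}"
      unfolding cell_def
      by (intro has_integral_add has_integral_mult_right has_integral_divide integrable_integral integrable_continuous_real
        cont_slices(2)[OF sq(3)] continuous_intros c\<Phi>)
    then show ?thesis by (rule integral_unique)
  qed
  also have "integral {a..a+d} (\<lambda>x. (\<Phi> x)\<^sup>2) / d \<le> (d\<^sup>2 * (d * cell a b d (\<lambda>x. (p x)\<^sup>2)) + (integral {a..a+d} \<Phi>)\<^sup>2 / d) / d"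
  proof (rule divide_right_mono)
    have "d\<^sup>2 * integral {a..a+d} (\<lambda>x. (\<Phi>' x)\<^sup>2) \<le> d\<^sup>2 * (d * cell a b d (\<lambda>x. (p x)\<^sup>2))" using 4 by (rule mult_left_mono) simp
    then show "integral {a..a+d} (\<lambda>x. (\<Phi> x)\<^sup>2) \<le> d\<^sup>2 * (d * cell a b d (\<lambda>x. (p x)\<^sup>2)) + (integral {a..a+d} \<Phi>)\<^sup>2 / d"
      using 2 by linarith
  qed (use d in simp)
  also have "\<dots> = d\<^sup>2 * cell a b d (\<lambda>x. (p x)\<^sup>2) + (cell a b d f)\<^sup>2 / d\<^sup>2"
    using d by (simp add: cell_def \<Phi>_def[abs_def] add_divide_distrib power2_eq_square)
  finally show ?thesis by (simp add: algebra_simps)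
qed

lemma integral_split_sum:
  fixes f :: "real \<Rightarrow> real"
  assumes "continuous_on UNIV f" "d > 0"
  shows "integral {a..a + real n * d} f = (\<Sum>i<n. integral {a + real i * d..a + real i * d + d} f)"
proof (induction n)
  case (Suc n)
  have "integral {a..a + real n * d} f + integral {a + real n * d..a + real (Suc n) * d} f = integral {a..a + real (Suc n) * d} f"
    using assms by (intro Henstock_Kurzweil_Integration.integral_combine integrable_continuous_real continuous_on_subset[OF assms(1)]) (auto simp: algebra_simps)
  then show ?case using Suc by (simp add: algebra_simps)
qed simp

lemma cell_split:
  fixes f :: "pt \<Rightarrow> real"
  assumes f: "continuous_on UNIV f" and d: "d > 0"
  shows "cell a b (real n * d) f = (\<Sum>i<n. \<Sum>j<n. cell (a + real i * d) (b + real j * d) d f)"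
proof -
  have s: "integral {b..b + real n * d} (\<lambda>y. f (x, y)) = (\<Sum>j<n. integral {b + real j * d..b + real j * d + d} (\<lambda>y. f (x, y)))" for x
    by (rule integral_split_sum[OF cont_slices(1)[OF f] d])
  have "cell a b (real n * d) f = (\<Sum>i<n. integral {a + real i * d..a + real i * d + d} (\<lambda>x. integral {b..b + real n * d} (\<lambda>y. f (x, y))))"
    unfolding cell_def by (rule integral_split_sum[OF cont_slices(2)[OF f] d])
  also have "\<dots> = (\<Sum>i<n. \<Sum>j<n. cell (a + real i * d) (b + real j * d) d f)"
    unfolding s cell_def
    by (intro sum.cong refl Henstock_Kurzweil_Integration.integral_sum integrable_continuous_real cont_slices(2)[OF f]) simp
  finally show ?thesis .
qed

lemma lborel_cell:
  fixes f :: "pt \<Rightarrow> real"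
  assumes f: "continuous_on UNIV f" and z: "\<And>x. R < norm x \<Longrightarrow> f x = 0"
  shows "integral\<^sup>L lborel f = cell (-R) (-R) (2 * R) f"
proof -
  have "integral\<^sup>L lborel f = integral (cbox (-R, -R) (R, R)) f"
  proof (rule lborel_integral_cbox[OF f])
    fix x :: pt assume "x \<notin> cbox (- R, - R) (R, R)"
    then have "R < \<bar>fst x\<bar> \<or> R < \<bar>snd x\<bar>" by (cases x) (auto simp: cbox_Pair_eq)
    then have "R < norm x" using norm_fst_le[of "fst x" "snd x"] norm_snd_le[of "snd x" "fst x"] by auto
    then show "f x = 0" by (rule z)
  qed
  also have "\<dots> = integral (cbox (-R) R) (\<lambda>x. integral (cbox (-R) R) (\<lambda>y. f (x, y)))"
    by (rule integral_prod_continuous) (rule continuous_on_subset[OF f], simp)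
  finally show ?thesis by (simp add: cell_def)
qed

text \<open>Rellich compactness: up to \<open>d\<^sup>2\<close> times the Dirichlet energy, the \<open>L\<^sup>2\<close> norm is controlled by
  the finitely many cell averages, and a diagonal subsequence makes all of these converge.\<close>
lemma rellich:
  fixes f p q :: "nat \<Rightarrow> pt \<Rightarrow> real"
  assumes g: "\<And>n x. has_grad (f n) (p n x) (q n x) x" and c: "\<And>n. continuous_on UNIV (p n)" "\<And>n. continuous_on UNIV (q n)"
    and z: "\<And>n x. R < norm x \<Longrightarrow> f n x = 0 \<and> p n x = 0 \<and> q n x = 0" and R: "R > 0"
    and b: "\<And>n. integral\<^sup>L lborel (\<lambda>x. (f n x)\<^sup>2) \<le> C" "\<And>n. integral\<^sup>L lborel (\<lambda>x. (p n x)\<^sup>2) \<le> C" "\<And>n. integral\<^sup>L lborel (\<lambda>x. (q n x)\<^sup>2) \<le> C"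
  obtains r where "strict_mono (r :: nat \<Rightarrow> nat)"
    "\<And>e. e > 0 \<Longrightarrow> \<exists>N. \<forall>m\<ge>N. \<forall>n\<ge>N. integral\<^sup>L lborel (\<lambda>x. (f (r m) x - f (r n) x)\<^sup>2) < e"
proof -
  have cf: "continuous_on UNIV (f n)" for n using g has_grad_isCont by (blast intro: continuous_at_imp_continuous_on)
  have csq: "continuous_on UNIV (\<lambda>x. (f n x)\<^sup>2)" for n by (intro continuous_intros cf)
  have zsq: "(f n x)\<^sup>2 = 0" if "R < norm x" for n x using z[OF that] by simp
  have C0: "C \<ge> 0" using b(1)[of 0] by (rule order_trans[rotated]) simp
  \<comment> \<open>Side length when [-R,R]^2 is cut into \<open>Suc N\<close> by
    \<open>Suc N\<close> squares.\<close>
  define dd where "dd N = 2 * R / real (Suc N)" for N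
  have dd: "dd N > 0" "real (Suc N) * dd N = 2 * R" for N using R by (auto simp: dd_def)
  define av where "av n z = (case z of (N, i, j) \<Rightarrow> cell (- R + real i * dd N) (- R + real j * dd N) (dd N) (f n))" for n and z :: "nat \<times> nat \<times> nat"
  define Z where "Z = {(N, i, j). i \<le> N \<and> j \<le> (N::nat)}"
  have avb: "norm (av n z) \<le> sqrt ((2 * R)\<^sup>2 * C)" if zZ: "z \<in> Z" for n z
  proof -
    obtain N i j where z': "z = (N, i, j)" "i < Suc N" "j < Suc N" using zZ by (auto simp: Z_def)
    let ?a = "- R + real i * dd N" and ?b = "- R + real j * dd N" and ?d = "dd N"
    have nn: "0 \<le> cell a b d (\<lambda>x. (f n x)\<^sup>2)" for a b d
      unfolding cell_def
      by (intro Henstock_Kurzweil_Integration.integral_nonneg integrable_continuous_real cont_slices[OF csq]) auto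
    have "(cell ?a ?b ?d (f n))\<^sup>2 \<le> ?d * integral {?a..?a + ?d} (\<lambda>x. (integral {?b..?b + ?d} (\<lambda>y. f n (x, y)))\<^sup>2)"
      unfolding cell_def using integral_square_le(2)[OF _ cont_slices(2)[OF cf], of ?a "?a + ?d"] dd(1)[of N] by simp
    also have "\<dots> \<le> ?d * integral {?a..?a + ?d} (\<lambda>x. ?d * integral {?b..?b + ?d} (\<lambda>y. (f n (x, y))\<^sup>2))"
    proof (intro mult_left_mono integral_le integrable_continuous_real continuous_intros cont_slices(2)[OF cf] cont_slices(2)[OF csq])
      show "(integral {?b..?b + ?d} (\<lambda>y. f n (x, y)))\<^sup>2 \<le> ?d * integral {?b..?b + ?d} (\<lambda>y. (f n (x, y))\<^sup>2)" for x
        using integral_square_le(2)[OF _ cont_slices(1)[OF cf], of ?b "?b + ?d"] dd(1)[of N] by simp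
    qed (use dd(1)[of N] in auto)
    also have "\<dots> = ?d\<^sup>2 * cell ?a ?b ?d (\<lambda>x. (f n x)\<^sup>2)" by (simp add: cell_def power2_eq_square)
    also have "\<dots> \<le> ?d\<^sup>2 * cell (-R) (-R) (2 * R) (\<lambda>x. (f n x)\<^sup>2)"
    proof (intro mult_left_mono)
      have "cell ?a ?b ?d (\<lambda>x. (f n x)\<^sup>2) \<le> (\<Sum>j<Suc N. cell ?a (- R + real j * dd N) ?d (\<lambda>x. (f n x)\<^sup>2))"
        using z'(3) nn by (intro member_le_sum) auto
      also have "\<dots> \<le> (\<Sum>i<Suc N. \<Sum>j<Suc N. cell (- R + real i * dd N) (- R + real j * dd N) ?d (\<lambda>x. (f n x)\<^sup>2))"
        using z'(2) nn by (intro member_le_sum[of i "{..<Suc N}" "\<lambda>i. \<Sum>j<Suc N. cell (- R + real i * dd N) (- R + real j * dd N) ?d (\<lambda>x. (f n x)\<^sup>2)"]) (intro sum_nonneg nn | simp)+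
      also have "\<dots> = cell (-R) (-R) (2 * R) (\<lambda>x. (f n x)\<^sup>2)"
        using cell_split[OF csq dd(1), of "-R" "-R" "Suc N" N n] dd(2)[of N] by simp
      finally show "cell ?a ?b ?d (\<lambda>x. (f n x)\<^sup>2) \<le> cell (-R) (-R) (2 * R) (\<lambda>x. (f n x)\<^sup>2)" .
    qed simp
    also have "cell (-R) (-R) (2 * R) (\<lambda>x. (f n x)\<^sup>2) = integral\<^sup>L lborel (\<lambda>x. (f n x)\<^sup>2)"
      using lborel_cell[OF csq zsq] by simp
    also have "?d\<^sup>2 * integral\<^sup>L lborel (\<lambda>x. (f n x)\<^sup>2) \<le> (2 * R)\<^sup>2 * C"
    proof (intro mult_mono power_mono b(1))
      have "2 * R * 1 \<le> 2 * R * real (Suc N)" using R by (intro mult_left_mono) auto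
      then show "?d \<le> 2 * R" using R by (simp add: dd_def pos_divide_le_eq)
    qed (use dd(1)[of N] in auto)
    finally show ?thesis using real_sqrt_le_mono by (fastforce simp: av_def z'(1))
  qed
  have "countable Z" by simp
  then obtain r where r: "strict_mono (r :: nat \<Rightarrow> nat)" "\<And>z. z \<in> Z \<Longrightarrow> \<exists>l. (\<lambda>n. av (r n) z) \<longlonglongrightarrow> l"
    using function_convergent_subsequence[of Z av "sqrt ((2 * R)\<^sup>2 * C)"] avb by blast
  show thesis
  proof (rule that[OF r(1)])
    fix e :: real assume e: "e > 0"
    \<comment> \<open>Each partial derivative of a difference has squared norm at most 4 C, the two
      together 8 C; the 1 keeps \<open>K\<close> positive.\<close>
    define K where "K = 8 * C + 1"
    have K: "K > 0" using C0 by (simp add: K_def)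
    obtain N where N: "(dd N)\<^sup>2 * K < e / 2"
    proof -
      have "(\<lambda>N. (2 * R * inverse (real (Suc N)))\<^sup>2 * K) \<longlonglongrightarrow> (2 * R * 0)\<^sup>2 * K"
        by (intro tendsto_intros LIMSEQ_inverse_real_of_nat)
      then have "(\<lambda>N. (dd N)\<^sup>2 * K) \<longlonglongrightarrow> 0" by (simp add: dd_def divide_inverse)
      then have "\<forall>\<^sub>F N in sequentially. (dd N)\<^sup>2 * K < e / 2" using order_tendstoD(2) e half_gt_zero by blast
      then show ?thesis using that eventually_sequentially by auto
    qed
    define d where "d = dd N"
    define A where "A i j n = av (r n) (N, i, j)" for i j n
    have "\<forall>i j. i < Suc N \<and> j < Suc N \<longrightarrow> Cauchy (A i j)"
    proof (intro allI impI)
      fix i j assume "i < Suc N \<and> j < Suc N"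
      then have "(N, i, j) \<in> Z" by (auto simp: Z_def)
      then have "convergent (\<lambda>n. av (r n) (N, i, j))" using r(2) unfolding convergent_def by blast
      then show "Cauchy (A i j)" unfolding A_def by (rule convergent_Cauchy)
    qed
    \<comment> \<open>Each of the (N+1)^2 squares will contribute eps^2/d^2; this choice makes the
      total e/2.\<close>
    define eps where "eps = sqrt (e / 2 * d\<^sup>2 / (real (Suc N))\<^sup>2)"
    have d: "d > 0" using dd(1) by (simp add: d_def)
    have "eps > 0" using e d by (simp add: eps_def)
    have eps2: "(real (Suc N))\<^sup>2 * eps\<^sup>2 / d\<^sup>2 = e / 2" using e d by (simp add: eps_def)
    have "\<forall>i\<in>{..<Suc N}. \<forall>j\<in>{..<Suc N}. \<exists>M. \<forall>m\<ge>M. \<forall>n\<ge>M. norm (A i j m - A i j n) < eps"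
      using \<open>\<forall>i j. i < Suc N \<and> j < Suc N \<longrightarrow> Cauchy (A i j)\<close> \<open>eps > 0\<close> unfolding Cauchy_iff by auto
    then obtain M where M: "\<And>i j m n. i < Suc N \<Longrightarrow> j < Suc N \<Longrightarrow> m \<ge> M i j \<Longrightarrow> n \<ge> M i j \<Longrightarrow> norm (A i j m - A i j n) < eps"
      by (simp add: Ball_def) metis
    define M' where "M' = (\<Sum>i<Suc N. \<Sum>j<Suc N. M i j)"
    have MM: "M i j \<le> M'" if "i < Suc N" "j < Suc N" for i j
    proof -
      have "M i j \<le> (\<Sum>j<Suc N. M i j)" using that by (intro member_le_sum) auto
      also have "\<dots> \<le> M'" unfolding M'_def using that by (intro member_le_sum[of i "{..<Suc N}" "\<lambda>i. \<Sum>j<Suc N. M i j"]) auto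
      finally show ?thesis .
    qed
    show "\<exists>N. \<forall>m\<ge>N. \<forall>n\<ge>N. integral\<^sup>L lborel (\<lambda>x. (f (r m) x - f (r n) x)\<^sup>2) < e"
    proof (intro exI[of _ M'] allI impI)
      fix m n assume mn: "M' \<le> m" "M' \<le> n"
      let ?f = "\<lambda>x. f (r m) x - f (r n) x" and ?p = "\<lambda>x. p (r m) x - p (r n) x" and ?q = "\<lambda>x. q (r m) x - q (r n) x"
      have gd: "has_grad ?f (?p x) (?q x) x" for x by (intro has_grad_diff g)
      have cd: "continuous_on UNIV ?f" "continuous_on UNIV ?p" "continuous_on UNIV ?q" by (intro continuous_intros cf c)+
      have cds: "continuous_on UNIV (\<lambda>x. (?f x)\<^sup>2)" "continuous_on UNIV (\<lambda>x. (?p x)\<^sup>2)" "continuous_on UNIV (\<lambda>x. (?q x)\<^sup>2)"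
        by (intro continuous_intros cd)+
      have en: "cell (-R) (-R) (2*R) (\<lambda>x. (h (r m) x - h (r n) x)\<^sup>2) \<le> 4 * C"
        if h: "\<And>n. continuous_on UNIV (h n)" "\<And>n x. R < norm x \<Longrightarrow> h n x = 0" "\<And>n. integral\<^sup>L lborel (\<lambda>x. (h n x)\<^sup>2) \<le> C" for h :: "nat \<Rightarrow> pt \<Rightarrow> real"
      proof -
        have hs: "continuous_on UNIV (\<lambda>x. (h k x)\<^sup>2)" for k by (intro continuous_intros h)
        have W: "cell (-R) (-R) (2*R) (\<lambda>x. (h k x)\<^sup>2) \<le> C" for k
        proof -
          have "integral\<^sup>L lborel (\<lambda>x. (h k x)\<^sup>2) = cell (-R) (-R) (2*R) (\<lambda>x. (h k x)\<^sup>2)"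
            by (rule lborel_cell[OF hs]) (simp add: h(2))
          then show ?thesis using h(3)[of k] by linarith
        qed
        have "cell (-R) (-R) (2*R) (\<lambda>x. (h (r m) x - h (r n) x)\<^sup>2) \<le> cell (-R) (-R) (2*R) (\<lambda>x. 2 * (h (r m) x)\<^sup>2 + 2 * (h (r n) x)\<^sup>2)"
        proof (rule cell_mono)
          show "(h (r m) x - h (r n) x)\<^sup>2 \<le> 2 * (h (r m) x)\<^sup>2 + 2 * (h (r n) x)\<^sup>2" for x
            using norm_diff_sq[of "h (r m) x" "h (r n) x"] by simp
        qed (intro continuous_intros h)+
        also have "\<dots> = 2 * cell (-R) (-R) (2*R) (\<lambda>x. (h (r m) x)\<^sup>2) + 2 * cell (-R) (-R) (2*R) (\<lambda>x. (h (r n) x)\<^sup>2)"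
          by (subst cell_add) (auto intro!: continuous_intros h simp: cell_cmult)
        also have "\<dots> \<le> 4 * C" using W[of "r m"] W[of "r n"] by simp
        finally show ?thesis .
      qed
      have pq: "cell (-R) (-R) (2*R) (\<lambda>x. (?p x)\<^sup>2) \<le> 4 * C" "cell (-R) (-R) (2*R) (\<lambda>x. (?q x)\<^sup>2) \<le> 4 * C"
        using en[of p] en[of q] c z b by auto
      let ?c = "\<lambda>i j. cell (- R + real i * d) (- R + real j * d) d"
      have split: "cell (-R) (-R) (2*R) h = (\<Sum>i<Suc N. \<Sum>j<Suc N. ?c i j h)" if "continuous_on UNIV h" for h
        using cell_split[OF that d, of "-R" "-R" "Suc N"] dd(2)[of N] by (simp add: d_def)
      have "integral\<^sup>L lborel (\<lambda>x. (?f x)\<^sup>2) = cell (-R) (-R) (2*R) (\<lambda>x. (?f x)\<^sup>2)"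
        by (rule lborel_cell[OF cds(1)]) (simp add: z)
      also have "\<dots> = (\<Sum>i<Suc N. \<Sum>j<Suc N. ?c i j (\<lambda>x. (?f x)\<^sup>2))" by (rule split[OF cds(1)])
      also have "\<dots> \<le> (\<Sum>i<Suc N. \<Sum>j<Suc N. d\<^sup>2 * (?c i j (\<lambda>x. (?p x)\<^sup>2) + ?c i j (\<lambda>x. (?q x)\<^sup>2)) + eps\<^sup>2 / d\<^sup>2)"
      proof (intro sum_mono)
        fix i j assume ij: "i \<in> {..<Suc N}" "j \<in> {..<Suc N}"
        have "?c i j ?f = A i j m - A i j n"
        proof -
          have "?c i j (\<lambda>x. f (r m) x + (-1) * f (r n) x) = ?c i j (f (r m)) + ?c i j (\<lambda>x. (-1) * f (r n) x)"
            by (rule cell_add) (intro continuous_intros cf)+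
          then show ?thesis unfolding cell_cmult by (simp add: A_def av_def d_def)
        qed
        moreover have "norm (A i j m - A i j n) < eps" using M[of i j m n] MM[of i j] ij mn by simp
        ultimately have "(?c i j ?f)\<^sup>2 \<le> eps\<^sup>2" using \<open>eps > 0\<close> by (intro power2_le_iff_abs_le[THEN iffD2]) auto
        then have "(?c i j ?f)\<^sup>2 / d\<^sup>2 \<le> eps\<^sup>2 / d\<^sup>2" by (intro divide_right_mono) auto
        then show "?c i j (\<lambda>x. (?f x)\<^sup>2) \<le> d\<^sup>2 * (?c i j (\<lambda>x. (?p x)\<^sup>2) + ?c i j (\<lambda>x. (?q x)\<^sup>2)) + eps\<^sup>2 / d\<^sup>2"
          using poincare_cell[OF d gd cd(2,3), of "- R + real i * d" "- R + real j * d"] by linarith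
      qed
      also have "\<dots> = d\<^sup>2 * ((\<Sum>i<Suc N. \<Sum>j<Suc N. ?c i j (\<lambda>x. (?p x)\<^sup>2)) + (\<Sum>i<Suc N. \<Sum>j<Suc N. ?c i j (\<lambda>x. (?q x)\<^sup>2))) + (real (Suc N))\<^sup>2 * (eps\<^sup>2 / d\<^sup>2)"
        unfolding sum.distrib by (simp only: sum_distrib_left[symmetric] sum_constant card_lessThan sum.distrib of_nat_id power2_eq_square mult.assoc)
      also have "\<dots> = d\<^sup>2 * (cell (-R) (-R) (2*R) (\<lambda>x. (?p x)\<^sup>2) + cell (-R) (-R) (2*R) (\<lambda>x. (?q x)\<^sup>2)) + e / 2"
        using eps2 by (simp only: split[OF cds(2)] split[OF cds(3)] times_divide_eq_right)
      also have "\<dots> \<le> d\<^sup>2 * K + e / 2" using pq by (intro add_right_mono mult_left_mono) (auto simp: K_def)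
      also have "\<dots> < e" using N by (simp add: d_def)
      finally show "integral\<^sup>L lborel (\<lambda>x. (?f x)\<^sup>2) < e" .
    qed
  qed
qed

section \<open>The lowest Dirichlet eigenvalue\<close>

lemma set_lint_restrict:
  fixes f :: "'a::euclidean_space \<Rightarrow> 'b::{banach, second_countable_topology}"
  assumes "open S" shows "(LINT x:S|lborel. f x) = integral\<^sup>L (restrict_space lborel S) f"
  unfolding set_lebesgue_integral_def using assms by (subst integral_restrict_space) auto

lemma L2sq_restrict:
  assumes "open S" shows "L2sq S f = (\<integral>x. (norm (f x))\<^sup>2 \<partial>restrict_space lborel S)"
  unfolding L2sq_def by (rule set_lint_restrict[OF assms])

lemma L2_sq_int:
  fixes f :: "pt \<Rightarrow> 'b::{banach, second_countable_topology}"
  assumes "open S" "L2 S f" shows "sq_int (restrict_space lborel S) f"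
  using assms unfolding L2_def sq_int_def set_integrable_def
  by (auto simp: integrable_restrict_space intro: measurable_restrict_space1)

lemma sq_int_L2:
  fixes f :: "pt \<Rightarrow> 'b::{banach, second_countable_topology}"
  assumes "open S" "sq_int (restrict_space lborel S) f" shows "L2 S (\<lambda>x. indicator S x *\<^sub>R f x)"
proof -
  have 1: "(\<lambda>x. indicator S x *\<^sub>R f x) \<in> borel_measurable lborel"
    using sq_intD(1)[OF assms(2)] assms(1) by (subst (asm) borel_measurable_restrict_space_iff) auto
  have "integrable lborel (\<lambda>x. indicator S x *\<^sub>R (norm (f x))\<^sup>2)"
    using sq_intD(2)[OF assms(2)] assms(1) by (subst (asm) integrable_restrict_space) auto
  moreover have "(\<lambda>x. indicator S x *\<^sub>R (norm (indicator S x *\<^sub>R f x))\<^sup>2) = (\<lambda>x. indicator S x *\<^sub>R (norm (f x))\<^sup>2)"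
    by (auto simp: indicator_def fun_eq_iff)
  ultimately show ?thesis using 1 unfolding L2_def set_integrable_def by simp
qed

lemma finite_measure_restrict:
  assumes "open S" "bounded S" shows "finite_measure (restrict_space lborel (S :: 'a::euclidean_space set))"
  using assms emeasure_bounded_finite[OF assms(2)]
  by (intro finite_measureI) (auto simp: emeasure_restrict_space space_restrict_space)

lemma restrict_lint_zero:
  fixes f :: "'a::euclidean_space \<Rightarrow> 'b::{banach, second_countable_topology}"
  assumes "open S" "\<And>x. x \<notin> S \<Longrightarrow> f x = 0"
  shows "integral\<^sup>L (restrict_space lborel S) f = integral\<^sup>L lborel f"
proof -
  have "(\<lambda>x. indicator S x *\<^sub>R f x) = f" using assms(2) by (auto simp: indicator_def fun_eq_iff)
  then show ?thesis using assms(1) by (subst integral_restrict_space) auto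
qed

lemma CinfD:
  fixes f :: "pt \<Rightarrow> 'b::real_normed_vector"
  assumes "Cinf S T f"
  obtains f1 f2 where "continuous_on T f" "Cinf S T f1" "Cinf S T f2" "\<And>x. x \<in> S \<Longrightarrow> has_grad f (f1 x) (f2 x) x"
proof -
  obtain F where F: "f \<in> F" "\<forall>g\<in>F. continuous_on T g \<and> (\<forall>x\<in>S. g differentiable (at x)) \<and>
        (\<exists>g1\<in>F. \<exists>g2\<in>F. \<forall>x\<in>S. pd1 g x = g1 x \<and> pd2 g x = g2 x)"
    using assms unfolding Cinf_def by blast
  from bspec[OF F(2,1)] obtain f1 f2 where f: "continuous_on T f" "\<forall>x\<in>S. f differentiable (at x)" "f1 \<in> F" "f2 \<in> F"
    "\<forall>x\<in>S. pd1 f x = f1 x \<and> pd2 f x = f2 x" by blast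
  have C: "Cinf S T k" if "k \<in> F" for k unfolding Cinf_def by (rule exI[of _ F]) (use that F(2) in blast)
  have "has_grad f (f1 x) (f2 x) x" if "x \<in> S" for x
    using differentiable_has_grad[OF bspec[OF f(2) that]] bspec[OF f(5) that] by simp
  then show ?thesis by (rule that[OF f(1) C[OF f(3)] C[OF f(4)]])
qed

lemma test_fun_smooth:
  assumes "test_fun S phi"
  shows "has_grad phi (pd1 phi x) (pd2 phi x) x" "continuous_on UNIV phi" "continuous_on UNIV (pd1 phi)" "continuous_on UNIV (pd2 phi)"
    "Cinf UNIV UNIV (pd1 phi)" "Cinf UNIV UNIV (pd2 phi)"
proof -
  have "Cinf UNIV UNIV phi" using assms by (simp add: test_fun_def)
  then obtain f1 f2 where f: "continuous_on UNIV phi" "Cinf UNIV UNIV f1" "Cinf UNIV UNIV f2" "\<And>x. has_grad phi (f1 x) (f2 x) x"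
    by (rule CinfD) blast
  have e: "pd1 phi = f1" "pd2 phi = f2" using has_grad_pd[OF f(4)] by auto
  show "has_grad phi (pd1 phi x) (pd2 phi x) x" unfolding e by (rule f(4))
  show "continuous_on UNIV phi" by (rule f(1))
  show "Cinf UNIV UNIV (pd1 phi)" "Cinf UNIV UNIV (pd2 phi)" unfolding e by (rule f)+
  show "continuous_on UNIV (pd1 phi)" unfolding e by (rule CinfD[OF f(2)])
  show "continuous_on UNIV (pd2 phi)" unfolding e by (rule CinfD[OF f(3)])
qed

lemma test_fun_support:
  assumes "test_fun S phi"
  obtains K where "compact K" "K \<subseteq> S" "\<And>x. x \<notin> K \<Longrightarrow> phi x = 0 \<and> pd1 phi x = 0 \<and> pd2 phi x = 0"
proof
  let ?K = "closure {x. phi x \<noteq> 0}"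
  show "compact ?K" "?K \<subseteq> S" using assms by (auto simp: test_fun_def)
  fix x assume x: "x \<notin> ?K"
  have z: "phi y = 0" if "y \<notin> ?K" for y using that closure_subset[of "{x. phi x \<noteq> 0}"] by blast
  show "phi x = 0 \<and> pd1 phi x = 0 \<and> pd2 phi x = 0"
    using z[OF x] has_grad_pd[OF has_grad_zero_outside[OF closed_closure x, of phi, OF z]] by blast
qed

lemma cont_compact_sq_int:
  fixes f :: "pt \<Rightarrow> 'b::euclidean_space"
  assumes "continuous_on UNIV f" "compact K" "\<And>x. x \<notin> K \<Longrightarrow> f x = 0" "open S"
  shows "sq_int (restrict_space lborel S) f" "L2 S f"
proof -
  have i: "integrable lborel (\<lambda>x. (norm (f x))\<^sup>2)"
    by (rule integrable_cont_compact[OF _ assms(2)]) (use assms in \<open>auto intro!: continuous_intros\<close>)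
  have m: "f \<in> borel_measurable lborel" using borel_measurable_continuous_onI[OF assms(1)] by simp
  show "L2 S f" unfolding L2_def set_integrable_def using i m assms(4)
    integrable_mult_indicator[OF _ i, of S] by simp
  then show "sq_int (restrict_space lborel S) f" using L2_sq_int[OF assms(4)] by blast
qed

lemma test_fun_sq_int:
  fixes phi :: "pt \<Rightarrow> 'b::euclidean_space"
  assumes "test_fun S phi" "open S"
  shows "sq_int (restrict_space lborel S) phi" "sq_int (restrict_space lborel S) (pd1 phi)" "sq_int (restrict_space lborel S) (pd2 phi)"
    "L2 S phi" "L2 S (pd1 phi)" "L2 S (pd2 phi)"
proof -
  obtain K where K: "compact K" "\<And>x. x \<notin> K \<Longrightarrow> phi x = 0 \<and> pd1 phi x = 0 \<and> pd2 phi x = 0" by (rule test_fun_support[OF assms(1)]) blast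
  note c = test_fun_smooth(2-4)[OF assms(1)]
  show "sq_int (restrict_space lborel S) phi" "L2 S phi" using cont_compact_sq_int[OF c(1) K(1) _ assms(2)] K(2) by blast+
  show "sq_int (restrict_space lborel S) (pd1 phi)" "L2 S (pd1 phi)" using cont_compact_sq_int[OF c(2) K(1) _ assms(2)] K(2) by blast+
  show "sq_int (restrict_space lborel S) (pd2 phi)" "L2 S (pd2 phi)" using cont_compact_sq_int[OF c(3) K(1) _ assms(2)] K(2) by blast+
qed

lemma test_fun_H10:
  fixes phi :: "pt \<Rightarrow> 'b::euclidean_space"
  assumes "test_fun S phi" "open S" shows "H10 S phi (pd1 phi) (pd2 phi)"
  unfolding H10_def using test_fun_sq_int[OF assms] assms(1)
  by (auto intro!: exI[of _ "\<lambda>_. phi"] simp: L2sq_def set_lebesgue_integral_def)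

lemma Cinf_lincomb:
  fixes phi psi :: "pt \<Rightarrow> real"
  assumes "Cinf UNIV UNIV phi" "Cinf UNIV UNIV psi"
  shows "Cinf UNIV UNIV (\<lambda>x. a * phi x + b * psi x)"
proof (rule CinfI_family)
  let ?F = "{\<lambda>x. a * f x + b * g x | f g. Cinf UNIV UNIV f \<and> Cinf UNIV UNIV g}"
  show "(\<lambda>x. a * phi x + b * psi x) \<in> ?F" using assms by blast
  fix h assume "h \<in> ?F"
  then obtain f g where h: "h = (\<lambda>x. a * f x + b * g x)" "Cinf UNIV UNIV f" "Cinf UNIV UNIV g" by blast
  obtain f1 f2 where f: "Cinf UNIV UNIV f1" "Cinf UNIV UNIV f2" "\<And>x. has_grad f (f1 x) (f2 x) x" by (rule CinfD[OF h(2)]) blast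
  obtain g1 g2 where g: "Cinf UNIV UNIV g1" "Cinf UNIV UNIV g2" "\<And>x. has_grad g (g1 x) (g2 x) x" by (rule CinfD[OF h(3)]) blast
  have "has_grad h (a * f1 x + b * g1 x) (a * f2 x + b * g2 x) x" for x
    unfolding h(1) by (intro has_grad_add has_grad_cmult f g)
  then show "\<exists>h1\<in>?F. \<exists>h2\<in>?F. \<forall>x. has_grad h (h1 x) (h2 x) x"
    using f(1,2) g(1,2) by (intro bexI[of _ "\<lambda>x. a * f1 x + b * g1 x"] bexI[of _ "\<lambda>x. a * f2 x + b * g2 x"]) blast+
qed

lemma test_fun_lincomb:
  fixes phi psi :: "pt \<Rightarrow> real"
  assumes "test_fun S phi" "test_fun S psi"
  shows "test_fun S (\<lambda>x. a * phi x + b * psi x)"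
    "pd1 (\<lambda>x. a * phi x + b * psi x) = (\<lambda>x. a * pd1 phi x + b * pd1 psi x)"
    "pd2 (\<lambda>x. a * phi x + b * psi x) = (\<lambda>x. a * pd2 phi x + b * pd2 psi x)"
proof -
  have g: "has_grad (\<lambda>x. a * phi x + b * psi x) (a * pd1 phi x + b * pd1 psi x) (a * pd2 phi x + b * pd2 psi x) x" for x
    by (intro has_grad_add has_grad_cmult test_fun_smooth(1)[OF assms(1)] test_fun_smooth(1)[OF assms(2)])
  show "pd1 (\<lambda>x. a * phi x + b * psi x) = (\<lambda>x. a * pd1 phi x + b * pd1 psi x)"
    "pd2 (\<lambda>x. a * phi x + b * psi x) = (\<lambda>x. a * pd2 phi x + b * pd2 psi x)"
    using has_grad_pd[OF g] by auto
  let ?K = "closure {x. phi x \<noteq> 0} \<union> closure {x. psi x \<noteq> 0}"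
  have K: "compact ?K" "?K \<subseteq> S" using assms by (auto simp: test_fun_def)
  have "{x. a * phi x + b * psi x \<noteq> 0} \<subseteq> {x. phi x \<noteq> 0} \<union> {x. psi x \<noteq> 0}" by auto
  also have "\<dots> \<subseteq> ?K" using closure_subset[of "{x. phi x \<noteq> 0}"] closure_subset[of "{x. psi x \<noteq> 0}"] by blast
  finally have sub: "closure {x. a * phi x + b * psi x \<noteq> 0} \<subseteq> ?K" using K(1) compact_imp_closed closure_minimal by blast
  then have "bounded (closure {x. a * phi x + b * psi x \<noteq> 0})" using compact_imp_bounded[OF K(1)] bounded_subset by blast
  then have "compact (closure {x. a * phi x + b * psi x \<noteq> 0})" using compact_eq_bounded_closed by blast
  then show "test_fun S (\<lambda>x. a * phi x + b * psi x)"
    using Cinf_lincomb assms sub K(2) unfolding test_fun_def by blast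
qed

lemma sq_int_quad:
  fixes f g :: "'a \<Rightarrow> real"
  assumes "sq_int M f" "sq_int M g"
  shows "(\<integral>x. (a * f x + b * g x)\<^sup>2 \<partial>M) = a\<^sup>2 * (\<integral>x. (f x)\<^sup>2 \<partial>M) + 2 * a * b * (\<integral>x. f x * g x \<partial>M) + b\<^sup>2 * (\<integral>x. (g x)\<^sup>2 \<partial>M)"
proof -
  have i: "integrable M (\<lambda>x. (f x)\<^sup>2)" "integrable M (\<lambda>x. (g x)\<^sup>2)" "integrable M (\<lambda>x. f x * g x)"
    using sq_intD(2)[OF assms(1)] sq_intD(2)[OF assms(2)] sq_int_mult[OF assms] by auto
  have "(\<lambda>x. (a * f x + b * g x)\<^sup>2) = (\<lambda>x. a\<^sup>2 * (f x)\<^sup>2 + 2 * a * b * (f x * g x) + b\<^sup>2 * (g x)\<^sup>2)"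
    by (auto simp: power2_eq_square algebra_simps)
  then show ?thesis using i by simp
qed

lemma integral_pos_ball:
  fixes f :: "pt \<Rightarrow> real"
  assumes i: "integrable lborel f" and nn: "\<And>x. f x \<ge> 0" and r: "r > 0" and pos: "\<And>x. x \<in> ball p r \<Longrightarrow> f x > 0"
  shows "integral\<^sup>L lborel f > 0"
proof -
  have "integral\<^sup>L lborel f \<noteq> 0"
  proof
    assume "integral\<^sup>L lborel f = 0"
    then have "AE y in lborel. f y = 0" using integral_nonneg_eq_0_iff_AE[OF i] nn by auto
    then have "AE y in lborel. y \<notin> ball p r"
    proof (rule AE_mp, intro AE_I2 impI)
      fix y assume "f y = 0" then show "y \<notin> ball p r" using pos[of y] by force
    qed
    then have "emeasure lborel (ball p r) = 0" by (subst (asm) AE_iff_measurable[of "ball p r"]) auto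
    then have "measure lborel (ball p r) = 0" by (simp add: measure_def)
    then show False using content_ball_pos[OF r, of p] by simp
  qed
  moreover have "integral\<^sup>L lborel f \<ge> 0" using nn by (intro integral_nonneg_AE) auto
  ultimately show ?thesis by simp
qed

section \<open>The Rayleigh quotient on test functions and its minimiser\<close>

context
  fixes S :: "pt set" assumes S: "open S" "bounded S" "S \<noteq> {}"
begin

abbreviation "lebS \<equiv> restrict_space lborel S"

definition nrm :: "(pt \<Rightarrow> real) \<Rightarrow> real" where "nrm phi = (\<integral>x. (phi x)\<^sup>2 \<partial>lebS)"
definition ip :: "(pt \<Rightarrow> real) \<Rightarrow> (pt \<Rightarrow> real) \<Rightarrow> real" where "ip phi psi = (\<integral>x. phi x * psi x \<partial>lebS)"
definition energy :: "(pt \<Rightarrow> real) \<Rightarrow> real" where "energy phi = nrm (pd1 phi) + nrm (pd2 phi)"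

lemma nrm_nonneg: "nrm phi \<ge> 0" by (simp add: nrm_def)

lemma energy_nonneg: "energy phi \<ge> 0" by (simp add: energy_def nrm_nonneg)

lemma nrm_lincomb:
  assumes "test_fun S phi" "test_fun S psi"
  shows "nrm (\<lambda>x. a * phi x + b * psi x) = a\<^sup>2 * nrm phi + 2 * a * b * ip phi psi + b\<^sup>2 * nrm psi"
  unfolding nrm_def ip_def by (rule sq_int_quad) (use test_fun_sq_int(1) assms S in blast)+

lemma energy_lincomb:
  assumes "test_fun S phi" "test_fun S psi"
  shows "energy (\<lambda>x. a * phi x + b * psi x) = a\<^sup>2 * energy phi + 2 * a * b * (ip (pd1 phi) (pd1 psi) + ip (pd2 phi) (pd2 psi)) + b\<^sup>2 * energy psi"
proof -
  note q = test_fun_sq_int(2,3)[OF assms(1) S(1)] test_fun_sq_int(2,3)[OF assms(2) S(1)]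
  show ?thesis
    unfolding energy_def test_fun_lincomb(2,3)[OF assms] nrm_def ip_def
    unfolding sq_int_quad[OF q(1,3)] sq_int_quad[OF q(2,4)] by (simp add: algebra_simps)
qed

text \<open>The variational value. \<open>lamD\<close> is an infimum over weak eigenvalues instead;
  the link between the two is \<open>bottom_eigenvalue\<close>.\<close>

definition bottom :: real where "bottom = Inf {energy phi | phi. test_fun S phi \<and> nrm phi = 1}"

lemma nrm_pos_ex: "\<exists>phi. test_fun S phi \<and> nrm phi > 0"
proof -
  obtain phi :: "pt \<Rightarrow> real" and p r where phi: "test_fun S phi" "r > 0" "\<And>x. x \<in> ball p r \<Longrightarrow> phi x > 0"
    by (rule test_fun_ex[OF S(1,3)]) blast
  obtain K where K: "compact K" "K \<subseteq> S" "\<And>x. x \<notin> K \<Longrightarrow> phi x = 0 \<and> pd1 phi x = 0 \<and> pd2 phi x = 0" by (rule test_fun_support[OF phi(1)]) blast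
  have "integrable lborel (\<lambda>x. (phi x)\<^sup>2)"
    by (rule integrable_cont_compact[OF _ K(1)]) (use K(3) test_fun_smooth(2)[OF phi(1)] in \<open>auto intro!: continuous_intros\<close>)
  then have "integral\<^sup>L lborel (\<lambda>x. (phi x)\<^sup>2) > 0"
    by (rule integral_pos_ball[OF _ _ phi(2)]) (use phi(3) in force)+
  moreover have "nrm phi = integral\<^sup>L lborel (\<lambda>x. (phi x)\<^sup>2)"
    unfolding nrm_def by (rule restrict_lint_zero[OF S(1)]) (use K(2,3) in auto)
  ultimately show ?thesis using phi(1) by metis
qed

lemma normalise:
  assumes "test_fun S phi" "nrm phi > 0"
  shows "energy phi / nrm phi \<in> {energy phi | phi. test_fun S phi \<and> nrm phi = 1}"
proof -
  define c where "c = 1 / sqrt (nrm phi)"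
  let ?psi = "\<lambda>x. c * phi x + 0 * phi x"
  have c2: "c\<^sup>2 = 1 / nrm phi" using assms(2) by (simp add: c_def power_divide)
  have "test_fun S ?psi" by (rule test_fun_lincomb(1)[OF assms(1,1)])
  moreover have "nrm ?psi = 1" using nrm_lincomb[OF assms(1,1), of c 0] c2 assms(2) by simp
  moreover have "energy ?psi = energy phi / nrm phi" using energy_lincomb[OF assms(1,1), of c 0] c2 by simp
  ultimately show ?thesis by (metis (mono_tags, lifting) mem_Collect_eq)
qed

lemma bottom_le:
  assumes "test_fun S phi" shows "bottom * nrm phi \<le> energy phi"
proof (cases "nrm phi > 0")
  case True
  have "bottom \<le> energy phi / nrm phi" unfolding bottom_def
    by (rule cInf_lower[OF normalise[OF assms True]]) (auto simp: bdd_below_def intro!: exI[of _ 0] energy_nonneg)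
  then show ?thesis using True by (simp add: pos_le_divide_eq)
next
  case False
  then have "nrm phi = 0" using nrm_nonneg[of phi] by simp
  then show ?thesis using energy_nonneg by simp
qed

lemma bottom_nonneg: "bottom \<ge> 0"
  unfolding bottom_def using nrm_pos_ex normalise energy_nonneg by (intro cInf_greatest) blast+

text \<open>Along a minimising sequence the parallelogram identity turns \<open>L\<^sup>2\<close> convergence into
  convergence of the gradients.\<close>
lemma minimiser:
  obtains phi u g1 g2 where "\<And>n. test_fun S (phi n)" "\<And>n. nrm (phi n) = 1" "(\<lambda>n. energy (phi n)) \<longlonglongrightarrow> bottom"
    "sq_int lebS u" "sq_int lebS g1" "sq_int lebS g2" "(\<lambda>n. \<integral>x. (phi n x - u x)\<^sup>2 \<partial>lebS) \<longlonglongrightarrow> 0"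
    "(\<lambda>n. \<integral>x. (pd1 (phi n) x - g1 x)\<^sup>2 \<partial>lebS) \<longlonglongrightarrow> 0" "(\<lambda>n. \<integral>x. (pd2 (phi n) x - g2 x)\<^sup>2 \<partial>lebS) \<longlonglongrightarrow> 0"
proof -
  have ne: "{energy phi | phi. test_fun S phi \<and> nrm phi = 1} \<noteq> {}" using nrm_pos_ex normalise by blast
  have "\<forall>n. \<exists>phi. test_fun S phi \<and> nrm phi = 1 \<and> energy phi < bottom + inverse (real (Suc n))"
  proof
    fix n
    have "Inf {energy phi | phi. test_fun S phi \<and> nrm phi = 1} < bottom + inverse (real (Suc n))" by (simp add: bottom_def)
    from cInf_lessD[OF ne this] show "\<exists>phi. test_fun S phi \<and> nrm phi = 1 \<and> energy phi < bottom + inverse (real (Suc n))" by blast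
  qed
  then obtain phi where phi: "\<And>n. test_fun S (phi n)" "\<And>n. nrm (phi n) = 1" "\<And>n. energy (phi n) < bottom + inverse (real (Suc n))" by metis
  have lo: "bottom \<le> energy (phi n)" for n using bottom_le[OF phi(1)[of n]] phi(2) by simp
  have en: "(\<lambda>n. energy (phi n)) \<longlonglongrightarrow> bottom"
  proof (rule tendsto_sandwich[OF _ _ tendsto_const])
    show "(\<lambda>n. bottom + inverse (real (Suc n))) \<longlonglongrightarrow> bottom"
      using tendsto_add[OF tendsto_const LIMSEQ_inverse_real_of_nat, of bottom] by simp
  qed (use lo phi(3) in \<open>auto intro!: always_eventually less_imp_le\<close>)
  obtain R where R: "R > 0" "\<And>x. x \<in> S \<Longrightarrow> norm x \<le> R" using S(2) bounded_pos by metis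
  have supp: "phi n x = 0 \<and> pd1 (phi n) x = 0 \<and> pd2 (phi n) x = 0" if "x \<notin> S" for n x
  proof -
    obtain K where "compact K" "K \<subseteq> S" "\<And>x. x \<notin> K \<Longrightarrow> phi n x = 0 \<and> pd1 (phi n) x = 0 \<and> pd2 (phi n) x = 0"
      by (rule test_fun_support[OF phi(1)[of n]]) blast
    then show ?thesis using that by blast
  qed
  have toL: "integral\<^sup>L lborel (\<lambda>x. (h x)\<^sup>2) = nrm h" if "\<And>x. x \<notin> S \<Longrightarrow> h x = 0" for h :: "pt \<Rightarrow> real"
    unfolding nrm_def by (rule restrict_lint_zero[symmetric, OF S(1)]) (simp add: that)
  have b: "nrm (pd1 (phi n)) \<le> bottom + 1" "nrm (pd2 (phi n)) \<le> bottom + 1" for n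
  proof -
    have "inverse (real (Suc n)) \<le> 1" by (simp add: field_simps)
    then have "energy (phi n) \<le> bottom + 1" using phi(3)[of n] by linarith
    then show "nrm (pd1 (phi n)) \<le> bottom + 1" "nrm (pd2 (phi n)) \<le> bottom + 1"
      using nrm_nonneg[of "pd1 (phi n)"] nrm_nonneg[of "pd2 (phi n)"] by (auto simp: energy_def)
  qed
  obtain r where r: "strict_mono (r :: nat \<Rightarrow> nat)"
    "\<And>e. e > 0 \<Longrightarrow> \<exists>N. \<forall>m\<ge>N. \<forall>n\<ge>N. integral\<^sup>L lborel (\<lambda>x. (phi (r m) x - phi (r n) x)\<^sup>2) < e"
  proof (rule rellich[of phi "\<lambda>n. pd1 (phi n)" "\<lambda>n. pd2 (phi n)" R "bottom + 1"])
    show "has_grad (phi n) (pd1 (phi n) x) (pd2 (phi n) x) x" "continuous_on UNIV (pd1 (phi n))" "continuous_on UNIV (pd2 (phi n))" for n x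
      using test_fun_smooth[OF phi(1)] by blast+
    show "phi n x = 0 \<and> pd1 (phi n) x = 0 \<and> pd2 (phi n) x = 0" if "R < norm x" for n x
      by (rule supp) (use R(2)[of x] that in auto)
    show "integral\<^sup>L lborel (\<lambda>x. (phi n x)\<^sup>2) \<le> bottom + 1" "integral\<^sup>L lborel (\<lambda>x. (pd1 (phi n) x)\<^sup>2) \<le> bottom + 1"
      "integral\<^sup>L lborel (\<lambda>x. (pd2 (phi n) x)\<^sup>2) \<le> bottom + 1" for n
      using toL[of "phi n"] toL[of "pd1 (phi n)"] toL[of "pd2 (phi n)"] supp phi(2)[of n] b[of n] bottom_nonneg by auto
  qed (use R in auto)
  define f where "f n = phi (r n)" for n
  have f: "test_fun S (f n)" "nrm (f n) = 1" for n using phi by (auto simp: f_def)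
  have enf: "(\<lambda>n. energy (f n)) \<longlonglongrightarrow> bottom"
    using LIMSEQ_subseq_LIMSEQ[OF en r(1)] by (simp add: f_def o_def)
  have N1: "\<exists>N. \<forall>m\<ge>N. \<forall>n\<ge>N. nrm (\<lambda>x. f m x - f n x) < e" if "e > 0" for e
  proof -
    have "integral\<^sup>L lborel (\<lambda>x. (phi (r m) x - phi (r n) x)\<^sup>2) = nrm (\<lambda>x. f m x - f n x)" for m n
      unfolding f_def by (rule toL) (simp add: supp)
    then show ?thesis using r(2)[OF that] by simp
  qed
  \<comment> \<open>The energy of the difference is twice the sum of the energies minus the energy
    of the sum, and the latter is at least \<open>bottom\<close> times the squared norm of the sum,
    which is 4 minus that of the difference.\<close>
  have key: "nrm (\<lambda>x. pd1 (f m) x - pd1 (f n) x) + nrm (\<lambda>x. pd2 (f m) x - pd2 (f n) x)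
      \<le> 2 * (energy (f m) - bottom) + 2 * (energy (f n) - bottom) + bottom * nrm (\<lambda>x. f m x - f n x)" for m n
  proof -
    let ?B = "ip (pd1 (f m)) (pd1 (f n)) + ip (pd2 (f m)) (pd2 (f n))" and ?I = "ip (f m) (f n)"
    have 1: "energy (\<lambda>x. 1 * f m x + (-1) * f n x) = energy (f m) - 2 * ?B + energy (f n)"
      using energy_lincomb[OF f(1) f(1), of 1 m "-1" n] by simp
    have 2: "energy (\<lambda>x. 1 * f m x + 1 * f n x) = energy (f m) + 2 * ?B + energy (f n)"
      using energy_lincomb[OF f(1) f(1), of 1 m 1 n] by simp
    have 3: "nrm (\<lambda>x. 1 * f m x + (-1) * f n x) = 2 - 2 * ?I" using nrm_lincomb[OF f(1) f(1), of 1 m "-1" n] f(2) by simp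
    have 4: "nrm (\<lambda>x. 1 * f m x + 1 * f n x) = 2 + 2 * ?I" using nrm_lincomb[OF f(1) f(1), of 1 m 1 n] f(2) by simp
    have 5: "bottom * (2 + 2 * ?I) \<le> energy (f m) + 2 * ?B + energy (f n)"
      using bottom_le[OF test_fun_lincomb(1)[OF f(1) f(1), of 1 m 1 n]] unfolding 2 4 .
    have 6: "energy (\<lambda>x. 1 * f m x + (-1) * f n x) = nrm (\<lambda>x. pd1 (f m) x - pd1 (f n) x) + nrm (\<lambda>x. pd2 (f m) x - pd2 (f n) x)"
      unfolding energy_def test_fun_lincomb(2,3)[OF f(1) f(1)] by simp
    have 7: "nrm (\<lambda>x. f m x - f n x) = 2 - 2 * ?I" using 3 by simp
    show ?thesis using 1 5 unfolding 6[symmetric] 7 by (simp add: algebra_simps)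
  qed
  have N2: "\<exists>N. \<forall>m\<ge>N. \<forall>n\<ge>N. nrm (\<lambda>x. pd1 (f m) x - pd1 (f n) x) + nrm (\<lambda>x. pd2 (f m) x - pd2 (f n) x) < e" if e: "e > 0" for e
  proof -
    obtain K1 where K1: "\<And>n. n \<ge> K1 \<Longrightarrow> energy (f n) - bottom < e / 8"
    proof -
      have "bottom < bottom + e / 8" using e by simp
      from order_tendstoD(2)[OF enf this] obtain K1 where K1: "\<And>n. n \<ge> K1 \<Longrightarrow> energy (f n) < bottom + e / 8"
        unfolding eventually_sequentially by blast
      have "energy (f n) - bottom < e / 8" if "n \<ge> K1" for n using K1[OF that] by linarith
      then show ?thesis by (rule that)
    qed
    \<comment> \<open>\<open>bottom\<close> is only known to be nonnegative here, so the divisor is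
      \<open>bottom + 1\<close>.\<close>
    define L where "L = bottom + 1"
    have L: "L > 0" "bottom \<le> L" using bottom_nonneg by (auto simp: L_def)
    have "e / (2 * L) > 0" using e L by simp
    from N1[OF this] obtain K2 where K2: "\<And>m n. m \<ge> K2 \<Longrightarrow> n \<ge> K2 \<Longrightarrow> nrm (\<lambda>x. f m x - f n x) < e / (2 * L)" by blast
    have "nrm (\<lambda>x. pd1 (f m) x - pd1 (f n) x) + nrm (\<lambda>x. pd2 (f m) x - pd2 (f n) x) < e" if "m \<ge> max K1 K2" "n \<ge> max K1 K2" for m n
    proof -
      have "bottom * nrm (\<lambda>x. f m x - f n x) \<le> L * (e / (2 * L))"
        using K2[of m n] that L nrm_nonneg by (intro mult_mono) auto
      also have "\<dots> = e / 2" using L(1) by simp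
      finally show ?thesis using key[of m n] K1[of m] K1[of n] that by simp
    qed
    then show ?thesis by blast
  qed
  note fin = finite_measure_restrict[OF S(1,2)]
  obtain u where u: "sq_int lebS u" "(\<lambda>n. \<integral>x. (f n x - u x)\<^sup>2 \<partial>lebS) \<longlonglongrightarrow> 0"
    by (rule sq_int_complete[OF fin, of f]) (use test_fun_sq_int(1)[OF f(1) S(1)] N1 in \<open>auto simp: nrm_def\<close>)
  obtain g1 where g1: "sq_int lebS g1" "(\<lambda>n. \<integral>x. (pd1 (f n) x - g1 x)\<^sup>2 \<partial>lebS) \<longlonglongrightarrow> 0"
  proof (rule sq_int_complete[OF fin, of "\<lambda>n. pd1 (f n)"])
    show "\<exists>N. \<forall>m\<ge>N. \<forall>n\<ge>N. (\<integral>x. (pd1 (f m) x - pd1 (f n) x)\<^sup>2 \<partial>lebS) < e" if "e > 0" for e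
      using N2[OF that] nrm_nonneg unfolding nrm_def[symmetric] by (smt (verit, best))
  qed (use test_fun_sq_int(2)[OF f(1) S(1)] in auto)
  obtain g2 where g2: "sq_int lebS g2" "(\<lambda>n. \<integral>x. (pd2 (f n) x - g2 x)\<^sup>2 \<partial>lebS) \<longlonglongrightarrow> 0"
  proof (rule sq_int_complete[OF fin, of "\<lambda>n. pd2 (f n)"])
    show "\<exists>N. \<forall>m\<ge>N. \<forall>n\<ge>N. (\<integral>x. (pd2 (f m) x - pd2 (f n) x)\<^sup>2 \<partial>lebS) < e" if "e > 0" for e
      using N2[OF that] nrm_nonneg unfolding nrm_def[symmetric] by (smt (verit, best))
  qed (use test_fun_sq_int(3)[OF f(1) S(1)] in auto)
  show thesis by (rule that[OF f enf u(1) g1(1) g2(1) u(2) g1(2) g2(2)])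
qed

abbreviation "eigenvalues \<equiv> {ev. \<exists>u g1 g2 :: pt \<Rightarrow> real. H10 S u g1 g2 \<and> L2sq S u \<noteq> 0 \<and>
      (\<forall>phi::pt \<Rightarrow> real. test_fun S phi \<longrightarrow>
         (LINT x:S|lborel. g1 x * pd1 phi x + g2 x * pd2 phi x) = ev * (LINT x:S|lborel. u x * phi x))}"

text \<open>Testing the weak equation with the test functions that approximate \<open>u\<close>
  gives, in the limit, that the Dirichlet energy of \<open>u\<close> is \<open>ev\<close> times its
  squared norm. This bounds the set behind the infimum \<open>lamD\<close> from below.\<close>

lemma eigenvalue_nonneg:
  assumes "ev \<in> eigenvalues" shows "ev \<ge> 0"
proof -
  obtain u g1 g2 :: "pt \<Rightarrow> real" where h: "H10 S u g1 g2" "L2sq S u \<noteq> 0"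
    and w: "\<And>phi::pt \<Rightarrow> real. test_fun S phi \<Longrightarrow>
         (LINT x:S|lborel. g1 x * pd1 phi x + g2 x * pd2 phi x) = ev * (LINT x:S|lborel. u x * phi x)"
    using assms by blast
  note [simp] = set_lint_restrict[OF S(1)] L2sq_restrict[OF S(1)]
  obtain phi :: "nat \<Rightarrow> pt \<Rightarrow> real" where phi: "\<And>n. test_fun S (phi n)" "(\<lambda>n. L2sq S (\<lambda>x. phi n x - u x)) \<longlonglongrightarrow> 0"
    "(\<lambda>n. L2sq S (\<lambda>x. pd1 (phi n) x - g1 x)) \<longlonglongrightarrow> 0" "(\<lambda>n. L2sq S (\<lambda>x. pd2 (phi n) x - g2 x)) \<longlonglongrightarrow> 0"
    using h(1) unfolding H10_def by blast
  have q: "sq_int lebS u" "sq_int lebS g1" "sq_int lebS g2" using h(1) L2_sq_int[OF S(1)] unfolding H10_def by blast+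
  note t = test_fun_sq_int(1-3)[OF phi(1) S(1)]
  have l: "(\<lambda>n. \<integral>x. phi n x * u x \<partial>lebS) \<longlonglongrightarrow> (\<integral>x. u x * u x \<partial>lebS)"
    "(\<lambda>n. \<integral>x. pd1 (phi n) x * g1 x \<partial>lebS) \<longlonglongrightarrow> (\<integral>x. g1 x * g1 x \<partial>lebS)"
    "(\<lambda>n. \<integral>x. pd2 (phi n) x * g2 x \<partial>lebS) \<longlonglongrightarrow> (\<integral>x. g2 x * g2 x \<partial>lebS)"
    using phi(2-4) by (auto intro!: sq_int_inner_tendsto t q)
  have eq: "(\<integral>x. pd1 (phi n) x * g1 x \<partial>lebS) + (\<integral>x. pd2 (phi n) x * g2 x \<partial>lebS) = ev * (\<integral>x. phi n x * u x \<partial>lebS)" for n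
  proof -
    have "(\<integral>x. g1 x * pd1 (phi n) x + g2 x * pd2 (phi n) x \<partial>lebS) = (\<integral>x. g1 x * pd1 (phi n) x \<partial>lebS) + (\<integral>x. g2 x * pd2 (phi n) x \<partial>lebS)"
      by (intro Bochner_Integration.integral_add sq_int_mult t q)
    then show ?thesis using w[OF phi(1)[of n]] by (simp add: mult.commute)
  qed
  have "(\<integral>x. g1 x * g1 x \<partial>lebS) + (\<integral>x. g2 x * g2 x \<partial>lebS) = ev * (\<integral>x. u x * u x \<partial>lebS)"
    using LIMSEQ_unique[OF tendsto_add[OF l(2,3)]] tendsto_mult[OF tendsto_const l(1), of ev] unfolding eq by blast
  moreover have "(\<integral>x. u x * u x \<partial>lebS) > 0"
  proof -
    have "(\<integral>x. u x * u x \<partial>lebS) \<noteq> 0" using h(2) by (simp add: power2_eq_square)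
    then have "(\<integral>x. u x * u x \<partial>lebS) < 0 \<or> (\<integral>x. u x * u x \<partial>lebS) > 0" by linarith
    moreover have "(\<integral>x. u x * u x \<partial>lebS) \<ge> 0" by simp
    ultimately show ?thesis by linarith
  qed
  moreover have "(\<integral>x. g1 x * g1 x \<partial>lebS) \<ge> 0" "(\<integral>x. g2 x * g2 x \<partial>lebS) \<ge> 0" by simp_all
  ultimately have "0 \<le> ev * (\<integral>x. u x * u x \<partial>lebS)" "(\<integral>x. u x * u x \<partial>lebS) > 0" by linarith+
  then show ?thesis by (simp add: zero_le_mult_iff)
qed

text \<open>First variation: energy minus \<open>bottom\<close> times squared norm is nonnegative on
  test functions. At phi_n + s psi it tends to 2 s a' + s^2 c, and nonnegativity for every real
  \<open>s\<close> forces a' = 0, which is the weak equation.\<close>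

lemma bottom_eigenvalue: "bottom \<in> eigenvalues"
proof -
  obtain phi u g1 g2 where m: "\<And>n. test_fun S (phi n)" "\<And>n. nrm (phi n) = 1" "(\<lambda>n. energy (phi n)) \<longlonglongrightarrow> bottom"
    "sq_int lebS u" "sq_int lebS g1" "sq_int lebS g2" "(\<lambda>n. \<integral>x. (phi n x - u x)\<^sup>2 \<partial>lebS) \<longlonglongrightarrow> 0"
    "(\<lambda>n. \<integral>x. (pd1 (phi n) x - g1 x)\<^sup>2 \<partial>lebS) \<longlonglongrightarrow> 0" "(\<lambda>n. \<integral>x. (pd2 (phi n) x - g2 x)\<^sup>2 \<partial>lebS) \<longlonglongrightarrow> 0"
    by (rule minimiser) blast
  note [simp] = set_lint_restrict[OF S(1)] L2sq_restrict[OF S(1)]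
  \<comment> \<open>The limits are determined on \<open>S\<close> only, while \<open>L2\<close> asks
    for measurability on the whole plane; \<open>i\<close> extends by zero.\<close>
  define i :: "(pt \<Rightarrow> real) \<Rightarrow> pt \<Rightarrow> real" where "i f x = indicator S x *\<^sub>R f x" for f x
  have sp: "space lebS = S" by (simp add: space_restrict_space)
  have ii: "i f x = f x" if "x \<in> space lebS" for f x using that by (simp add: i_def sp)
  note t = test_fun_sq_int(1-3)[OF m(1) S(1)]
  have "(\<lambda>n. \<integral>x. 1 * (norm (phi n x))\<^sup>2 \<partial>lebS) \<longlonglongrightarrow> (\<integral>x. 1 * (norm (u x))\<^sup>2 \<partial>lebS)"
    by (rule sq_int_norm_tendsto(1)[where B=1]) (use t m(4,7) in auto)
  then have "(\<integral>x. (u x)\<^sup>2 \<partial>lebS) = 1" using m(2) LIMSEQ_unique[OF _ tendsto_const] unfolding nrm_def by simp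
  then have u1: "L2sq S (i u) \<noteq> 0" using Bochner_Integration.integral_cong[OF refl, of lebS "\<lambda>x. (i u x)\<^sup>2" "\<lambda>x. (u x)\<^sup>2"] ii by simp
  have cg: "(\<integral>x. (h x - i f x)\<^sup>2 \<partial>lebS) = (\<integral>x. (h x - f x)\<^sup>2 \<partial>lebS)" for h f
    by (intro Bochner_Integration.integral_cong refl) (simp add: ii)
  have H: "H10 S (i u) (i g1) (i g2)" unfolding H10_def
  proof (intro conjI exI[of _ phi] allI)
    show "L2 S (i u)" "L2 S (i g1)" "L2 S (i g2)" unfolding i_def using sq_int_L2[OF S(1)] m(4-6) by blast+
  qed (use m cg in auto)
  have weak: "(\<integral>x. g1 x * pd1 psi x \<partial>lebS) + (\<integral>x. g2 x * pd2 psi x \<partial>lebS) = bottom * (\<integral>x. u x * psi x \<partial>lebS)" if psi: "test_fun S psi" for psi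
  proof -
    note tp = test_fun_sq_int(1-3)[OF psi S(1)]
    define a where "a n = ip (pd1 (phi n)) (pd1 psi) + ip (pd2 (phi n)) (pd2 psi) - bottom * ip (phi n) psi" for n
    define a' where "a' = (\<integral>x. g1 x * pd1 psi x \<partial>lebS) + (\<integral>x. g2 x * pd2 psi x \<partial>lebS) - bottom * (\<integral>x. u x * psi x \<partial>lebS)"
    define c where "c = energy psi - bottom * nrm psi"
    have al: "a \<longlonglongrightarrow> a'" unfolding a_def a'_def ip_def
      by (intro tendsto_intros sq_int_inner_tendsto t tp m) (use m(7-9) in auto)
    have ge: "0 \<le> 2 * s * a' + s\<^sup>2 * c" for s
    proof (rule LIMSEQ_le_const)
      show "(\<lambda>n. (energy (phi n) - bottom) + 2 * s * a n + s\<^sup>2 * c) \<longlonglongrightarrow> 2 * s * a' + s\<^sup>2 * c"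
        using tendsto_add[OF tendsto_add[OF tendsto_diff[OF m(3) tendsto_const[of bottom]] tendsto_mult[OF tendsto_const[of "2 * s"] al]] tendsto_const[of "s\<^sup>2 * c"]] by simp
      have "0 \<le> (energy (phi n) - bottom) + 2 * s * a n + s\<^sup>2 * c" for n
        using bottom_le[OF test_fun_lincomb(1)[OF m(1)[of n] psi, of 1 s]]
        unfolding nrm_lincomb[OF m(1) psi] energy_lincomb[OF m(1) psi] by (simp add: m(2) a_def c_def algebra_simps)
      then show "\<exists>N. \<forall>n\<ge>N. 0 \<le> (energy (phi n) - bottom) + 2 * s * a n + s\<^sup>2 * c" by blast
    qed
    have "a' = 0"
    proof (rule ccontr)
      assume n: "a' \<noteq> 0"
      \<comment> \<open>\<open>c\<close> may vanish; \<open>L\<close> is a positive majorant, and s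
        = - a'/L minimises 2 s a' + s^2 L.\<close>
      define L where "L = \<bar>c\<bar> + 1"
      have L: "L > 0" "c \<le> L" by (auto simp: L_def)
      define s where "s = - a' / L"
      have "2 * s * a' + s\<^sup>2 * c \<le> 2 * s * a' + s\<^sup>2 * L" using L(2) by (intro add_left_mono mult_left_mono) auto
      also have "\<dots> = - (a'\<^sup>2 / L)"
        using L(1) by (simp add: s_def power2_eq_square field_simps)
      also have "\<dots> < 0" using n L(1) by simp
      finally show False using ge[of s] by simp
    qed
    then show ?thesis by (simp add: a'_def)
  qed
  have "(\<integral>x. i g1 x * pd1 psi x + i g2 x * pd2 psi x \<partial>lebS) = bottom * (\<integral>x. i u x * psi x \<partial>lebS)" if psi: "test_fun S psi" for psi
  proof -
    note tp = test_fun_sq_int(1-3)[OF psi S(1)]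
    have "(\<integral>x. i g1 x * pd1 psi x + i g2 x * pd2 psi x \<partial>lebS) = (\<integral>x. g1 x * pd1 psi x + g2 x * pd2 psi x \<partial>lebS)"
      by (intro Bochner_Integration.integral_cong refl) (simp add: ii)
    also have "\<dots> = (\<integral>x. g1 x * pd1 psi x \<partial>lebS) + (\<integral>x. g2 x * pd2 psi x \<partial>lebS)"
      by (intro Bochner_Integration.integral_add sq_int_mult tp m)
    also have "\<dots> = bottom * (\<integral>x. u x * psi x \<partial>lebS)" by (rule weak[OF psi])
    also have "(\<integral>x. u x * psi x \<partial>lebS) = (\<integral>x. i u x * psi x \<partial>lebS)"
      by (intro Bochner_Integration.integral_cong refl) (simp add: ii)
    finally show ?thesis .
  qed
  then show ?thesis using H u1 by auto
qed

text \<open>That \<open>bottom\<close> is an eigenvalue bounds \<open>lamD\<close> above by it and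
  makes the infimum one over a nonempty set; \<open>eigenvalue_nonneg\<close> supplies the lower
  bound.\<close>

theorem lamD_rayleigh:
  shows "lamD S \<ge> 0" "test_fun S phi \<Longrightarrow> lamD S * nrm phi \<le> energy phi"
proof -
  show "lamD S \<ge> 0" unfolding lamD_def
    by (rule cInf_greatest) (use bottom_eigenvalue eigenvalue_nonneg in auto)
  have "lamD S \<le> bottom" unfolding lamD_def
    by (rule cInf_lower[OF bottom_eigenvalue]) (use eigenvalue_nonneg in \<open>auto simp: bdd_below_def\<close>)
  then show "lamD S * nrm phi \<le> energy phi" if "test_fun S phi"
    using bottom_le[OF that] mult_right_mono[OF _ nrm_nonneg] order_trans by blast
qed

end

section \<open>Curves tangent to a unit field\<close>

text \<open>The charts take the place of a Lipschitz condition on \<open>tau\<close>: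
  \<open>beta\<close> is a local solution, and \<open>s\<close> is a coordinate inverse to it on
  \<open>F\<close> whose derivative along \<open>tau\<close> is 1, so along any solution it grows at
  the prescribed speed.\<close>

locale unit_tangent_curve =
  fixes F :: "'a::euclidean_space set" and tau :: "'a \<Rightarrow> 'a"
  assumes compact: "compact F" and connected: "connected F" and nonempty: "F \<noteq> {}"
    and chart: "\<And>p. p \<in> F \<Longrightarrow> \<exists>e>0. \<exists>beta s U. open U \<and> p \<in> U \<and> beta 0 = p \<and>
      (\<forall>t. \<bar>t\<bar> < e \<longrightarrow> beta t \<in> F \<inter> U \<and> s (beta t) = t \<and> (beta has_vector_derivative tau (beta t)) (at t)) \<and>
      (\<forall>x\<in>F \<inter> U. \<bar>s x\<bar> < e \<and> beta (s x) = x \<and> (\<exists>s'. (s has_derivative s') (at x) \<and> s' (tau x) = (1::real)))"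
    and continuous: "continuous_on F tau"
begin

text \<open>\<open>c\<close> is the speed: constantly 1 for the flow itself, general for an
  arbitrary traversal, so that one uniqueness statement covers both.\<close>

definition sol :: "(real \<Rightarrow> real) \<Rightarrow> real set \<Rightarrow> (real \<Rightarrow> 'a) \<Rightarrow> bool" where
  "sol c I \<delta> \<longleftrightarrow> (\<forall>t\<in>I. \<delta> t \<in> F \<and> (\<delta> has_vector_derivative c t *\<^sub>R tau (\<delta> t)) (at t))"

lemma sol_isCont: "sol c I \<delta> \<Longrightarrow> t \<in> I \<Longrightarrow> isCont \<delta> t"
  unfolding sol_def using has_vector_derivative_continuous by blast

lemma sol_subset: "sol c I \<delta> \<Longrightarrow> J \<subseteq> I \<Longrightarrow> sol c J \<delta>"
  unfolding sol_def by blast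

text \<open>The coincidence set is closed by continuity. It is open because, in a chart,
  \<open>s\<close> composed with either solution has derivative \<open>c\<close>, and
  \<open>beta\<close> recovers the solutions from \<open>s\<close>.\<close>

lemma sol_unique:
  assumes I: "open I" "is_interval I" and s1: "sol c I \<delta>1" and s2: "sol c I \<delta>2"
    and t0: "t0 \<in> I" "\<delta>1 t0 = \<delta>2 t0" and t: "t \<in> I"
  shows "\<delta>1 t = \<delta>2 t"
proof -
  define A where "A = {t\<in>I. \<delta>1 t - \<delta>2 t = 0}"
  have "continuous_on I (\<lambda>t. \<delta>1 t - \<delta>2 t)"
    using sol_isCont[OF s1] sol_isCont[OF s2] by (intro continuous_on_diff continuous_at_imp_continuous_on) auto
  then have clo: "closedin (top_of_set I) A"
    unfolding A_def using continuous_closedin_preimage_constant by blast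
  have "open A"
    unfolding open_contains_ball
  proof
    fix u assume "u \<in> A"
    then have u: "u \<in> I" "\<delta>1 u = \<delta>2 u" by (auto simp: A_def)
    then have uF: "\<delta>1 u \<in> F" using s1 by (auto simp: sol_def)
    from chart[OF uF] obtain e beta s U where ch: "e > 0" "open U" "\<delta>1 u \<in> U"
      "\<forall>x\<in>F \<inter> U. \<bar>s x\<bar> < e \<and> beta (s x) = x \<and> (\<exists>s'. (s has_derivative s') (at x) \<and> s' (tau x) = (1::real))"
      by blast
    have "\<forall>\<^sub>F t in at u. \<delta>1 t \<in> U" "\<forall>\<^sub>F t in at u. \<delta>2 t \<in> U"
      using sol_isCont[OF s1 u(1)] sol_isCont[OF s2 u(1)] ch(2,3) u(2)
      by (auto simp: isCont_def intro: topological_tendstoD)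
    moreover have "\<forall>\<^sub>F t in at u. t \<in> I" using I(1) u(1) by (rule eventually_at_in_open')
    ultimately have "\<forall>\<^sub>F t in at u. \<delta>1 t \<in> U \<and> \<delta>2 t \<in> U \<and> t \<in> I" by eventually_elim auto
    then obtain d where d: "d > 0" "\<And>t. dist t u < d \<Longrightarrow> t \<noteq> u \<Longrightarrow> \<delta>1 t \<in> U \<and> \<delta>2 t \<in> U \<and> t \<in> I"
      unfolding eventually_at by auto
    have J: "\<delta>1 t \<in> U" "\<delta>2 t \<in> U" "t \<in> I" if "t \<in> ball u d" for t
    proof -
      have "\<delta>1 t \<in> U \<and> \<delta>2 t \<in> U \<and> t \<in> I"
      proof (cases "t = u")
        case True then show ?thesis using u ch(3) by simp
      next
        case False then show ?thesis using d(2)[of t] that by (simp add: dist_commute)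
      qed
      then show "\<delta>1 t \<in> U" "\<delta>2 t \<in> U" "t \<in> I" by auto
    qed
    have der: "((\<lambda>t. s (\<delta> t)) has_vector_derivative c t) (at t)"
      if "sol c I \<delta>" "\<delta> t \<in> U" "t \<in> I" for \<delta> t
    proof -
      have "\<delta> t \<in> F" using that by (auto simp: sol_def)
      then obtain s' where s': "(s has_derivative s') (at (\<delta> t))" "s' (tau (\<delta> t)) = 1"
        using ch(4) \<open>\<delta> t \<in> U\<close> by blast
      have dd: "(\<delta> has_derivative (\<lambda>h. h *\<^sub>R (c t *\<^sub>R tau (\<delta> t)))) (at t)"
        using that(1,3) unfolding sol_def has_vector_derivative_def by blast
      have "((\<lambda>t. s (\<delta> t)) has_derivative (\<lambda>h. s' (h *\<^sub>R (c t *\<^sub>R tau (\<delta> t))))) (at t)"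
        using has_derivative_compose[OF dd s'(1)] .
      moreover have "s' (h *\<^sub>R (c t *\<^sub>R tau (\<delta> t))) = h *\<^sub>R c t" for h
        using linear_scale[OF has_derivative_linear[OF s'(1)], of "h * c t" "tau (\<delta> t)"] s'(2) by simp
      ultimately show ?thesis unfolding has_vector_derivative_def by simp
    qed
    have "((\<lambda>t. s (\<delta>1 t) - s (\<delta>2 t)) has_derivative (\<lambda>h. 0)) (at t within ball u d)" if "t \<in> ball u d" for t
    proof -
      have "((\<lambda>t. s (\<delta>1 t) - s (\<delta>2 t)) has_vector_derivative (c t - c t)) (at t)"
        by (intro has_vector_derivative_diff der s1 s2 J that)
      then show ?thesis
        unfolding has_vector_derivative_def by (auto intro: has_derivative_at_withinI)
    qed
    then obtain k where k: "\<And>t. t \<in> ball u d \<Longrightarrow> s (\<delta>1 t) - s (\<delta>2 t) = k"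
      using has_derivative_zero_constant[of "ball u d" "\<lambda>t. s (\<delta>1 t) - s (\<delta>2 t)"] by auto
    have "k = 0" using k[of u] d(1) u(2) by simp
    have "ball u d \<subseteq> A"
    proof
      fix t assume t: "t \<in> ball u d"
      have "\<delta>1 t \<in> F" "\<delta>2 t \<in> F" using J[OF t] s1 s2 by (auto simp: sol_def)
      then have "beta (s (\<delta>1 t)) = \<delta>1 t" "beta (s (\<delta>2 t)) = \<delta>2 t" using ch(4) J[OF t] by auto
      moreover have "s (\<delta>1 t) = s (\<delta>2 t)" using k[OF t] \<open>k = 0\<close> by simp
      ultimately have "\<delta>1 t = \<delta>2 t" by metis
      then show "t \<in> A" using J(3)[OF t] by (simp add: A_def)
    qed
    then show "\<exists>e>0. ball u e \<subseteq> A" using d(1) by blast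
  qed
  then have "openin (top_of_set I) A" by (simp add: open_openin_trans[OF I(1)] A_def subsetI)
  then have "A = {} \<or> A = I"
    using clo is_interval_connected[OF I(2)] connected_clopen[of I] by blast
  moreover have "t0 \<in> A" using t0 by (auto simp: A_def)
  ultimately show ?thesis using t by (auto simp: A_def)
qed

lemma sol_shift: "sol (\<lambda>_. 1) I \<delta> \<Longrightarrow> sol (\<lambda>_. 1) {t. t + a \<in> I} (\<lambda>t. \<delta> (t + a))"
proof -
  assume *: "sol (\<lambda>_. 1) I \<delta>"
  have "((\<lambda>t. \<delta> (t + a)) has_vector_derivative tau (\<delta> (t + a))) (at t)" if "t + a \<in> I" for t
  proof -
    have "(\<delta> has_vector_derivative tau (\<delta> (t + a))) (at (t + a))" using * that by (auto simp: sol_def)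
    then have "((\<delta> \<circ> (\<lambda>t. t + a)) has_vector_derivative (1 *\<^sub>R tau (\<delta> (t + a)))) (at t)"
      by (intro vector_diff_chain_at) (auto intro!: derivative_eq_intros)
    then show ?thesis by (simp add: o_def)
  qed
  then show ?thesis using * by (auto simp: sol_def)
qed

text \<open>Compactness makes the life span uniform: start points without life span 1/(n+1) would
  accumulate at a point whose chart gives all nearby points a life span of e/2, by a time shift of
  \<open>beta\<close>.\<close>

lemma local_sol:
  obtains e where "e > 0" "\<And>q. q \<in> F \<Longrightarrow> \<exists>beta. beta 0 = q \<and> sol (\<lambda>_. 1) {-e<..<e} beta"
proof (rule ccontr)
  assume "\<not> thesis"
  then have neg: "\<not> (\<forall>q. q \<in> F \<longrightarrow> (\<exists>beta. beta 0 = q \<and> sol (\<lambda>_. 1) {-e<..<e} beta))" if "e > 0" for e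
    using \<open>\<And>e. 0 < e \<Longrightarrow> (\<And>q. q \<in> F \<Longrightarrow> \<exists>beta. beta 0 = q \<and> sol (\<lambda>_. 1) {-e<..<e} beta) \<Longrightarrow> thesis\<close>[OF that] by auto
  have "\<forall>n. \<exists>q\<in>F. \<not> (\<exists>beta. beta 0 = q \<and> sol (\<lambda>_. 1) {-inverse (Suc n)<..<inverse (Suc n)} beta)"
  proof
    fix n
    have "0 < inverse (real (Suc n))" by simp
    from neg[OF this] show "\<exists>q\<in>F. \<not> (\<exists>beta. beta 0 = q \<and> sol (\<lambda>_. 1) {-inverse (Suc n)<..<inverse (Suc n)} beta)" by auto
  qed
  then obtain q where q: "\<And>n. q n \<in> F"
    "\<And>n. \<not> (\<exists>beta. beta 0 = q n \<and> sol (\<lambda>_. 1) {-inverse (Suc n)<..<inverse (Suc n)} beta)" by metis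
  then obtain l r where l: "l \<in> F" "strict_mono (r::nat\<Rightarrow>nat)" "(q \<circ> r) \<longlonglongrightarrow> l"
    using compact unfolding compact_def by metis
  from chart[OF l(1)] obtain e beta s U where ch: "e > 0" "open U" "l \<in> U" "beta 0 = l"
    "\<forall>t. \<bar>t\<bar> < e \<longrightarrow> beta t \<in> F \<inter> U \<and> s (beta t) = t \<and> (beta has_vector_derivative tau (beta t)) (at t)"
    "\<forall>x\<in>F \<inter> U. \<bar>s x\<bar> < e \<and> beta (s x) = x \<and> (\<exists>s'. (s has_derivative s') (at x) \<and> s' (tau x) = (1::real))"
    by blast
  have "isCont s l" using ch(3,6) l(1) has_derivative_continuous by blast
  moreover have "s l = 0" using ch(1,4,5) by (metis abs_zero)
  ultimately have "(\<lambda>n. s ((q \<circ> r) n)) \<longlonglongrightarrow> 0" using isCont_tendsto_compose l(3) by fastforce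
  then have "\<forall>\<^sub>F n in sequentially. \<bar>s ((q \<circ> r) n)\<bar> < e/2"
    using ch(1) by (auto dest!: tendstoD[of _ _ _ "e/2"])
  moreover have "\<forall>\<^sub>F n in sequentially. (q \<circ> r) n \<in> U" using topological_tendstoD[OF l(3) ch(2,3)] .
  moreover have "\<forall>\<^sub>F n in sequentially. inverse (Suc n) < e/2"
    using ch(1) LIMSEQ_inverse_real_of_nat by (auto dest!: tendstoD[of _ _ _ "e/2"])
  ultimately have "\<forall>\<^sub>F n in sequentially. \<bar>s ((q \<circ> r) n)\<bar> < e/2 \<and> (q \<circ> r) n \<in> U \<and> inverse (Suc n) < e/2"
    by eventually_elim auto
  then obtain n where n: "\<bar>s (q (r n))\<bar> < e/2" "q (r n) \<in> U" "inverse (Suc n) < e/2"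
    using eventually_sequentially by auto
  have "inverse (Suc (r n)) \<le> inverse (real (Suc n))" using seq_suble[OF l(2), of n] by (intro le_imp_inverse_le) auto
  then have rn: "inverse (real (Suc (r n))) < e/2" using n(3) by linarith
  have b: "sol (\<lambda>_. 1) {-e<..<e} beta" using ch(5) by (auto simp: sol_def)
  let ?a = "s (q (r n))"
  have "sol (\<lambda>_. 1) {-inverse (Suc (r n))<..<inverse (Suc (r n))} (\<lambda>t. beta (t + ?a))"
    by (rule sol_subset[OF sol_shift[OF b, of ?a]]) (use n(1) rn in auto)
  moreover have "beta (0 + ?a) = q (r n)" using ch(6) n(2) q(1) by auto
  ultimately show False using q(2)[of "r n"] by (metis)
qed

lemma sol_glue:
  assumes "sol c {a<..<b} \<delta>1" "sol c {d<..<e} \<delta>2" "a \<le> d" "b \<le> e" "u \<in> {d<..<b}" "\<delta>1 u = \<delta>2 u"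
  obtains \<delta> where "sol c {a<..<e} \<delta>" "\<And>t. t \<in> {a<..<b} \<Longrightarrow> \<delta> t = \<delta>1 t" "\<And>t. t \<in> {d<..<e} \<Longrightarrow> \<delta> t = \<delta>2 t"
proof -
  define \<delta> where "\<delta> t = (if t < b then \<delta>1 t else \<delta>2 t)" for t
  have eq: "\<delta>1 t = \<delta>2 t" if "t \<in> {d<..<b}" for t
  proof (rule sol_unique[of "{d<..<b}" c \<delta>1 \<delta>2 u])
    show "sol c {d<..<b} \<delta>1" "sol c {d<..<b} \<delta>2" using assms(1,2) by (auto intro: sol_subset simp: assms(3,4) subset_iff order.strict_trans1[OF assms(3)] order.strict_trans2[OF _ assms(4)])
  qed (use assms that in auto)
  have 1: "\<delta> t = \<delta>1 t" if "t \<in> {a<..<b}" for t using that by (auto simp: \<delta>_def)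
  have 2: "\<delta> t = \<delta>2 t" if "t \<in> {d<..<e}" for t using that eq by (auto simp: \<delta>_def)
  have "sol c {a<..<e} \<delta>" unfolding sol_def
  proof
    fix t assume t: "t \<in> {a<..<e}"
    show "\<delta> t \<in> F \<and> (\<delta> has_vector_derivative c t *\<^sub>R tau (\<delta> t)) (at t)"
    proof (cases "t < b")
      case True
      then have tt: "t \<in> {a<..<b}" using t by auto
      have "(\<delta> has_vector_derivative c t *\<^sub>R tau (\<delta>1 t)) (at t)"
        by (rule has_vector_derivative_transform_within_open[of \<delta>1 _ _ "{a<..<b}"])
          (use assms(1) tt 1 in \<open>auto simp: sol_def\<close>)
      then show ?thesis using assms(1) tt 1 by (auto simp: sol_def)
    next
      case False
      then have tt: "t \<in> {d<..<e}" using t assms(5) by auto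
      have "(\<delta> has_vector_derivative c t *\<^sub>R tau (\<delta>2 t)) (at t)"
        by (rule has_vector_derivative_transform_within_open[of \<delta>2 _ _ "{d<..<e}"])
          (use assms(2) tt 2 in \<open>auto simp: sol_def\<close>)
      then show ?thesis using assms(2) tt 2 by (auto simp: sol_def)
    qed
  qed
  then show thesis using that 1 2 by blast
qed

section \<open>Global flow, surjectivity and the minimal period\<close>

lemma sol_extend:
  assumes e: "e > 0" "\<And>q. q \<in> F \<Longrightarrow> \<exists>beta. beta 0 = q \<and> sol (\<lambda>_. 1) {-e<..<e} beta"
    and d: "sol (\<lambda>_. 1) {-T<..<T} \<delta>" "T > e"
  obtains \<delta>' where "sol (\<lambda>_. 1) {-(T + e/2)<..<T + e/2} \<delta>'" "\<delta>' 0 = \<delta> 0"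
proof -
  have sh: "\<exists>beta. beta a = \<delta> a \<and> sol (\<lambda>_. 1) {a-e<..<a+e} beta" if "a \<in> {-T<..<T}" for a
  proof -
    have "\<delta> a \<in> F" using d that by (auto simp: sol_def)
    then obtain beta where b: "beta 0 = \<delta> a" "sol (\<lambda>_. 1) {-e<..<e} beta" using e by blast
    have "sol (\<lambda>_. 1) {a-e<..<a+e} (\<lambda>t. beta (t + (-a)))"
      by (rule sol_subset[OF sol_shift[OF b(2), of "-a"]]) auto
    then show ?thesis using b(1) by (intro exI[of _ "\<lambda>t. beta (t + (-a))"]) auto
  qed
  \<comment> \<open>Restarted e/2 before the end of its life, a solution of span \<open>e\<close>
    reaches e/2 beyond that end.\<close>
  obtain b1 where b1: "b1 (T - e/2) = \<delta> (T - e/2)" "sol (\<lambda>_. 1) {T-e/2-e<..<T-e/2+e} b1"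
    using sh[of "T - e/2"] d e(1) by auto
  obtain d1 where d1: "sol (\<lambda>_. 1) {-T<..<T-e/2+e} d1" "\<And>t. t \<in> {-T<..<T} \<Longrightarrow> d1 t = \<delta> t"
    by (rule sol_glue[OF d(1) b1(2), of "T - e/2"]) (use d e(1) b1 in auto)
  obtain b2 where b2: "b2 (-T + e/2) = \<delta> (-T + e/2)" "sol (\<lambda>_. 1) {-T+e/2-e<..<-T+e/2+e} b2"
    using sh[of "-T + e/2"] d e(1) by auto
  obtain d2 where d2: "sol (\<lambda>_. 1) {-T+e/2-e<..<T-e/2+e} d2" "\<And>t. t \<in> {-T<..<T-e/2+e} \<Longrightarrow> d2 t = d1 t"
    by (rule sol_glue[OF b2(2) d1(1), of "-T + e/2"]) (use d e(1) b2 d1(2)[of "-T + e/2"] in auto)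
  have "sol (\<lambda>_. 1) {-(T + e/2)<..<T + e/2} d2"
    by (rule sol_subset[OF d2(1)]) (auto simp: field_simps)
  moreover have "d2 0 = \<delta> 0" using d1(2)[of 0] d2(2)[of 0] d(2) e(1) by auto
  ultimately show thesis using that by blast
qed

lemma global_sol: obtains gam where "sol (\<lambda>_. 1) UNIV gam"
proof -
  obtain e where e: "e > 0" "\<And>q. q \<in> F \<Longrightarrow> \<exists>beta. beta 0 = q \<and> sol (\<lambda>_. 1) {-e<..<e} beta" by (rule local_sol) blast
  \<comment> \<open>\<open>sol_extend\<close> asks for a life strictly longer than its step; halving
    provides this already for the initial solution on (-e, e).\<close>
  define e' where "e' = e/2"
  have e': "e' > 0" "\<And>q. q \<in> F \<Longrightarrow> \<exists>beta. beta 0 = q \<and> sol (\<lambda>_. 1) {-e'<..<e'} beta"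
  proof -
    show "e' > 0" using e(1) by (simp add: e'_def)
    fix q assume "q \<in> F"
    then obtain beta where "beta 0 = q" "sol (\<lambda>_. 1) {-e<..<e} beta" using e(2) by blast
    then show "\<exists>beta. beta 0 = q \<and> sol (\<lambda>_. 1) {-e'<..<e'} beta"
      using e(1) by (intro exI[of _ beta] conjI sol_subset[of _ "{-e<..<e}" beta "{-e'<..<e'}"]) (auto simp: e'_def)
  qed
  obtain p where p: "p \<in> F" using nonempty by blast
  have ex: "\<exists>\<delta>. \<delta> 0 = p \<and> sol (\<lambda>_. 1) {-(e + n * (e'/2))<..<e + n * (e'/2)} \<delta>" for n :: nat
  proof (induction n)
    case 0 then show ?case using e(2)[OF p] by simp
  next
    case (Suc n)
    then obtain \<delta> where d: "\<delta> 0 = p" "sol (\<lambda>_. 1) {-(e + n * (e'/2))<..<e + n * (e'/2)} \<delta>" by blast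
    have "0 \<le> n * (e'/2)" using e'(1) by simp
    then have "e + n * (e'/2) > e'" using e(1) unfolding e'_def by linarith
    then obtain \<delta>' where d': "sol (\<lambda>_. 1) {-(e + n * (e'/2) + e'/2)<..<e + n * (e'/2) + e'/2} \<delta>'" "\<delta>' 0 = \<delta> 0"
      using sol_extend[OF e' d(2)] by blast
    have "e + n * (e'/2) + e'/2 = e + Suc n * (e'/2)" by (simp add: algebra_simps)
    then show ?case using d' d(1) by metis
  qed
  then obtain dn where dn: "\<And>n::nat. dn n 0 = p" "\<And>n::nat. sol (\<lambda>_. 1) {-(e + n * (e'/2))<..<e + n * (e'/2)} (dn n)"
    by metis
  have mono: "dn m t = dn n t" if "m \<le> n" "\<bar>t\<bar> < e + m * (e'/2)" for m n t
  proof (rule sol_unique[of "{-(e + m * (e'/2))<..<e + m * (e'/2)}" "\<lambda>_. 1" _ _ 0])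
    have "m * (e'/2) \<le> n * (e'/2)" using that(1) e'(1) by (intro mult_right_mono) auto
    then show "sol (\<lambda>_. 1) {-(e + m * (e'/2))<..<e + m * (e'/2)} (dn n)"
      by (intro sol_subset[OF dn(2)[of n]]) auto
    have "0 \<le> m * (e'/2)" using e'(1) by simp
    then show "0 \<in> {-(e + m * (e'/2))<..<e + m * (e'/2)}" using e(1) by auto
  qed (use that dn in auto)
  have big: "\<exists>n::nat. \<bar>t\<bar> < e + n * (e'/2)" for t
  proof -
    obtain n :: nat where "\<bar>t\<bar> < n * (e'/2)" using reals_Archimedean3[of "e'/2"] e'(1) by auto
    then show ?thesis using e(1) by (intro exI[of _ n]) linarith
  qed
  \<comment> \<open>The solutions on growing intervals agree on overlaps, so any sufficiently large
    index gives the same value; the least one makes the choice definite.\<close>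
  define N where "N t = (LEAST n::nat. \<bar>t\<bar> < e + n * (e'/2))" for t
  have N: "\<bar>t\<bar> < e + N t * (e'/2)" for t unfolding N_def using big LeastI_ex by (metis (mono_tags, lifting))
  define gam where "gam t = dn (N t) t" for t
  have g: "gam t = dn n t" if "\<bar>t\<bar> < e + n * (e'/2)" for n t
    unfolding gam_def using mono[OF _ N[of t], of n] mono[OF _ that, of "N t"] nat_le_linear[of "N t" n] by metis
  have "sol (\<lambda>_. 1) UNIV gam" unfolding sol_def
  proof
    fix t
    let ?I = "{-(e + N t * (e'/2))<..<e + N t * (e'/2)}"
    have "t \<in> ?I" using N[of t] by auto
    then have "(dn (N t) has_vector_derivative tau (dn (N t) t)) (at t)" "dn (N t) t \<in> F"
      using dn(2)[of "N t"] by (auto simp: sol_def)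
    moreover have "(gam has_vector_derivative tau (dn (N t) t)) (at t)"
      by (rule has_vector_derivative_transform_within_open[of "dn (N t)" _ _ ?I])
        (use calculation \<open>t \<in> ?I\<close> in \<open>auto intro!: g[symmetric]\<close>)
    ultimately show "gam t \<in> F \<and> (gam has_vector_derivative 1 *\<^sub>R tau (gam t)) (at t)" by (simp add: gam_def)
  qed
  then show thesis using that by blast
qed

lemma sol_shift_UNIV: "sol (\<lambda>_. 1) UNIV gam \<Longrightarrow> sol (\<lambda>_. 1) I (\<lambda>t. gam (t + a))"
  using sol_subset[OF sol_shift[of UNIV gam a], of I] by simp

lemma sol_chart:
  assumes g: "sol (\<lambda>_. 1) UNIV gam" and p: "p \<in> F"
  obtains e U where "e > 0" "open U" "p \<in> U"
    "\<And>t. gam t \<in> U \<Longrightarrow> \<exists>u. \<bar>u\<bar> < e \<and> gam (t - u) = p \<and> F \<inter> U \<subseteq> gam ` {t - u - e<..<t - u + e}"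
    "\<And>t u. gam t = p \<Longrightarrow> \<bar>u\<bar> < e \<Longrightarrow> gam (t + u) = p \<Longrightarrow> u = 0"
proof -
  from chart[OF p] obtain e beta s U where ch: "e > 0" "open U" "p \<in> U" "beta 0 = p"
    "\<forall>t. \<bar>t\<bar> < e \<longrightarrow> beta t \<in> F \<inter> U \<and> s (beta t) = t \<and> (beta has_vector_derivative tau (beta t)) (at t)"
    "\<forall>x\<in>F \<inter> U. \<bar>s x\<bar> < e \<and> beta (s x) = x" by blast
  have b: "sol (\<lambda>_. 1) {-e<..<e} beta" using ch(5) by (auto simp: sol_def)
  have eq: "gam (v + a) = beta v" if "\<bar>u\<bar> < e" "gam (u + a) = beta u" "\<bar>v\<bar> < e" for u v a
    by (rule sol_unique[OF _ _ sol_shift_UNIV[OF g] b, of u]) (use that in auto)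
  have 1: "\<exists>u. \<bar>u\<bar> < e \<and> gam (t - u) = p \<and> F \<inter> U \<subseteq> gam ` {t - u - e<..<t - u + e}" if "gam t \<in> U" for t
  proof -
    define u where "u = s (gam t)"
    have "gam t \<in> F" using g by (auto simp: sol_def)
    then have u: "\<bar>u\<bar> < e" "gam (u + (t - u)) = beta u" using ch(6) that by (auto simp: u_def)
    have e: "gam (v + (t - u)) = beta v" if "\<bar>v\<bar> < e" for v using eq[OF u that] .
    have "F \<inter> U \<subseteq> gam ` {t - u - e<..<t - u + e}"
    proof
      fix x assume x: "x \<in> F \<inter> U"
      then have "gam (s x + (t - u)) = x" "\<bar>s x\<bar> < e" using ch(6) e by auto
      then show "x \<in> gam ` {t - u - e<..<t - u + e}" by (intro image_eqI[of _ _ "s x + (t - u)"]) auto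
    qed
    moreover have "gam (t - u) = p" using e[of 0] ch(1,4) by simp
    ultimately show ?thesis using u(1) by blast
  qed
  have 2: "u = 0" if "gam t = p" "\<bar>u\<bar> < e" "gam (t + u) = p" for t u
  proof -
    have "gam (u + t) = beta u" using eq[of 0 t u] that ch(1,4) by simp
    then have "beta u = beta 0" using that ch(4) by (simp add: add.commute)
    then show "u = 0" using ch(1,5) that(2) by (metis abs_zero)
  qed
  show thesis by (rule that[OF ch(1-3) 1 2])
qed

text \<open>A chart domain that meets the range has all its points of \<open>F\<close> covered, so
  the range is open and closed in the connected set \<open>F\<close>.\<close>

lemma sol_surj:
  assumes g: "sol (\<lambda>_. 1) UNIV gam" shows "range gam = F"
proof -
  have sub: "range gam \<subseteq> F" using g by (auto simp: sol_def)
  have op: "\<exists>U. open U \<and> p \<in> U \<and> (U \<inter> range gam \<noteq> {} \<longrightarrow> F \<inter> U \<subseteq> range gam)" if "p \<in> F" for p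
  proof -
    obtain e U where "e > 0" "open U" "p \<in> U"
    "\<And>t. gam t \<in> U \<Longrightarrow> \<exists>u. \<bar>u\<bar> < e \<and> gam (t - u) = p \<and> F \<inter> U \<subseteq> gam ` {t - u - e<..<t - u + e}"
      by (rule sol_chart[OF g \<open>p \<in> F\<close>]) blast
    then show ?thesis by (intro exI[of _ U]) blast
  qed
  have "openin (top_of_set F) (range gam)"
    unfolding openin_contains_ball
  proof (intro conjI sub ballI)
    fix p assume p: "p \<in> range gam"
    then obtain U where "open U" "p \<in> U" "F \<inter> U \<subseteq> range gam" using op[of p] sub by auto
    then show "\<exists>e>0. ball p e \<inter> F \<subseteq> range gam" unfolding open_contains_ball by blast
  qed
  moreover have "openin (top_of_set F) (F - range gam)"
    unfolding openin_contains_ball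
  proof (intro conjI ballI)
    fix p assume p: "p \<in> F - range gam"
    then obtain U where "open U" "p \<in> U" "U \<inter> range gam = {}" using op[of p] by auto
    then show "\<exists>e>0. ball p e \<inter> F \<subseteq> F - range gam" unfolding open_contains_ball by blast
  qed auto
  then have "closedin (top_of_set F) (range gam)" using sub by (auto simp: closedin_def)
  ultimately show ?thesis using connected connected_clopen by (metis UNIV_not_empty image_is_empty)
qed

lemma sol_periodic_iff:
  assumes g: "sol (\<lambda>_. 1) UNIV gam" and "gam (a + P) = gam a" shows "gam (t + P) = gam t"
  by (rule sol_unique[OF _ _ sol_shift_UNIV[OF g, of UNIV P] g, of a]) (use assms in auto)

text \<open>Otherwise the points gam(n) accumulate at some \<open>l\<close>, and each visit to the
  chart at \<open>l\<close> passes through \<open>l\<close> itself within time \<open>e\<close>; two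
  visits more than 2 e apart give two parameters for one point.\<close>

lemma sol_not_inj:
  assumes g: "sol (\<lambda>_. 1) UNIV gam" shows "\<exists>P>0. gam P = gam 0"
proof -
  have "\<not> inj gam"
  proof
    assume inj: "inj gam"
    have "\<forall>n. gam (real n) \<in> F" using g by (auto simp: sol_def)
    then obtain l r where l: "l \<in> F" "strict_mono (r::nat\<Rightarrow>nat)" "((\<lambda>n. gam (real n)) \<circ> r) \<longlonglongrightarrow> l"
      using compact unfolding compact_def by metis
    obtain e U where U: "e > 0" "open U" "l \<in> U"
      "\<And>t. gam t \<in> U \<Longrightarrow> \<exists>u. \<bar>u\<bar> < e \<and> gam (t - u) = l \<and> F \<inter> U \<subseteq> gam ` {t - u - e<..<t - u + e}"
      by (rule sol_chart[OF g l(1)]) blast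
    obtain k where k: "\<And>n. n \<ge> k \<Longrightarrow> gam (real (r n)) \<in> U"
      using topological_tendstoD[OF l(3) U(2,3)] by (auto simp: eventually_sequentially)
    obtain u where u: "\<bar>u\<bar> < e" "gam (real (r k) - u) = l" using U(4)[OF k[of k]] by auto
    obtain m :: nat where m: "real m > r k + 2 * e" using reals_Archimedean2 by blast
    define n where "n = max k m"
    obtain v where v: "\<bar>v\<bar> < e" "gam (real (r n) - v) = l" using U(4)[OF k[of n]] by (auto simp: n_def)
    have "real (r n) - v = real (r k) - u" using inj u(2) v(2) by (metis injD)
    moreover have "real (r n) \<ge> real m" using seq_suble[OF l(2), of n] by (simp add: n_def)
    ultimately show False using m u(1) v(1) by linarith
  qed
  then obtain a b where ab: "gam a = gam b" "a < b" unfolding inj_def by (metis linorder_neqE)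
  have "gam (0 + (b - a)) = gam 0" by (rule sol_periodic_iff[OF g, of a]) (use ab in auto)
  then show ?thesis using ab(2) by (intro exI[of _ "b - a"]) auto
qed

text \<open>The chart at gam(0) excludes return times below \<open>e\<close>, so their infimum is
  positive; continuity makes it a return time, and by uniqueness every coincidence of values yields
  a period.\<close>

lemma sol_min_period:
  assumes g: "sol (\<lambda>_. 1) UNIV gam"
  obtains T where "T > 0" "\<And>t. gam (t + T) = gam t" "inj_on gam {0..<T}" "gam ` {0..T} = F"
    "\<And>P. P > 0 \<Longrightarrow> gam P = gam 0 \<Longrightarrow> P \<ge> T"
proof -
  define Per where "Per = {P. P > 0 \<and> gam P = gam 0}"
  have ne: "Per \<noteq> {}" using sol_not_inj[OF g] by (auto simp: Per_def)
  have "gam 0 \<in> F" using g by (auto simp: sol_def)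
  then obtain e where e: "e > 0" "\<And>t u. gam t = gam 0 \<Longrightarrow> \<bar>u\<bar> < e \<Longrightarrow> gam (t + u) = gam 0 \<Longrightarrow> u = 0"
    using sol_chart[OF g \<open>gam 0 \<in> F\<close>] by metis
  have low: "P \<ge> e" if "P \<in> Per" for P
    using e(2)[of 0 P] that by (auto simp: Per_def) (meson abs_of_pos linorder_not_le order_less_irrefl)
  define T where "T = Inf Per"
  have bdd: "bdd_below Per" using low by (auto simp: bdd_below_def)
  have Te: "T \<ge> e" unfolding T_def using ne low by (intro cInf_greatest) auto
  have Tle: "T \<le> P" if "P \<in> Per" for P unfolding T_def using cInf_lower[OF that bdd] .
  have "T \<in> closure Per" unfolding T_def using closure_contains_Inf[OF ne bdd] .
  then obtain f where f: "\<And>n. f n \<in> Per" "f \<longlonglongrightarrow> T" unfolding closure_sequential by blast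
  have "(\<lambda>n. gam (f n)) \<longlonglongrightarrow> gam T" using isCont_tendsto_compose[OF sol_isCont[OF g] f(2)] by simp
  moreover have "(\<lambda>n. gam (f n)) = (\<lambda>n. gam 0)" using f(1) by (auto simp: Per_def)
  ultimately have gT: "gam T = gam 0" using LIMSEQ_const_iff LIMSEQ_unique by metis
  have per: "gam (t + T) = gam t" for t by (rule sol_periodic_iff[OF g, of 0]) (use gT in auto)
  have inj: "inj_on gam {0..<T}"
  proof (rule ccontr)
    assume "\<not> ?thesis"
    then obtain a b where ab: "gam a = gam b" "a < b" "a \<ge> 0" "b < T"
      unfolding inj_on_def by (metis atLeastLessThan_iff linorder_neqE)
    have "gam (0 + (b - a)) = gam 0" by (rule sol_periodic_iff[OF g, of a]) (use ab in auto)
    then have "b - a \<in> Per" using ab by (auto simp: Per_def)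
    then show False using Tle ab by fastforce
  qed
  have T0: "T > 0" using Te e(1) by linarith
  have pern: "gam (t + real n * T) = gam t" for t n
  proof (induction n)
    case (Suc n) then show ?case using per[of "t + real n * T"] by (simp add: algebra_simps)
  qed simp
  have "gam ` {0..T} = F"
  proof
    show "gam ` {0..T} \<subseteq> F" using g by (auto simp: sol_def)
    show "F \<subseteq> gam ` {0..T}"
    proof
      fix x assume "x \<in> F"
      then obtain t where t: "x = gam t" using sol_surj[OF g] by auto
      define k where "k = \<lfloor>t / T\<rfloor>"
      have k: "of_int k * T \<le> t" "t < (of_int k + 1) * T"
        using T0 floor_divide_lower[of T t] floor_divide_upper[of T t] by (auto simp: k_def)
      have "gam (t - of_int k * T) = gam t"
      proof (cases "k \<ge> 0")
        case True
        then show ?thesis using pern[of "t - of_int k * T" "nat k"] by simp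
      next
        case False
        then show ?thesis using pern[of t "nat (-k)"] by simp
      qed
      moreover have "t - of_int k * T \<in> {0..T}" using k by (auto simp: algebra_simps)
      ultimately show "x \<in> gam ` {0..T}" using t by (metis imageI)
    qed
  qed
  then show thesis using that T0 per inj Tle by (auto simp: Per_def)
qed

lemma antiderivative_UNIV:
  fixes f :: "real \<Rightarrow> real"
  assumes "continuous_on UNIV f" obtains G where "\<And>x. (G has_vector_derivative f x) (at x)"
  using einterval_antiderivative[of "-\<infinity>" "\<infinity>" f] assms that
  by (auto simp: continuous_on_eq_continuous_at)

text \<open>Any regular traversal of \<open>F\<close> in the direction \<open>tau\<close> is a reparametrisation of the
  unit-speed one, so line integrals along \<open>F\<close> are well defined.\<close>
lemma traversal_integral:
  assumes g: "sol (\<lambda>_. 1) UNIV gam"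
    and T: "T > 0" "\<And>t. gam (t + T) = gam t" "\<And>P. P > 0 \<Longrightarrow> gam P = gam 0 \<Longrightarrow> P \<ge> T"
    and d: "sol c UNIV \<delta>" "continuous_on UNIV c" "\<And>t. c t > 0" "\<delta> 1 = \<delta> 0" "inj_on \<delta> {0..<1}"
    and f: "continuous_on F f"
    and G: "\<And>t. (G has_vector_derivative (f (gam t) \<bullet> tau (gam t))) (at t)"
  shows "((\<lambda>t. f (\<delta> t) \<bullet> (c t *\<^sub>R tau (\<delta> t))) has_integral G T - G 0) {0..1}"
proof -
  obtain \<sigma>' where s': "\<And>x. (\<sigma>' has_vector_derivative c x) (at x)" by (rule antiderivative_UNIV[OF d(2)]) blast
  \<comment> \<open>Elapsed flow time: \<open>\<delta>\<close> is the flow started at gam(a), read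
    at time \<open>\<sigma>\<close>.\<close>
  define \<sigma> where "\<sigma> t = \<sigma>' t - \<sigma>' 0" for t
  have s: "(\<sigma> has_vector_derivative c x) (at x)" "\<sigma> 0 = 0" for x
    unfolding \<sigma>_def by (auto intro!: derivative_eq_intros s')
  have "\<delta> 0 \<in> F" using d(1) by (auto simp: sol_def)
  then obtain a where a: "gam a = \<delta> 0" using sol_surj[OF g] by (metis rangeE)
  have s2: "sol c UNIV (\<lambda>t. gam (a + \<sigma> t))" unfolding sol_def
  proof
    fix t
    have "(gam has_vector_derivative tau (gam (a + \<sigma> t))) (at (a + \<sigma> t))" using g by (auto simp: sol_def)
    then have "((gam \<circ> (\<lambda>t. a + \<sigma> t)) has_vector_derivative (c t *\<^sub>R tau (gam (a + \<sigma> t)))) (at t)"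
      by (intro vector_diff_chain_at) (auto intro!: derivative_eq_intros s)
    then show "gam (a + \<sigma> t) \<in> F \<and> ((\<lambda>t. gam (a + \<sigma> t)) has_vector_derivative c t *\<^sub>R tau (gam (a + \<sigma> t))) (at t)"
      using g by (auto simp: o_def sol_def)
  qed
  have eq: "\<delta> t = gam (a + \<sigma> t)" for t
    by (rule sol_unique[OF _ _ d(1) s2, of 0]) (use a s in auto)
  have mono: "\<sigma> x < \<sigma> y" if "x < y" for x y
    by (rule DERIV_pos_imp_increasing[OF that])
      (use s(1) d(3) in \<open>auto simp: has_real_derivative_iff_has_vector_derivative\<close>)
  have per0: "gam P = gam 0" if "gam (a + P) = gam a" for P using sol_periodic_iff[OF g that, of 0] by simp
  have "gam (\<sigma> 1) = gam 0" by (rule per0) (use eq[of 1] eq[of 0] d(4) s in auto)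
  moreover have "\<sigma> 1 > 0" using mono[of 0 1] s by simp
  ultimately have "\<sigma> 1 \<ge> T" using T(3) by blast
  \<comment> \<open>A traversal longer than one period would return to its start before time 1,
    against injectivity on the half-open interval.\<close>
  moreover have "\<not> \<sigma> 1 > T"
  proof
    assume "\<sigma> 1 > T"
    have "continuous_on {0..1} \<sigma>"
      by (intro continuous_at_imp_continuous_on ballI) (use s has_vector_derivative_continuous in blast)
    then obtain t where t: "0 \<le> t" "t \<le> 1" "\<sigma> t = T" using IVT'[of \<sigma> 0 T 1] s T(1) \<open>\<sigma> 1 > T\<close> by auto
    have "\<delta> t = \<delta> 0" using eq[of t] eq[of 0] t(3) s T(2)[of a] by simp
    moreover have "t \<noteq> 1" "t \<noteq> 0" using t \<open>\<sigma> 1 > T\<close> s T(1) by auto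
    ultimately show False using d(5) t unfolding inj_on_def by force
  qed
  ultimately have s1: "\<sigma> 1 = T" by linarith
  have ig: "((\<lambda>t. G (a + \<sigma> t)) has_vector_derivative f (\<delta> t) \<bullet> (c t *\<^sub>R tau (\<delta> t))) (at t)" for t
  proof -
    have "((G \<circ> (\<lambda>t. a + \<sigma> t)) has_vector_derivative (c t *\<^sub>R (f (gam (a + \<sigma> t)) \<bullet> tau (gam (a + \<sigma> t))))) (at t)"
      by (intro vector_diff_chain_at G) (auto intro!: derivative_eq_intros s)
    then show ?thesis by (simp add: o_def eq)
  qed
  have "((\<lambda>t. f (\<delta> t) \<bullet> (c t *\<^sub>R tau (\<delta> t))) has_integral G (a + \<sigma> 1) - G (a + \<sigma> 0)) {0..1}"
    by (rule fundamental_theorem_of_calculus) (use has_vector_derivative_at_within[OF ig] in \<open>auto simp del: inner_scaleR_right\<close>)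
  \<comment> \<open>The integrand is T-periodic, so its integral over a period does not depend on
    the start \<open>a\<close>.\<close>
  moreover have "G (a + T) - G a = G (0 + T) - G 0"
  proof -
    have "((\<lambda>t. G (t + T) - G t) has_derivative (\<lambda>h. 0)) (at x within UNIV)" for x
    proof -
      have "((G \<circ> (\<lambda>t. t + T)) has_vector_derivative (1 *\<^sub>R (f (gam (x + T)) \<bullet> tau (gam (x + T))))) (at x)"
        by (intro vector_diff_chain_at G) (auto intro!: derivative_eq_intros)
      then have "((\<lambda>t. G (t + T) - G t) has_vector_derivative (f (gam x) \<bullet> tau (gam x)) - (f (gam x) \<bullet> tau (gam x))) (at x)"
        by (intro has_vector_derivative_diff G) (simp add: o_def T(2))
      then show ?thesis by (simp add: has_vector_derivative_def)
    qed
    then show ?thesis using has_derivative_zero_constant[of UNIV "\<lambda>t. G (t + T) - G t"] by (metis UNIV_I convex_UNIV)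
  qed
  ultimately show ?thesis by (simp add: s1 s)
qed

end

section \<open>Boundary parametrisations\<close>

text \<open>The unit inner normal, characterised by the directions that enter and leave
  \<open>D\<close>. No defining function occurs, so normals computed in different charts
  agree.\<close>

definition inward :: "pt set \<Rightarrow> pt \<Rightarrow> pt \<Rightarrow> bool" where
  "inward D p m \<longleftrightarrow> norm m = 1 \<and> (\<forall>u.
     (u \<bullet> m > 0 \<longrightarrow> (\<exists>e>0. \<forall>s. 0 < s \<and> s < e \<longrightarrow> p + s *\<^sub>R u \<in> D)) \<and>
     (u \<bullet> m < 0 \<longrightarrow> (\<exists>e>0. \<forall>s. 0 < s \<and> s < e \<longrightarrow> p + s *\<^sub>R u \<notin> D)))"

definition inner_normal :: "pt set \<Rightarrow> pt \<Rightarrow> pt" where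
  "inner_normal D p = (THE m. inward D p m)"

text \<open>The normal turned clockwise, so that \<open>rot\<close> gives the normal back and
  \<open>D\<close> lies to the left, as \<open>ccw_param\<close> requires.\<close>

definition tang :: "pt set \<Rightarrow> pt \<Rightarrow> pt" where
  "tang D p = (snd (inner_normal D p), - fst (inner_normal D p))"

text \<open>For distinct unit vectors m - m' has positive product with m and negative product with
  m', so the ray in this direction would both enter and leave \<open>D\<close>.\<close>

lemma inward_unique:
  assumes "inward D p m" "inward D p m'" shows "m = m'"
proof (rule ccontr)
  assume ne: "m \<noteq> m'"
  have n: "m \<bullet> m = 1" "m' \<bullet> m' = 1" using assms by (auto simp: inward_def dot_square_norm)
  have "(m - m') \<bullet> (m - m') > 0" using ne by simp
  then have "m \<bullet> m' < 1" using n by (simp add: inner_diff_left inner_diff_right inner_commute)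
  then have "(m - m') \<bullet> m > 0" "(m - m') \<bullet> m' < 0"
    using n by (simp_all add: inner_diff_left inner_commute[of m' m])
  then have "\<exists>e>0. \<forall>s. 0 < s \<and> s < e \<longrightarrow> p + s *\<^sub>R (m - m') \<in> D"
    "\<exists>e>0. \<forall>s. 0 < s \<and> s < e \<longrightarrow> p + s *\<^sub>R (m - m') \<notin> D"
    using assms(1)[unfolded inward_def, THEN conjunct2, THEN spec, of "m - m'"]
      assms(2)[unfolded inward_def, THEN conjunct2, THEN spec, of "m - m'"] by simp_all
  then obtain e e' where e: "e > 0" "\<And>s. 0 < s \<and> s < e \<Longrightarrow> p + s *\<^sub>R (m - m') \<in> D"
    "e' > 0" "\<And>s. 0 < s \<and> s < e' \<Longrightarrow> p + s *\<^sub>R (m - m') \<notin> D" by auto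
  have "0 < min e e' / 2" "min e e' / 2 < e" "min e e' / 2 < e'" using e(1,3) by auto
  then show False using e(2)[of "min e e' / 2"] e(4)[of "min e e' / 2"] by blast
qed

lemma inner_normal_eq: "inward D p m \<Longrightarrow> inner_normal D p = m"
  unfolding inner_normal_def using inward_unique by blast

section \<open>Charts of a smooth boundary\<close>

lemma has_grad_dir:
  fixes f :: "pt \<Rightarrow> real"
  assumes "has_grad f a b x"
  shows "((\<lambda>s. f (x + s *\<^sub>R u)) has_real_derivative ((a, b) \<bullet> u)) (at 0)"
proof -
  have "((\<lambda>s. x + s *\<^sub>R u) has_vector_derivative u) (at 0)"
    by (auto intro!: derivative_eq_intros)
  from has_grad_along[of f a b "\<lambda>s. x + s *\<^sub>R u" 0, OF _ this] assms
  show ?thesis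
    by (simp add: has_real_derivative_iff_has_vector_derivative inner_prod_def mult.commute)
qed

locale boundary_chart =
  fixes D :: "pt set" and p :: pt and r :: real and \<rho> a b :: "pt \<Rightarrow> real"
  assumes openD: "open D" and r: "r > 0"
    and grad: "\<And>x. x \<in> ball p r \<Longrightarrow> has_grad \<rho> (a x) (b x) x"
    and cont_a: "continuous_on (ball p r) a" and cont_b: "continuous_on (ball p r) b"
    and nz: "\<And>x. x \<in> ball p r \<Longrightarrow> (a x, b x) \<noteq> 0"
    and memD: "\<And>x. x \<in> ball p r \<Longrightarrow> x \<in> D \<longleftrightarrow> \<rho> x < 0"
    and p: "p \<in> frontier D"
begin

lemma dir_neg:
  assumes x: "x \<in> ball p r" "\<rho> x = 0" and u: "(a x, b x) \<bullet> u < 0"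
  shows "\<exists>e>0. \<forall>s. 0 < s \<and> s < e \<longrightarrow> x + s *\<^sub>R u \<in> D"
proof -
  obtain d where d: "d > 0" "\<And>h. h > 0 \<Longrightarrow> h < d \<Longrightarrow> \<rho> (x + (0 + h) *\<^sub>R u) < \<rho> (x + 0 *\<^sub>R u)"
    using DERIV_neg_dec_right[OF has_grad_dir[OF grad[OF x(1)], of u] u] by blast
  have "open ((\<lambda>s. x + s *\<^sub>R u) -` ball p r)" by (intro open_vimage continuous_intros) auto
  then obtain e where e: "e > 0" "ball 0 e \<subseteq> (\<lambda>s. x + s *\<^sub>R u) -` ball p r"
    using x(1) open_contains_ball by (metis (no_types, lifting) add.right_neutral scaleR_zero_left vimageI)
  show ?thesis
  proof (intro exI[of _ "min d e"] conjI allI impI)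
    fix s assume s: "0 < s \<and> s < min d e"
    then have "x + s *\<^sub>R u \<in> ball p r" using e(2) by (auto simp: subset_iff dist_real_def)
    then show "x + s *\<^sub>R u \<in> D" using d(2)[of s] s x(2) memD by auto
  qed (use d e in auto)
qed

lemma dir_pos:
  assumes x: "x \<in> ball p r" "\<rho> x = 0" and u: "(a x, b x) \<bullet> u > 0"
  shows "\<exists>e>0. \<forall>s. 0 < s \<and> s < e \<longrightarrow> x + s *\<^sub>R u \<in> {y\<in>ball p r. \<rho> y > 0}"
proof -
  obtain d where d: "d > 0" "\<And>h. h > 0 \<Longrightarrow> h < d \<Longrightarrow> \<rho> (x + 0 *\<^sub>R u) < \<rho> (x + (0 + h) *\<^sub>R u)"
    using DERIV_pos_inc_right[OF has_grad_dir[OF grad[OF x(1)], of u] u] by blast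
  have "open ((\<lambda>s. x + s *\<^sub>R u) -` ball p r)" by (intro open_vimage continuous_intros) auto
  then obtain e where e: "e > 0" "ball 0 e \<subseteq> (\<lambda>s. x + s *\<^sub>R u) -` ball p r"
    using x(1) open_contains_ball by (metis (no_types, lifting) add.right_neutral scaleR_zero_left vimageI)
  show ?thesis
  proof (intro exI[of _ "min d e"] conjI allI impI)
    fix s assume s: "0 < s \<and> s < min d e"
    then have "x + s *\<^sub>R u \<in> ball p r" using e(2) by (auto simp: subset_iff dist_real_def)
    then show "x + s *\<^sub>R u \<in> {y\<in>ball p r. \<rho> y > 0}" using d(2)[of s] s x(2) by auto
  qed (use d e in auto)
qed

lemma open_pos: "open {y\<in>ball p r. \<rho> y > 0}"
proof -
  have "continuous_on (ball p r) \<rho>"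
    by (intro continuous_at_imp_continuous_on ballI) (use grad has_grad_isCont in blast)
  from continuous_open_preimage[OF this open_ball, of "{0<..}"]
  show ?thesis by (auto simp: vimage_def Int_def conj_commute)
qed

lemma closure_le:
  assumes "x \<in> ball p r" "x \<in> closure D" shows "\<rho> x \<le> 0"
proof (rule ccontr)
  assume "\<not> \<rho> x \<le> 0"
  then have "x \<in> {y\<in>ball p r. \<rho> y > 0}" using assms by auto
  then have "{y\<in>ball p r. \<rho> y > 0} \<inter> D \<noteq> {}"
    using open_pos open_Int_closure_eq_empty assms(2) by blast
  then show False using memD by fastforce
qed

text \<open>The gradient does not vanish, so from each zero of \<open>\<rho>\<close> the direction
  of steepest descent leads into \<open>D\<close>.\<close>

lemma frontier_iff:
  assumes x: "x \<in> ball p r" shows "x \<in> frontier D \<longleftrightarrow> \<rho> x = 0"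
proof
  assume "x \<in> frontier D"
  then have "x \<in> closure D" "x \<notin> D" using openD by (auto simp: frontier_def interior_open)
  then show "\<rho> x = 0" using closure_le[OF x] memD[OF x] by auto
next
  assume 0: "\<rho> x = 0"
  have "(a x, b x) \<bullet> (- (a x, b x)) < 0" using nz[OF x] inner_gt_zero_iff[of "(a x, b x)"] unfolding inner_minus_right by linarith
  then obtain e where e: "e > 0" "\<And>s. 0 < s \<and> s < e \<Longrightarrow> x + s *\<^sub>R (- (a x, b x)) \<in> D"
    using dir_neg[OF x 0] by blast
  have "(\<lambda>n. x + (e / 2 * inverse (real (Suc n))) *\<^sub>R (- (a x, b x))) \<longlonglongrightarrow> x + (e / 2 * 0) *\<^sub>R (- (a x, b x))"
    by (intro tendsto_intros LIMSEQ_inverse_real_of_nat)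
  moreover have "x + (e / 2 * inverse (real (Suc n))) *\<^sub>R (- (a x, b x)) \<in> D" for n
  proof (rule e(2))
    have "inverse (real (Suc n)) \<le> 1" by (simp add: field_simps)
    then have "e / 2 * inverse (real (Suc n)) \<le> e / 2 * 1" using e(1) by (intro mult_left_mono) auto
    then show "0 < e / 2 * inverse (real (Suc n)) \<and> e / 2 * inverse (real (Suc n)) < e" using e(1) by auto
  qed
  ultimately have "x \<in> closure D" unfolding closure_sequential mult_zero_right scaleR_zero_left add_0_right
    by (intro exI[of _ "\<lambda>n. x + (e / 2 * inverse (real (Suc n))) *\<^sub>R (- (a x, b x))"] conjI allI)
  then show "x \<in> frontier D" using openD memD[OF x] 0 by (auto simp: frontier_def interior_open)
qed

definition n :: "pt \<Rightarrow> real" where "n x = norm (a x, b x)"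

lemma n_pos: "x \<in> ball p r \<Longrightarrow> n x > 0" using nz by (auto simp: n_def)

lemma n_sq: "n x * n x = a x * a x + b x * b x"
  by (simp add: n_def norm_Pair power2_eq_square[symmetric])

lemma inward_grad:
  assumes x: "x \<in> ball p r" "\<rho> x = 0"
  shows "inward D x ((- 1 / n x) *\<^sub>R (a x, b x))"
  unfolding inward_def
proof (intro conjI allI impI)
  show "norm ((- 1 / n x) *\<^sub>R (a x, b x)) = 1" using n_pos[OF x(1)] unfolding norm_scaleR n_def by simp
  fix u
  have eq: "u \<bullet> ((- 1 / n x) *\<^sub>R (a x, b x)) = - ((a x, b x) \<bullet> u / n x)"
    unfolding inner_scaleR_right by (simp only: inner_commute[of u]) simp
  show "\<exists>e>0. \<forall>s. 0 < s \<and> s < e \<longrightarrow> x + s *\<^sub>R u \<in> D" if "u \<bullet> ((- 1 / n x) *\<^sub>R (a x, b x)) > 0"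
    using that n_pos[OF x(1)] unfolding eq by (intro dir_neg[OF x]) (simp add: zero_less_divide_iff divide_less_0_iff)
  show "\<exists>e>0. \<forall>s. 0 < s \<and> s < e \<longrightarrow> x + s *\<^sub>R u \<notin> D" if "u \<bullet> ((- 1 / n x) *\<^sub>R (a x, b x)) < 0"
  proof -
    have "(a x, b x) \<bullet> u > 0" using that n_pos[OF x(1)] unfolding eq by (simp add: zero_less_divide_iff)
    from dir_pos[OF x this] show ?thesis using memD by fastforce
  qed
qed

lemma tang_eq:
  assumes x: "x \<in> ball p r" "\<rho> x = 0"
  shows "tang D x = (- b x / n x, a x / n x)"
  by (simp add: tang_def inner_normal_eq[OF inward_grad[OF x]])

lemma p_ball: "p \<in> ball p r" "\<rho> p = 0" using r p frontier_iff by auto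

text \<open>The inverse function theorem straightens the boundary: x is sent to its coordinate along
  the tangent at \<open>p\<close> together with \<rho>(x). The zero level becomes a curve
  \<open>\<alpha>\<close>, which is then reparametrised by arc length \<open>S\<close>.\<close>

lemma chart:
  "\<exists>e>0. \<exists>beta s U. open U \<and> p \<in> U \<and> beta 0 = p \<and>
      (\<forall>t. \<bar>t\<bar> < e \<longrightarrow> beta t \<in> frontier D \<inter> U \<and> s (beta t) = t \<and> (beta has_vector_derivative tang D (beta t)) (at t)) \<and>
      (\<forall>x\<in>frontier D \<inter> U. \<bar>s x\<bar> < e \<and> beta (s x) = x \<and> (\<exists>s'. (s has_derivative s') (at x) \<and> s' (tang D x) = (1::real)))"
proof -
  define T where "T = tang D p"
  have T: "T = (- b p / n p, a p / n p)" unfolding T_def by (rule tang_eq[OF p_ball])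
  \<comment> \<open>Tangential component of the gradient turned by a right angle, and up to sign the
    Jacobian determinant of \<open>G\<close>; where it is positive, the tangential coordinate
    parametrises the boundary locally.\<close>
  define q where "q x = - b x * fst T + a x * snd T" for x
  define W where "W = {x\<in>ball p r. q x > 0}"
  have cq: "continuous_on (ball p r) q" unfolding q_def by (intro continuous_intros cont_a cont_b)
  have "open W" using continuous_open_preimage[OF cq open_ball, of "{0<..}"]
    by (auto simp: W_def vimage_def Int_def conj_commute)
  have np: "n p > 0" using n_pos p_ball by auto
  have "q p = n p" using np n_sq[of p] by (simp add: q_def T field_simps)
  then have pW: "p \<in> W" using np p_ball by (simp add: W_def)
  have Wb: "W \<subseteq> ball p r" by (auto simp: W_def)
  define G where "G x = ((x - p) \<bullet> T, \<rho> x)" for x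
  define G' where "G' x = Blinfun (\<lambda>v. (v \<bullet> T, fst v *\<^sub>R a x + snd v *\<^sub>R b x))" for x
  have G'[simp]: "blinfun_apply (G' x) = (\<lambda>v. (v \<bullet> T, fst v *\<^sub>R a x + snd v *\<^sub>R b x))" for x
    unfolding G'_def
    by (intro bounded_linear_Blinfun_apply linear_conv_bounded_linear[THEN iffD1] linearI)
      (auto simp: inner_add_left algebra_simps)
  \<comment> \<open>\<open>T\<close> is a unit vector orthogonal to the gradient at
    \<open>p\<close>, whose length is \<open>n p\<close>; hence this explicit inverse of
    \<open>G' p\<close>.\<close>
  define iv where "iv = Blinfun (\<lambda>v. fst v *\<^sub>R T + (snd v / (n p * n p)) *\<^sub>R (a p, b p))"
  have iv[simp]: "blinfun_apply iv = (\<lambda>v. fst v *\<^sub>R T + (snd v / (n p * n p)) *\<^sub>R (a p, b p))"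
    unfolding iv_def
    by (intro bounded_linear_Blinfun_apply linear_conv_bounded_linear[THEN iffD1] linearI)
      (auto simp: algebra_simps add_divide_distrib)
  have dG: "(G has_derivative blinfun_apply (G' x)) (at x)" if "x \<in> W" for x
  proof -
    have "((\<lambda>x. (x - p) \<bullet> T) has_derivative (\<lambda>v. v \<bullet> T)) (at x)"
      by (auto intro!: derivative_eq_intros)
    from has_derivative_Pair[OF this grad[unfolded has_grad_def, of x]] that Wb
    show ?thesis unfolding G_def G' by auto
  qed
  have cG: "continuous_on W G'"
  proof (rule continuous_on_blinfun_componentwise)
    fix i :: pt
    show "continuous_on W (\<lambda>x. blinfun_apply (G' x) i)" unfolding G'
      by (intro continuous_intros continuous_on_subset[OF cont_a Wb] continuous_on_subset[OF cont_b Wb])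
  qed
  have "iv o\<^sub>L G' p = id_blinfun"
  proof (rule blinfun_eqI)
    fix v :: pt
    have nn: "n p \<noteq> 0" using np by simp
    have "(fst v * a p + snd v * b p) * a p + (fst v * b p - snd v * a p) * b p = fst v * (n p * n p)"
      "(fst v * a p + snd v * b p) * b p - (fst v * b p - snd v * a p) * a p = snd v * (n p * n p)"
      by (simp_all add: n_sq algebra_simps)
    moreover have "fst (blinfun_apply (iv o\<^sub>L G' p) v) =
        ((fst v * a p + snd v * b p) * a p + (fst v * b p - snd v * a p) * b p) / (n p * n p)"
      "snd (blinfun_apply (iv o\<^sub>L G' p) v) =
        ((fst v * a p + snd v * b p) * b p - (fst v * b p - snd v * a p) * a p) / (n p * n p)"
      using nn by (simp_all add: T inner_prod_def field_simps)
    ultimately show "blinfun_apply (iv o\<^sub>L G' p) v = blinfun_apply id_blinfun v"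
      using nn by (intro prod_eqI) simp_all
  qed
  from inverse_function_theorem[OF \<open>open W\<close> dG cG pW this]
  obtain U' V g g' where ift: "open U'" "U' \<subseteq> W" "p \<in> U'" "open V" "G p \<in> V" "homeomorphism U' V G g"
    "\<And>y. y \<in> V \<Longrightarrow> (g has_derivative (g' y)) (at y)"
    "\<And>y. y \<in> V \<Longrightarrow> g' y = inv (blinfun_apply (G' (g y)))"
    "\<And>y. y \<in> V \<Longrightarrow> bij (blinfun_apply (G' (g y)))" by metis
  have Gp: "G p = (0, 0)" using p_ball by (simp add: G_def)
  have "open ((\<lambda>t. (t, 0::real)) -` V)" by (intro open_vimage ift continuous_intros)
  moreover have "0 \<in> (\<lambda>t. (t, 0::real)) -` V" using Gp ift(5) by simp
  ultimately obtain eta where eta: "eta > 0" "ball 0 eta \<subseteq> (\<lambda>t. (t, 0::real)) -` V"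
    using open_contains_ball by blast
  have inV: "(t, 0) \<in> V" if "\<bar>t\<bar> < eta" for t using eta(2) that by (auto simp: subset_iff)
  define \<alpha> where "\<alpha> t = g (t, 0)" for t
  have \<alpha>U: "\<alpha> t \<in> U'" "G (\<alpha> t) = (t, 0)" if "\<bar>t\<bar> < eta" for t
    using ift(6) inV[OF that] unfolding \<alpha>_def homeomorphism_def by auto
  have \<alpha>b: "\<alpha> t \<in> ball p r" "q (\<alpha> t) > 0" if "\<bar>t\<bar> < eta" for t
    using \<alpha>U(1)[OF that] ift(2) by (auto simp: W_def)
  have \<alpha>0: "\<rho> (\<alpha> t) = 0" "(\<alpha> t - p) \<bullet> T = t" if "\<bar>t\<bar> < eta" for t
    using \<alpha>U(2)[OF that] by (auto simp: G_def)
  define w where "w t = g' (t, 0) (1, 0)" for t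
  have d\<alpha>: "(\<alpha> has_vector_derivative w t) (at t)" if "\<bar>t\<bar> < eta" for t
  proof -
    have gd: "(g has_derivative g' (t, 0)) (at (t, 0))" using ift(7) inV[OF that] by blast
    have "((\<lambda>t. (t, 0::real)) has_derivative (\<lambda>h. (h, 0))) (at t)" by (auto intro!: derivative_eq_intros)
    from has_derivative_compose[OF this gd]
    have "(\<alpha> has_derivative (\<lambda>h. g' (t, 0) (h, 0))) (at t)" by (simp add: \<alpha>_def[abs_def])
    moreover have "g' (t, 0) (h, 0) = h *\<^sub>R w t" for h
      using linear_scale[OF has_derivative_linear[OF gd], of h "(1,0)"] by (simp add: w_def)
    ultimately show ?thesis by (simp add: has_vector_derivative_def)
  qed
  \<comment> \<open>Speed of \<open>\<alpha>\<close>: it advances at unit rate along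
    \<open>T\<close>, and the unit tangent has \<open>T\<close>-component q/n.\<close>
  define \<kappa> where "\<kappa> t = n (\<alpha> t) / q (\<alpha> t)" for t
  have \<kappa>: "\<kappa> t > 0" if "\<bar>t\<bar> < eta" for t using \<alpha>b[OF that] n_pos by (simp add: \<kappa>_def)
  have tq: "tang D (\<alpha> t) \<bullet> T = q (\<alpha> t) / n (\<alpha> t)" if "\<bar>t\<bar> < eta" for t
    unfolding tang_eq[OF \<alpha>b(1)[OF that] \<alpha>0(1)[OF that]]
    by (simp add: inner_prod_def q_def add_divide_distrib diff_divide_distrib)
  have w: "w t = \<kappa> t *\<^sub>R tang D (\<alpha> t)" if t: "\<bar>t\<bar> < eta" for t
  proof -
    let ?x = "\<alpha> t"
    have "blinfun_apply (G' (g (t, 0))) (w t) = (1, 0)"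
      unfolding w_def ift(8)[OF inV[OF t]]
      using ift(9)[OF inV[OF t]] by (metis bij_is_surj surj_f_inv_f)
    then have e: "w t \<bullet> T = 1" "fst (w t) * a ?x + snd (w t) * b ?x = 0" by (simp_all add: \<alpha>_def)
    have e1: "fst (w t) * fst T + snd (w t) * snd T = 1" using e(1) by (simp add: inner_prod_def)
    have "fst (w t) * q ?x = - b ?x * (fst (w t) * fst T) + (fst (w t) * a ?x) * snd T"
      by (simp add: q_def algebra_simps)
    also have "fst (w t) * a ?x = - snd (w t) * b ?x" using e(2) by simp
    also have "- b ?x * (fst (w t) * fst T) + - snd (w t) * b ?x * snd T = - b ?x * (fst (w t) * fst T + snd (w t) * snd T)"
      by (simp add: algebra_simps)
    finally have w1: "fst (w t) * q ?x = - b ?x" using e1 by simp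
    have "snd (w t) * q ?x = - (snd (w t) * b ?x) * fst T + a ?x * (snd (w t) * snd T)"
      by (simp add: q_def algebra_simps)
    also have "snd (w t) * b ?x = - fst (w t) * a ?x" using e(2) by simp
    also have "- (- fst (w t) * a ?x) * fst T + a ?x * (snd (w t) * snd T) = a ?x * (fst (w t) * fst T + snd (w t) * snd T)"
      by (simp add: algebra_simps)
    finally have w2: "snd (w t) * q ?x = a ?x" using e1 by simp
    have "fst (w t) = - b ?x / q ?x" "snd (w t) = a ?x / q ?x"
      using w1 w2 \<alpha>b(2)[OF t] by (auto simp: field_simps)
    then show ?thesis unfolding tang_eq[OF \<alpha>b(1)[OF t] \<alpha>0(1)[OF t]]
      using \<alpha>b[OF t] n_pos[OF \<alpha>b(1)[OF t]] by (intro prod_eqI) (auto simp: \<kappa>_def)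
  qed
  have c\<alpha>: "isCont \<alpha> t" if "\<bar>t\<bar> < eta" for t
    using d\<alpha>[OF that] has_vector_derivative_continuous by blast
  have c\<kappa>: "isCont \<kappa> t" if t: "\<bar>t\<bar> < eta" for t
  proof -
    have "isCont a (\<alpha> t)" "isCont b (\<alpha> t)" "isCont q (\<alpha> t)"
      using cont_a cont_b cq \<alpha>b(1)[OF t] continuous_on_eq_continuous_at[OF open_ball] by blast+
    then have "isCont (\<lambda>t. a (\<alpha> t)) t" "isCont (\<lambda>t. b (\<alpha> t)) t" "isCont (\<lambda>t. q (\<alpha> t)) t"
      using isCont_o2[OF c\<alpha>[OF t]] by blast+
    moreover have "q (\<alpha> t) \<noteq> 0" using \<alpha>b(2)[OF t] by simp
    ultimately show ?thesis unfolding \<kappa>_def[abs_def] n_def by (intro continuous_intros)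
  qed
  have "\<exists>S'. \<forall>x. ereal (-eta) < ereal x \<longrightarrow> ereal x < ereal eta \<longrightarrow> (S' has_vector_derivative \<kappa> x) (at x)"
    by (rule einterval_antiderivative) (use c\<kappa> eta(1) in auto)
  then obtain S' where "\<forall>x. ereal (-eta) < ereal x \<longrightarrow> ereal x < ereal eta \<longrightarrow> (S' has_vector_derivative \<kappa> x) (at x)" ..
  then have S': "(S' has_vector_derivative \<kappa> t) (at t)" if "\<bar>t\<bar> < eta" for t using that by auto
  define S where "S t = S' t - S' 0" for t
  have S: "(S has_vector_derivative \<kappa> t) (at t)" if "\<bar>t\<bar> < eta" for t
    unfolding S_def using S'[OF that] by (auto intro!: derivative_eq_intros)
  have S0: "S 0 = 0" by (simp add: S_def)
  have cS: "isCont S t" if "\<bar>t\<bar> < eta" for t using S[OF that] has_vector_derivative_continuous by blast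
  have Smono: "S x < S y" if "x < y" "\<bar>x\<bar> < eta" "\<bar>y\<bar> < eta" for x y
  proof (rule DERIV_pos_imp_increasing[OF that(1)])
    fix z assume "x \<le> z" "z \<le> y"
    then have "\<bar>z\<bar> < eta" using that by auto
    then show "\<exists>y. DERIV S z :> y \<and> 0 < y"
      using S \<kappa> by (auto simp: has_real_derivative_iff_has_vector_derivative)
  qed
  define h where "h = eta / 2"
  have h: "h > 0" "h < eta" using eta(1) by (auto simp: h_def)
  have Sinj: "inj_on S {-h..h}"
    by (rule inj_onI) (use Smono h in \<open>metis abs_le_iff atLeastAtMost_iff le_less_trans minus_le_iff not_less_iff_gr_or_eq\<close>)
  \<comment> \<open>\<open>S\<close> maps (-h,h) onto an interval containing (-e,e);
    \<open>h\<close> is half of \<open>eta\<close> so that the closed interval [-h,h] stays inside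
    the domain of \<open>\<alpha>\<close>.\<close>
  define e where "e = min (S h) (- S (-h))"
  have e: "e > 0" using Smono[of 0 h] Smono[of "-h" 0] S0 h by (auto simp: e_def)
  define Ti where "Ti = inv_into {-h..h} S"
  have TiS: "Ti (S t) = t" if "t \<in> {-h..h}" for t unfolding Ti_def using inv_into_f_f[OF Sinj that] .
  have cSh: "continuous_on {-h..h} S"
    by (intro continuous_at_imp_continuous_on ballI cS) (use h in auto)
  have Ti: "Ti u \<in> {-h<..<h}" "S (Ti u) = u" if u: "\<bar>u\<bar> < e" for u
  proof -
    have "S (-h) < u" "u < S h" using u by (auto simp: e_def abs_less_iff)
    then obtain t where t: "-h \<le> t" "t \<le> h" "S t = u"
      using IVT'[of S "-h" u h] cSh h by auto
    moreover have "t \<noteq> h" "t \<noteq> -h" using t \<open>S (-h) < u\<close> \<open>u < S h\<close> by auto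
    ultimately show "Ti u \<in> {-h<..<h}" "S (Ti u) = u" using TiS[of t] by auto
  qed
  have dTi: "(Ti has_vector_derivative inverse (\<kappa> (Ti u))) (at u)" if u: "\<bar>u\<bar> < e" for u
  proof -
    have a: "\<bar>Ti u\<bar> < eta" using Ti(1)[OF u] h by auto
    have "isCont Ti (S (Ti u))"
      by (rule isCont_inverse_function2[of "-h" _ h]) (use Ti(1)[OF u] TiS h in \<open>auto intro!: cS\<close>)
    then have c: "isCont Ti u" using Ti(2)[OF u] by simp
    have "DERIV S (Ti u) :> \<kappa> (Ti u)" using S[OF a] by (simp add: has_real_derivative_iff_has_vector_derivative)
    then have "DERIV Ti u :> inverse (\<kappa> (Ti u))"
      by (rule DERIV_inverse_function[of _ _ _ _ "-e" e]) (use \<kappa>[OF a] u Ti(2) c in \<open>auto simp: abs_less_iff\<close>)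
    then show ?thesis by (simp add: has_real_derivative_iff_has_vector_derivative)
  qed
  define beta where "beta u = \<alpha> (Ti u)" for u
  define s where "s x = S ((x - p) \<bullet> T)" for x
  define J where "J = {-h<..<h} \<inter> S -` {-e<..<e}"
  have "open J" unfolding J_def
    by (intro continuous_open_preimage continuous_at_imp_continuous_on ballI cS) (use h in auto)
  define U where "U = U' \<inter> (\<lambda>x. (x - p) \<bullet> T) -` J"
  have "open U" unfolding U_def by (intro open_Int ift open_vimage \<open>open J\<close> continuous_intros)
  have "0 \<in> J" using h e S0 by (auto simp: J_def)
  then have "p \<in> U" using ift(3) by (simp add: U_def)
  have "Ti 0 = 0" using TiS[of 0] S0 h by auto
  moreover have "\<alpha> 0 = p" using ift(6,3) Gp unfolding \<alpha>_def homeomorphism_def by metis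
  ultimately have "beta 0 = p" by (simp add: beta_def)
  have 1: "beta u \<in> frontier D \<inter> U \<and> s (beta u) = u \<and> (beta has_vector_derivative tang D (beta u)) (at u)" if u: "\<bar>u\<bar> < e" for u
  proof -
    have a: "\<bar>Ti u\<bar> < eta" using Ti(1)[OF u] h by auto
    have "((\<alpha> \<circ> Ti) has_vector_derivative (inverse (\<kappa> (Ti u)) *\<^sub>R w (Ti u))) (at u)"
      by (rule vector_diff_chain_at[OF dTi[OF u] d\<alpha>[OF a]])
    then have "(beta has_vector_derivative tang D (beta u)) (at u)"
      using w[OF a] \<kappa>[OF a] by (simp add: beta_def[abs_def] o_def)
    moreover have "beta u \<in> frontier D" using frontier_iff \<alpha>b(1)[OF a] \<alpha>0(1)[OF a] by (simp add: beta_def)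
    moreover have "s (beta u) = u" using \<alpha>0(2)[OF a] Ti(2)[OF u] by (simp add: s_def beta_def)
    moreover have "beta u \<in> U" using \<alpha>U(1)[OF a] \<alpha>0(2)[OF a] Ti[OF u] u by (auto simp: U_def beta_def J_def)
    ultimately show ?thesis by blast
  qed
  have 2: "\<bar>s x\<bar> < e \<and> beta (s x) = x \<and> (\<exists>s'. (s has_derivative s') (at x) \<and> s' (tang D x) = 1)"
    if x: "x \<in> frontier D \<inter> U" for x
  proof -
    define t where "t = (x - p) \<bullet> T"
    have tJ: "t \<in> J" "x \<in> U'" using x by (auto simp: U_def t_def)
    have xb: "x \<in> ball p r" using tJ(2) ift(2) Wb by blast
    have "G x = (t, 0)" using frontier_iff[OF xb] x by (simp add: G_def t_def)
    then have xt: "x = \<alpha> t" using ift(6) tJ(2) unfolding \<alpha>_def homeomorphism_def by metis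
    have a: "\<bar>t\<bar> < eta" using tJ(1) h by (auto simp: J_def)
    have "\<bar>s x\<bar> < e" using tJ(1) by (auto simp: J_def s_def t_def)
    moreover have "beta (s x) = x"
    proof -
      have "Ti (S t) = t" using TiS[of t] tJ(1) by (auto simp: J_def)
      then have "beta (s x) = \<alpha> t" unfolding beta_def s_def t_def[symmetric] by (rule arg_cong)
      then show ?thesis using xt by (rule trans[OF _ sym])
    qed
    moreover have "(s has_derivative (\<lambda>v. (v \<bullet> T) *\<^sub>R \<kappa> t)) (at x)"
    proof -
      have d: "((\<lambda>x. (x - p) \<bullet> T) has_derivative (\<lambda>v. v \<bullet> T)) (at x)"
        by (auto intro!: derivative_eq_intros)
      have "(S has_derivative (\<lambda>h. h *\<^sub>R \<kappa> t)) (at ((x - p) \<bullet> T))"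
        using S[OF a] by (simp add: has_vector_derivative_def t_def)
      from has_derivative_compose[OF d this] show ?thesis by (simp add: s_def[abs_def])
    qed
    moreover have "(tang D x \<bullet> T) *\<^sub>R \<kappa> t = 1"
      using tq[OF a] \<alpha>b[OF a] n_pos[OF \<alpha>b(1)[OF a]] by (simp add: xt[symmetric] \<kappa>_def)
    ultimately show ?thesis by blast
  qed
  show ?thesis
    using e \<open>open U\<close> \<open>p \<in> U\<close> \<open>beta 0 = p\<close> 1 2 by (intro exI[of _ e] conjI exI[of _ beta] exI[of _ s] exI[of _ U]) auto
qed

lemma tang_cont: "continuous (at p within frontier D) (tang D)"
proof -
  have "isCont a p" "isCont b p"
    using cont_a cont_b p_ball continuous_on_eq_continuous_at[OF open_ball] by blast+
  then have "isCont (\<lambda>x. (- b x / n x, a x / n x)) p"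
    unfolding n_def using n_pos[OF p_ball(1)] by (intro continuous_intros) (auto simp: n_def)
  then have "continuous (at p within frontier D) (\<lambda>x. (- b x / n x, a x / n x))"
    using continuous_at_imp_continuous_at_within by blast
  then show ?thesis
    by (rule continuous_transform_within[where \<delta>=r])
      (use r p tang_eq frontier_iff in \<open>auto simp: dist_commute\<close>)
qed

end

lemma boundary_chart_ex:
  assumes D: "smooth_sc_domain D" and p: "p \<in> frontier D"
  obtains r \<rho> a b where "boundary_chart D p r \<rho> a b"
proof -
  obtain r and \<rho> :: "pt \<Rightarrow> real" where r: "r > 0" "Cinf (ball p r) (ball p r) \<rho>"
      "\<forall>x\<in>ball p r. (pd1 \<rho> x, pd2 \<rho> x) \<noteq> 0" "D \<inter> ball p r = {x \<in> ball p r. \<rho> x < 0}"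
    using D p unfolding smooth_sc_domain_def by blast
  obtain F where F: "\<rho> \<in> F" "\<forall>g\<in>F. continuous_on (ball p r) g \<and> (\<forall>x\<in>ball p r. g differentiable (at x)) \<and>
        (\<exists>g1\<in>F. \<exists>g2\<in>F. \<forall>x\<in>ball p r. pd1 g x = g1 x \<and> pd2 g x = g2 x)"
    using r(2) unfolding Cinf_def by blast
  then obtain g1 g2 where g: "g1 \<in> F" "g2 \<in> F" "\<forall>x\<in>ball p r. pd1 \<rho> x = g1 x \<and> pd2 \<rho> x = g2 x" by blast
  have "boundary_chart D p r \<rho> g1 g2"
  proof
    show "open D" using D by (simp add: smooth_sc_domain_def)
    show "has_grad \<rho> (g1 x) (g2 x) x" if "x \<in> ball p r" for x
      using differentiable_has_grad[of \<rho> x] F g(3) that by auto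
    show "(g1 x, g2 x) \<noteq> 0" if "x \<in> ball p r" for x using r(3) g(3) that by auto
    show "x \<in> D \<longleftrightarrow> \<rho> x < 0" if "x \<in> ball p r" for x using r(4) that by blast
  qed (use r F g p in auto)
  then show thesis using that by blast
qed


lemma unit_tangent_curve_frontier:
  assumes D: "smooth_sc_domain D" and c: "connected (frontier D)"
  shows "unit_tangent_curve (frontier D) (tang D)"
proof
  have b: "bounded D" "D \<noteq> {}" using D by (auto simp: smooth_sc_domain_def)
  show "compact (frontier D)" using b by (simp add: compact_frontier_bounded)
  show "frontier D \<noteq> {}" using b frontier_eq_empty not_bounded_UNIV by blast
  show "continuous_on (frontier D) (tang D)"
    unfolding continuous_on_eq_continuous_within using boundary_chart_ex[OF D] boundary_chart.tang_cont by metis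
  fix p assume p: "p \<in> frontier D"
  obtain r \<rho> a b where "boundary_chart D p r \<rho> a b" using boundary_chart_ex[OF D p] .
  from boundary_chart.chart[OF this]
  show "\<exists>e>0. \<exists>beta s U. open U \<and> p \<in> U \<and> beta 0 = p \<and>
      (\<forall>t. \<bar>t\<bar> < e \<longrightarrow> beta t \<in> frontier D \<inter> U \<and> s (beta t) = t \<and> (beta has_vector_derivative tang D (beta t)) (at t)) \<and>
      (\<forall>x\<in>frontier D \<inter> U. \<bar>s x\<bar> < e \<and> beta (s x) = x \<and> (\<exists>s'. (s has_derivative s') (at x) \<and> s' (tang D x) = (1::real)))" .
qed (rule c)

lemma rot_inner_normal: "rot (c *\<^sub>R tang D p) = c *\<^sub>R inner_normal D p"
  by (simp add: rot_def tang_def prod_eq_iff)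

lemma inward_inner_normal:
  assumes "smooth_sc_domain D" "p \<in> frontier D" shows "inward D p (inner_normal D p)"
proof -
  obtain r \<rho> a b where "boundary_chart D p r \<rho> a b" using boundary_chart_ex[OF assms] .
  then interpret boundary_chart D p r \<rho> a b .
  show ?thesis using inward_grad[OF p_ball] inner_normal_eq by metis
qed

lemma norm_tang:
  assumes "smooth_sc_domain D" "p \<in> frontier D" shows "norm (tang D p) = 1"
  using inward_inner_normal[OF assms] by (auto simp: inward_def tang_def norm_prod_def add.commute)

lemma periodic_int:
  assumes "\<And>t::real. g (t + 1) = g t" shows "g (t + of_int k) = g t"
proof -
  have n: "g (t + real n) = g t" for t n
  proof (induction n)
    case (Suc n) then show ?case using assms[of "t + real n"] by (simp add: algebra_simps)
  qed simp
  show ?thesis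
  proof (cases "k \<ge> 0")
    case True then show ?thesis using n[of t "nat k"] by simp
  next
    case False then show ?thesis using n[of "t + of_int k" "nat (-k)"] by simp
  qed
qed

section \<open>Counterclockwise parametrisations and well-defined circulations\<close>

lemma ccw_param_frontier:
  assumes "ccw_param D gam" shows "gam t \<in> frontier D"
proof -
  have "gam t = gam (t - of_int \<lfloor>t\<rfloor>)"
    using periodic_int[of gam "t - of_int \<lfloor>t\<rfloor>" "\<lfloor>t\<rfloor>"] assms by (simp add: ccw_param_def)
  moreover have "t - of_int \<lfloor>t\<rfloor> \<in> {0..1}" by simp linarith
  ultimately show ?thesis using assms unfolding ccw_param_def by (metis imageI)
qed

lemma ccw_param_derivative:
  assumes "ccw_param D gam" shows "(gam has_vector_derivative vector_derivative gam (at t)) (at t)"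
  using assms vector_derivative_works unfolding ccw_param_def C1_differentiable_on_eq by blast

text \<open>\<open>\<rho>\<close> vanishes along the curve, so the velocity is orthogonal to its
  gradient and a multiple of the tangent; a negative factor would turn the left normal outwards,
  against \<open>ccw_param\<close>.\<close>

lemma ccw_param_tang:
  assumes D: "smooth_sc_domain D" and g: "ccw_param D gam"
  shows "vector_derivative gam (at t) = norm (vector_derivative gam (at t)) *\<^sub>R tang D (gam t)"
proof -
  let ?v = "vector_derivative gam (at t)"
  have F: "gam s \<in> frontier D" for s using ccw_param_frontier[OF g] .
  obtain r \<rho> a b where "boundary_chart D (gam t) r \<rho> a b" using boundary_chart_ex[OF D F] .
  then interpret boundary_chart D "gam t" r \<rho> a b .
  have c: "isCont gam t" using ccw_param_derivative[OF g] has_vector_derivative_continuous by blast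
  have "\<forall>\<^sub>F s in at t. gam s \<in> ball (gam t) r"
    using c p_ball(1) unfolding isCont_def by (intro topological_tendstoD[of gam "gam t"]) auto
  then obtain d where d: "d > 0" "\<And>s. dist s t < d \<Longrightarrow> gam s \<in> ball (gam t) r"
    unfolding eventually_at using p_ball(1) by (metis UNIV_I)
  have "((\<lambda>s. \<rho> (gam s)) has_vector_derivative (fst ?v *\<^sub>R a (gam t) + snd ?v *\<^sub>R b (gam t))) (at t)"
    by (rule has_grad_along[OF grad ccw_param_derivative[OF g]]) (rule p_ball)
  moreover have "((\<lambda>s. \<rho> (gam s)) has_vector_derivative 0) (at t)"
  proof (rule has_vector_derivative_transform_within_open[of "\<lambda>_. 0" _ _ "ball t d"])
    show "0 = \<rho> (gam s)" if "s \<in> ball t d" for s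
      using d(2)[of s] that F[of s] frontier_iff[of "gam s"] by (simp add: dist_commute)
  qed (use d in auto)
  ultimately have z: "fst ?v * a (gam t) + snd ?v * b (gam t) = 0"
    using vector_derivative_unique_at by fastforce
  let ?m = "inner_normal D (gam t)"
  have n: "n (gam t) > 0" using n_pos p_ball by blast
  have m: "?m = (- a (gam t) / n (gam t), - b (gam t) / n (gam t))"
    using inner_normal_eq[OF inward_grad[OF p_ball]] by simp
  define l where "l = fst ?v * (- b (gam t) / n (gam t)) + snd ?v * (a (gam t) / n (gam t))"
  have nn: "n (gam t) * n (gam t) = a (gam t) * a (gam t) + b (gam t) * b (gam t)" by (rule n_sq)
  have vl: "?v = l *\<^sub>R tang D (gam t)"
  proof (rule prod_eqI)
    have "fst ?v * (n (gam t) * n (gam t)) = (fst ?v * a (gam t)) * a (gam t) + fst ?v * b (gam t) * b (gam t)"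
      unfolding nn by (simp add: algebra_simps)
    also have "fst ?v * a (gam t) = - snd ?v * b (gam t)" using z by simp
    finally have "fst ?v * (n (gam t) * n (gam t)) = (fst ?v * b (gam t) - snd ?v * a (gam t)) * b (gam t)"
      by (simp add: algebra_simps)
    then have "fst ?v = (fst ?v * b (gam t) - snd ?v * a (gam t)) * b (gam t) / (n (gam t) * n (gam t))"
      using n by (simp add: nonzero_eq_divide_eq)
    then show "fst ?v = fst (l *\<^sub>R tang D (gam t))"
      using n by (simp add: tang_def m l_def field_simps)
    have "snd ?v * (n (gam t) * n (gam t)) = (snd ?v * b (gam t)) * b (gam t) + snd ?v * a (gam t) * a (gam t)"
      unfolding nn by (simp add: algebra_simps)
    also have "snd ?v * b (gam t) = - fst ?v * a (gam t)" using z by simp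
    finally have "snd ?v * (n (gam t) * n (gam t)) = (snd ?v * a (gam t) - fst ?v * b (gam t)) * a (gam t)"
      by (simp add: algebra_simps)
    then have "snd ?v = (snd ?v * a (gam t) - fst ?v * b (gam t)) * a (gam t) / (n (gam t) * n (gam t))"
      using n by (simp add: nonzero_eq_divide_eq)
    then show "snd ?v = snd (l *\<^sub>R tang D (gam t))"
      using n by (simp add: tang_def m l_def field_simps)
  qed
  have inw: "inward D (gam t) ?m" using inward_inner_normal[OF D F] .
  have rv: "rot ?v = l *\<^sub>R ?m" using vl rot_inner_normal by metis
  have "l \<ge> 0"
  proof (rule ccontr)
    assume "\<not> l \<ge> 0"
    moreover have "rot ?v \<bullet> ?m = l" using inw unfolding rv by (simp add: inward_def dot_square_norm)
    ultimately have "rot ?v \<bullet> ?m < 0" by simp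
    then obtain e where e: "e > 0" "\<And>s. 0 < s \<and> s < e \<Longrightarrow> gam t + s *\<^sub>R rot ?v \<notin> D"
      using inw unfolding inward_def by blast
    obtain e' where e': "e' > 0" "\<And>s. 0 < s \<and> s < e' \<Longrightarrow> gam t + s *\<^sub>R rot ?v \<in> D"
      using g unfolding ccw_param_def by blast
    have "0 < min e e' / 2" "min e e' / 2 < e" "min e e' / 2 < e'" using e(1) e'(1) by auto
    then show False using e(2)[of "min e e' / 2"] e'(2)[of "min e e' / 2"] by blast
  qed
  then have "norm ?v = l" using arg_cong[OF vl, of norm] norm_tang[OF D F[of t]] by simp
  then show ?thesis using vl by simp
qed

lemma ccw_param_sol:
  assumes D: "smooth_sc_domain D" and c: "connected (frontier D)" and g: "ccw_param D gam"
  shows "unit_tangent_curve.sol (frontier D) (tang D) (\<lambda>t. norm (vector_derivative gam (at t))) UNIV gam"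
  unfolding unit_tangent_curve.sol_def[OF unit_tangent_curve_frontier[OF D c]]
  using ccw_param_frontier[OF g] ccw_param_derivative[OF g] ccw_param_tang[OF D g, symmetric] by simp

text \<open>The unit-speed flow rescaled by its minimal period. This gives the definite description
  in \<open>circulation\<close> a candidate.\<close>

lemma ccw_param_ex:
  assumes D: "smooth_sc_domain D" and c: "connected (frontier D)"
  shows "\<exists>gam. ccw_param D gam"
proof -
  interpret unit_tangent_curve "frontier D" "tang D" by (rule unit_tangent_curve_frontier[OF D c])
  obtain gam where g: "sol (\<lambda>_. 1) UNIV gam" by (rule global_sol) blast
  obtain T where T: "T > 0" "\<And>t. gam (t + T) = gam t" "inj_on gam {0..<T}" "gam ` {0..T} = frontier D"
    by (rule sol_min_period[OF g]) blast
  define \<delta> where "\<delta> t = gam (T * t)" for t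
  have gF: "gam t \<in> frontier D" "(gam has_vector_derivative tang D (gam t)) (at t)" for t
    using g by (auto simp: sol_def)
  have d: "(\<delta> has_vector_derivative T *\<^sub>R tang D (\<delta> t)) (at t)" for t
  proof -
    have "((\<lambda>t. T * t) has_vector_derivative T) (at t)" by (auto intro!: derivative_eq_intros)
    from vector_diff_chain_at[OF this gF(2)] show ?thesis by (simp add: o_def \<delta>_def[abs_def])
  qed
  have vd: "vector_derivative \<delta> (at t) = T *\<^sub>R tang D (\<delta> t)" for t using vector_derivative_at[OF d] .
  have cd: "continuous_on UNIV \<delta>"
    by (intro continuous_at_imp_continuous_on ballI) (use d has_vector_derivative_continuous in blast)
  have ct: "continuous_on UNIV (\<lambda>t. T *\<^sub>R tang D (\<delta> t))"
    by (intro continuous_intros continuous_on_compose2[OF continuous cd]) (use gF in \<open>auto simp: \<delta>_def\<close>)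
  have "ccw_param D \<delta>" unfolding ccw_param_def
  proof (intro conjI allI)
    show "\<delta> C1_differentiable_on UNIV" unfolding C1_differentiable_on_def using d ct
      by (intro exI[of _ "\<lambda>t. T *\<^sub>R tang D (\<delta> t)"]) auto
    show "\<delta> (t + 1) = \<delta> t" for t using T(2)[of "T * t"] by (simp add: \<delta>_def algebra_simps)
    show "inj_on \<delta> {0..<1}"
    proof (rule inj_onI)
      fix x y assume xy: "x \<in> {0..<1}" "y \<in> {0..<1}" "\<delta> x = \<delta> y"
      then have "T * x \<in> {0..<T}" "T * y \<in> {0..<T}" using T(1) by auto
      then have "T * x = T * y" using T(3) xy(3) unfolding \<delta>_def inj_on_def by blast
      then show "x = y" using T(1) by simp
    qed
    have "(\<lambda>t. T * t) ` {0..1} = {0..T}"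
      using image_mult_atLeastAtMost[OF T(1), of 0 1] by simp
    then show "\<delta> ` {0..1} = frontier D" using T(4) unfolding \<delta>_def[abs_def] by (metis image_image)
    fix t
    have F: "\<delta> t \<in> frontier D" using gF by (simp add: \<delta>_def)
    show "vector_derivative \<delta> (at t) \<noteq> 0" using norm_tang[OF D F] T(1) unfolding vd by auto
    have "inward D (\<delta> t) (inner_normal D (\<delta> t))" using inward_inner_normal[OF D F] .
    moreover from this have "rot (vector_derivative \<delta> (at t)) \<bullet> inner_normal D (\<delta> t) > 0"
      unfolding vd rot_inner_normal using T(1) by (simp add: inward_def dot_square_norm)
    ultimately show "\<exists>eps>0. \<forall>s. 0 < s \<and> s < eps \<longrightarrow> \<delta> t + s *\<^sub>R rot (vector_derivative \<delta> (at t)) \<in> D"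
      unfolding inward_def by blast
  qed
  then show ?thesis by blast
qed

text \<open>Every counterclockwise parametrisation traverses the same flow at positive speed, so
  each gives the integral over one period of the unit-speed flow; this is the uniqueness behind the
  definite description.\<close>

theorem circulation_integral:
  assumes D: "smooth_sc_domain D" and c: "connected (frontier D)" and g: "ccw_param D gam"
    and f: "continuous_on (frontier D) f"
  shows "((\<lambda>t. f (gam t) \<bullet> vector_derivative gam (at t)) has_integral circulation D f) {0..1}"
proof -
  interpret unit_tangent_curve "frontier D" "tang D" by (rule unit_tangent_curve_frontier[OF D c])
  obtain \<alpha> where a: "sol (\<lambda>_. 1) UNIV \<alpha>" by (rule global_sol) blast
  obtain T where T: "T > 0" "\<And>t. \<alpha> (t + T) = \<alpha> t" "\<And>P. P > 0 \<Longrightarrow> \<alpha> P = \<alpha> 0 \<Longrightarrow> P \<ge> T"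
    by (rule sol_min_period[OF a]) blast
  have ca: "continuous_on UNIV \<alpha>"
    by (intro continuous_at_imp_continuous_on ballI) (use sol_isCont[OF a] in blast)
  have "continuous_on UNIV (\<lambda>t. f (\<alpha> t) \<bullet> tang D (\<alpha> t))"
    by (intro continuous_intros continuous_on_compose2[OF continuous ca] continuous_on_compose2[OF f ca])
      (use a in \<open>auto simp: sol_def\<close>)
  then obtain G where G: "\<And>t. (G has_vector_derivative (f (\<alpha> t) \<bullet> tang D (\<alpha> t))) (at t)"
    by (rule antiderivative_UNIV) blast
  have I: "((\<lambda>t. f (\<delta> t) \<bullet> vector_derivative \<delta> (at t)) has_integral G T - G 0) {0..1}"
    if d: "ccw_param D \<delta>" for \<delta>
  proof -
    have "((\<lambda>t. f (\<delta> t) \<bullet> (norm (vector_derivative \<delta> (at t)) *\<^sub>R tang D (\<delta> t))) has_integral G T - G 0) {0..1}"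
    proof (rule traversal_integral[OF a T ccw_param_sol[OF D c d] _ _ _ _ f G])
      show "continuous_on UNIV (\<lambda>t. norm (vector_derivative \<delta> (at t)))"
        using d unfolding ccw_param_def C1_differentiable_on_eq by (intro continuous_intros) auto
      show "norm (vector_derivative \<delta> (at t)) > 0" for t using d by (simp add: ccw_param_def)
      show "\<delta> 1 = \<delta> 0" using d unfolding ccw_param_def by (metis add_0)
      show "inj_on \<delta> {0..<1}" using d by (simp add: ccw_param_def)
    qed
    then show ?thesis using ccw_param_tang[OF D d] by simp
  qed
  have "circulation D f = G T - G 0" unfolding circulation_def
  proof (rule the_equality)
    show "\<exists>gam. ccw_param D gam \<and> G T - G 0 = integral {0..1} (\<lambda>t. f (gam t) \<bullet> vector_derivative gam (at t))"
      using g I[OF g] by (intro exI[of _ gam]) (auto simp: integral_unique)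
    show "x = G T - G 0" if "\<exists>gam. ccw_param D gam \<and> x = integral {0..1} (\<lambda>t. f (gam t) \<bullet> vector_derivative gam (at t))" for x
      using that I integral_unique by blast
  qed
  then show ?thesis using I[OF g] by simp
qed

section \<open>Winding of the boundary\<close>

definition toC :: "pt \<Rightarrow> complex" where "toC p = Complex (fst p) (snd p)"

lemma toC_sel[simp]: "Re (toC p) = fst p" "Im (toC p) = snd p" by (simp_all add: toC_def)

lemma linear_toC: "linear toC" by (rule linearI) (simp_all add: complex_eq_iff)

lemma bounded_linear_toC: "bounded_linear toC" using linear_toC linear_conv_bounded_linear by blast

lemma norm_toC[simp]: "norm (toC p) = norm p"
  by (simp add: cmod_def norm_prod_def)

lemma toC_diff: "toC (p - q) = toC p - toC q" by (simp add: complex_eq_iff)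

lemma bij_toC: "bij toC"
  by (rule o_bij[of "\<lambda>z. (Re z, Im z)"]) (auto simp: fun_eq_iff complex_eq_iff)

lemma inj_toC: "inj toC" using bij_toC bij_is_inj by blast

lemma toC_mem[simp]: "toC x \<in> toC ` S \<longleftrightarrow> x \<in> S" using inj_toC by (rule inj_image_mem_iff)

lemma open_toC: "open S \<Longrightarrow> open (toC ` S)"
  using open_bijective_linear_image_eq[OF linear_toC bij_toC] by blast

lemma closure_toC: "closure (toC ` S) = toC ` closure S"
  using closure_injective_linear_image[OF linear_toC inj_toC] by simp

lemma frontier_toC: "frontier (toC ` S) = toC ` frontier S"
  by (simp add: frontier_def closure_toC interior_bijective_linear_image[OF linear_toC bij_toC] image_set_diff[OF inj_toC])

lemma homeomorphic_toC: "S homeomorphic (toC ` S)"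
  using linear_homeomorphic_image[OF linear_toC inj_toC] .

lemma connected_toC: "connected (toC ` S) \<longleftrightarrow> connected S"
  using homeomorphic_connectedness[OF homeomorphic_toC] by blast

lemma bounded_toC: "bounded S \<Longrightarrow> bounded (toC ` S)"
  by (simp add: bounded_linear_image bounded_linear_toC)

lemma simply_connected_toC: "simply_connected S \<Longrightarrow> simply_connected (toC ` S)"
  using homeomorphic_simply_connected_eq[OF homeomorphic_toC] by blast

text \<open>Here simple connectedness enters, through the characterisation of simply connected open
  subsets of the complex plane by their frontiers.\<close>

lemma connected_frontier_smooth:
  assumes "smooth_sc_domain D" shows "connected (frontier D)"
proof -
  have "open (toC ` D)" "simply_connected (toC ` D)" "bounded (toC ` D)"
    using assms open_toC simply_connected_toC bounded_toC by (auto simp: smooth_sc_domain_def)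
  then have "connected (frontier (toC ` D))" using simply_connected_eq_frontier_properties by auto
  then show ?thesis by (simp add: frontier_toC connected_toC)
qed

lemma has_vector_derivative_toC:
  "(c has_vector_derivative c') F \<Longrightarrow> ((\<lambda>t. toC (c t)) has_vector_derivative toC c') F"
  by (rule bounded_linear.has_vector_derivative[OF bounded_linear_toC])

lemma valid_path_toC:
  assumes "\<And>t. t \<in> {0..1} \<Longrightarrow> (c has_vector_derivative c' t) (at t)" "continuous_on {0..1} c'"
  shows "valid_path (\<lambda>t. toC (c t))"
proof -
  have "(\<lambda>t. toC (c t)) C1_differentiable_on {0..1}" unfolding C1_differentiable_on_def
    using has_vector_derivative_toC[OF assms(1)] bounded_linear.continuous_on[OF bounded_linear_toC assms(2)] by (intro exI[of _ "\<lambda>t. toC (c' t)"]) auto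
  then show ?thesis unfolding valid_path_def by (rule C1_differentiable_imp_piecewise)
qed

lemma ccw_param_valid_path: "ccw_param D gam \<Longrightarrow> valid_path (\<lambda>t. toC (gam t))"
  by (rule valid_path_toC[OF ccw_param_derivative])
    (auto simp: ccw_param_def C1_differentiable_on_eq intro: continuous_on_subset)

text \<open>\<open>D\<close> is the inside of its boundary in the sense of the Jordan curve theorem.
  The sign is left open: later arguments use only that \<open>w\<close> is an integer with w * w =
  1.\<close>

lemma ccw_param_winding:
  assumes D: "smooth_sc_domain D" and g: "ccw_param D gam"
  obtains w :: int where "w * w = 1" "\<And>x. x \<in> D \<Longrightarrow> winding_number (\<lambda>t. toC (gam t)) (toC x) = of_int w"
    "\<And>x. x \<notin> closure D \<Longrightarrow> winding_number (\<lambda>t. toC (gam t)) (toC x) = 0"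
proof -
  let ?c = "\<lambda>t. toC (gam t)"
  have vp: "valid_path ?c" using ccw_param_valid_path[OF g] .
  have g10: "gam 1 = gam 0" using g unfolding ccw_param_def by (metis add_0)
  then have cl: "pathfinish ?c = pathstart ?c" by (simp add: pathfinish_def pathstart_def)
  have pi: "path_image ?c = toC ` frontier D"
    using g unfolding path_image_def ccw_param_def by (metis image_image)
  have sp: "simple_path ?c" unfolding simple_path_def loop_free_def
  proof (intro conjI ballI impI)
    show "path ?c" using vp valid_path_imp_path by blast
    fix x y :: real assume xy: "x \<in> {0..1}" "y \<in> {0..1}" "?c x = ?c y"
    then have e: "gam x = gam y" using inj_toC by (simp add: inj_eq)
    have inj: "\<And>x y. x \<in> {0..<1} \<Longrightarrow> y \<in> {0..<1} \<Longrightarrow> gam x = gam y \<Longrightarrow> x = y"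
      using g unfolding ccw_param_def inj_on_def by blast
    show "x = y \<or> x = 0 \<and> y = 1 \<or> x = 1 \<and> y = 0"
    proof (cases "x = 1")
      case True
      then show ?thesis using inj[of 0 y] e g10 xy(2) by (cases "y = 1") auto
    next
      case x: False
      show ?thesis
      proof (cases "y = 1")
        case True
        then show ?thesis using inj[of x 0] e g10 xy(1) x by auto
      next
        case False
        then show ?thesis using inj[of x y] e xy(1,2) x by auto
      qed
    qed
  qed
  have op: "open D" and ne: "D \<noteq> {}" and co: "connected D" and bd: "bounded D"
    using D by (auto simp: smooth_sc_domain_def)
  let ?I = "inside (path_image ?c)" and ?O = "outside (path_image ?c)"
  have J: "?I \<noteq> {}" "open ?I" "connected ?I" "connected ?O" "\<not> bounded ?O" "?I \<inter> ?O = {}"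
    "?I \<union> ?O = - path_image ?c" "open ?O"
    using Jordan_inside_outside[OF sp cl] by blast+
  have disj: "toC ` D \<inter> path_image ?c = {}"
    unfolding pi using op inj_toC by (auto simp: frontier_def interior_open inj_eq)
  \<comment> \<open>A connected set that avoids the frontier of \<open>D\<close> cannot leave
    \<open>D\<close>. Applied to the unbounded outside this keeps \<open>D\<close> inside; applied
    to the inside it gives equality.\<close>
  have whole: "S \<subseteq> toC ` D" if S: "connected S" "S \<inter> path_image ?c = {}" "S \<inter> toC ` D \<noteq> {}" for S
  proof (rule ccontr)
    assume "\<not> S \<subseteq> toC ` D"
    then have "S \<inter> frontier (toC ` D) \<noteq> {}" using connected_Int_frontier[OF S(1,3)] by blast
    then show False using S(2) pi frontier_toC by auto
  qed
  have "?O \<inter> toC ` D = {}"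
    using whole[of ?O] J(4,5) outside_no_overlap bounded_subset[OF bounded_toC[OF bd]] by blast
  then have sub: "toC ` D \<subseteq> ?I" using J(7) disj by blast
  then have "?I = toC ` D" using whole[of ?I] J(3) ne inside_no_overlap by blast
  then have out: "toC x \<in> ?O" if "x \<notin> closure D" for x
  proof -
    have "toC x \<notin> path_image ?c" "toC x \<notin> ?I"
      using that \<open>?I = toC ` D\<close> closure_subset[of D] by (auto simp: pi inj_toC frontier_def inj_eq)
    then show ?thesis using J(7) by blast
  qed
  have zero: "winding_number ?c (toC x) = 0" if "x \<notin> closure D" for x
    using winding_number_zero_in_outside[OF simple_path_imp_path[OF sp] cl out[OF that]] .
  show thesis
  proof (rule simple_closed_path_winding_number_inside[OF sp])
    assume *: "\<And>z. z \<in> ?I \<Longrightarrow> winding_number ?c z = 1"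
    show thesis
    proof (rule that[of 1])
      show "winding_number ?c (toC x) = of_int 1" if "x \<in> D" for x
        using *[of "toC x"] sub that by auto
    qed (use zero in auto)
  next
    assume *: "\<And>z. z \<in> ?I \<Longrightarrow> winding_number ?c z = -1"
    show thesis
    proof (rule that[of "-1"])
      show "winding_number ?c (toC x) = of_int (-1)" if "x \<in> D" for x
        using *[of "toC x"] sub that by auto
    qed (use zero in auto)
  qed
qed

section \<open>Pushing a boundary curve off its domain\<close>

lemma (in boundary_chart) push_local:
  assumes t: "continuous_on UNIV gam" "continuous_on UNIV V" "gam t0 = p" "\<And>t. gam t \<in> frontier D"
    and V: "V t0 \<bullet> inner_normal D p < 0"
  obtains e where "e > 0" "\<And>t s. \<bar>t - t0\<bar> < e \<Longrightarrow> 0 < s \<Longrightarrow> s < e \<Longrightarrow> gam t + s *\<^sub>R V t \<notin> closure D"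
proof -
  define W where "W = {x\<in>ball p r \<times> UNIV. (a (fst x), b (fst x)) \<bullet> (snd x :: pt) > 0}"
  have "continuous_on (ball p r \<times> UNIV) (\<lambda>x::pt\<times>pt. (a (fst x), b (fst x)) \<bullet> snd x)"
    by (intro continuous_intros continuous_on_compose2[OF cont_a] continuous_on_compose2[OF cont_b]) auto
  from continuous_open_preimage[OF this, of "{0<..}"] have "open W"
    by (simp add: W_def open_Times vimage_def Int_def conj_commute)
  then have "open ((\<lambda>x. (gam (fst x) + snd x *\<^sub>R V (fst x), V (fst x))) -` W)"
    by (intro open_vimage continuous_intros continuous_on_compose2[OF t(1)] continuous_on_compose2[OF t(2)]) auto
  moreover have "(t0, 0) \<in> (\<lambda>x. (gam (fst x) + snd x *\<^sub>R V (fst x), V (fst x))) -` W"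
  proof -
    have "inner_normal D p = (- 1 / n p) *\<^sub>R (a p, b p)" using inner_normal_eq[OF inward_grad[OF p_ball]] .
    then have "(a p, b p) \<bullet> V t0 > 0"
      using V n_pos[OF p_ball(1)] by (simp add: inner_commute divide_less_0_iff field_simps del: scaleR_Pair)
    then show ?thesis using p_ball t(3) by (simp add: W_def)
  qed
  ultimately obtain e where e: "e > 0" "ball (t0, 0) e \<subseteq> (\<lambda>x. (gam (fst x) + snd x *\<^sub>R V (fst x), V (fst x))) -` W"
    using open_contains_ball by blast
  have inW: "(gam t + s *\<^sub>R V t, V t) \<in> W" if "\<bar>t - t0\<bar> < e/2" "\<bar>s\<bar> < e/2" for t s
  proof -
    have "dist (t0, 0) (t, s) \<le> \<bar>t - t0\<bar> + \<bar>s\<bar>"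
      using norm_Pair_le[of "t0 - t" "- s"] by (simp add: dist_norm abs_minus_commute)
    then have "(t, s) \<in> ball (t0, 0) e" using that by simp
    then show ?thesis using e(2) by auto
  qed
  show thesis
  proof (rule that[of "e/2"])
    fix t s assume ts: "\<bar>t - t0\<bar> < e/2" "0 < s" "s < e/2"
    have b: "gam t + u *\<^sub>R V t \<in> ball p r" "(a (gam t + u *\<^sub>R V t), b (gam t + u *\<^sub>R V t)) \<bullet> V t > 0"
      if "0 \<le> u" "u \<le> s" for u
      using inW[OF ts(1), of u] that ts by (auto simp: W_def)
    have "\<rho> (gam t + 0 *\<^sub>R V t) < \<rho> (gam t + s *\<^sub>R V t)"
    proof (rule DERIV_pos_imp_increasing[OF ts(2)])
      fix u assume u: "0 \<le> u" "u \<le> s"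
      have "((\<lambda>u. gam t + u *\<^sub>R V t) has_vector_derivative V t) (at u)" by (auto intro!: derivative_eq_intros)
      from has_grad_along[OF grad[OF b(1)[OF u]] this] b(2)[OF u]
      show "\<exists>y. DERIV (\<lambda>u. \<rho> (gam t + u *\<^sub>R V t)) u :> y \<and> 0 < y"
        by (auto simp: has_real_derivative_iff_has_vector_derivative inner_prod_def mult.commute)
    qed
    moreover have "\<rho> (gam t) = 0" using frontier_iff[of "gam t"] b(1)[of 0] ts(2) t(4)[of t] by simp
    ultimately show "gam t + s *\<^sub>R V t \<notin> closure D" using closure_le b(1)[of s] ts(2) by fastforce
  qed (use e in auto)
qed

text \<open>The rotated velocity of a C^1 curve is merely continuous, whereas the pushed curves must
  be C^1. A symmetric difference quotient over a fixed step, rotated, is C^1 and close enough to the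
  rotated velocity to point outwards.\<close>

lemma push_out:
  assumes D: "smooth_sc_domain D" and g: "ccw_param D gam"
  obtains V V' s0 where "\<And>t. (V has_vector_derivative V' t) (at t)" "continuous_on UNIV V'"
    "\<And>t. V (t + 1) = V t" "s0 > 0"
    "\<And>t s. t \<in> {0..1} \<Longrightarrow> 0 < s \<Longrightarrow> s < s0 \<Longrightarrow> gam t + s *\<^sub>R V t \<notin> closure D"
proof -
  define v where "v t = vector_derivative gam (at t)" for t
  have dg: "(gam has_vector_derivative v t) (at t)" for t unfolding v_def using ccw_param_derivative[OF g] .
  have cv: "continuous_on UNIV v" using g unfolding ccw_param_def C1_differentiable_on_eq v_def by auto
  have cg: "continuous_on UNIV gam"
    by (intro continuous_at_imp_continuous_on ballI) (use dg has_vector_derivative_continuous in blast)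
  have per: "gam (t + 1) = gam t" for t using g by (simp add: ccw_param_def)
  have "\<exists>t0\<in>{0..1::real}. \<forall>t\<in>{0..1}. norm (v t0) \<le> norm (v t)"
    by (rule continuous_attains_inf) (auto intro!: continuous_intros continuous_on_subset[OF cv])
  then obtain t0 where t0: "\<And>t. t \<in> {0..1} \<Longrightarrow> norm (v t0) \<le> norm (v t)" by blast
  define m where "m = norm (v t0)"
  have m: "m > 0" using g by (simp add: m_def v_def ccw_param_def)
  have "uniformly_continuous_on {-1..2} v"
    by (rule compact_uniformly_continuous) (auto intro: continuous_on_subset[OF cv])
  then obtain d where d: "d > 0" "\<And>x y. x \<in> {-1..2} \<Longrightarrow> y \<in> {-1..2} \<Longrightarrow> dist y x < d \<Longrightarrow> dist (v y) (v x) < m/2"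
    unfolding uniformly_continuous_on_def using m by (metis half_gt_zero)
  \<comment> \<open>Below \<open>d\<close>, the mean velocity over [t - \<delta>, t + \<delta>]
    differs from v(t) by at most half the minimal speed \<open>m\<close>; below 1, the window stays
    in [-1,2] for t in [0,1].\<close>
  define \<delta> where "\<delta> = min (d/2) 1"
  have \<delta>: "\<delta> > 0" "\<delta> < d" "\<delta> \<le> 1" using d(1) by (auto simp: \<delta>_def)
  define V where "V t = (- 1 / (2 * \<delta>)) *\<^sub>R rot (gam (t + \<delta>) - gam (t - \<delta>))" for t
  define V' where "V' t = (- 1 / (2 * \<delta>)) *\<^sub>R rot (v (t + \<delta>) - v (t - \<delta>))" for t
  have "linear rot" by (rule linearI) (auto simp: rot_def)
  then have blr: "bounded_linear rot" using linear_conv_bounded_linear by blast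
  have nr: "norm (rot x) = norm x" for x by (simp add: rot_def norm_prod_def add.commute)
  have sh: "((\<lambda>t. gam (t + c)) has_vector_derivative v (t + c)) (at t)" for t c
  proof -
    have "((gam \<circ> (\<lambda>t. t + c)) has_vector_derivative 1 *\<^sub>R v (t + c)) (at t)"
      by (intro vector_diff_chain_at dg) (auto intro!: derivative_eq_intros)
    then show ?thesis by (simp add: o_def)
  qed
  have dV: "(V has_vector_derivative V' t) (at t)" for t
  proof -
    have "((\<lambda>t. gam (t + \<delta>) - gam (t - \<delta>)) has_vector_derivative (v (t + \<delta>) - v (t - \<delta>))) (at t)"
      using has_vector_derivative_diff[OF sh[of \<delta>] sh[of "-\<delta>"]] by simp
    from bounded_linear.has_vector_derivative[OF blr this]
    show ?thesis unfolding V_def V'_def by (rule bounded_linear.has_vector_derivative[OF bounded_linear_scaleR_right])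
  qed
  have cV': "continuous_on UNIV V'" unfolding V'_def
    by (intro continuous_intros bounded_linear.continuous_on[OF blr] continuous_on_compose2[OF cv]) auto
  have cV: "continuous_on UNIV V"
    by (intro continuous_at_imp_continuous_on ballI) (use dV has_vector_derivative_continuous in blast)
  have perV: "V (t + 1) = V t" for t
    unfolding V_def using per[of "t + \<delta>"] per[of "t - \<delta>"] by (simp add: algebra_simps)
  have F: "gam t \<in> frontier D" for t using ccw_param_frontier[OF g] .
  have Vin: "V t \<bullet> inner_normal D (gam t) < 0" if t: "t \<in> {0..1}" for t
  proof -
    have "norm (gam (t + \<delta>) - gam (t - \<delta>) - ((t + \<delta>) - (t - \<delta>)) *\<^sub>R v t) \<le> norm ((t + \<delta>) - (t - \<delta>)) * (m/2)"
    proof (rule vector_differentiable_bound_linearization[of "{t - \<delta>..t + \<delta>}"])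
      show "norm (v x - v t) \<le> m/2" if "x \<in> {t - \<delta>..t + \<delta>}" for x
      proof -
        have "\<bar>x - t\<bar> < d" using that \<delta> by auto
        then show ?thesis using d(2)[of t x] t that \<delta> by (auto simp: dist_norm)
      qed
    qed (use dg \<delta> in \<open>auto simp: closed_segment_eq_real_ivl intro: has_vector_derivative_at_within\<close>)
    then have e: "norm (gam (t + \<delta>) - gam (t - \<delta>) - (2 * \<delta>) *\<^sub>R v t) \<le> \<delta> * m" using \<delta> by simp
    have "V t + rot (v t) = (- 1 / (2 * \<delta>)) *\<^sub>R rot (gam (t + \<delta>) - gam (t - \<delta>) - (2 * \<delta>) *\<^sub>R v t)"
      unfolding V_def using \<delta> linear_diff[OF \<open>linear rot\<close>] linear_scale[OF \<open>linear rot\<close>] by (simp add: scaleR_diff_right)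
    then have "norm (V t + rot (v t)) = norm (gam (t + \<delta>) - gam (t - \<delta>) - (2 * \<delta>) *\<^sub>R v t) / (2 * \<delta>)"
      using \<delta> by (simp add: nr)
    also have "\<dots> \<le> \<delta> * m / (2 * \<delta>)" using e \<delta> by (intro divide_right_mono) auto
    finally have n1: "norm (V t + rot (v t)) \<le> m/2" using \<delta> by simp
    let ?i = "inner_normal D (gam t)"
    have i: "norm ?i = 1" using inward_inner_normal[OF D F] by (auto simp: inward_def)
    have "rot (v t) = norm (v t) *\<^sub>R ?i"
      using ccw_param_tang[OF D g, of t] rot_inner_normal unfolding v_def by metis
    then have "rot (v t) \<bullet> ?i = norm (v t)" using i by (simp add: dot_square_norm)
    then have "V t \<bullet> ?i = (V t + rot (v t)) \<bullet> ?i - norm (v t)" by (simp add: inner_add_left)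
    also have "(V t + rot (v t)) \<bullet> ?i \<le> norm (V t + rot (v t)) * norm ?i" by (rule norm_cauchy_schwarz)
    finally show ?thesis using n1 i m t0[OF t] unfolding m_def[symmetric] by simp
  qed
  \<comment> \<open>One \<open>s0\<close> for all t by compactness: bad pairs (t, s) with s tending
    to 0 would accumulate at some \<open>l\<close>, against \<open>push_local\<close> there.\<close>
  have "\<exists>s0>0. \<forall>t\<in>{0..1}. \<forall>s. 0 < s \<and> s < s0 \<longrightarrow> gam t + s *\<^sub>R V t \<notin> closure D"
  proof (rule ccontr)
    assume "\<not> ?thesis"
    then have neg: "\<exists>t\<in>{0..1}. \<exists>s. 0 < s \<and> s < e \<and> gam t + s *\<^sub>R V t \<in> closure D" if "e > 0" for e
      using that by blast
    have "\<forall>n. \<exists>t s. t \<in> {0..1} \<and> 0 < s \<and> s < inverse (real (Suc n)) \<and> gam t + s *\<^sub>R V t \<in> closure D"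
    proof
      fix n :: nat
      have "0 < inverse (real (Suc n))" by simp
      from neg[OF this] show "\<exists>t s. t \<in> {0..1} \<and> 0 < s \<and> s < inverse (real (Suc n)) \<and> gam t + s *\<^sub>R V t \<in> closure D" by blast
    qed
    then obtain t s where ts: "\<And>n. t n \<in> {0..1} \<and> 0 < s n \<and> s n < inverse (real (Suc n)) \<and> gam (t n) + s n *\<^sub>R V (t n) \<in> closure D"
      by metis
    have "compact {0..1::real}" by simp
    then obtain l r where l: "l \<in> {0..1}" "strict_mono (r::nat\<Rightarrow>nat)" "(t \<circ> r) \<longlonglongrightarrow> l"
      using ts unfolding compact_def by metis
    obtain R \<rho> a b where "boundary_chart D (gam l) R \<rho> a b" using boundary_chart_ex[OF D F] .
    from boundary_chart.push_local[OF this cg cV refl F Vin[OF l(1)]]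
    obtain e where e: "e > 0" "\<And>t s. \<bar>t - l\<bar> < e \<Longrightarrow> 0 < s \<Longrightarrow> s < e \<Longrightarrow> gam t + s *\<^sub>R V t \<notin> closure D" by blast
    have "\<forall>\<^sub>F n in sequentially. \<bar>(t \<circ> r) n - l\<bar> < e" using tendstoD[OF l(3) e(1)] by (simp add: dist_real_def)
    moreover have "\<forall>\<^sub>F n in sequentially. inverse (real (Suc n)) < e"
      using tendstoD[OF LIMSEQ_inverse_real_of_nat e(1)] by simp
    ultimately have "\<forall>\<^sub>F n in sequentially. \<bar>(t \<circ> r) n - l\<bar> < e \<and> inverse (real (Suc n)) < e" by eventually_elim auto
    then obtain n where n: "\<bar>t (r n) - l\<bar> < e" "inverse (real (Suc n)) < e"
      using eventually_sequentially by auto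
    have "inverse (real (Suc (r n))) \<le> inverse (real (Suc n))" using seq_suble[OF l(2), of n] by (intro le_imp_inverse_le) auto
    then have "s (r n) < e" using ts[of "r n"] n(2) by linarith
    then show False using e(2)[OF n(1), of "s (r n)"] ts[of "r n"] by blast
  qed
  then show thesis using that[OF dV cV' perV] by blast
qed

section \<open>Closed forms\<close>

definition C1_curve :: "(real \<Rightarrow> pt) \<Rightarrow> (real \<Rightarrow> pt) \<Rightarrow> bool" where
  "C1_curve c c' \<longleftrightarrow> (\<forall>t\<in>{0..1}. (c has_vector_derivative c' t) (at t within {0..1})) \<and> continuous_on {0..1} c'"

lemma C1_curve_cont: "C1_curve c c' \<Longrightarrow> continuous_on {0..1} c" "C1_curve c c' \<Longrightarrow> continuous_on {0..1} c'"
  unfolding C1_curve_def continuous_on_eq_continuous_within using has_vector_derivative_continuous by blast+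

definition sqn :: "pt \<Rightarrow> real" where "sqn y = fst y * fst y + snd y * snd y"

lemma sqn_norm: "sqn y = (norm y)\<^sup>2"
  by (simp add: sqn_def norm_prod_def power2_eq_square)

lemma has_grad_fst: "has_grad fst 1 0 x" and has_grad_snd: "has_grad snd 0 1 x"
  unfolding has_grad_def by (auto intro!: derivative_eq_intros)

lemma has_grad_sqn: "has_grad sqn (2 * fst y) (2 * snd y) y"
  unfolding sqn_def[abs_def]
  using has_grad_add[OF has_grad_mult[OF has_grad_fst has_grad_fst] has_grad_mult[OF has_grad_snd has_grad_snd], of y]
  by simp

text \<open>The kernel is \<open>rot y / |y|\<^sup>2\<close> for \<open>|y|\<^sup>2 \<ge> d\<close>, extended \<open>C\<^sup>1\<close> into the disc; its curl
  \<open>bump d\<close> is a nonnegative continuous bump supported in that disc.\<close>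
definition mcut :: "real \<Rightarrow> real \<Rightarrow> real" where
  "mcut d r = (if r \<in> {..<d} then (2 * d - r) / d\<^sup>2 else 1 / r)"

definition mcut' :: "real \<Rightarrow> real \<Rightarrow> real" where
  "mcut' d r = (if r \<in> {..<d} then - 1 / d\<^sup>2 else - 1 / r\<^sup>2)"

lemma mcut_derivative:
  assumes "d > 0" shows "(mcut d has_vector_derivative mcut' d r) (at r)"
proof -
  have c: "closure {..<d} = {..d}" "closure {d..} = {d..}" by simp_all
  have "((\<lambda>r. if r \<in> {..<d} then (2 * d - r) / d\<^sup>2 else 1 / r) has_vector_derivative
      (if r \<in> {..<d} then - 1 / d\<^sup>2 else - 1 / r\<^sup>2)) (at r within UNIV)"
  proof (rule has_vector_derivative_If_within_closures[where T="{d..}"])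
    show "((\<lambda>r. (2 * d - r) / d\<^sup>2) has_vector_derivative - 1 / d\<^sup>2) (at r within {..<d} \<union> closure {..<d} \<inter> closure {d..})"
      unfolding has_real_derivative_iff_has_vector_derivative[symmetric]
      by (rule DERIV_cdivide) (auto intro!: derivative_eq_intros)
    assume "r \<in> {d..} \<union> closure {..<d} \<inter> closure {d..}"
    then have "r > 0" using assms unfolding c by auto
    then show "((\<lambda>r. 1 / r) has_vector_derivative - 1 / r\<^sup>2) (at r within {d..} \<union> closure {..<d} \<inter> closure {d..})"
      unfolding has_real_derivative_iff_has_vector_derivative[symmetric]
      by (auto intro!: derivative_eq_intros simp: power2_eq_square)
  next
    assume "r \<in> closure {..<d}" "r \<in> closure {d..}"
    then have "r = d" unfolding c by auto
    then show "(2 * d - r) / d\<^sup>2 = 1 / r" "- 1 / d\<^sup>2 = - 1 / r\<^sup>2"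
      using assms by (simp_all add: power2_eq_square)
  qed auto
  then show ?thesis by (simp add: mcut_def[abs_def] mcut'_def)
qed

lemma mcut_cont: "d > 0 \<Longrightarrow> continuous_on UNIV (mcut d)"
  by (intro continuous_at_imp_continuous_on ballI) (use mcut_derivative has_vector_derivative_continuous in blast)

lemma mcut'_cont: assumes "d > 0" shows "continuous_on UNIV (mcut' d)"
proof -
  have "mcut' d = (\<lambda>r. - 1 / (max r d)\<^sup>2)" by (auto simp: mcut'_def fun_eq_iff max_def)
  then show ?thesis using assms by (auto intro!: continuous_intros)
qed

definition kx :: "real \<Rightarrow> pt \<Rightarrow> real" where "kx d y = - snd y * mcut d (sqn y)"
definition ky :: "real \<Rightarrow> pt \<Rightarrow> real" where "ky d y = fst y * mcut d (sqn y)"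
definition kxx :: "real \<Rightarrow> pt \<Rightarrow> real" where "kxx d y = - snd y * (2 * fst y * mcut' d (sqn y))"
definition kxy :: "real \<Rightarrow> pt \<Rightarrow> real" where "kxy d y = - mcut d (sqn y) - snd y * (2 * snd y * mcut' d (sqn y))"
definition kyy :: "real \<Rightarrow> pt \<Rightarrow> real" where "kyy d y = fst y * (2 * snd y * mcut' d (sqn y))"
definition bump :: "real \<Rightarrow> pt \<Rightarrow> real" where "bump d y = 2 * mcut d (sqn y) + 2 * sqn y * mcut' d (sqn y)"

lemma bump_eq: assumes "d > 0" shows "bump d y = 4 * max 0 (d - sqn y) / d\<^sup>2"
  using assms by (auto simp: bump_def mcut_def mcut'_def field_simps power2_eq_square)

lemma sqn_cont: "continuous_on S sqn" unfolding sqn_def[abs_def] by (intro continuous_intros)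

lemma kernel_cont:
  assumes "d > 0"
  shows "continuous_on UNIV (kx d)" "continuous_on UNIV (ky d)" "continuous_on UNIV (kxx d)"
    "continuous_on UNIV (kxy d)" "continuous_on UNIV (kyy d)" "continuous_on UNIV (bump d)"
  unfolding kx_def[abs_def] ky_def[abs_def] kxx_def[abs_def] kxy_def[abs_def] kyy_def[abs_def] bump_def[abs_def]
  by (intro continuous_intros continuous_on_compose2[OF mcut_cont[OF assms] sqn_cont]
    continuous_on_compose2[OF mcut'_cont[OF assms] sqn_cont] sqn_cont; simp)+

text \<open>The cross derivatives differ by \<open>bump d\<close>: the kernel is curl free exactly
  where \<open>sqn\<close> is at least \<open>d\<close>.\<close>

lemma kernel_grad:
  assumes "d > 0"
  shows "has_grad (kx d) (kxx d y) (kxy d y) y" "has_grad (ky d) (kxy d y + bump d y) (kyy d y) y"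
proof -
  note g = has_grad_compose[OF has_grad_sqn mcut_derivative[OF assms], of y]
  have n: "has_grad (\<lambda>x. - snd x) 0 (-1) y" using has_grad_diff[OF has_grad_const[of 0] has_grad_snd] by simp
  show "has_grad (kx d) (kxx d y) (kxy d y) y"
    using has_grad_mult[OF n g] by (simp add: kx_def[abs_def] kxx_def kxy_def)
  have "mcut d (sqn y) + fst y * (2 * fst y * mcut' d (sqn y)) = kxy d y + bump d y"
    by (simp add: kxy_def bump_def sqn_def algebra_simps)
  then show "has_grad (ky d) (kxy d y + bump d y) (kyy d y) y"
    using has_grad_mult[OF has_grad_fst g] by (simp add: ky_def[abs_def] kyy_def)
qed

lemma has_grad_reflect:
  assumes "has_grad f a b (c - x)"
  shows "has_grad (\<lambda>x. f (c - x)) (- a) (- b) x"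
proof -
  have "((\<lambda>x. c - x) has_derivative (\<lambda>v. - v)) (at x)" by (auto intro!: derivative_eq_intros)
  from has_derivative_compose[OF this assms[unfolded has_grad_def]]
  show ?thesis unfolding has_grad_def by (simp add: algebra_simps)
qed

text \<open>At points farther than sqrt(d) from a closed curve this is 2 pi times the winding
  number; closer to the curve it is a C^1 regularisation of that step function.\<close>

definition stream :: "real \<Rightarrow> (real \<Rightarrow> pt) \<Rightarrow> (real \<Rightarrow> pt) \<Rightarrow> pt \<Rightarrow> real" where
  "stream d c c' x = integral {0..1} (\<lambda>t. kx d (c t - x) * fst (c' t) + ky d (c t - x) * snd (c' t))"

lemma cont_param:
  assumes "C1_curve c c'" "continuous_on UNIV (f :: pt \<Rightarrow> real)"
  shows "continuous_on (S \<times> {0..1}) (\<lambda>z. f (c (snd z) - fst z))"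
    "continuous_on (S \<times> {0..1}) (\<lambda>z. fst (c' (snd z)))" "continuous_on (S \<times> {0..1}) (\<lambda>z. snd (c' (snd z)))"
    "continuous_on {0..1} (\<lambda>t. f (c t - x))" "continuous_on {0..1} (\<lambda>t. fst (c' t))" "continuous_on {0..1} (\<lambda>t. snd (c' t))"
proof -
  note c = C1_curve_cont[OF assms(1)]
  have s: "continuous_on (S \<times> {0..1}) (snd :: pt \<times> real \<Rightarrow> real)" by (intro continuous_intros)
  have cs: "continuous_on (S \<times> {0..1}) (\<lambda>z. c (snd z))" "continuous_on (S \<times> {0..1}) (\<lambda>z. c' (snd z))"
    using continuous_on_compose2[OF c(1) s] continuous_on_compose2[OF c(2) s] by auto
  show "continuous_on (S \<times> {0..1}) (\<lambda>z. f (c (snd z) - fst z))"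
    by (intro continuous_on_compose2[OF assms(2)] continuous_intros cs) auto
  show "continuous_on (S \<times> {0..1}) (\<lambda>z. fst (c' (snd z)))" "continuous_on (S \<times> {0..1}) (\<lambda>z. snd (c' (snd z)))"
    by (intro continuous_on_fst continuous_on_snd cs)+
  show "continuous_on {0..1} (\<lambda>t. f (c t - x))"
    by (intro continuous_on_compose2[OF assms(2)] continuous_intros c) auto
  show "continuous_on {0..1} (\<lambda>t. fst (c' t))" "continuous_on {0..1} (\<lambda>t. snd (c' t))"
    using continuous_on_fst[OF c(2)] continuous_on_snd[OF c(2)] by auto
qed

text \<open>Up to sign and the curl term \<open>bump\<close>, differentiating the kernel in
  \<open>x\<close> amounts to differentiating it along the curve. The latter part integrates to end
  point values, which cancel over a cycle.\<close>

lemma stream_grad: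
  assumes d: "d > 0" and c: "C1_curve c c'"
  shows "has_grad (stream d c c')
    (- (kx d (c 1 - x) - kx d (c 0 - x)) - integral {0..1} (\<lambda>t. bump d (c t - x) * snd (c' t)))
    (- (ky d (c 1 - x) - ky d (c 0 - x)) + integral {0..1} (\<lambda>t. bump d (c t - x) * fst (c' t))) x"
proof -
  note k = kernel_cont[OF d]
  note cp = cont_param[OF c]
  define p where "p x t = - kxx d (c t - x) * fst (c' t) - (kxy d (c t - x) + bump d (c t - x)) * snd (c' t)" for x t
  define q where "q x t = - kxy d (c t - x) * fst (c' t) - kyy d (c t - x) * snd (c' t)" for x t
  have "has_grad (stream d c c') (integral {0..1} (p x)) (integral {0..1} (q x)) x"
    unfolding stream_def[abs_def]
  proof (rule has_grad_integral[of "0::real" 1, unfolded cbox_interval])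
    fix x t
    show "has_grad (\<lambda>x. kx d (c t - x) * fst (c' t) + ky d (c t - x) * snd (c' t)) (p x t) (q x t) x"
      using has_grad_add[OF has_grad_mult[OF has_grad_reflect[OF kernel_grad(1)[OF d, of "c t - x"]] has_grad_const[of "fst (c' t)"]]
        has_grad_mult[OF has_grad_reflect[OF kernel_grad(2)[OF d, of "c t - x"]] has_grad_const[of "snd (c' t)"]]]
      by (simp add: p_def q_def algebra_simps)
  next
    show "continuous_on {0..1} (\<lambda>t. kx d (c t - x) * fst (c' t) + ky d (c t - x) * snd (c' t))" for x
      by (intro continuous_intros cp(4-6) k C1_curve_cont(2)[OF c])
    show "continuous_on (UNIV \<times> {0..1}) (\<lambda>z. p (fst z) (snd z))" "continuous_on (UNIV \<times> {0..1}) (\<lambda>z. q (fst z) (snd z))"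
      unfolding p_def q_def by (intro continuous_intros cp(1)[OF k(1)] cp(1)[OF k(2)] cp(1)[OF k(3)] cp(1)[OF k(4)] cp(1)[OF k(5)] cp(1)[OF k(6)] cp(2,3)[OF k(1)])+
  qed
  moreover have "integral {0..1} (p x) = - (kx d (c 1 - x) - kx d (c 0 - x)) - integral {0..1} (\<lambda>t. bump d (c t - x) * snd (c' t))"
  proof (rule integral_unique)
    have cx: "((\<lambda>t. c t - x) has_vector_derivative c' t) (at t within {0..1})" if "t \<in> {0..1}" for t
      using c that by (auto simp: C1_curve_def intro!: derivative_eq_intros)
    have "((\<lambda>t. fst (c' t) *\<^sub>R kxx d (c t - x) + snd (c' t) *\<^sub>R kxy d (c t - x)) has_integral (kx d (c 1 - x) - kx d (c 0 - x))) {0..1}"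
      by (rule fundamental_theorem_of_calculus) (use has_grad_along[OF kernel_grad(1)[OF d] cx] in auto)
    moreover have "((\<lambda>t. bump d (c t - x) * snd (c' t)) has_integral integral {0..1} (\<lambda>t. bump d (c t - x) * snd (c' t))) {0..1}"
      by (intro integrable_integral integrable_continuous_real continuous_intros cp(4-6) k C1_curve_cont(2)[OF c])
    ultimately show "(p x has_integral - (kx d (c 1 - x) - kx d (c 0 - x)) - integral {0..1} (\<lambda>t. bump d (c t - x) * snd (c' t))) {0..1}"
      by (rule has_integral_eq_rhs[OF has_integral_eq[OF _ has_integral_diff[OF has_integral_neg]], rotated 1]) (auto simp: p_def algebra_simps)
  qed
  moreover have "integral {0..1} (q x) = - (ky d (c 1 - x) - ky d (c 0 - x)) + integral {0..1} (\<lambda>t. bump d (c t - x) * fst (c' t))"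
  proof (rule integral_unique)
    have cx: "((\<lambda>t. c t - x) has_vector_derivative c' t) (at t within {0..1})" if "t \<in> {0..1}" for t
      using c that by (auto simp: C1_curve_def intro!: derivative_eq_intros)
    have "((\<lambda>t. fst (c' t) *\<^sub>R (kxy d (c t - x) + bump d (c t - x)) + snd (c' t) *\<^sub>R kyy d (c t - x)) has_integral (ky d (c 1 - x) - ky d (c 0 - x))) {0..1}"
      by (rule fundamental_theorem_of_calculus) (use has_grad_along[OF kernel_grad(2)[OF d] cx] in auto)
    moreover have "((\<lambda>t. bump d (c t - x) * fst (c' t)) has_integral integral {0..1} (\<lambda>t. bump d (c t - x) * fst (c' t))) {0..1}"
      by (intro integrable_integral integrable_continuous_real continuous_intros cp(4-6) k C1_curve_cont(2)[OF c])
    ultimately show "(q x has_integral - (ky d (c 1 - x) - ky d (c 0 - x)) + integral {0..1} (\<lambda>t. bump d (c t - x) * fst (c' t))) {0..1}"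
      by (rule has_integral_eq_rhs[OF has_integral_eq[OF _ has_integral_add[OF has_integral_neg]], rotated 1]) (auto simp: q_def algebra_simps)
  qed
  ultimately show ?thesis by simp
qed

lemma continuous_on_extend_zero:
  fixes g :: "pt \<Rightarrow> 'b::real_normed_vector"
  assumes "open S" "closed K" "K \<subseteq> S" "continuous_on S g" "\<And>x. x \<in> S \<Longrightarrow> x \<notin> K \<Longrightarrow> g x = 0"
  shows "continuous_on UNIV (\<lambda>x. if x \<in> S then g x else 0)"
proof -
  have "continuous_on S (\<lambda>x. if x \<in> S then g x else 0)" using assms(4) by (rule continuous_on_eq) auto
  moreover have "continuous_on (- K) (\<lambda>x. if x \<in> S then g x else 0)"
    using assms(5) by (intro continuous_on_eq[OF continuous_on_const[of _ 0]]) auto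
  ultimately have "continuous_on (S \<union> - K) (\<lambda>x. if x \<in> S then g x else 0)"
    using continuous_on_open_Un[OF assms(1)] assms(2) by (metis open_Compl)
  moreover have "S \<union> - K = UNIV" using assms(3) by blast
  ultimately show ?thesis by simp
qed

text \<open>Both components share the cross derivative \<open>a12\<close>, so the integrand is the
  x1-derivative of eta E2 minus the x2-derivative of eta E1, each of integral zero.\<close>

lemma closed_form_weak:
  fixes E1 E2 eta A B :: "pt \<Rightarrow> real"
  assumes S: "open S" and K: "compact K" "K \<subseteq> S"
    and eta: "\<And>x. has_grad eta (A x) (B x) x" "continuous_on UNIV A" "continuous_on UNIV B"
      "\<And>x. x \<notin> K \<Longrightarrow> eta x = 0"
    and E: "\<And>x. x \<in> S \<Longrightarrow> has_grad E1 (a11 x) (a12 x) x" "\<And>x. x \<in> S \<Longrightarrow> has_grad E2 (a12 x) (a22 x) x"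
      "continuous_on S a12"
  shows "integral\<^sup>L lborel (\<lambda>x. if x \<in> S then A x * E2 x - B x * E1 x else 0) = 0"
proof -
  have cK: "closed K" using K(1) compact_imp_closed by blast
  have z: "A x = 0 \<and> B x = 0" if "x \<notin> K" for x
    using has_grad_unique[OF eta(1)[of x] has_grad_zero_outside[OF cK that eta(4)]] by auto
  have cE: "continuous_on S E1" "continuous_on S E2" using E(1,2) has_grad_isCont
    by (blast intro: continuous_at_imp_continuous_on)+
  have ceta: "continuous_on UNIV eta" using eta(1) has_grad_isCont by (blast intro: continuous_at_imp_continuous_on)
  have ch: "continuous_on S eta" "continuous_on S A" "continuous_on S B"
    using ceta eta(2,3) continuous_on_subset by blast+
  define u1 where "u1 x = (if x \<in> S then A x * E2 x + eta x * a12 x else 0)" for x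
  define u2 where "u2 x = (if x \<in> S then B x * E1 x + eta x * a12 x else 0)" for x
  have u1: "continuous_on UNIV u1" unfolding u1_def
    by (rule continuous_on_extend_zero[OF S cK K(2)]) (use z eta(4) in \<open>auto intro!: continuous_intros ch cE E(3)\<close>)
  have u2: "continuous_on UNIV u2" unfolding u2_def
    by (rule continuous_on_extend_zero[OF S cK K(2)]) (use z eta(4) in \<open>auto intro!: continuous_intros ch cE E(3)\<close>)
  have ig: "integral\<^sup>L lborel u1 = 0 \<and> integrable lborel u1" "integral\<^sup>L lborel u2 = 0 \<and> integrable lborel u2"
  proof -
    have I: "has_grad (\<lambda>x. eta x * F x) (if x \<in> S then A x * F x + eta x * f1 x else 0) (if x \<in> S then B x * F x + eta x * f2 x else 0) x"
      if F: "\<And>x. x \<in> S \<Longrightarrow> has_grad F (f1 x) (f2 x) x" for F f1 f2 x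
    proof -
      show "has_grad (\<lambda>x. eta x * F x) (if x \<in> S then A x * F x + eta x * f1 x else 0) (if x \<in> S then B x * F x + eta x * f2 x else 0) x"
      proof (cases "x \<in> S")
        case True then show ?thesis using has_grad_mult[OF eta(1) F] by simp
      next
        case False
        then have "x \<notin> K" using K(2) by blast
        then show ?thesis using False has_grad_zero_outside[OF cK, of x "\<lambda>x. eta x * F x"] eta(4) by simp
      qed
    qed
    show "integral\<^sup>L lborel u1 = 0 \<and> integrable lborel u1"
    proof -
      have g1: "((\<lambda>x. (eta (x, y) * E2 (x, y))) has_vector_derivative u1 (x, y)) (at x)" for x y
      proof -
        from has_grad_slice1[OF I[of E2 a12 a22, OF E(2)]] show ?thesis unfolding u1_def .
      qed
      have z1: "u1 x = 0" if "x \<notin> K" for x using z[OF that] eta(4)[OF that] by (simp add: u1_def)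
      have i1: "integrable lborel u1" by (rule integrable_cont_compact[OF u1 K(1) z1])
      show ?thesis using i1 ibp_slice1[OF g1 u1 K(1)] eta(4) by simp
    qed
    show "integral\<^sup>L lborel u2 = 0 \<and> integrable lborel u2"
    proof -
      have g2: "((\<lambda>y. (eta (x, y) * E1 (x, y))) has_vector_derivative u2 (x, y)) (at y)" for x y
      proof -
        from has_grad_slice2[OF I[of E1 a11 a12, OF E(1)]] show ?thesis unfolding u2_def .
      qed
      have z2: "u2 x = 0" if "x \<notin> K" for x using z[OF that] eta(4)[OF that] by (simp add: u2_def)
      have i2: "integrable lborel u2" by (rule integrable_cont_compact[OF u2 K(1) z2])
      show ?thesis using i2 ibp_slice2[OF g2 u2 K(1)] eta(4) by simp
    qed
  qed
  have "(\<lambda>x. if x \<in> S then A x * E2 x - B x * E1 x else 0) = (\<lambda>x. u1 x - u2 x)"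
    by (auto simp: u1_def u2_def)
  then show ?thesis using ig by simp
qed


lemma continuous_on_section:
  assumes "continuous_on (UNIV \<times> T) (\<lambda>z. g (fst z) (snd z))" "t \<in> T"
  shows "continuous_on UNIV (\<lambda>x. g x t)"
proof -
  have "continuous_on UNIV (\<lambda>x. (x, t))" "(\<lambda>x. (x, t)) ` UNIV \<subseteq> UNIV \<times> T"
    using assms(2) by (auto intro!: continuous_intros)
  from continuous_on_compose2[OF assms(1) this] show ?thesis by simp
qed

lemma lborel_integral_swap:
  fixes g :: "pt \<Rightarrow> real \<Rightarrow> real"
  assumes g: "continuous_on (UNIV \<times> {0..1}) (\<lambda>z. g (fst z) (snd z))"
    and z: "\<And>x t. t \<in> {0..1} \<Longrightarrow> R < norm x \<Longrightarrow> g x t = 0"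
  shows "integral\<^sup>L lborel (\<lambda>x. integral {0..1} (g x)) = integral {0..1} (\<lambda>t. integral\<^sup>L lborel (\<lambda>x. g x t))"
proof -
  have out: "R < norm x" if "x \<notin> cbox (- R, - R) (R, R)" for x :: pt
  proof -
    have "R < \<bar>fst x\<bar> \<or> R < \<bar>snd x\<bar>" using that by (cases x) (auto simp: cbox_Pair_eq)
    then show ?thesis using norm_fst_le[of "fst x" "snd x"] norm_snd_le[of "snd x" "fst x"] by auto
  qed
  have cx: "continuous_on UNIV (\<lambda>x. integral (cbox 0 1) (g x))"
    by (rule integral_continuous_on_param) (use g in \<open>simp add: split_def\<close>)
  have "integral\<^sup>L lborel (\<lambda>x. integral {0..1} (g x)) = integral (cbox (- R, - R) (R, R)) (\<lambda>x. integral {0..1} (g x))"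
  proof (rule lborel_integral_cbox)
    show "integral {0..1} (g x) = 0" if "x \<notin> cbox (- R, - R) (R, R)" for x
      using z[OF _ out[OF that]] by (intro integral_unique[OF has_integral_is_0]) auto
  qed (use cx in simp)
  also have "\<dots> = integral (cbox 0 1) (\<lambda>t. integral (cbox (- R, - R) (R, R)) (\<lambda>x. g x t))"
    using integral_swap_continuous[of "(-R,-R)" 0 "(R,R)" 1 g] continuous_on_subset[OF g] by (simp add: split_def cbox_Pair_eq Sigma_mono)
  also have "\<dots> = integral {0..1} (\<lambda>t. integral\<^sup>L lborel (\<lambda>x. g x t))"
  proof (simp, rule Henstock_Kurzweil_Integration.integral_cong)
    fix t :: real assume t: "t \<in> {0..1}"
    have "continuous_on UNIV (\<lambda>x. g x t)" using continuous_on_section[OF g t] .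
    then show "integral (cbox (- R, - R) (R, R)) (\<lambda>x. g x t) = integral\<^sup>L lborel (\<lambda>x. g x t)"
      by (rule lborel_integral_cbox[symmetric]) (rule z[OF t out])
  qed
  finally show ?thesis .
qed

lemma bump_facts:
  assumes "d > 0"
  shows "bump d y \<ge> 0" "d \<le> sqn y \<Longrightarrow> bump d y = 0" "bump d (- y) = bump d y"
  using assms by (auto simp: bump_eq sqn_def)

lemma bump_integrable:
  assumes "e > 0"
  shows "integrable lborel (\<lambda>x. bump (e\<^sup>2) (y - x))"
    "integral\<^sup>L lborel (\<lambda>x. bump (e\<^sup>2) (y - x)) = integral\<^sup>L lborel (bump (e\<^sup>2))"
    "integral\<^sup>L lborel (bump (e\<^sup>2)) > 0"
proof -
  have e: "e\<^sup>2 > 0" using assms by simp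
  have c: "continuous_on UNIV (bump (e\<^sup>2))" by (rule kernel_cont(6)[OF e])
  have z: "bump (e\<^sup>2) x = 0" if "x \<notin> cball 0 e" for x
    using that assms by (intro bump_facts(2)[OF e]) (auto simp: sqn_norm intro!: power_mono)
  have "bump (e\<^sup>2) (y - x) = 0" if "x \<notin> cball y e" for x
    using that by (intro z) (simp add: dist_norm norm_minus_commute)
  then show "integrable lborel (\<lambda>x. bump (e\<^sup>2) (y - x))"
    by (intro integrable_cont_compact[OF _ compact_cball] continuous_on_compose2[OF c] continuous_intros) auto
  have i: "integrable lborel (bump (e\<^sup>2))" using integrable_cont_compact[OF c compact_cball z] .
  have "integral\<^sup>L lborel (bump (e\<^sup>2)) = integral\<^sup>L (distr lborel borel ((+) (- y))) (bump (e\<^sup>2))"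
    by (simp add: lborel_distr_plus)
  also have "\<dots> = integral\<^sup>L lborel (\<lambda>x. bump (e\<^sup>2) (- y + x))"
    by (rule integral_distr) (use borel_measurable_continuous_onI[OF c] in auto)
  also have "(\<lambda>x. bump (e\<^sup>2) (- y + x)) = (\<lambda>x. bump (e\<^sup>2) (y - x))"
  proof
    fix x show "bump (e\<^sup>2) (- y + x) = bump (e\<^sup>2) (y - x)" using bump_facts(3)[OF e, of "y - x"] by simp
  qed
  finally show "integral\<^sup>L lborel (\<lambda>x. bump (e\<^sup>2) (y - x)) = integral\<^sup>L lborel (bump (e\<^sup>2))" ..
  define k where "k = 4 * (e\<^sup>2 - (e/2)\<^sup>2) / (e\<^sup>2)\<^sup>2"
  have k: "k > 0" using assms by (simp add: k_def power2_eq_square field_simps)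
  have le: "k * indicator (ball 0 (e/2)) x \<le> bump (e\<^sup>2) x" for x :: pt
  proof (cases "x \<in> ball 0 (e/2)")
    case True
    then have "sqn x \<le> (e/2)\<^sup>2" unfolding sqn_norm by (intro power_mono) auto
    then have "4 * (e\<^sup>2 - (e/2)\<^sup>2) \<le> 4 * max 0 (e\<^sup>2 - sqn x)"
      by (intro mult_left_mono) (simp_all add: le_max_iff_disj)
    then have "k \<le> bump (e\<^sup>2) x" unfolding bump_eq[OF e] k_def by (intro divide_right_mono) auto
    then show ?thesis using True by simp
  next
    case False then show ?thesis using bump_facts(1)[OF e] by simp
  qed
  have im: "integrable lborel (\<lambda>x. k * indicator (ball (0::pt) (e/2)) x)"
    using emeasure_bounded_finite[OF bounded_ball, of "0::pt" "e/2"]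
    by (intro integrable_mult_right integrable_real_indicator) auto
  have "0 < k * measure lborel (ball (0::pt) (e/2))" using k content_ball_pos assms by simp
  also have "\<dots> = integral\<^sup>L lborel (\<lambda>x. k * indicator (ball (0::pt) (e/2)) x)" by simp
  also have "\<dots> \<le> integral\<^sup>L lborel (bump (e\<^sup>2))"
    by (rule integral_mono[OF im i le])
  finally show "integral\<^sup>L lborel (bump (e\<^sup>2)) > 0" .
qed

text \<open>\<open>stream\<close> is a smoothed winding number; it vanishes off \<open>S\<close>, and its rotated gradient is the
  mollified current carried by the chain. Integrating by parts against the closed form therefore
  kills the smoothed line integral.\<close>
theorem closed_form_chain:
  fixes w :: "'i \<Rightarrow> real" and c c' :: "'i \<Rightarrow> real \<Rightarrow> pt" and E1 E2 :: "pt \<Rightarrow> real"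
  assumes I: "finite I" and S: "open S" "bounded S"
    and E: "\<And>x. x \<in> S \<Longrightarrow> has_grad E1 (a11 x) (a12 x) x" "\<And>x. x \<in> S \<Longrightarrow> has_grad E2 (a12 x) (a22 x) x"
      "continuous_on S a12"
    and c: "\<And>i. i \<in> I \<Longrightarrow> C1_curve (c i) (c' i)" "\<And>i t. i \<in> I \<Longrightarrow> t \<in> {0..1} \<Longrightarrow> c i t \<in> S"
    and chain: "\<And>f::pt \<Rightarrow> real. (\<Sum>i\<in>I. w i * (f (c i 1) - f (c i 0))) = 0"
    and wind: "\<And>x. x \<notin> S \<Longrightarrow> (\<Sum>i\<in>I. w i * integral {0..1} (\<lambda>t.
      (fst (c i t - x) * snd (c' i t) - snd (c i t - x) * fst (c' i t)) / sqn (c i t - x))) = 0"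
  shows "(\<Sum>i\<in>I. w i * integral {0..1} (\<lambda>t. E1 (c i t) * fst (c' i t) + E2 (c i t) * snd (c' i t))) = 0"
proof -
  define K where "K = (\<Union>i\<in>I. c i ` {0..1})"
  have K: "compact K" "K \<subseteq> S" unfolding K_def using I c
    by (auto intro!: compact_UN compact_continuous_image C1_curve_cont(1))
  have inK: "c i t \<in> K" if "i \<in> I" "t \<in> {0..1}" for i t
    unfolding K_def using that by blast
  obtain e where e: "e > 0" "(\<Union>x\<in>K. cball x e) \<subseteq> S"
    using compact_subset_open_imp_cball_epsilon_subset[OF K(1) S(1) K(2)] .
  define K1 where "K1 = (\<Union>x\<in>K. \<Union>y\<in>cball 0 e. {x + y})"
  have K1: "compact K1" unfolding K1_def by (rule compact_sums'[OF K(1) compact_cball])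
  have inK1: "y \<in> K1" if "x \<in> K" "dist x y \<le> e" for x y
    unfolding K1_def using that by (intro UN_I[of x] UN_I[of "y - x"]) (auto simp: dist_norm norm_minus_commute)
  have K1S: "K1 \<subseteq> S" using e(2) by (force simp: K1_def dist_norm)
  have cE: "continuous_on S E1" "continuous_on S E2" using E(1,2) has_grad_isCont
    by (blast intro: continuous_at_imp_continuous_on)+
  have "closedin (top_of_set UNIV) K1" using K1 compact_imp_closed by auto
  \<comment> \<open>Continuous extensions to the plane that agree with \<open>E1\<close> and
    \<open>E2\<close> on \<open>K1\<close>; they keep the smeared integrands globally continuous and
    supply the modulus of continuity.\<close>
  then obtain F1 where F1: "continuous_on UNIV F1" "\<And>x. x \<in> K1 \<Longrightarrow> F1 x = E1 x"
    using Tietze_unbounded[OF continuous_on_subset[OF cE(1) K1S]] by metis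
  have "closedin (top_of_set UNIV) K1" using K1 compact_imp_closed by auto
  then obtain F2 where F2: "continuous_on UNIV F2" "\<And>x. x \<in> K1 \<Longrightarrow> F2 x = E2 x"
    using Tietze_unbounded[OF continuous_on_subset[OF cE(2) K1S]] by metis
  obtain R where R: "\<And>x. x \<in> K1 \<Longrightarrow> norm x \<le> R" using K1 compact_imp_bounded bounded_iff by metis
  define tot where "tot = (\<Sum>i\<in>I. w i * integral {0..1} (\<lambda>t. F1 (c i t) * fst (c' i t) + F2 (c i t) * snd (c' i t)))"
  define C where "C = (\<Sum>i\<in>I. \<bar>w i\<bar> * integral {0..1} (\<lambda>t. \<bar>fst (c' i t)\<bar> + \<bar>snd (c' i t)\<bar>))"
  have main: "\<bar>tot\<bar> \<le> \<omega> * C" if \<omega>: "\<omega> > 0" for \<omega>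
  proof -
    have "uniformly_continuous_on K1 F1" "uniformly_continuous_on K1 F2"
      using compact_uniformly_continuous[OF _ K1] continuous_on_subset F1(1) F2(1) by blast+
    then obtain eps1 eps2 where "eps1 > 0" "eps2 > 0"
      and e1: "\<And>x y. x \<in> K1 \<Longrightarrow> y \<in> K1 \<Longrightarrow> dist y x < eps1 \<Longrightarrow> dist (F1 y) (F1 x) < \<omega>"
      and e2: "\<And>x y. x \<in> K1 \<Longrightarrow> y \<in> K1 \<Longrightarrow> dist y x < eps2 \<Longrightarrow> dist (F2 y) (F2 x) < \<omega>"
      unfolding uniformly_continuous_on_def using \<omega> by metis
    \<comment> \<open>Strictly below \<open>e\<close>, so a margin e - eps remains between the
      smeared curves and the complement of \<open>S\<close>.\<close>
    define eps where "eps = min (e/2) (min eps1 eps2)"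
    have eps: "eps > 0" "eps < e" "eps \<le> eps1" "eps \<le> eps2" using e(1) \<open>eps1 > 0\<close> \<open>eps2 > 0\<close> by (auto simp: eps_def)
    define d where "d = eps\<^sup>2"
    have d: "d > 0" using eps by (simp add: d_def)
    have far: "bump d (y - x) = 0" "d < sqn (y - x)" if "dist y x > eps" for x y
    proof -
      have "eps\<^sup>2 < (norm (y - x))\<^sup>2" using that eps(1) by (intro power_strict_mono) (auto simp: dist_norm)
      then show "d < sqn (y - x)" by (simp add: sqn_norm d_def)
      then show "bump d (y - x) = 0" using bump_facts(2)[OF d] by simp
    qed
    have near0: "bump d (y - x) = 0" if "dist y x \<ge> eps" for x y
      using that eps(1) by (intro bump_facts(2)[OF d]) (auto simp: sqn_norm d_def dist_norm intro!: power_mono)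
    define A where "A x = - (\<Sum>i\<in>I. w i * integral {0..1} (\<lambda>t. bump d (c i t - x) * snd (c' i t)))" for x
    define B where "B x = (\<Sum>i\<in>I. w i * integral {0..1} (\<lambda>t. bump d (c i t - x) * fst (c' i t)))" for x
    define eta where "eta x = (\<Sum>i\<in>I. w i * stream d (c i) (c' i) x)" for x
    have etag: "has_grad eta (A x) (B x) x" for x
    proof -
      define P where "P i = integral {0..1} (\<lambda>t. bump d (c i t - x) * snd (c' i t))" for i
      define Q where "Q i = integral {0..1} (\<lambda>t. bump d (c i t - x) * fst (c' i t))" for i
      have "has_grad eta (\<Sum>i\<in>I. 0 * stream d (c i) (c' i) x + w i * (- (kx d (c i 1 - x) - kx d (c i 0 - x)) - P i))
         (\<Sum>i\<in>I. 0 * stream d (c i) (c' i) x + w i * (- (ky d (c i 1 - x) - ky d (c i 0 - x)) + Q i)) x"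
        unfolding eta_def[abs_def] P_def Q_def
        by (intro has_grad_sum has_grad_mult has_grad_const stream_grad d c)
      moreover have "(\<Sum>i\<in>I. 0 * stream d (c i) (c' i) x + w i * (- (kx d (c i 1 - x) - kx d (c i 0 - x)) - P i))
         = - (\<Sum>i\<in>I. w i * (kx d (c i 1 - x) - kx d (c i 0 - x))) - (\<Sum>i\<in>I. w i * P i)"
        by (simp add: sum_negf[symmetric] sum_subtractf[symmetric] algebra_simps)
      moreover have "(\<Sum>i\<in>I. 0 * stream d (c i) (c' i) x + w i * (- (ky d (c i 1 - x) - ky d (c i 0 - x)) + Q i))
         = - (\<Sum>i\<in>I. w i * (ky d (c i 1 - x) - ky d (c i 0 - x))) + (\<Sum>i\<in>I. w i * Q i)"
        by (simp add: sum_negf[symmetric] sum.distrib[symmetric] algebra_simps)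
      ultimately show ?thesis
        using chain[of "\<lambda>y. kx d (y - x)"] chain[of "\<lambda>y. ky d (y - x)"] by (simp add: A_def B_def P_def Q_def)
    qed
    note kc = kernel_cont(6)[OF d]
    have cpar: "continuous_on UNIV (\<lambda>x. integral (cbox 0 1) (\<lambda>t. bump d (c i t - x) * snd (c' i t)))"
      "continuous_on UNIV (\<lambda>x. integral (cbox 0 1) (\<lambda>t. bump d (c i t - x) * fst (c' i t)))" if "i \<in> I" for i
      using cont_param(1-3)[OF c(1)[OF that] kc, where S=UNIV]
      by (intro integral_continuous_on_param; simp add: split_def continuous_on_mult)+
    have cAB: "continuous_on UNIV A" "continuous_on UNIV B"
      unfolding A_def B_def using cpar by (auto intro!: continuous_intros)
    \<comment> \<open>A compact set carrying \<open>eta\<close>. From a point of \<open>S\<close>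
      off \<open>L\<close>, a segment shorter than e - eps leads to some y outside \<open>S\<close>;
      it stays farther than eps from all curves, so the gradient of \<open>eta\<close> vanishes
      along it, and eta(y) = 0 by the winding hypothesis.\<close>
    define L where "L = {x\<in>S. \<forall>y. y \<notin> S \<longrightarrow> e - eps \<le> dist x y}"
    have "L = (\<Inter>y\<in>-S. {x. e - eps \<le> dist x y})"
    proof -
      have "x \<in> S" if "\<And>y. y \<notin> S \<Longrightarrow> e - eps \<le> dist x y" for x using that[of x] eps(2) by auto
      then show ?thesis unfolding L_def by blast
    qed
    moreover have "closed {x. e - eps \<le> dist x y}" for y :: pt
      by (intro closed_Collect_le continuous_intros)
    ultimately have "closed L" by auto
    moreover have "bounded L" using S(2) by (rule bounded_subset) (auto simp: L_def)
    ultimately have L: "compact L" "L \<subseteq> S" using compact_eq_bounded_closed by (auto simp: L_def)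
    have out: "dist (c i t) y > e" if "y \<notin> S" "i \<in> I" "t \<in> {0..1}" for i t y
      using e(2) inK[OF that(2,3)] that(1) by (meson UN_subset_iff linorder_not_le mem_cball subsetD)
    have etaS: "eta y = 0" if y: "y \<notin> S" for y
    proof -
      have "stream d (c i) (c' i) y = integral {0..1} (\<lambda>t.
        (fst (c i t - y) * snd (c' i t) - snd (c i t - y) * fst (c' i t)) / sqn (c i t - y))" if i: "i \<in> I" for i
        unfolding stream_def
      proof (rule Henstock_Kurzweil_Integration.integral_cong)
        fix t :: real assume t: "t \<in> {0..1}"
        have "d < sqn (c i t - y)" by (rule far(2)) (use out[OF y i t] eps(2) in linarith)
        then show "kx d (c i t - y) * fst (c' i t) + ky d (c i t - y) * snd (c' i t) =
          (fst (c i t - y) * snd (c' i t) - snd (c i t - y) * fst (c' i t)) / sqn (c i t - y)"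
          by (simp add: kx_def ky_def mcut_def divide_inverse algebra_simps)
      qed
      then show ?thesis using wind[OF y] by (simp add: eta_def)
    qed
    have etaL: "eta x = 0" if "x \<notin> L" for x
    proof (cases "x \<in> S")
      case True
      then have "\<not> (\<forall>y. y \<notin> S \<longrightarrow> e - eps \<le> dist x y)" using that unfolding L_def by blast
      then obtain y where y: "y \<notin> S" "dist x y < e - eps" unfolding not_all not_imp not_le by blast
      have "(eta has_derivative (\<lambda>h. 0)) (at z within closed_segment x y)" if z: "z \<in> closed_segment x y" for z
      proof -
        have "dist z y \<le> dist x y" using z by (metis dist_commute dist_decreases_closed_segment dist_in_closed_segment)
        then have zd: "dist (c i t) z > eps" if "i \<in> I" "t \<in> {0..1}" for i t
          using out[OF y(1) that] y(2) dist_triangle[of "c i t" y z] by linarith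
        have b0: "bump d (c i t - z) = 0" if "i \<in> I" "t \<in> {0..1}" for i t
          using far(1)[OF zd[OF that]] .
        have "integral {0..1} (\<lambda>t. bump d (c i t - z) * snd (c' i t)) = 0" if "i \<in> I" for i
          by (rule integral_unique, rule has_integral_is_0) (use b0[OF that] in simp)
        moreover have "integral {0..1} (\<lambda>t. bump d (c i t - z) * fst (c' i t)) = 0" if "i \<in> I" for i
          by (rule integral_unique, rule has_integral_is_0) (use b0[OF that] in simp)
        ultimately have "A z = 0" "B z = 0" by (simp_all add: A_def B_def)
        then show ?thesis using etag[of z] by (auto simp: has_grad_def intro: has_derivative_at_withinI)
      qed
      then obtain k where "\<And>z. z \<in> closed_segment x y \<Longrightarrow> eta z = k"
        using has_derivative_zero_constant[of "closed_segment x y" eta] by auto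
      then show ?thesis using etaS[OF y(1)] by (metis ends_in_segment)
    qed (rule etaS)
    have weak: "integral\<^sup>L lborel (\<lambda>x. if x \<in> S then A x * E2 x - B x * E1 x else 0) = 0"
      by (rule closed_form_weak[OF S(1) L etag cAB etaL E])
    define G where "G i x t = bump d (c i t - x) * (F1 x * fst (c' i t) + F2 x * snd (c' i t))" for i x t
    have inK1': "x \<in> K1" if "i \<in> I" "t \<in> {0..1}" "bump d (c i t - x) \<noteq> 0" for i x t
      using near0[of "c i t" x] that eps(2) by (intro inK1[OF inK[OF that(1,2)]]) (meson linorder_not_le nless_le order.strict_trans)
    have cF: "continuous_on (UNIV \<times> {0..1}) (\<lambda>z. F1 (fst z))" "continuous_on (UNIV \<times> {0..1}) (\<lambda>z. F2 (fst z))"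
      by (auto intro!: continuous_on_compose2[OF F1(1)] continuous_on_compose2[OF F2(1)] continuous_intros)
    have cG: "continuous_on (UNIV \<times> {0..1}) (\<lambda>z. G i (fst z) (snd z))" if "i \<in> I" for i
      unfolding G_def using cont_param(1-3)[OF c(1)[OF that] kc, where S=UNIV] cF
      by (intro continuous_on_mult continuous_on_add) auto
    have Gz: "G i x t = 0" if "i \<in> I" "t \<in> {0..1}" "R < norm x" for i x t
      using inK1'[OF that(1,2)] R that(3) unfolding G_def by fastforce
    have cGi: "continuous_on UNIV (\<lambda>x. integral {0..1} (G i x))" if "i \<in> I" for i
      using integral_continuous_on_param[of UNIV 0 1 "\<lambda>x t. G i x t"] cG[OF that] by (simp add: split_def)
    have iGi: "integrable lborel (\<lambda>x. integral {0..1} (G i x))" if "i \<in> I" for i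
    proof (rule integrable_cont_compact[OF cGi[OF that] compact_cball[of 0 R]])
      fix x :: pt assume "x \<notin> cball 0 R"
      then show "integral {0..1} (G i x) = 0" using Gz[OF that] by (intro integral_unique[OF has_integral_is_0]) auto
    qed
    \<comment> \<open>The weak pairing is minus the density of the smeared line integral;
      \<open>F1\<close>, \<open>F2\<close> may replace \<open>E1\<close>, \<open>E2\<close> because
      the bump around a curve point lives in \<open>K1\<close>.\<close>
    have eqG: "(if x \<in> S then A x * E2 x - B x * E1 x else 0) = - (\<Sum>i\<in>I. w i * integral {0..1} (G i x))" for x
    proof -
      have EF: "bump d (c i t - x) * E1 x = bump d (c i t - x) * F1 x" "bump d (c i t - x) * E2 x = bump d (c i t - x) * F2 x"
        if "i \<in> I" "t \<in> {0..1}" for i t using inK1'[OF that, of x] F1(2)[of x] F2(2)[of x]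
        by (cases "bump d (c i t - x) = 0"; simp)+
      have ii: "(\<lambda>t. bump d (c i t - x) * snd (c' i t)) integrable_on {0..1}"
        "(\<lambda>t. bump d (c i t - x) * fst (c' i t)) integrable_on {0..1}" if "i \<in> I" for i
        using cont_param(4-6)[OF c(1)[OF that] kc] by (intro integrable_continuous_real continuous_on_mult; simp)+
      have s: "integral {0..1} (G i x) = integral {0..1} (\<lambda>t. bump d (c i t - x) * fst (c' i t)) * E1 x
        + integral {0..1} (\<lambda>t. bump d (c i t - x) * snd (c' i t)) * E2 x" if i: "i \<in> I" for i
      proof -
        have "integral {0..1} (G i x) = integral {0..1} (\<lambda>t. bump d (c i t - x) * fst (c' i t) * E1 x + bump d (c i t - x) * snd (c' i t) * E2 x)"
        proof (rule Henstock_Kurzweil_Integration.integral_cong)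
          fix t :: real assume t: "t \<in> {0..1}"
          have "bump d (c i t - x) * fst (c' i t) * E1 x + bump d (c i t - x) * snd (c' i t) * E2 x
            = (bump d (c i t - x) * E1 x) * fst (c' i t) + (bump d (c i t - x) * E2 x) * snd (c' i t)" by simp
          then show "G i x t = bump d (c i t - x) * fst (c' i t) * E1 x + bump d (c i t - x) * snd (c' i t) * E2 x"
            unfolding EF[OF i t] by (simp add: G_def algebra_simps)
        qed
        also have "\<dots> = integral {0..1} (\<lambda>t. bump d (c i t - x) * fst (c' i t)) * E1 x
          + integral {0..1} (\<lambda>t. bump d (c i t - x) * snd (c' i t)) * E2 x"
          using ii[OF i] by (intro integral_unique has_integral_add has_integral_mult_left integrable_integral)
        finally show ?thesis .
      qed
      show ?thesis
      proof (cases "x \<in> S")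
        case True
        have "A x * E2 x - B x * E1 x = - (\<Sum>i\<in>I. w i * (integral {0..1} (\<lambda>t. bump d (c i t - x) * fst (c' i t)) * E1 x
           + integral {0..1} (\<lambda>t. bump d (c i t - x) * snd (c' i t)) * E2 x))"
          by (simp add: A_def B_def sum_distrib_right distrib_left sum.distrib mult.assoc)
        then show ?thesis using True s by simp
      next
        case False
        have "integral {0..1} (G i x) = 0" if i: "i \<in> I" for i
        proof (rule integral_unique, rule has_integral_is_0)
          fix t :: real assume t: "t \<in> {0..1}"
          have "bump d (c i t - x) = 0" by (rule far(1)) (use out[OF False i t] eps(2) in linarith)
          then show "G i x t = 0" by (simp add: G_def)
        qed
        then show ?thesis using False by simp
      qed
    qed
    have sum0: "(\<Sum>i\<in>I. w i * integral {0..1} (\<lambda>t. integral\<^sup>L lborel (\<lambda>x. G i x t))) = 0"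
    proof -
      have "0 = integral\<^sup>L lborel (\<lambda>x. \<Sum>i\<in>I. w i * integral {0..1} (G i x))"
        using weak unfolding eqG by simp
      also have "\<dots> = (\<Sum>i\<in>I. w i * integral\<^sup>L lborel (\<lambda>x. integral {0..1} (G i x)))"
        using iGi by (subst Bochner_Integration.integral_sum) auto
      also have "\<dots> = (\<Sum>i\<in>I. w i * integral {0..1} (\<lambda>t. integral\<^sup>L lborel (\<lambda>x. G i x t)))"
        using lborel_integral_swap[OF cG Gz] by (intro sum.cong) auto
      finally show ?thesis by simp
    qed
    define M where "M = integral\<^sup>L lborel (bump d)"
    have M: "M > 0" using bump_integrable(3)[OF eps(1)] by (simp add: M_def d_def)
    have bi: "integrable lborel (\<lambda>x. bump d (y - x))" "integral\<^sup>L lborel (\<lambda>x. bump d (y - x)) = M" for y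
      using bump_integrable(1,2)[OF eps(1)] by (simp_all add: M_def d_def)
    define H where "H i t = integral\<^sup>L lborel (\<lambda>x. G i x t)" for i t
    define T where "T i t = F1 (c i t) * fst (c' i t) + F2 (c i t) * snd (c' i t)" for i t
    have iG: "integrable lborel (\<lambda>x. G i x t)" if "i \<in> I" "t \<in> {0..1}" for i t
    proof (rule integrable_cont_compact[OF _ compact_cball[of 0 R]])
      show "continuous_on UNIV (\<lambda>x. G i x t)" using continuous_on_section[OF cG[OF that(1)] that(2)] .
    qed (use Gz[OF that] in auto)
    \<comment> \<open>On the support of the bump the form varies by at most \<open>\<omega>\<close>,
      so smearing changes the integrand by that much relative to the mass \<open>M\<close>.\<close>
    have est: "\<bar>H i t - M * T i t\<bar> \<le> M * \<omega> * (\<bar>fst (c' i t)\<bar> + \<bar>snd (c' i t)\<bar>)" if it: "i \<in> I" "t \<in> {0..1}" for i t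
    proof -
      have "H i t - M * T i t = integral\<^sup>L lborel (\<lambda>x. G i x t - bump d (c i t - x) * T i t)"
        unfolding H_def using iG[OF it] bi by (subst Bochner_Integration.integral_diff) auto
      also have "\<bar>\<dots>\<bar> \<le> integral\<^sup>L lborel (\<lambda>x. bump d (c i t - x) * (\<omega> * (\<bar>fst (c' i t)\<bar> + \<bar>snd (c' i t)\<bar>)))"
      proof (rule integral_abs_bound_integral)
        show "integrable lborel (\<lambda>x. G i x t - bump d (c i t - x) * T i t)" using iG[OF it] bi by auto
        show "integrable lborel (\<lambda>x. bump d (c i t - x) * (\<omega> * (\<bar>fst (c' i t)\<bar> + \<bar>snd (c' i t)\<bar>)))" using bi by auto
        fix x
        let ?y = "c i t"
        have b0: "bump d (?y - x) \<ge> 0" by (rule bump_facts(1)[OF d])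
        have "G i x t - bump d (?y - x) * T i t = bump d (?y - x) * ((F1 x - F1 ?y) * fst (c' i t) + (F2 x - F2 ?y) * snd (c' i t))"
          by (simp add: G_def T_def algebra_simps)
        also have "\<bar>\<dots>\<bar> = bump d (?y - x) * \<bar>(F1 x - F1 ?y) * fst (c' i t) + (F2 x - F2 ?y) * snd (c' i t)\<bar>"
          using b0 by (simp add: abs_mult)
        also have "\<dots> \<le> bump d (?y - x) * (\<omega> * (\<bar>fst (c' i t)\<bar> + \<bar>snd (c' i t)\<bar>))"
        proof (cases "bump d (?y - x) = 0")
          case False
          then have xK: "x \<in> K1" "?y \<in> K1" "dist ?y x < eps"
            using inK1'[OF it] near0[of ?y x] inK1[OF inK[OF it], of ?y] e(1) by (auto simp: not_le[symmetric])
          have f: "\<bar>F1 x - F1 ?y\<bar> \<le> \<omega>" "\<bar>F2 x - F2 ?y\<bar> \<le> \<omega>"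
            using e1[OF xK(2,1)] e2[OF xK(2,1)] xK(3) eps(3,4) by (auto simp: dist_commute dist_real_def)
          have "\<bar>(F1 x - F1 ?y) * fst (c' i t) + (F2 x - F2 ?y) * snd (c' i t)\<bar>
            \<le> \<bar>F1 x - F1 ?y\<bar> * \<bar>fst (c' i t)\<bar> + \<bar>F2 x - F2 ?y\<bar> * \<bar>snd (c' i t)\<bar>"
            by (metis abs_mult abs_triangle_ineq)
          also have "\<dots> \<le> \<omega> * \<bar>fst (c' i t)\<bar> + \<omega> * \<bar>snd (c' i t)\<bar>"
            using f by (intro add_mono mult_right_mono) auto
          finally show ?thesis using b0 by (intro mult_left_mono) (auto simp: algebra_simps)
        qed simp
        finally show "\<bar>G i x t - bump d (?y - x) * T i t\<bar> \<le> bump d (?y - x) * (\<omega> * (\<bar>fst (c' i t)\<bar> + \<bar>snd (c' i t)\<bar>))" .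
      qed
      also have "\<dots> = M * \<omega> * (\<bar>fst (c' i t)\<bar> + \<bar>snd (c' i t)\<bar>)" using bi by simp
      finally show ?thesis .
    qed
    have cc: "continuous_on {0..1} (c i)" "continuous_on {0..1} (\<lambda>t. fst (c' i t))" "continuous_on {0..1} (\<lambda>t. snd (c' i t))" if "i \<in> I" for i
      using C1_curve_cont[OF c(1)[OF that]] continuous_on_fst continuous_on_snd by blast+
    have cT: "continuous_on {0..1} (T i)" if "i \<in> I" for i
      unfolding T_def using cc[OF that]
      by (intro continuous_on_add continuous_on_mult continuous_on_compose2[OF F1(1)] continuous_on_compose2[OF F2(1)]) auto
    have cH: "continuous_on {0..1} (H i)" if i: "i \<in> I" for i
    proof -
      have sw: "continuous_on ({0..1} \<times> cbox (- R, - R) (R, R)) (\<lambda>z. G i (snd z) (fst z))"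
      proof -
        have "continuous_on ({0..1} \<times> cbox (- R, - R) (R, R)) (\<lambda>z::real\<times>pt. (snd z, fst z))"
          "(\<lambda>z::real\<times>pt. (snd z, fst z)) ` ({0..1} \<times> cbox (- R, - R) (R, R)) \<subseteq> UNIV \<times> {0..1}"
          by (auto intro!: continuous_intros)
        from continuous_on_compose2[OF cG[OF i] this] show ?thesis by simp
      qed
      have "continuous_on {0..1} (\<lambda>t. integral (cbox (- R, - R) (R, R)) (\<lambda>x. G i x t))"
        by (rule integral_continuous_on_param) (use sw in \<open>simp add: split_def\<close>)
      moreover have "integral (cbox (- R, - R) (R, R)) (\<lambda>x. G i x t) = H i t" if t: "t \<in> {0..1}" for t
        unfolding H_def
      proof (rule lborel_integral_cbox[symmetric])
        show "continuous_on UNIV (\<lambda>x. G i x t)" using continuous_on_section[OF cG[OF i] t] .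
        fix x :: pt assume "x \<notin> cbox (- R, - R) (R, R)"
        then have "R < \<bar>fst x\<bar> \<or> R < \<bar>snd x\<bar>" by (cases x) (auto simp: cbox_Pair_eq)
        then have "R < norm x" using norm_fst_le[of "fst x" "snd x"] norm_snd_le[of "snd x" "fst x"] by auto
        then show "G i x t = 0" using Gz[OF i t] by blast
      qed
      ultimately show ?thesis by (rule continuous_on_eq)
    qed
    have tot_eq: "M * tot = (\<Sum>i\<in>I. w i * (integral {0..1} (\<lambda>t. M * T i t)))"
      by (simp add: tot_def T_def[symmetric] sum_distrib_left mult.left_commute)
    have "\<bar>M * tot\<bar> = \<bar>(\<Sum>i\<in>I. w i * integral {0..1} (\<lambda>t. M * T i t)) - (\<Sum>i\<in>I. w i * integral {0..1} (H i))\<bar>"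
      using sum0[folded H_def] by (simp add: tot_eq)
    also have "\<dots> = \<bar>\<Sum>i\<in>I. w i * integral {0..1} (\<lambda>t. M * T i t - H i t)\<bar>"
    proof -
      have "integral {0..1} (\<lambda>t. M * T i t - H i t) = integral {0..1} (\<lambda>t. M * T i t) - integral {0..1} (H i)" if "i \<in> I" for i
        using cT[OF that] cH[OF that] by (intro Henstock_Kurzweil_Integration.integral_diff integrable_continuous_real continuous_on_mult_left) auto
      then show ?thesis by (simp add: sum_subtractf[symmetric] right_diff_distrib)
    qed
    also have "\<dots> \<le> (\<Sum>i\<in>I. \<bar>w i * integral {0..1} (\<lambda>t. M * T i t - H i t)\<bar>)" by (rule sum_abs)
    also have "\<dots> \<le> (\<Sum>i\<in>I. \<bar>w i\<bar> * (M * \<omega> * integral {0..1} (\<lambda>t. \<bar>fst (c' i t)\<bar> + \<bar>snd (c' i t)\<bar>)))"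
    proof (rule sum_mono)
      fix i assume i: "i \<in> I"
      have "norm (integral {0..1} (\<lambda>t. M * T i t - H i t)) \<le> integral {0..1} (\<lambda>t. M * \<omega> * (\<bar>fst (c' i t)\<bar> + \<bar>snd (c' i t)\<bar>))"
      proof (rule integral_norm_bound_integral)
        show "(\<lambda>t. M * T i t - H i t) integrable_on {0..1}"
          by (intro integrable_continuous_real continuous_on_diff continuous_on_mult_left cT cH i)
        show "(\<lambda>t. M * \<omega> * (\<bar>fst (c' i t)\<bar> + \<bar>snd (c' i t)\<bar>)) integrable_on {0..1}"
          by (intro integrable_continuous_real continuous_on_mult_left continuous_on_add continuous_on_rabs cc[OF i])
        show "norm (M * T i t - H i t) \<le> M * \<omega> * (\<bar>fst (c' i t)\<bar> + \<bar>snd (c' i t)\<bar>)" if "t \<in> {0..1}" for t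
          using est[OF i that] by (simp add: abs_minus_commute)
      qed
      then show "\<bar>w i * integral {0..1} (\<lambda>t. M * T i t - H i t)\<bar> \<le> \<bar>w i\<bar> * (M * \<omega> * integral {0..1} (\<lambda>t. \<bar>fst (c' i t)\<bar> + \<bar>snd (c' i t)\<bar>))"
        by (simp add: abs_mult mult_left_mono)
    qed
    also have "\<dots> = M * (\<omega> * C)" by (simp add: C_def sum_distrib_left mult_ac)
    finally show ?thesis using M by (simp add: abs_mult)
  qed
  have "C \<ge> 0" unfolding C_def
    using c(1) by (intro sum_nonneg mult_nonneg_nonneg Henstock_Kurzweil_Integration.integral_nonneg integrable_continuous_real continuous_on_add continuous_on_rabs)
      (auto intro!: continuous_on_fst continuous_on_snd C1_curve_cont)
  have "tot = 0"
  proof (rule ccontr)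
    assume "tot \<noteq> 0"
    define \<omega> where "\<omega> = \<bar>tot\<bar> / (2 * (C + 1))"
    have o: "\<omega> > 0" using \<open>tot \<noteq> 0\<close> \<open>C \<ge> 0\<close> by (simp add: \<omega>_def)
    have "\<omega> * C < \<omega> * (2 * (C + 1))" using o \<open>C \<ge> 0\<close> by (intro mult_strict_left_mono) auto
    also have "\<dots> = \<bar>tot\<bar>" using \<open>C \<ge> 0\<close> by (simp add: \<omega>_def)
    finally show False using main[OF o] by simp
  qed
  moreover have "integral {0..1} (\<lambda>t. E1 (c i t) * fst (c' i t) + E2 (c i t) * snd (c' i t)) =
    integral {0..1} (\<lambda>t. F1 (c i t) * fst (c' i t) + F2 (c i t) * snd (c' i t))" if "i \<in> I" for i
    using inK1[OF inK[OF that], where y="c i _"] F1(2) F2(2) e(1) by (intro Henstock_Kurzweil_Integration.integral_cong) auto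
  ultimately show ?thesis unfolding tot_def by simp
qed

section \<open>The gauge function of a domain with holes\<close>

text \<open>The imaginary part of the contour integral of 1/(w - x) in real terms: for a closed
  curve avoiding x, 2 pi times its winding number.\<close>

definition ang_int :: "(real \<Rightarrow> pt) \<Rightarrow> (real \<Rightarrow> pt) \<Rightarrow> pt \<Rightarrow> real" where
  "ang_int c c' x = integral {0..1} (\<lambda>t. (fst (c t - x) * snd (c' t) - snd (c t - x) * fst (c' t)) / sqn (c t - x))"

definition line_int :: "(pt \<Rightarrow> real) \<Rightarrow> (pt \<Rightarrow> real) \<Rightarrow> (real \<Rightarrow> pt) \<Rightarrow> (real \<Rightarrow> pt) \<Rightarrow> real" where
  "line_int E1 E2 c c' = integral {0..1} (\<lambda>t. E1 (c t) * fst (c' t) + E2 (c t) * snd (c' t))"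

lemma C1_curveI:
  assumes "\<And>t. (c has_vector_derivative c' t) (at t)" "continuous_on UNIV c'"
  shows "C1_curve c c'"
  using assms unfolding C1_curve_def by (auto intro: has_vector_derivative_at_within continuous_on_subset)

lemma C1_curve_valid_path:
  assumes "\<And>t. (c has_vector_derivative c' t) (at t)" "continuous_on UNIV c'"
  shows "valid_path (\<lambda>t. toC (c t))"
  by (rule valid_path_toC[OF assms(1)]) (rule continuous_on_subset[OF assms(2)], simp)

lemma Im_contour_ang:
  assumes d: "\<And>t. (c has_vector_derivative c' t) (at t)" "continuous_on UNIV c'"
    and x: "\<And>t. t \<in> {0..1} \<Longrightarrow> c t \<noteq> x"
  shows "Im (contour_integral (\<lambda>t. toC (c t)) (\<lambda>w. 1 / (w - toC x))) = ang_int c c' x"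
    "(\<lambda>w. 1 / (w - toC x)) contour_integrable_on (\<lambda>t. toC (c t))"
proof -
  have cc: "continuous_on {0..1} c"
    using C1_curve_cont(1)[OF C1_curveI[OF d]] .
  have cc': "continuous_on {0..1} (\<lambda>t. toC (c' t))" "continuous_on {0..1} (\<lambda>t. toC (c t))"
    using bounded_linear.continuous_on[OF bounded_linear_toC] cc continuous_on_subset[OF d(2)] by blast+
  have ne: "toC (c t) - toC x \<noteq> 0" if "t \<in> {0..1}" for t
    using x[OF that] inj_toC by (auto simp: inj_eq)
  have i: "(\<lambda>t. 1 / (toC (c t) - toC x) * toC (c' t)) integrable_on {0..1}"
    using ne by (intro integrable_continuous_real continuous_intros cc') auto
  have eq: "((\<lambda>t. 1 / (toC (c t) - toC x) * vector_derivative (\<lambda>t. toC (c t)) (at t)) has_integral I) {0..1}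
    \<longleftrightarrow> ((\<lambda>t. 1 / (toC (c t) - toC x) * toC (c' t)) has_integral I) {0..1}" for I
    using vector_derivative_at[OF has_vector_derivative_toC[OF d(1)]] by simp
  have hc: "((\<lambda>w. 1 / (w - toC x)) has_contour_integral integral {0..1} (\<lambda>t. 1 / (toC (c t) - toC x) * toC (c' t))) (\<lambda>t. toC (c t))"
    unfolding has_contour_integral eq using integrable_integral[OF i] .
  then show "(\<lambda>w. 1 / (w - toC x)) contour_integrable_on (\<lambda>t. toC (c t))"
    unfolding contour_integrable_on_def by blast
  have "Im (integral {0..1} (\<lambda>t. 1 / (toC (c t) - toC x) * toC (c' t))) = integral {0..1} (\<lambda>t. Im (1 / (toC (c t) - toC x) * toC (c' t)))"
    using integral_linear[OF i bounded_linear_Im] by (simp add: o_def)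
  also have "\<dots> = ang_int c c' x" unfolding ang_int_def
  proof (rule Henstock_Kurzweil_Integration.integral_cong)
    fix t :: real assume "t \<in> {0..1}"
    have "Im (1 / (toC (c t) - toC x) * toC (c' t)) = Im (toC (c' t) / (toC (c t) - toC x))" by simp
    also have "\<dots> = (fst (c t - x) * snd (c' t) - snd (c t - x) * fst (c' t)) / sqn (c t - x)"
      by (simp add: Im_divide sqn_def power2_eq_square algebra_simps)
    finally show "Im (1 / (toC (c t) - toC x) * toC (c' t)) = (fst (c t - x) * snd (c' t) - snd (c t - x) * fst (c' t)) / sqn (c t - x)" .
  qed
  finally show "Im (contour_integral (\<lambda>t. toC (c t)) (\<lambda>w. 1 / (w - toC x))) = ang_int c c' x"
    using contour_integral_unique[OF hc] by simp
qed

lemma Re_winding_number: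
  assumes "valid_path g" "z \<notin> path_image g"
  shows "Im (contour_integral g (\<lambda>w. 1 / (w - z))) = 2 * pi * Re (winding_number g z)"
  using winding_number_valid_path[OF assms] by (simp add: Re_divide power2_eq_square)

section \<open>Curves in a domain with holes\<close>

locale holed_domain =
  fixes Om0 Om :: "pt set" and Hs :: "'k::finite \<Rightarrow> pt set"
  assumes D0: "smooth_sc_domain Om0" and DH: "\<And>j. smooth_sc_domain (Hs j)"
    and disj: "\<And>i j. i \<noteq> j \<Longrightarrow> closure (Hs i) \<inter> closure (Hs j) = {}"
    and sub: "\<And>j. closure (Hs j) \<subseteq> Om0"
    and Om: "Om = Om0 - (\<Union>j. closure (Hs j))" and conn: "connected Om"
begin

lemma open_Om: "open Om" using D0 unfolding Om smooth_sc_domain_def by (intro open_Diff closed_UN) auto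

lemma bounded_Om: "bounded Om" using D0 unfolding Om smooth_sc_domain_def by (meson Diff_subset bounded_subset)

lemma outside_cases: "x \<notin> Om \<Longrightarrow> x \<notin> Om0 \<or> (\<exists>l. x \<in> closure (Hs l))" unfolding Om by auto

lemma winding_off_Om0:
  assumes "path g" "pathfinish g = pathstart g" "path_image g \<subseteq> toC ` Om" "x \<notin> Om0"
  shows "winding_number g (toC x) = 0"
proof (rule simply_connected_imp_winding_number_zero[OF _ assms(1) _ assms(2)])
  show "simply_connected (toC ` Om0)" using D0 simply_connected_toC by (auto simp: smooth_sc_domain_def)
  show "path_image g \<subseteq> toC ` Om0" using assms(3) unfolding Om by blast
  show "toC x \<notin> toC ` Om0" using assms(4) by simp
qed

lemma winding_const_hole:
  assumes "path g" "pathfinish g = pathstart g" "path_image g \<subseteq> toC ` Om" "x \<in> closure (Hs l)" "y \<in> closure (Hs l)"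
  shows "winding_number g (toC x) = winding_number g (toC y)"
proof -
  have "connected (toC ` closure (Hs l))"
    unfolding connected_toC using DH[of l] by (simp add: smooth_sc_domain_def connected_imp_connected_closure)
  moreover have "toC ` closure (Hs l) \<inter> path_image g = {}"
  proof -
    have "closure (Hs l) \<inter> Om = {}" unfolding Om by blast
    then have "toC ` closure (Hs l) \<inter> toC ` Om = {}" by (simp add: image_Int[OF inj_toC, symmetric])
    then show ?thesis using assms(3) by blast
  qed
  ultimately have "winding_number g constant_on (toC ` closure (Hs l))"
    using winding_number_constant[OF assms(1,2)] by blast
  then show ?thesis using assms(4,5) unfolding constant_on_def by (metis imageI)
qed

text \<open>Boundary curve of one hole with velocity \<open>v\<close>, a push field
  \<open>V\<close>, and a range \<open>s0\<close> in which the pushed curves stay in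
  \<open>Om\<close> with known angle integrals around every point off \<open>Om\<close>. The last
  clause concerns the unpushed curve, which runs on the frontier, and hence only interior points of
  the holes.\<close>

definition collar_data :: "'k \<Rightarrow> (real \<Rightarrow> pt) \<Rightarrow> (real \<Rightarrow> pt) \<Rightarrow> (real \<Rightarrow> pt) \<Rightarrow> (real \<Rightarrow> pt) \<Rightarrow> int \<Rightarrow> real \<Rightarrow> bool" where
  "collar_data j gam v V V' w s0 \<longleftrightarrow> ccw_param (Hs j) gam \<and> (\<forall>t. (gam has_vector_derivative v t) (at t)) \<and> continuous_on UNIV v \<and>
    (\<forall>t. (V has_vector_derivative V' t) (at t)) \<and> continuous_on UNIV V' \<and> w * w = 1 \<and> s0 > 0 \<and> gam 1 = gam 0 \<and> V 1 = V 0 \<and>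
    (\<forall>s t. 0 < s \<longrightarrow> s < s0 \<longrightarrow> t \<in> {0..1} \<longrightarrow> gam t + s *\<^sub>R V t \<in> Om) \<and>
    (\<forall>s x. 0 < s \<longrightarrow> s < s0 \<longrightarrow> x \<notin> Om \<longrightarrow>
      ang_int (\<lambda>t. gam t + s *\<^sub>R V t) (\<lambda>t. v t + s *\<^sub>R V' t) x = (if x \<in> closure (Hs j) then 2 * pi * w else 0)) \<and>
    (\<forall>l x. x \<in> Hs l \<longrightarrow> ang_int gam v x = (if l = j then 2 * pi * w else 0))"

lemma collar_data_ex: "\<exists>gam v V V' w s0. collar_data j gam v V V' w s0"
proof -
  obtain gam where g: "ccw_param (Hs j) gam" using ccw_param_ex[OF DH connected_frontier_smooth[OF DH]] by blast
  define v where "v t = vector_derivative gam (at t)" for t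
  have dg: "(gam has_vector_derivative v t) (at t)" for t unfolding v_def using ccw_param_derivative[OF g] .
  have cv: "continuous_on UNIV v" using g unfolding ccw_param_def C1_differentiable_on_eq v_def by auto
  have cg: "continuous_on UNIV gam"
    by (intro continuous_at_imp_continuous_on ballI) (use dg has_vector_derivative_continuous in blast)
  obtain w :: int where w: "w * w = 1" "\<And>x. x \<in> Hs j \<Longrightarrow> winding_number (\<lambda>t. toC (gam t)) (toC x) = of_int w"
    "\<And>x. x \<notin> closure (Hs j) \<Longrightarrow> winding_number (\<lambda>t. toC (gam t)) (toC x) = 0"
    using ccw_param_winding[OF DH g] by metis
  obtain V V' s1 where V: "\<And>t. (V has_vector_derivative V' t) (at t)" "continuous_on UNIV V'"
    "\<And>t. V (t + 1) = V t" "s1 > 0"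
    "\<And>t s. t \<in> {0..1} \<Longrightarrow> 0 < s \<Longrightarrow> s < s1 \<Longrightarrow> gam t + s *\<^sub>R V t \<notin> closure (Hs j)"
    using push_out[OF DH g] by metis
  have cV: "continuous_on UNIV V"
    by (intro continuous_at_imp_continuous_on ballI) (use V(1) has_vector_derivative_continuous in blast)
  have g1: "gam 1 = gam 0" using g unfolding ccw_param_def by (metis add_0)
  have V1: "V 1 = V 0" using V(3)[of 0] by simp
  have F: "gam t \<in> frontier (Hs j)" for t using ccw_param_frontier[OF g] .
  have Fc: "frontier (Hs j) \<subseteq> closure (Hs j)" by (simp add: frontier_def)
  have "bounded (V ` {0..1})" by (intro compact_imp_bounded compact_continuous_image continuous_on_subset[OF cV]) auto
  then obtain N where N: "N > 0" "\<And>t. t \<in> {0..1} \<Longrightarrow> norm (V t) \<le> N" unfolding bounded_pos by blast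
  \<comment> \<open>A neighbourhood of this frontier that excludes the other holes; within it, only
    the closed hole itself remains to be avoided.\<close>
  define O' where "O' = Om0 - (\<Union>i\<in>-{j}. closure (Hs i))"
  have "open O'" using D0 unfolding O'_def smooth_sc_domain_def by (intro open_Diff closed_UN) auto
  moreover have "compact (frontier (Hs j))" using DH[of j] by (simp add: smooth_sc_domain_def compact_frontier_bounded)
  moreover have "frontier (Hs j) \<subseteq> O'" using Fc disj sub[of j] unfolding O'_def by blast
  ultimately obtain e where e: "e > 0" "(\<Union>x\<in>frontier (Hs j). cball x e) \<subseteq> O'"
    using compact_subset_open_imp_cball_epsilon_subset by metis
  define a where "a l = (SOME x. x \<in> Hs l)" for l
  have a: "a l \<in> Hs l" for l using DH[of l] unfolding a_def smooth_sc_domain_def by (metis some_in_eq)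
  have aF: "a l \<notin> frontier (Hs j)" for l
  proof (cases "l = j")
    case True then show ?thesis using a[of j] DH[of j] by (auto simp: frontier_def smooth_sc_domain_def interior_open)
  next
    case False then show ?thesis using a[of l] disj[OF False] Fc closure_subset by blast
  qed
  have "\<exists>m>0. \<forall>l. \<forall>t\<in>{0..1}. m \<le> norm (gam t - a l)"
  proof -
    have cl: "closed (frontier (Hs j))" by simp
    have ne: "frontier (Hs j) \<noteq> {}" using F by blast
    define m where "m = Min (range (\<lambda>l. setdist {a l} (frontier (Hs j))))"
    have "m \<in> range (\<lambda>l. setdist {a l} (frontier (Hs j)))" unfolding m_def by (intro Min_in) auto
    then obtain l where "m = setdist {a l} (frontier (Hs j))" by blast
    moreover have "setdist {a l} (frontier (Hs j)) \<noteq> 0"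
      using aF[of l] cl ne setdist_eq_0_sing_1[of "a l" "frontier (Hs j)"] closure_closed by auto
    ultimately have "m > 0" using setdist_pos_le[of "{a l}" "frontier (Hs j)"] by linarith
    moreover have "m \<le> norm (gam t - a l)" for l t
    proof -
      have "m \<le> setdist {a l} (frontier (Hs j))" unfolding m_def by (intro Min_le) auto
      also have "\<dots> \<le> dist (a l) (gam t)" using F by (intro setdist_le_dist) auto
      finally show ?thesis by (simp add: dist_norm norm_minus_commute)
    qed
    ultimately show ?thesis by blast
  qed
  then obtain m where m: "m > 0" "\<And>l t. t \<in> {0..1} \<Longrightarrow> m \<le> norm (gam t - a l)" by blast
  \<comment> \<open>\<open>s1\<close> keeps the curve off the closed hole, e/N keeps it in
    \<open>O'\<close>, and m/N moves it by less than the distance of the boundary curve to the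
    points \<open>a l\<close>, so winding numbers persist.\<close>
  define s0 where "s0 = min s1 (min (e / N) (m / N))"
  have s0: "s0 > 0" using V(4) e(1) N(1) m(1) by (simp add: s0_def)
  have sV: "norm (s *\<^sub>R V t) < e" "norm (s *\<^sub>R V t) < m" if "0 < s" "s < s0" "t \<in> {0..1}" for s t
  proof -
    have "norm (s *\<^sub>R V t) \<le> s * N" using N(2)[OF that(3)] that(1) by simp
    moreover have "s * N < e" "s * N < m" using that N(1) by (auto simp: s0_def pos_less_divide_eq)
    ultimately show "norm (s *\<^sub>R V t) < e" "norm (s *\<^sub>R V t) < m" by auto
  qed
  have inOm: "gam t + s *\<^sub>R V t \<in> Om" if st: "0 < s" "s < s0" "t \<in> {0..1}" for s t
  proof -
    have "gam t + s *\<^sub>R V t \<in> cball (gam t) e" using sV(1)[OF st] by (simp add: dist_norm)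
    then have "gam t + s *\<^sub>R V t \<in> O'" using e(2) F by blast
    moreover have "gam t + s *\<^sub>R V t \<notin> closure (Hs j)" using V(5)[OF st(3,1)] st(2) by (simp add: s0_def)
    ultimately show ?thesis unfolding O'_def Om by blast
  qed
  have dgs: "((\<lambda>t. gam t + s *\<^sub>R V t) has_vector_derivative v t + s *\<^sub>R V' t) (at t)" for s t
    by (auto intro!: derivative_eq_intros dg V(1))
  have cgs: "continuous_on UNIV (\<lambda>t. v t + s *\<^sub>R V' t)" for s by (intro continuous_intros cv V(2))
  have pimg: "path_image (\<lambda>t. toC (c t)) = toC ` c ` {0..1}" for c by (simp add: path_image_def image_image)
  have ang: "ang_int (\<lambda>t. gam t + s *\<^sub>R V t) (\<lambda>t. v t + s *\<^sub>R V' t) x = (if x \<in> closure (Hs j) then 2 * pi * w else 0)"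
    if s: "0 < s" "s < s0" and x: "x \<notin> Om" for s x
  proof -
    let ?c = "\<lambda>t. gam t + s *\<^sub>R V t" let ?g = "\<lambda>t. toC (gam t + s *\<^sub>R V t)"
    have vp: "valid_path ?g" by (rule C1_curve_valid_path[OF dgs cgs])
    have pi: "path_image ?g \<subseteq> toC ` Om" unfolding pimg using inOm[OF s] by blast
    have cl: "pathfinish ?g = pathstart ?g" by (simp add: pathfinish_def pathstart_def g1 V1)
    have xi: "toC x \<notin> path_image ?g" using pi x by (meson subsetD toC_mem)
    have "ang_int ?c (\<lambda>t. v t + s *\<^sub>R V' t) x = 2 * pi * Re (winding_number ?g (toC x))"
    proof -
      have "gam t + s *\<^sub>R V t \<noteq> x" if "t \<in> {0..1}" for t using inOm[OF s that] x by blast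
      from Im_contour_ang(1)[OF dgs cgs this] Re_winding_number[OF vp xi] show ?thesis by simp
    qed
    moreover have "winding_number ?g (toC x) = (if x \<in> closure (Hs j) then of_int w else 0)"
    proof (cases "x \<in> Om0")
      case False
      then show ?thesis using winding_off_Om0[OF valid_path_imp_path[OF vp] cl pi False] sub by auto
    next
      case True
      then obtain l where l: "x \<in> closure (Hs l)" using outside_cases[OF x] by blast
      have al: "a l \<in> closure (Hs l)" using a closure_subset by blast
      have "winding_number ?g (toC x) = winding_number ?g (toC (a l))"
        by (rule winding_const_hole[OF valid_path_imp_path[OF vp] cl pi l al])
      also have "\<dots> = winding_number (\<lambda>t. toC (gam t)) (toC (a l))"
      proof (rule winding_number_nearby_loops_eq)
        show "path (\<lambda>t. toC (gam t))" using ccw_param_valid_path[OF g] valid_path_imp_path by blast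
        show "path ?g" using vp valid_path_imp_path by blast
        show "norm (?g t - toC (gam t)) < norm (toC (gam t) - toC (a l))" if "t \<in> {0..1}" for t
          unfolding toC_diff[symmetric] norm_toC using sV(2)[OF s that] m(2)[OF that, of l] by simp
      qed (use cl g1 in \<open>auto simp: pathfinish_def pathstart_def\<close>)
      also have "\<dots> = (if l = j then of_int w else 0)"
        using w(2)[of "a l"] w(3)[of "a l"] a[of l] disj[of l j] al by auto
      also have "(l = j) = (x \<in> closure (Hs j))" using l disj[of l j] by blast
      finally show ?thesis .
    qed
    ultimately show ?thesis by auto
  qed
  have ang0: "ang_int gam v x = (if l = j then 2 * pi * w else 0)" if x: "x \<in> Hs l" for l x
  proof -
    let ?g = "\<lambda>t. toC (gam t)"
    have "x \<notin> frontier (Hs j)"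
    proof (cases "l = j")
      case True then show ?thesis using x DH[of j] by (auto simp: frontier_def smooth_sc_domain_def interior_open)
    next
      case False then show ?thesis using x disj[OF False] Fc closure_subset by blast
    qed
    then have n: "gam t \<noteq> x" for t using F by metis
    then have xi: "toC x \<notin> path_image ?g" unfolding pimg by auto
    have "ang_int gam v x = 2 * pi * Re (winding_number ?g (toC x))"
      using Im_contour_ang(1)[OF dg cv n] Re_winding_number[OF ccw_param_valid_path[OF g] xi] by simp
    moreover have "winding_number ?g (toC x) = (if l = j then of_int w else 0)"
      using w(2)[of x] w(3)[of x] x disj[of l j] closure_subset[of "Hs l"] by auto
    ultimately show ?thesis by auto
  qed
  have "collar_data j gam v V V' w s0" unfolding collar_data_def
    by (intro conjI allI impI g dg cv V(1,2) w(1) s0 g1 V1 inOm ang ang0)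
  then show ?thesis by blast
qed

lemma collar_in_closure:
  assumes "collar_data j gam v V V' w s0" "0 \<le> s" "s < s0" "t \<in> {0..1}"
  shows "gam t + s *\<^sub>R V t \<in> closure Om"
proof (cases "s = 0")
  case True
  have s0: "s0 > 0" using assms(1) by (simp add: collar_data_def)
  have "(\<lambda>n. gam t + (s0 / 2 * inverse (real (Suc n))) *\<^sub>R V t) \<longlonglongrightarrow> gam t + (s0 / 2 * 0) *\<^sub>R V t"
    by (intro tendsto_intros LIMSEQ_inverse_real_of_nat)
  moreover have "gam t + (s0 / 2 * inverse (real (Suc n))) *\<^sub>R V t \<in> Om" for n
  proof -
    have "inverse (real (Suc n)) \<le> 1" by (simp add: field_simps)
    then have "s0 / 2 * inverse (real (Suc n)) \<le> s0 / 2 * 1" using s0 by (intro mult_left_mono) auto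
    moreover have "0 < s0 / 2 * inverse (real (Suc n))" using s0 by simp
    ultimately show ?thesis using assms(1,4) s0 unfolding collar_data_def by auto
  qed
  ultimately show ?thesis using True unfolding closure_sequential
    by (intro exI[of _ "\<lambda>n. gam t + (s0 / 2 * inverse (real (Suc n))) *\<^sub>R V t"]) simp
next
  case False
  then show ?thesis using assms closure_subset[of Om] unfolding collar_data_def by force
qed

text \<open>The pushed curves lie in \<open>Om\<close> and converge to the boundary curve as s tends
  to 0.\<close>

lemma frontier_sub: "frontier (Hs j) \<subseteq> closure Om"
proof -
  obtain gam v V V' w s0 where c: "collar_data j gam v V V' w s0" using collar_data_ex by blast
  then have "frontier (Hs j) = gam ` {0..1}" "s0 > 0" unfolding collar_data_def ccw_param_def by auto
  then show ?thesis using collar_in_closure[OF c, of 0] by auto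
qed

lemma circulation_collar:
  assumes c: "collar_data j gam v V V' w s0" and E: "continuous_on (closure Om) E1" "continuous_on (closure Om) E2"
  shows "circulation (Hs j) (\<lambda>x. (E1 x, E2 x)) = line_int E1 E2 gam v"
proof -
  have g: "ccw_param (Hs j) gam" and v: "vector_derivative gam (at t) = v t" for t
    using c vector_derivative_at unfolding collar_data_def by blast+
  have "continuous_on (frontier (Hs j)) (\<lambda>x. (E1 x, E2 x))"
    using continuous_on_subset[OF _ frontier_sub] E by (intro continuous_on_Pair) blast+
  from circulation_integral[OF DH connected_frontier_smooth[OF DH] g this]
  show ?thesis by (simp add: line_int_def v inner_prod_def integral_unique)
qed

text \<open>The form is closed in the open domain only, so chains are compared with pushed curves;
  continuity up to the closure then gives the boundary circulation in the limit.\<close>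

lemma collar_limit:
  assumes c: "collar_data j gam v V V' w s0" and E: "continuous_on (closure Om) E1" "continuous_on (closure Om) E2"
  shows "((\<lambda>s. line_int E1 E2 (\<lambda>t. gam t + s *\<^sub>R V t) (\<lambda>t. v t + s *\<^sub>R V' t)) \<longlongrightarrow> circulation (Hs j) (\<lambda>x. (E1 x, E2 x))) (at_right 0)"
proof -
  have s0: "s0 > 0" and cg: "continuous_on UNIV gam" "continuous_on UNIV v" "continuous_on UNIV V" "continuous_on UNIV V'"
    using c has_vector_derivative_continuous unfolding collar_data_def
    by (auto intro!: continuous_at_imp_continuous_on) blast+
  define S where "S = {0..s0/2}"
  have cur: "continuous_on (S \<times> {0..1}) (\<lambda>z. gam (snd z) + fst z *\<^sub>R V (snd z))"
    "continuous_on (S \<times> {0..1}) (\<lambda>z. v (snd z) + fst z *\<^sub>R V' (snd z))"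
    by (intro continuous_intros continuous_on_compose2[OF cg(1)] continuous_on_compose2[OF cg(2)]
      continuous_on_compose2[OF cg(3)] continuous_on_compose2[OF cg(4)]; simp)+
  have im: "(\<lambda>z. gam (snd z) + fst z *\<^sub>R V (snd z)) ` (S \<times> {0..1}) \<subseteq> closure Om"
    using collar_in_closure[OF c] s0 by (auto simp: S_def)
  have "continuous_on (S \<times> {0..1}) (\<lambda>z. E1 (gam (snd z) + fst z *\<^sub>R V (snd z)) * fst (v (snd z) + fst z *\<^sub>R V' (snd z))
    + E2 (gam (snd z) + fst z *\<^sub>R V (snd z)) * snd (v (snd z) + fst z *\<^sub>R V' (snd z)))"
    by (intro continuous_on_add continuous_on_mult continuous_on_fst[OF cur(2)] continuous_on_snd[OF cur(2)]
      continuous_on_compose2[OF E(1) cur(1) im] continuous_on_compose2[OF E(2) cur(1) im])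
  then have "continuous_on S (\<lambda>s. integral (cbox 0 1) (\<lambda>t. E1 (gam t + s *\<^sub>R V t) * fst (v t + s *\<^sub>R V' t)
    + E2 (gam t + s *\<^sub>R V t) * snd (v t + s *\<^sub>R V' t)))"
    by (intro integral_continuous_on_param) (simp add: split_def)
  then have "continuous_on S (\<lambda>s. line_int E1 E2 (\<lambda>t. gam t + s *\<^sub>R V t) (\<lambda>t. v t + s *\<^sub>R V' t))"
    by (simp add: line_int_def)
  then have "((\<lambda>s. line_int E1 E2 (\<lambda>t. gam t + s *\<^sub>R V t) (\<lambda>t. v t + s *\<^sub>R V' t)) \<longlongrightarrow>
    line_int E1 E2 (\<lambda>t. gam t + 0 *\<^sub>R V t) (\<lambda>t. v t + 0 *\<^sub>R V' t)) (at 0 within S)"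
    using s0 unfolding continuous_on_def by (elim ballE[of _ _ 0]) (auto simp: S_def)
  moreover have "at 0 within S = at_right 0"
    unfolding S_def using s0 by (intro at_within_Icc_at_right) simp
  ultimately show ?thesis using circulation_collar[OF c E] by simp
qed

text \<open>Subtracting m j * w j copies of each pushed boundary curve leaves a chain of winding
  number zero around every point off \<open>Om\<close>, to which \<open>closed_form_chain\<close>
  applies; the factor \<open>w j\<close> undoes the sign in the winding of the pushed curve
  itself.\<close>

lemma period:
  fixes m :: "'k \<Rightarrow> int" and u :: "'i \<Rightarrow> real" and c c' :: "'i \<Rightarrow> real \<Rightarrow> pt"
  assumes E: "\<And>x. x \<in> Om \<Longrightarrow> has_grad E1 (a11 x) (a12 x) x" "\<And>x. x \<in> Om \<Longrightarrow> has_grad E2 (a12 x) (a22 x) x"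
      "continuous_on Om a12" "continuous_on (closure Om) E1" "continuous_on (closure Om) E2"
    and I: "finite I" and c: "\<And>i. i \<in> I \<Longrightarrow> C1_curve (c i) (c' i)" "\<And>i t. i \<in> I \<Longrightarrow> t \<in> {0..1} \<Longrightarrow> c i t \<in> Om"
    and chain: "\<And>f::pt \<Rightarrow> real. (\<Sum>i\<in>I. u i * (f (c i 1) - f (c i 0))) = 0"
    and wind: "\<And>l x. x \<in> closure (Hs l) \<Longrightarrow> (\<Sum>i\<in>I. u i * ang_int (c i) (c' i) x) = 2 * pi * m l"
      "\<And>x. x \<notin> Om0 \<Longrightarrow> (\<Sum>i\<in>I. u i * ang_int (c i) (c' i) x) = 0"
  obtains w :: "'k \<Rightarrow> int" where
    "(\<Sum>i\<in>I. u i * line_int E1 E2 (c i) (c' i)) = (\<Sum>j\<in>UNIV. m j * w j * circulation (Hs j) (\<lambda>x. (E1 x, E2 x)))"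
proof -
  have "\<forall>j. \<exists>gam v V V' w s0. collar_data j gam v V V' w s0" using collar_data_ex by blast
  then obtain gam v V V' w s0 where cd: "\<And>j. collar_data j (gam j) (v j) (V j) (V' j) (w j) (s0 j)" by metis
  define sm where "sm = Min (range s0)"
  have "sm \<in> range s0" unfolding sm_def by (intro Min_in) auto
  then have sm: "sm > 0" using cd by (auto simp: collar_data_def)
  have sml: "sm \<le> s0 j" for j unfolding sm_def by (intro Min_le) auto
  let ?J = "\<lambda>s j. line_int E1 E2 (\<lambda>t. gam j t + s *\<^sub>R V j t) (\<lambda>t. v j t + s *\<^sub>R V' j t)"
  let ?S = "\<Sum>i\<in>I. u i * line_int E1 E2 (c i) (c' i)"
  have main: "?S = (\<Sum>j\<in>UNIV. m j * w j * ?J s j)" if s: "0 < s" "s < sm" for s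
  proof -
    have ss: "s < s0 j" for j using s(2) sml[of j] by linarith
    \<comment> \<open>The given chain and the pushed boundaries as one family over a disjoint
      sum.\<close>
    define u2 where "u2 = case_sum u (\<lambda>j. - real_of_int (m j * w j))"
    define c2 where "c2 = case_sum c (\<lambda>j t. gam j t + s *\<^sub>R V j t)"
    define d2 where "d2 = case_sum c' (\<lambda>j t. v j t + s *\<^sub>R V' j t)"
    have sP: "(\<Sum>i\<in>I <+> UNIV. u2 i * F (c2 i) (d2 i)) = (\<Sum>i\<in>I. u i * F (c i) (c' i))
       - (\<Sum>j\<in>UNIV. m j * w j * F (\<lambda>t. gam j t + s *\<^sub>R V j t) (\<lambda>t. v j t + s *\<^sub>R V' j t))" for F :: "(real \<Rightarrow> pt) \<Rightarrow> (real \<Rightarrow> pt) \<Rightarrow> real"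
      by (subst sum.Plus[OF I finite_class.finite_UNIV]) (simp add: u2_def c2_def d2_def sum_negf[symmetric])
    have "(\<Sum>i\<in>I <+> UNIV. u2 i * integral {0..1} (\<lambda>t. E1 (c2 i t) * fst (d2 i t) + E2 (c2 i t) * snd (d2 i t))) = 0"
    proof (rule closed_form_chain[OF _ open_Om bounded_Om E(1-3)])
      show "finite (I <+> (UNIV :: 'k set))" using I by simp
      show "C1_curve (c2 i) (d2 i)" if "i \<in> I <+> UNIV" for i
      proof (cases i)
        case (Inl a) then show ?thesis using that c(1) by (auto simp: c2_def d2_def)
      next
        case (Inr j)
        have "C1_curve (\<lambda>t. gam j t + s *\<^sub>R V j t) (\<lambda>t. v j t + s *\<^sub>R V' j t)"
          using cd[of j] unfolding collar_data_def
          by (intro C1_curveI) (auto intro!: derivative_eq_intros continuous_intros)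
        then show ?thesis using Inr by (simp add: c2_def d2_def)
      qed
      show "c2 i t \<in> Om" if "i \<in> I <+> UNIV" "t \<in> {0..1}" for i t
        using that c(2) cd s(1) ss unfolding collar_data_def c2_def by (cases i) auto
      show "(\<Sum>i\<in>I <+> UNIV. u2 i * (f (c2 i 1) - f (c2 i 0))) = 0" for f :: "pt \<Rightarrow> real"
        using sP[of "\<lambda>c c'. f (c 1) - f (c 0)"] chain[of f] cd by (simp add: collar_data_def)
      fix x assume x: "x \<notin> Om"
      have "(\<Sum>i\<in>I <+> UNIV. u2 i * ang_int (c2 i) (d2 i) x) = (\<Sum>i\<in>I. u i * ang_int (c i) (c' i) x)
       - (\<Sum>j\<in>UNIV. m j * w j * (if x \<in> closure (Hs j) then 2 * pi * w j else 0))"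
      proof -
        have "ang_int (\<lambda>t. gam j t + s *\<^sub>R V j t) (\<lambda>t. v j t + s *\<^sub>R V' j t) x = (if x \<in> closure (Hs j) then 2 * pi * w j else 0)" for j
          using cd[of j] s(1) ss[of j] x unfolding collar_data_def by blast
        then show ?thesis using sP[of "\<lambda>c c'. ang_int c c' x"] by (simp only:)
      qed
      also have "\<dots> = 0"
      proof (cases "x \<in> Om0")
        case False
        then have "x \<notin> closure (Hs j)" for j using sub by blast
        then show ?thesis using wind(2)[OF False] by simp
      next
        case True
        then obtain l where l: "x \<in> closure (Hs l)" using outside_cases[OF x] by blast
        have eq: "(x \<in> closure (Hs j)) = (j = l)" for j using l disj[of j l] by blast
        have "w l * w l = 1" using cd[of l] by (simp add: collar_data_def)
        then have "real_of_int (w l) * real_of_int (w l) = 1" by (metis of_int_1 of_int_mult)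
        then show ?thesis using wind(1)[OF l] unfolding eq by (simp add: if_distrib sum.delta cong: if_cong)
      qed
      finally show "(\<Sum>i\<in>I <+> UNIV. u2 i * integral {0..1} (\<lambda>t. (fst (c2 i t - x) * snd (d2 i t) - snd (c2 i t - x) * fst (d2 i t)) / sqn (c2 i t - x))) = 0"
        by (simp add: ang_int_def)
    qed
    then show ?thesis using sP[of "line_int E1 E2"] by (simp add: line_int_def)
  qed
  have "((\<lambda>s. \<Sum>j\<in>UNIV. m j * w j * ?J s j) \<longlongrightarrow> (\<Sum>j\<in>UNIV. m j * w j * circulation (Hs j) (\<lambda>x. (E1 x, E2 x)))) (at_right 0)"
    by (intro tendsto_sum tendsto_mult tendsto_const collar_limit[OF cd E(4,5)])
  moreover have "\<forall>\<^sub>F s in at_right 0. (\<Sum>j\<in>UNIV. m j * w j * ?J s j) = ?S"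
    unfolding eventually_at_right_field using sm main by (intro exI[of _ sm]) auto
  ultimately have "((\<lambda>s. ?S) \<longlongrightarrow> (\<Sum>j\<in>UNIV. m j * w j * circulation (Hs j) (\<lambda>x. (E1 x, E2 x)))) (at_right (0::real))"
    using tendsto_cong by force
  then have "?S = (\<Sum>j\<in>UNIV. m j * w j * circulation (Hs j) (\<lambda>x. (E1 x, E2 x)))"
    by (intro tendsto_unique[OF _ tendsto_const]) auto
  then show thesis using that by blast
qed

text \<open>A polygon-like loop through three curves has integer winding numbers, so changing the path of
  integration changes the primitive of \<open>E\<close> by an integer combination of the circulations.\<close>
lemma gauge:
  assumes E: "\<And>x. x \<in> Om \<Longrightarrow> has_grad E1 (a11 x) (a12 x) x" "\<And>x. x \<in> Om \<Longrightarrow> has_grad E2 (a12 x) (a22 x) x"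
      "continuous_on Om a12" "continuous_on (closure Om) E1" "continuous_on (closure Om) E2"
    and h: "h > 0" and circ: "\<And>j. \<exists>n::int. circulation (Hs j) (\<lambda>x. (E1 x, E2 x)) = 2 * pi * h * n"
  obtains g :: "pt \<Rightarrow> complex" where "\<And>x. x \<in> Om \<Longrightarrow> cmod (g x) = 1"
    "\<And>x. x \<in> Om \<Longrightarrow> has_grad g (\<i> * of_real (E1 x / h) * g x) (\<i> * of_real (E2 x / h) * g x) x"
proof (cases "Om = {}")
  case True then show ?thesis using that by auto
next
  case False
  then obtain x0 where x0: "x0 \<in> Om" by blast
  define ok where "ok x p p' \<longleftrightarrow> (\<forall>t. (p has_vector_derivative p' t) (at t)) \<and> continuous_on UNIV p' \<and> p 0 = x0 \<and> p 1 = x \<and> (\<forall>t\<in>{0..1}. p t \<in> Om)"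
    for x :: pt and p p'
  have "\<exists>p p'. ok x p p'" if x: "x \<in> Om" for x
  proof -
    \<comment> \<open>Polynomial paths are C^1, so each path is a single admissible member of a
      chain.\<close>
    obtain p where p: "polynomial_function p" "path_image p \<subseteq> Om" "pathstart p = x0" "pathfinish p = x"
      using connected_open_polynomial_connected[OF open_Om conn x0 x] by blast
    obtain p' where p': "polynomial_function p'" "\<And>t. (p has_vector_derivative p' t) (at t)"
      using has_vector_derivative_polynomial_function[OF p(1)] by blast
    show ?thesis using p p' continuous_on_polymonial_function[OF p'(1)]
      by (intro exI[of _ p] exI[of _ p']) (auto simp: ok_def pathstart_def pathfinish_def path_image_def)
  qed
  then obtain p p' where "\<And>x. x \<in> Om \<Longrightarrow> ok x (p x) (p' x)" by metis
  then have p: "\<And>x t. x \<in> Om \<Longrightarrow> (p x has_vector_derivative p' x t) (at t)" "\<And>x. x \<in> Om \<Longrightarrow> continuous_on UNIV (p' x)"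
    "\<And>x. x \<in> Om \<Longrightarrow> p x 0 = x0" "\<And>x. x \<in> Om \<Longrightarrow> p x 1 = x" "\<And>x t. x \<in> Om \<Longrightarrow> t \<in> {0..1} \<Longrightarrow> p x t \<in> Om"
    unfolding ok_def by blast+
  define \<Theta> where "\<Theta> x = line_int E1 E2 (p x) (p' x)" for x
  define lp where "lp x y t = x + t *\<^sub>R (y - x)" for x y :: pt and t :: real
  have lp: "(lp x y has_vector_derivative (y - x)) (at t)" "lp x y 0 = x" "lp x y 1 = y" for x y t
    unfolding lp_def by (auto intro!: derivative_eq_intros)
  have step: "\<exists>n::int. \<Theta> x + line_int E1 E2 (lp x y) (\<lambda>_. y - x) - \<Theta> y = 2 * pi * h * n"
    if xy: "x \<in> Om" "y \<in> Om" "closed_segment x y \<subseteq> Om" for x y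
  proof -
    have lin: "lp x y t \<in> Om" if "t \<in> {0..1}" for t
    proof -
      have "lp x y t = (1 - t) *\<^sub>R x + t *\<^sub>R y" by (simp add: lp_def algebra_simps)
      then show ?thesis using xy(3) that unfolding closed_segment_def by auto
    qed
    let ?p1 = "\<lambda>t. toC (p x t)" and ?p2 = "\<lambda>t. toC (lp x y t)" and ?p3 = "\<lambda>t. toC (p y t)"
    \<comment> \<open>The closed loop through x and y, used for the integrality of winding numbers;
      the chain handed to \<open>period\<close> consists of the three C^1 curves separately, the
      last with weight -1.\<close>
    let ?P = "?p1 +++ (?p2 +++ reversepath ?p3)"
    have vp: "valid_path ?p1" "valid_path ?p2" "valid_path ?p3"
      using C1_curve_valid_path[OF p(1,2)[OF xy(1)]] C1_curve_valid_path[OF lp(1) continuous_on_const] C1_curve_valid_path[OF p(1,2)[OF xy(2)]] by blast+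
    have ends: "pathstart ?p1 = toC x0" "pathfinish ?p1 = toC x" "pathstart ?p2 = toC x" "pathfinish ?p2 = toC y"
      "pathstart ?p3 = toC x0" "pathfinish ?p3 = toC y"
      using p(3,4) xy lp by (auto simp: pathstart_def pathfinish_def)
    have vr: "valid_path (reversepath ?p3)" using vp(3) by simp
    have v23: "valid_path (?p2 +++ reversepath ?p3)" using vp(2) vr ends by (intro valid_path_join) auto
    have vP: "valid_path ?P" using vp(1) v23 ends by (intro valid_path_join) auto
    have cl: "pathfinish ?P = pathstart ?P" using ends by simp
    have pimg: "path_image (\<lambda>t. toC (c t)) = toC ` c ` {0..1}" for c by (simp add: path_image_def image_image)
    have pis: "path_image ?p1 \<subseteq> toC ` Om" "path_image ?p2 \<subseteq> toC ` Om" "path_image ?p3 \<subseteq> toC ` Om"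
      unfolding pimg using p(5) xy lin by blast+
    then have pi: "path_image ?P \<subseteq> toC ` Om" using ends by (auto simp: path_image_join)
    have W: "ang_int (p x) (p' x) z + ang_int (lp x y) (\<lambda>_. y - x) z - ang_int (p y) (p' y) z = 2 * pi * Re (winding_number ?P (toC z))"
      if z: "z \<notin> Om" for z
    proof -
      have nz: "p x t \<noteq> z" "lp x y t \<noteq> z" "p y t \<noteq> z" if "t \<in> {0..1}" for t
        using p(5)[OF xy(1) that] p(5)[OF xy(2) that] lin[OF that] z by auto
      let ?f = "\<lambda>w. 1 / (w - toC z)"
      note i1 = Im_contour_ang[OF p(1,2)[OF xy(1)] nz(1)]
      note i2 = Im_contour_ang[OF lp(1)[of x y] continuous_on_const nz(2)]
      note i3 = Im_contour_ang[OF p(1,2)[OF xy(2)] nz(3)]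
      have r: "?f contour_integrable_on reversepath ?p3" using i3(2) vp(3) by (simp add: contour_integrable_reversepath_eq)
      have "contour_integral ?P ?f = contour_integral ?p1 ?f + (contour_integral ?p2 ?f - contour_integral ?p3 ?f)"
      proof -
        have "contour_integral (?p2 +++ reversepath ?p3) ?f = contour_integral ?p2 ?f + contour_integral (reversepath ?p3) ?f"
          by (rule contour_integral_join[OF i2(2) r vp(2) vr])
        moreover have "contour_integral (reversepath ?p3) ?f = - contour_integral ?p3 ?f"
          by (rule contour_integral_reversepath[OF vp(3)])
        moreover have "contour_integral ?P ?f = contour_integral ?p1 ?f + contour_integral (?p2 +++ reversepath ?p3) ?f"
          by (rule contour_integral_join[OF i1(2) contour_integrable_joinI[OF i2(2) r vp(2) vr] vp(1) v23])
        ultimately show ?thesis by simp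
      qed
      then have "Im (contour_integral ?P ?f) = ang_int (p x) (p' x) z + ang_int (lp x y) (\<lambda>_. y - x) z - ang_int (p y) (p' y) z"
        using i1(1) i2(1) i3(1) by simp
      moreover have "toC z \<notin> path_image ?P" using pi z by (meson subsetD toC_mem)
      ultimately show ?thesis using Re_winding_number[OF vP] by metis
    qed
    have "\<exists>m::int. \<forall>z\<in>closure (Hs l). winding_number ?P (toC z) = of_int m" for l
    proof -
      obtain a where a: "a \<in> closure (Hs l)" using DH[of l] unfolding smooth_sc_domain_def by (metis closure_eq_empty ex_in_conv)
      then have "a \<notin> Om" unfolding Om by blast
      then have "toC a \<notin> path_image ?P" using pi by (meson subsetD toC_mem)
      then have "winding_number ?P (toC a) \<in> \<int>"
        using integer_winding_number[OF valid_path_imp_path[OF vP] cl] by blast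
      then obtain m :: int where ma: "winding_number ?P (toC a) = of_int m" by (rule Ints_cases)
      have "winding_number ?P (toC z) = of_int m" if "z \<in> closure (Hs l)" for z
        using winding_const_hole[OF valid_path_imp_path[OF vP] cl pi that a] ma by (rule trans)
      then show ?thesis by (intro exI[of _ m] ballI)
    qed
    then obtain m :: "'k \<Rightarrow> int" where m: "\<And>l z. z \<in> closure (Hs l) \<Longrightarrow> winding_number ?P (toC z) = of_int (m l)" by metis
    define c where "c i = (if i = (0::nat) then p x else if i = 1 then lp x y else p y)" for i
    define c' where "c' i = (if i = (0::nat) then p' x else if i = 1 then (\<lambda>_. y - x) else p' y)" for i
    define u where "u i = (if i = (2::nat) then -1 else 1 :: real)" for i
    have S: "(\<Sum>i\<in>{0,1,2}. u i * F (c i) (c' i)) = F (p x) (p' x) + F (lp x y) (\<lambda>_. y - x) - F (p y) (p' y)" for F :: "(real \<Rightarrow> pt) \<Rightarrow> (real \<Rightarrow> pt) \<Rightarrow> real"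
      by (simp add: u_def c_def c'_def)
    have "\<exists>w :: 'k \<Rightarrow> int. (\<Sum>i\<in>{0,1,2}. u i * line_int E1 E2 (c i) (c' i)) = (\<Sum>j\<in>UNIV. m j * w j * circulation (Hs j) (\<lambda>x. (E1 x, E2 x)))"
    proof (rule period[OF E, of "{0,1,2}" c c' u m])
      show "C1_curve (c i) (c' i)" if "i \<in> {0,1,2}" for i
        unfolding c_def c'_def using C1_curveI[OF p(1,2)[OF xy(1)]] C1_curveI[OF p(1,2)[OF xy(2)]] C1_curveI[OF lp(1) continuous_on_const] by auto
      show "c i t \<in> Om" if "i \<in> {0,1,2}" "t \<in> {0..1}" for i t
        unfolding c_def using p(5) xy lin that by auto
      show "(\<Sum>i\<in>{0,1,2}. u i * (f (c i 1) - f (c i 0))) = 0" for f :: "pt \<Rightarrow> real"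
        using S[of "\<lambda>c c'. f (c 1) - f (c 0)"] p(3,4) xy lp(2,3) by simp
      show "(\<Sum>i\<in>{0,1,2}. u i * ang_int (c i) (c' i) z) = 2 * pi * m l" if z: "z \<in> closure (Hs l)" for l z
      proof -
        have "z \<notin> Om" using z unfolding Om by blast
        then show ?thesis using S[of "\<lambda>c c'. ang_int c c' z"] W m[OF z] by simp
      qed
      show "(\<Sum>i\<in>{0,1,2}. u i * ang_int (c i) (c' i) z) = 0" if z: "z \<notin> Om0" for z
      proof -
        have "z \<notin> Om" using z unfolding Om by blast
        then show ?thesis using S[of "\<lambda>c c'. ang_int c c' z"] W winding_off_Om0[OF valid_path_imp_path[OF vP] cl pi z] by simp
      qed
    qed (auto intro: exI)
    then obtain w :: "'k \<Rightarrow> int" where w: "\<Theta> x + line_int E1 E2 (lp x y) (\<lambda>_. y - x) - \<Theta> y = (\<Sum>j\<in>UNIV. m j * w j * circulation (Hs j) (\<lambda>x. (E1 x, E2 x)))"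
      unfolding \<Theta>_def S[of "line_int E1 E2"] by blast
    obtain n :: "'k \<Rightarrow> int" where "\<And>j. circulation (Hs j) (\<lambda>x. (E1 x, E2 x)) = 2 * pi * h * n j" using circ by metis
    then have "\<Theta> x + line_int E1 E2 (lp x y) (\<lambda>_. y - x) - \<Theta> y = 2 * pi * h * of_int (\<Sum>j\<in>UNIV. m j * w j * n j)"
      unfolding w by (simp add: sum_distrib_left mult_ac)
    then show ?thesis by blast
  qed
  \<comment> \<open>\<open>\<Theta>\<close> need not be continuous, since paths are chosen point by
    point; by \<open>step\<close> it differs from a local primitive by multiples of 2 pi h, which
    the exponential ignores.\<close>
  define g where "g x = exp (\<i> * of_real (\<Theta> x / h))" for x
  have "cmod (g x) = 1" for x by (simp add: g_def)
  moreover have "has_grad g (\<i> * of_real (E1 x / h) * g x) (\<i> * of_real (E2 x / h) * g x) x" if x: "x \<in> Om" for x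
  proof -
    obtain r where r: "r > 0" "ball x r \<subseteq> Om" using open_Om x open_contains_ball by blast
    define L where "L y = line_int E1 E2 (lp x y) (\<lambda>_. y - x)" for y
    have cE: "isCont E1 x" "isCont E2 x" using E(1,2)[OF x] has_grad_isCont by blast+
    have cEO: "continuous_on Om E1" "continuous_on Om E2"
      by (rule continuous_on_subset[OF E(4) closure_subset], rule continuous_on_subset[OF E(5) closure_subset])
    \<comment> \<open>The integral along segments from x is a local primitive to first order at x:
      only continuity of the form at the centre enters the estimate.\<close>
    have L: "(L has_derivative (\<lambda>v. fst v *\<^sub>R E1 x + snd v *\<^sub>R E2 x)) (at x)"
      unfolding has_derivative_at_alt
    proof (intro conjI allI impI)
      show "bounded_linear (\<lambda>v. fst v *\<^sub>R E1 x + snd v *\<^sub>R E2 x)"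
        by (intro bounded_linear_add bounded_linear_compose[OF bounded_linear_scaleR_left] bounded_linear_fst bounded_linear_snd)
      fix e :: real assume e: "e > 0"
      then have e2: "e / 2 > 0" by simp
      obtain d1 where d1: "d1 > 0" "\<And>y. dist y x < d1 \<Longrightarrow> dist (E1 y) (E1 x) < e/2"
        using cE(1)[unfolded continuous_at_eps_delta, rule_format, OF e2] by blast
      obtain d2 where d2: "d2 > 0" "\<And>y. dist y x < d2 \<Longrightarrow> dist (E2 y) (E2 x) < e/2"
        using cE(2)[unfolded continuous_at_eps_delta, rule_format, OF e2] by blast
      note d = d1 d2
      show "\<exists>d>0. \<forall>y. norm (y - x) < d \<longrightarrow> norm (L y - L x - (fst (y - x) *\<^sub>R E1 x + snd (y - x) *\<^sub>R E2 x)) \<le> e * norm (y - x)"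
      proof (intro exI[of _ "min r (min d1 d2)"] conjI allI impI)
        fix y assume y: "norm (y - x) < min r (min d1 d2)"
        have dl: "dist (lp x y t) x \<le> norm (y - x)" if "t \<in> {0..1}" for t
          using that by (simp add: lp_def dist_norm mult_left_le_one_le)
        have lO: "lp x y t \<in> Om" if "t \<in> {0..1}" for t using dl[OF that] y r(2) by (auto simp: dist_commute)
        have cl: "continuous_on {0..1} (lp x y)" unfolding lp_def by (intro continuous_intros)
        have im: "lp x y ` {0..1} \<subseteq> Om" using lO by blast
        let ?F = "\<lambda>t. E1 (lp x y t) * fst (y - x) + E2 (lp x y t) * snd (y - x)"
        have iF: "?F integrable_on {0..1}"
          by (intro integrable_continuous_real continuous_on_add continuous_on_mult continuous_on_const
            continuous_on_compose2[OF cEO(1) cl im] continuous_on_compose2[OF cEO(2) cl im])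
        have "L x = 0" by (simp add: L_def line_int_def)
        moreover have "L y - (fst (y - x) *\<^sub>R E1 x + snd (y - x) *\<^sub>R E2 x) = integral {0..1} (\<lambda>t. ?F t - (fst (y - x) * E1 x + snd (y - x) * E2 x))"
          using iF by (subst Henstock_Kurzweil_Integration.integral_diff) (auto simp: L_def line_int_def)
        moreover have "norm (integral {0..1} (\<lambda>t. ?F t - (fst (y - x) * E1 x + snd (y - x) * E2 x))) \<le> integral {0..1} (\<lambda>t::real. e * norm (y - x))"
        proof (rule integral_norm_bound_integral)
          show "(\<lambda>t. ?F t - (fst (y - x) * E1 x + snd (y - x) * E2 x)) integrable_on {0..1}"
            by (intro integrable_diff iF) auto
          fix t :: real assume t: "t \<in> {0..1}"
          have l: "\<bar>E1 (lp x y t) - E1 x\<bar> \<le> e/2" "\<bar>E2 (lp x y t) - E2 x\<bar> \<le> e/2"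
            using d(2)[of "lp x y t"] d(4)[of "lp x y t"] dl[OF t] y by (auto simp: dist_real_def)
          have "?F t - (fst (y - x) * E1 x + snd (y - x) * E2 x) = (E1 (lp x y t) - E1 x) * fst (y - x) + (E2 (lp x y t) - E2 x) * snd (y - x)"
            by (simp add: algebra_simps)
          also have "norm \<dots> \<le> \<bar>E1 (lp x y t) - E1 x\<bar> * \<bar>fst (y - x)\<bar> + \<bar>E2 (lp x y t) - E2 x\<bar> * \<bar>snd (y - x)\<bar>"
            unfolding real_norm_def by (metis abs_mult abs_triangle_ineq)
          also have "\<dots> \<le> e/2 * norm (y - x) + e/2 * norm (y - x)"
          proof -
            have "\<bar>fst (y - x)\<bar> \<le> norm (y - x)" "\<bar>snd (y - x)\<bar> \<le> norm (y - x)"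
              using norm_fst_le[of "fst (y - x)" "snd (y - x)"] norm_snd_le[of "snd (y - x)" "fst (y - x)"] by (simp_all only: prod.collapse real_norm_def)
            then show ?thesis using l e2 by (intro add_mono mult_mono) linarith+
          qed
          finally show "norm (?F t - (fst (y - x) * E1 x + snd (y - x) * E2 x)) \<le> e * norm (y - x)" by simp
        qed auto
        ultimately show "norm (L y - L x - (fst (y - x) *\<^sub>R E1 x + snd (y - x) *\<^sub>R E2 x)) \<le> e * norm (y - x)" by simp
      qed (use r d in auto)
    qed
    have geq: "g x * exp (\<i> * of_real (L y / h)) = g y" if y: "y \<in> ball x r" for y
    proof -
      have "closed_segment x y \<subseteq> Om"
        using r y by (meson centre_in_ball closed_segment_subset convex_ball order_trans)
      then obtain n :: int where n: "\<Theta> x + L y - \<Theta> y = 2 * pi * h * n"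
        using step[OF x, of y] y r(2) unfolding L_def by blast
      then have "\<Theta> x / h + L y / h = \<Theta> y / h + 2 * pi * n" using h by (simp add: field_simps)
      then have ex: "\<i> * of_real (\<Theta> x / h) + \<i> * of_real (L y / h) = \<i> * of_real (\<Theta> y / h) + \<i> * (of_int n * (of_real pi * 2))"
      proof -
        assume "\<Theta> x / h + L y / h = \<Theta> y / h + 2 * pi * n"
        then have "\<i> * of_real (\<Theta> x / h + L y / h) = \<i> * of_real (\<Theta> y / h + 2 * pi * n)" by (simp only:)
        then show ?thesis by (simp only: of_real_add distrib_left of_real_mult of_real_of_int_eq of_real_numeral mult_ac)
      qed
      show ?thesis unfolding g_def exp_add[symmetric] ex by (rule exp_plus_2pin)
    qed
    have hL: "has_grad L (E1 x) (E2 x) x" using L by (simp add: has_grad_def)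
    have "((\<lambda>s. exp (\<i> * of_real (s / h))) has_vector_derivative (\<i> * of_real (1 / h) * exp (\<i> * of_real (s / h)))) (at s)" for s
    proof -
      have "((\<lambda>s. s / h) has_vector_derivative 1 / h) (at s)"
        unfolding has_real_derivative_iff_has_vector_derivative[symmetric] by (rule DERIV_cdivide) simp
      then have "((\<lambda>s. \<i> * of_real (s / h)) has_vector_derivative \<i> * of_real (1 / h)) (at s)"
        by (intro has_vector_derivative_mult_right has_vector_derivative_of_real)
          (simp add: has_real_derivative_iff_has_vector_derivative)
      from field_vector_diff_chain_at[OF this DERIV_exp] show ?thesis by (simp only: o_def)
    qed
    from has_grad_compose[OF hL this]
    have "has_grad (\<lambda>y. exp (\<i> * of_real (L y / h))) (E1 x *\<^sub>R (\<i> * of_real (1 / h) * exp (\<i> * of_real (L x / h)))) (E2 x *\<^sub>R (\<i> * of_real (1 / h) * exp (\<i> * of_real (L x / h)))) x" .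
    moreover have "L x = 0" by (simp add: L_def line_int_def)
    ultimately have "has_grad (\<lambda>y. g x * exp (\<i> * of_real (L y / h))) (\<i> * of_real (E1 x / h) * g x) (\<i> * of_real (E2 x / h) * g x) x"
      using has_grad_mult[OF has_grad_const[of "g x"]] by (fastforce simp: scaleR_conv_of_real mult_ac)
    then show ?thesis by (rule has_grad_transform[of _ _ _ _ "ball x r"]) (use r geq in auto)
  qed
  ultimately show thesis using that by blast
qed

end

section \<open>The Wirtinger derivative\<close>

text \<open>\<open>Cinf\<close> supplies iterated partial derivatives, but their symmetry has to be
  proved: f(b,y) - f(a,y) is an integral of f1, which is differentiated in y under the integral sign
  and then in b.\<close>

lemma schwarz:
  fixes f :: "pt \<Rightarrow> real"
  assumes f: "\<And>x. has_grad f (f1 x) (f2 x) x" "\<And>x. has_grad f1 (f11 x) (f12 x) x" "\<And>x. has_grad f2 (f21 x) (f22 x) x"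
    and c: "continuous_on UNIV f12"
  shows "f21 x = f12 x"
proof -
  obtain p q where x: "x = (p, q)" by (cases x)
  \<comment> \<open>A base point to the left of \<open>p\<close>, so that \<open>p\<close> is
    interior to the range of b in which the formula holds.\<close>
  define a where "a = p - 1"
  have grad_snd: "has_grad (\<lambda>z. k (t, snd z)) 0 (k2 (t, snd z)) z" if "\<And>x. has_grad k (k1 x) (k2 x) x"
    for k k1 k2 :: "pt \<Rightarrow> real" and t z
    using has_grad_compose[OF has_grad_snd has_grad_slice2[OF that]] by simp
  have eq: "f2 (b, q) - f2 (a, q) = integral {a..b} (\<lambda>t. f12 (t, q))" if ab: "a \<le> b" for b
  proof -
    have ftc: "integral {a..b} (\<lambda>t. f1 (t, y)) = f (b, y) - f (a, y)" for y
      by (rule integral_unique, rule fundamental_theorem_of_calculus[OF ab, where f="\<lambda>t. f (t, y)"]) (rule has_grad_slice1[OF f(1)])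
    have c1: "continuous_on UNIV f1" using has_grad_isCont[OF f(2)] by (blast intro: continuous_at_imp_continuous_on)
    have "has_grad (\<lambda>z. integral (cbox a b) (\<lambda>t. f1 (t, snd z))) (integral (cbox a b) (\<lambda>t. 0)) (integral (cbox a b) (\<lambda>t. f12 (t, snd ((0, q) :: pt)))) (0, q)"
    proof (rule has_grad_integral[where a=a and b=b and x="(0, q)" and f="\<lambda>z t. f1 (t, snd z)" and p="\<lambda>_ _. 0" and q="\<lambda>z t. f12 (t, snd z)"])
      show "has_grad (\<lambda>z. f1 (t, snd z)) 0 (f12 (t, snd z)) z" for z :: pt and t by (rule grad_snd[OF f(2)])
      show "continuous_on (cbox a b) (\<lambda>t. f1 (t, snd z))" for z :: pt
        by (intro continuous_on_compose2[OF c1] continuous_intros) simp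
      show "continuous_on (UNIV \<times> cbox a b) (\<lambda>z :: pt \<times> real. f12 (snd z, snd (fst z)))"
        by (intro continuous_on_compose2[OF c] continuous_intros) simp
    qed (intro continuous_intros)
    then have 1: "has_grad (\<lambda>z. f (b, snd z) - f (a, snd z)) (integral (cbox a b) (\<lambda>t. 0)) (integral {a..b} (\<lambda>t. f12 (t, q))) (0, q)"
      using ftc by (simp add: cbox_interval)
    have "has_grad (\<lambda>z. f (b, snd z) - f (a, snd z)) (0 - 0) (f2 (b, snd ((0, q) :: pt)) - f2 (a, snd ((0, q) :: pt))) (0, q)"
      by (intro has_grad_diff grad_snd[OF f(1)])
    from has_grad_unique(2)[OF this 1] show ?thesis by simp
  qed
  have "((\<lambda>b. integral {a..b} (\<lambda>t. f12 (t, q))) has_vector_derivative f12 (p, q)) (at p within {a..p + 1})"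
    by (rule integral_has_vector_derivative) (auto simp: a_def intro!: continuous_on_compose2[OF c] continuous_intros)
  then have "((\<lambda>b. integral {a..b} (\<lambda>t. f12 (t, q))) has_vector_derivative f12 (p, q)) (at p within {a<..<p + 1})"
    by (rule has_vector_derivative_within_subset) auto
  then have "((\<lambda>b. f2 (b, q) - f2 (a, q)) has_vector_derivative f12 (p, q)) (at p within {a<..<p + 1})"
    by (rule has_vector_derivative_transform[rotated 2]) (use eq in \<open>auto simp: a_def\<close>)
  then have "((\<lambda>b. f2 (b, q) - f2 (a, q)) has_vector_derivative f12 (p, q)) (at p)"
    by (subst (asm) has_vector_derivative_within_open) (auto simp: a_def)
  moreover have "((\<lambda>b. f2 (b, q) - f2 (a, q)) has_vector_derivative (f21 (p, q) - 0)) (at p)"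
    by (intro has_vector_derivative_diff has_grad_slice1[OF f(3)] has_vector_derivative_const)
  ultimately show ?thesis using vector_derivative_unique_at x by fastforce
qed

lemma has_grad_extend_zero:
  fixes g :: "pt \<Rightarrow> 'b::real_normed_vector"
  assumes "open S" "closed K" "K \<subseteq> S" "\<And>x. x \<in> S \<Longrightarrow> x \<notin> K \<Longrightarrow> g x = 0" "\<And>x. x \<in> S \<Longrightarrow> has_grad g (a x) (b x) x"
  shows "has_grad (\<lambda>x. if x \<in> S then g x else 0) (if x \<in> S then a x else 0) (if x \<in> S then b x else 0) x"
    "x \<in> S \<Longrightarrow> x \<notin> K \<Longrightarrow> a x = 0" "x \<in> S \<Longrightarrow> x \<notin> K \<Longrightarrow> b x = 0"
proof -
  let ?g = "\<lambda>x. if x \<in> S then g x else 0"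
  have in_S: "has_grad ?g (a x) (b x) x" if "x \<in> S"
    by (rule has_grad_transform[OF assms(5)[OF that] assms(1) that]) auto
  have off_K: "has_grad ?g 0 0 x" if "x \<notin> K"
    by (rule has_grad_zero_outside[OF assms(2) that]) (use assms(4) in auto)
  show "has_grad ?g (if x \<in> S then a x else 0) (if x \<in> S then b x else 0) x"
    using in_S off_K assms(3) by auto
  show "a x = 0" "b x = 0" if "x \<in> S" "x \<notin> K" using has_grad_unique[OF in_S off_K] that by auto
qed

lemma curl_integral_zero:
  assumes S: "open S" "compact K" "K \<subseteq> S" and z: "\<And>x. x \<in> S \<Longrightarrow> x \<notin> K \<Longrightarrow> P x = 0 \<and> Q x = 0"
    and g: "\<And>x. x \<in> S \<Longrightarrow> has_grad P (p1 x) (p2 x) x" "\<And>x. x \<in> S \<Longrightarrow> has_grad Q (q1 x) (q2 x) x"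
    and c: "continuous_on S p2" "continuous_on S q1"
  shows "integrable (restrict_space lborel S) (\<lambda>x. q1 x - p2 x)" "(\<integral>x. q1 x - p2 x \<partial>restrict_space lborel S) = (0::real)"
proof -
  let ?e = "\<lambda>g x. if x \<in> S then g x else (0::real)"
  note K = compact_imp_closed[OF S(2)]
  note EP = has_grad_extend_zero[OF S(1) K S(3), of P p1 p2, OF conjunct1[OF z] g(1)]
  note EQ = has_grad_extend_zero[OF S(1) K S(3), of Q q1 q2, OF conjunct2[OF z] g(2)]
  have cP: "continuous_on UNIV (?e p2)" by (rule continuous_on_extend_zero[OF S(1) K S(3) c(1)]) (use EP(3) in auto)
  have cQ: "continuous_on UNIV (?e q1)" by (rule continuous_on_extend_zero[OF S(1) K S(3) c(2)]) (use EQ(2) in auto)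
  have P: "integrable lborel (?e p2)" "integral\<^sup>L lborel (?e p2) = 0"
    by (rule ibp_slice2[of "?e P", OF has_grad_slice2[OF EP(1)] cP S(2)]; use z in auto)+
  have Q: "integrable lborel (?e q1)" "integral\<^sup>L lborel (?e q1) = 0"
    by (rule ibp_slice1[of "?e Q", OF has_grad_slice1[OF EQ(1)] cQ S(2)]; use z in auto)+
  have e: "(\<lambda>x. indicator S x *\<^sub>R (q1 x - p2 x)) = (\<lambda>x. ?e q1 x - ?e p2 x)" by (auto simp: indicator_def)
  have i: "integrable lborel (\<lambda>x. ?e q1 x - ?e p2 x)" "integral\<^sup>L lborel (\<lambda>x. ?e q1 x - ?e p2 x) = 0"
    using P Q by simp_all
  show "integrable (restrict_space lborel S) (\<lambda>x. q1 x - p2 x)"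
    by (subst integrable_restrict_space) (use S(1) i(1) e in auto)
  show "(\<integral>x. q1 x - p2 x \<partial>restrict_space lborel S) = 0"
    by (subst integral_restrict_space) (use S(1) i(2) e in auto)
qed

lemma test_fun_mixed:
  fixes phi :: "pt \<Rightarrow> 'b::euclidean_space"
  assumes "test_fun S phi"
  obtains p11 p12 p22 where "\<And>x. has_grad (pd1 phi) (p11 x) (p12 x) x" "\<And>x. has_grad (pd2 phi) (p12 x) (p22 x) x"
    "continuous_on UNIV p12"
proof -
  have *: "has_grad f (pd1 f x) (pd2 f x) x" "continuous_on UNIV (pd2 f)" if f: "Cinf UNIV UNIV f" for f :: "pt \<Rightarrow> 'b" and x
  proof -
    obtain f1 f2 where g: "Cinf UNIV UNIV f2" "\<And>x. has_grad f (f1 x) (f2 x) x" by (rule CinfD[OF f]) blast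
    have e: "pd1 f = f1" "pd2 f = f2" using has_grad_pd[OF g(2)] by auto
    show "has_grad f (pd1 f x) (pd2 f x) x" unfolding e by (rule g(2))
    show "continuous_on UNIV (pd2 f)" unfolding e by (rule CinfD[OF g(1)])
  qed
  note t = test_fun_smooth[OF assms]
  have "pd1 (pd2 phi) x = pd2 (pd1 phi) x" for x
  proof (rule euclidean_eqI)
    fix b :: 'b assume "b \<in> Basis"
    have L: "bounded_linear (\<lambda>y. y \<bullet> b)" by (rule bounded_linear_inner_left)
    show "pd1 (pd2 phi) x \<bullet> b = pd2 (pd1 phi) x \<bullet> b"
      by (rule schwarz[of "\<lambda>x. phi x \<bullet> b" "\<lambda>x. pd1 phi x \<bullet> b" "\<lambda>x. pd2 phi x \<bullet> b" "\<lambda>x. pd1 (pd1 phi) x \<bullet> b" _ _ "\<lambda>x. pd2 (pd2 phi) x \<bullet> b",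
        OF has_grad_bounded_linear[OF t(1) L] has_grad_bounded_linear[OF *(1)[OF t(5)] L] has_grad_bounded_linear[OF *(1)[OF t(6)] L]
          bounded_linear.continuous_on[OF L *(2)[OF t(5)]]])
  qed
  then show ?thesis using that[OF *(1)[OF t(5)], of "pd2 (pd2 phi)"] *(1)[OF t(6)] *(2)[OF t(5)] by simp
qed

context
  fixes S :: "pt set" assumes S: "open S" "bounded S" "S \<noteq> {}"
begin

abbreviation "lbS \<equiv> restrict_space lborel S"

lemma unif_sq_tendsto:
  fixes f :: "nat \<Rightarrow> pt \<Rightarrow> real"
  assumes "\<And>n. sq_int lbS (f n)" "sq_int lbS g" "\<And>n x. \<bar>f n x - g x\<bar> \<le> c / real (Suc n)"
  shows "(\<lambda>n. nrm S (f n)) \<longlonglongrightarrow> nrm S g"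
proof -
  have fin: "finite_measure lbS" by (rule finite_measure_restrict[OF S(1,2)])
  have "(\<lambda>n. \<integral>x. (norm (f n x - g x))\<^sup>2 \<partial>lbS) \<longlonglongrightarrow> 0"
  proof (rule tendsto_sandwich[OF _ _ tendsto_const])
    have "(\<lambda>n. c\<^sup>2 * (inverse (real (Suc n)) * inverse (real (Suc n))) * measure lbS (space lbS)) \<longlonglongrightarrow> c\<^sup>2 * (0 * 0) * measure lbS (space lbS)"
      by (intro tendsto_intros LIMSEQ_inverse_real_of_nat)
    then show "(\<lambda>n. c\<^sup>2 * (inverse (real (Suc n)) * inverse (real (Suc n))) * measure lbS (space lbS)) \<longlonglongrightarrow> 0" by simp
    have "(\<integral>x. (norm (f n x - g x))\<^sup>2 \<partial>lbS) \<le> (\<integral>x. c\<^sup>2 * (inverse (real (Suc n)) * inverse (real (Suc n))) \<partial>lbS)" for n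
    proof (rule integral_mono)
      show "integrable lbS (\<lambda>x. (norm (f n x - g x))\<^sup>2)" using sq_intD(2)[OF sq_int_diff[OF assms(1,2)]] .
      show "integrable lbS (\<lambda>x. c\<^sup>2 * (inverse (real (Suc n)) * inverse (real (Suc n))))"
        using fin by (simp add: finite_measure.integrable_const)
      fix x show "(norm (f n x - g x))\<^sup>2 \<le> c\<^sup>2 * (inverse (real (Suc n)) * inverse (real (Suc n)))"
        using power_mono[OF assms(3)[of n x] abs_ge_zero, of 2] by (simp add: power_divide power2_eq_square divide_inverse algebra_simps)
    qed
    then show "\<forall>\<^sub>F n in sequentially. (\<integral>x. (norm (f n x - g x))\<^sup>2 \<partial>lbS) \<le> c\<^sup>2 * (inverse (real (Suc n)) * inverse (real (Suc n))) * measure lbS (space lbS)"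
      by (simp add: mult_ac)
  qed auto
  from sq_int_norm_tendsto(1)[OF assms(1,2) this, of "\<lambda>_. 1" 1] show ?thesis by (simp add: nrm_def[OF S])
qed

text \<open>Expanding the squares leaves the Dirichlet energies and a multiple of the Jacobian of
  (a, b), which integrates to zero because it is the curl of (a \<partial>1 b, a \<partial>2
  b).\<close>

lemma wirtinger_test:
  assumes "test_fun S a" "test_fun S b"
  shows "lamD S * (nrm S a + nrm S b) \<le> nrm S (\<lambda>x. pd1 a x - pd2 b x) + nrm S (\<lambda>x. pd2 a x + pd1 b x)"
proof -
  obtain b11 b12 b22 where b: "\<And>x. has_grad (pd1 b) (b11 x) (b12 x) x" "\<And>x. has_grad (pd2 b) (b12 x) (b22 x) x"
    "continuous_on UNIV b12" by (rule test_fun_mixed[OF assms(2)]) blast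
  obtain K where K: "compact K" "K \<subseteq> S" "\<And>x. x \<notin> K \<Longrightarrow> a x = 0 \<and> pd1 a x = 0 \<and> pd2 a x = 0"
    by (rule test_fun_support[OF assms(1)]) blast
  note ta = test_fun_smooth[OF assms(1)] note tb = test_fun_smooth[OF assms(2)]
  have z: "(\<integral>x. (pd1 a x * pd2 b x + a x * b12 x) - (pd2 a x * pd1 b x + a x * b12 x) \<partial>lbS) = 0"
  proof (rule curl_integral_zero(2)[OF S(1) K(1,2)])
    show "has_grad (\<lambda>x. a x * pd1 b x) (pd1 a x * pd1 b x + a x * b11 x) (pd2 a x * pd1 b x + a x * b12 x) x"
      "has_grad (\<lambda>x. a x * pd2 b x) (pd1 a x * pd2 b x + a x * b12 x) (pd2 a x * pd2 b x + a x * b22 x) x" for x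
      by (intro has_grad_mult ta b)+
    show "continuous_on S (\<lambda>x. pd2 a x * pd1 b x + a x * b12 x)" "continuous_on S (\<lambda>x. pd1 a x * pd2 b x + a x * b12 x)"
      by (intro continuous_intros continuous_on_subset[OF ta(2)] continuous_on_subset[OF ta(3)] continuous_on_subset[OF ta(4)]
        continuous_on_subset[OF tb(3)] continuous_on_subset[OF tb(4)] continuous_on_subset[OF b(3)] subset_UNIV)+
  qed (use K(3) in auto)
  note qa = test_fun_sq_int(1-3)[OF assms(1) S(1)] and qb = test_fun_sq_int(1-3)[OF assms(2) S(1)]
  have "(\<integral>x. pd1 a x * pd2 b x \<partial>lbS) = (\<integral>x. pd2 a x * pd1 b x \<partial>lbS)"
    using z by (simp add: Bochner_Integration.integral_diff[OF sq_int_mult[OF qa(2) qb(3)] sq_int_mult[OF qa(3) qb(2)]])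
  then have "nrm S (\<lambda>x. pd1 a x - pd2 b x) + nrm S (\<lambda>x. pd2 a x + pd1 b x) = energy S a + energy S b"
    using sq_int_quad[OF qa(2) qb(3), of 1 "-1"] sq_int_quad[OF qa(3) qb(2), of 1 1]
    unfolding energy_def[OF S] nrm_def[OF S] by simp
  then show ?thesis using lamD_rayleigh(2)[OF S assms(1)] lamD_rayleigh(2)[OF S assms(2)] by (simp add: algebra_simps)
qed

text \<open>Mollification with uniform error 1/(n+1) carries the inequality from test functions to
  C^1 functions: on a bounded set uniform convergence gives convergence of the L^2 norms.\<close>

lemma wirtinger:
  assumes K: "compact K" "K \<subseteq> S"
    and a: "\<And>x. has_grad a (a1 x) (a2 x) x" "continuous_on UNIV a1" "continuous_on UNIV a2" "\<And>x. x \<notin> K \<Longrightarrow> a x = 0"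
    and b: "\<And>x. has_grad b (b1 x) (b2 x) x" "continuous_on UNIV b1" "continuous_on UNIV b2" "\<And>x. x \<notin> K \<Longrightarrow> b x = 0"
  shows "lamD S * (nrm S a + nrm S b) \<le> nrm S (\<lambda>x. a1 x - b2 x) + nrm S (\<lambda>x. a2 x + b1 x)"
proof -
  have ex: "\<exists>phi. \<forall>n. test_fun S (phi n) \<and> (\<forall>x. \<bar>phi n x - f x\<bar> \<le> 1 / real (Suc n)) \<and>
      (\<forall>x. \<bar>pd1 (phi n) x - f1 x\<bar> \<le> 1 / real (Suc n)) \<and> (\<forall>x. \<bar>pd2 (phi n) x - f2 x\<bar> \<le> 1 / real (Suc n))"
    if f: "\<And>x. has_grad f (f1 x) (f2 x) x" "continuous_on UNIV f1" "continuous_on UNIV f2" "\<And>x. x \<notin> K \<Longrightarrow> f x = 0" for f f1 f2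
  proof (rule choice, rule allI)
    fix n :: nat
    show "\<exists>phi. test_fun S phi \<and> (\<forall>x. \<bar>phi x - f x\<bar> \<le> 1 / real (Suc n)) \<and>
      (\<forall>x. \<bar>pd1 phi x - f1 x\<bar> \<le> 1 / real (Suc n)) \<and> (\<forall>x. \<bar>pd2 phi x - f2 x\<bar> \<le> 1 / real (Suc n))"
      by (rule mollify[OF f(1-3) K f(4) S(1), of "1 / real (Suc n)"]) (assumption, simp, blast)
  qed
  obtain phi where phi: "\<And>n. test_fun S (phi n)" "\<And>n x. \<bar>phi n x - a x\<bar> \<le> 1 / real (Suc n)"
    "\<And>n x. \<bar>pd1 (phi n) x - a1 x\<bar> \<le> 1 / real (Suc n)" "\<And>n x. \<bar>pd2 (phi n) x - a2 x\<bar> \<le> 1 / real (Suc n)"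
    using ex[OF a] by blast
  obtain \<chi>' where \<chi>: "\<And>n. test_fun S (\<chi>' n)" "\<And>n x. \<bar>\<chi>' n x - b x\<bar> \<le> 1 / real (Suc n)"
    "\<And>n x. \<bar>pd1 (\<chi>' n) x - b1 x\<bar> \<le> 1 / real (Suc n)" "\<And>n x. \<bar>pd2 (\<chi>' n) x - b2 x\<bar> \<le> 1 / real (Suc n)"
    using ex[OF b] by blast
  have sq: "sq_int lbS f" "sq_int lbS f1" "sq_int lbS f2"
    if f: "\<And>x. has_grad f (f1 x) (f2 x) x" "continuous_on UNIV f1" "continuous_on UNIV f2" "\<And>x. x \<notin> K \<Longrightarrow> f x = 0" for f f1 f2 :: "pt \<Rightarrow> real"
  proof -
    have c: "continuous_on UNIV f" using has_grad_isCont[OF f(1)] by (blast intro: continuous_at_imp_continuous_on)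
    have "f1 x = 0" "f2 x = 0" if "x \<notin> K" for x
      using has_grad_unique[OF f(1) has_grad_zero_outside[OF compact_imp_closed[OF K(1)] that f(4)]] by auto
    then show "sq_int lbS f" "sq_int lbS f1" "sq_int lbS f2"
      using cont_compact_sq_int(1)[OF c K(1) f(4) S(1)] cont_compact_sq_int(1)[OF f(2) K(1) _ S(1)] cont_compact_sq_int(1)[OF f(3) K(1) _ S(1)] by blast+
  qed
  note qa = sq[OF a] and qb = sq[OF b]
  note qphi = test_fun_sq_int(1-3)[OF phi(1) S(1)] and q\<chi> = test_fun_sq_int(1-3)[OF \<chi>(1) S(1)]
  have l: "(\<lambda>n. nrm S (phi n)) \<longlonglongrightarrow> nrm S a" "(\<lambda>n. nrm S (\<chi>' n)) \<longlonglongrightarrow> nrm S b"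
    using unif_sq_tendsto[OF qphi(1) qa(1) phi(2)] unif_sq_tendsto[OF q\<chi>(1) qb(1) \<chi>(2)] by blast+
  have e: "\<bar>(p - q) - (r - s)\<bar> \<le> 2 / real (Suc n)" "\<bar>(p + q) - (r + s)\<bar> \<le> 2 / real (Suc n)"
    if "\<bar>p - r\<bar> \<le> 1 / real (Suc n)" "\<bar>q - s\<bar> \<le> 1 / real (Suc n)" for p q r s :: real and n
    using that by (auto simp: abs_le_iff field_simps)
  have l1: "(\<lambda>n. nrm S (\<lambda>x. pd1 (phi n) x - pd2 (\<chi>' n) x)) \<longlonglongrightarrow> nrm S (\<lambda>x. a1 x - b2 x)"
    by (rule unif_sq_tendsto[OF sq_int_diff[OF qphi(2) q\<chi>(3)] sq_int_diff[OF qa(2) qb(3)] e(1)[OF phi(3) \<chi>(4)]])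
  have l2: "(\<lambda>n. nrm S (\<lambda>x. pd2 (phi n) x + pd1 (\<chi>' n) x)) \<longlonglongrightarrow> nrm S (\<lambda>x. a2 x + b1 x)"
    by (rule unif_sq_tendsto[OF sq_int_add[OF qphi(3) q\<chi>(2)] sq_int_add[OF qa(3) qb(2)] e(2)[OF phi(4) \<chi>(3)]])
  show ?thesis
    by (rule tendsto_le[OF sequentially_bot tendsto_add[OF l1 l2] tendsto_mult[OF tendsto_const tendsto_add[OF l]]])
      (use wirtinger_test[OF phi(1) \<chi>(1)] in simp)
qed

end

section \<open>The magnetic form\<close>

text \<open>One component of (hD - A)u. The derivative \<open>g\<close> is a separate argument
  because members of \<open>H10\<close> carry their weak gradient as separate data.\<close>

definition mom :: "real \<Rightarrow> (pt \<Rightarrow> real) \<Rightarrow> (pt \<Rightarrow> complex) \<Rightarrow> (pt \<Rightarrow> complex) \<Rightarrow> pt \<Rightarrow> complex" where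
  "mom h A g u x = - \<i> * of_real h * g x - of_real (A x) * u x"

lemma test_fun_bounded_linear:
  assumes "test_fun S phi" "bounded_linear L"
  shows "test_fun S (\<lambda>x. L (phi x))"
proof -
  have "Cinf UNIV UNIV (\<lambda>x. L (phi x))"
  proof (rule CinfI_family)
    let ?F = "{\<lambda>x. L (f x) | f. Cinf UNIV UNIV f}"
    show "(\<lambda>x. L (phi x)) \<in> ?F" using assms(1) unfolding test_fun_def by blast
    fix g assume "g \<in> ?F"
    then obtain f where f: "g = (\<lambda>x. L (f x))" "Cinf UNIV UNIV f" by blast
    obtain f1 f2 where f12: "Cinf UNIV UNIV f1" "Cinf UNIV UNIV f2" "\<And>x. has_grad f (f1 x) (f2 x) x" by (rule CinfD[OF f(2)]) blast
    have "has_grad g (L (f1 x)) (L (f2 x)) x" for x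
      unfolding f(1) by (rule has_grad_bounded_linear[OF f12(3) assms(2)])
    then show "\<exists>h1\<in>?F. \<exists>h2\<in>?F. \<forall>x. has_grad g (h1 x) (h2 x) x"
      using f12(1,2) by (intro bexI[of _ "\<lambda>x. L (f1 x)"] bexI[of _ "\<lambda>x. L (f2 x)"]) blast+
  qed
  moreover have sub: "closure {x. L (phi x) \<noteq> 0} \<subseteq> closure {x. phi x \<noteq> 0}"
    using linear_0[OF bounded_linear.linear[OF assms(2)]] by (intro closure_mono) auto
  moreover have "compact (closure {x. L (phi x) \<noteq> 0})"
    using sub assms(1) bounded_subset[of "closure {x. phi x \<noteq> 0}"]
    by (auto simp: compact_eq_bounded_closed test_fun_def)
  ultimately show ?thesis using assms(1) unfolding test_fun_def by blast
qed

context
  fixes S :: "pt set" assumes S: "open S" "bounded S" "S \<noteq> {}"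
begin

abbreviation "lS \<equiv> restrict_space lborel S"

lemma space_lS: "space lS = S" by (simp add: space_restrict_space)

lemma cont_meas: "continuous_on S f \<Longrightarrow> f \<in> borel_measurable lS" for f :: "pt \<Rightarrow> real"
  using borel_measurable_continuous_on_restrict[of S f] by (simp add: measurable_def space_restrict_space sets_restrict_space)

lemma mom_sq_int:
  assumes g: "sq_int lS g" "sq_int lS u" and A: "continuous_on S A" "\<And>x. x \<in> S \<Longrightarrow> \<bar>A x\<bar> \<le> M"
  shows "sq_int lS (mom h A g u)"
    "(\<integral>x. (cmod (mom h A g u x))\<^sup>2 \<partial>lS) \<le> 2 * h\<^sup>2 * (\<integral>x. (cmod (g x))\<^sup>2 \<partial>lS) + 2 * M\<^sup>2 * (\<integral>x. (cmod (u x))\<^sup>2 \<partial>lS)"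
proof -
  note m[measurable] = sq_intD(1)[OF g(1)] sq_intD(1)[OF g(2)] cont_meas[OF A(1)]
  note i = sq_intD(2)[OF g(1)] sq_intD(2)[OF g(2)]
  have mm: "mom h A g u \<in> borel_measurable lS" unfolding mom_def[abs_def] by measurable
  have b: "(cmod (mom h A g u x))\<^sup>2 \<le> 2 * h\<^sup>2 * (cmod (g x))\<^sup>2 + 2 * M\<^sup>2 * (cmod (u x))\<^sup>2" if "x \<in> space lS" for x
  proof -
    have "(cmod (mom h A g u x))\<^sup>2 \<le> 2 * (cmod (- \<i> * of_real h * g x))\<^sup>2 + 2 * (cmod (of_real (A x) * u x))\<^sup>2"
      unfolding mom_def by (rule norm_diff_sq)
    also have "\<dots> = 2 * h\<^sup>2 * (cmod (g x))\<^sup>2 + 2 * (\<bar>A x\<bar>\<^sup>2 * (cmod (u x))\<^sup>2)"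
      by (simp add: norm_mult power_mult_distrib)
    also have "\<bar>A x\<bar>\<^sup>2 * (cmod (u x))\<^sup>2 \<le> M\<^sup>2 * (cmod (u x))\<^sup>2"
      using A(2) that by (intro mult_right_mono power_mono) (auto simp: space_lS)
    finally show ?thesis by (simp add: algebra_simps)
  qed
  have i2: "integrable lS (\<lambda>x. 2 * h\<^sup>2 * (cmod (g x))\<^sup>2 + 2 * M\<^sup>2 * (cmod (u x))\<^sup>2)" using i by simp
  have i3: "integrable lS (\<lambda>x. (cmod (mom h A g u x))\<^sup>2)"
  proof (rule Bochner_Integration.integrable_bound[OF i2])
    show "(\<lambda>x. (cmod (mom h A g u x))\<^sup>2) \<in> borel_measurable lS" using mm by measurable
    show "AE x in lS. norm ((cmod (mom h A g u x))\<^sup>2) \<le> norm (2 * h\<^sup>2 * (cmod (g x))\<^sup>2 + 2 * M\<^sup>2 * (cmod (u x))\<^sup>2)"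
      using b by (intro AE_I2) fastforce
  qed
  show "sq_int lS (mom h A g u)" using mm i3 by (simp add: sq_int_def)
  show "(\<integral>x. (cmod (mom h A g u x))\<^sup>2 \<partial>lS) \<le> 2 * h\<^sup>2 * (\<integral>x. (cmod (g x))\<^sup>2 \<partial>lS) + 2 * M\<^sup>2 * (\<integral>x. (cmod (u x))\<^sup>2 \<partial>lS)"
    using integral_mono[OF i3 i2 b] i by simp
qed

lemma wirtinger_complex:
  assumes K: "compact K" "K \<subseteq> S"
    and w: "\<And>x. has_grad w (w1 x) (w2 x) x" "continuous_on UNIV w1" "continuous_on UNIV w2" "\<And>x. x \<notin> K \<Longrightarrow> w x = 0"
  shows "lamD S * (\<integral>x. (cmod (w x))\<^sup>2 \<partial>lS) \<le> (\<integral>x. (cmod (w1 x + \<i> * w2 x))\<^sup>2 \<partial>lS)"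
    "integrable lS (\<lambda>x. (cmod (w x))\<^sup>2)" "integrable lS (\<lambda>x. (cmod (w1 x + \<i> * w2 x))\<^sup>2)"
proof -
  have c: "continuous_on UNIV w" using has_grad_isCont[OF w(1)] by (blast intro: continuous_at_imp_continuous_on)
  have z: "w1 x = 0" "w2 x = 0" if "x \<notin> K" for x
    using has_grad_unique[OF w(1) has_grad_zero_outside[OF compact_imp_closed[OF K(1)] that w(4)]] by auto
  have split: "integrable lS (\<lambda>x. (cmod (f x))\<^sup>2)" "(\<integral>x. (cmod (f x))\<^sup>2 \<partial>lS) = nrm S (\<lambda>x. Re (f x)) + nrm S (\<lambda>x. Im (f x))"
    if f: "continuous_on UNIV f" "\<And>x. x \<notin> K \<Longrightarrow> f x = 0" for f :: "pt \<Rightarrow> complex"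
  proof -
    have "sq_int lS (\<lambda>x. Re (f x))" "sq_int lS (\<lambda>x. Im (f x))" "sq_int lS f"
      using cont_compact_sq_int(1)[OF continuous_on_Re[OF f(1)] K(1) _ S(1)] cont_compact_sq_int(1)[OF continuous_on_Im[OF f(1)] K(1) _ S(1)]
        cont_compact_sq_int(1)[OF f(1) K(1) f(2) S(1)] f(2) by auto
    from sq_intD(2)[OF this(1)] sq_intD(2)[OF this(2)] sq_intD(2)[OF this(3)]
    show "integrable lS (\<lambda>x. (cmod (f x))\<^sup>2)" "(\<integral>x. (cmod (f x))\<^sup>2 \<partial>lS) = nrm S (\<lambda>x. Re (f x)) + nrm S (\<lambda>x. Im (f x))"
      unfolding nrm_def[OF S] by (simp_all add: cmod_power2)
  qed
  have c2: "continuous_on UNIV (\<lambda>x. w1 x + \<i> * w2 x)" by (intro continuous_intros w)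
  note s1 = split[OF c w(4)] and s2 = split[OF c2]
  show "integrable lS (\<lambda>x. (cmod (w x))\<^sup>2)" "integrable lS (\<lambda>x. (cmod (w1 x + \<i> * w2 x))\<^sup>2)" using s1(1) s2(1) z by auto
  have "lamD S * (nrm S (\<lambda>x. Re (w x)) + nrm S (\<lambda>x. Im (w x))) \<le> nrm S (\<lambda>x. Re (w1 x) - Im (w2 x)) + nrm S (\<lambda>x. Re (w2 x) + Im (w1 x))"
  proof (rule wirtinger[OF S K])
    show "has_grad (\<lambda>x. Re (w x)) (Re (w1 x)) (Re (w2 x)) x" "has_grad (\<lambda>x. Im (w x)) (Im (w1 x)) (Im (w2 x)) x" for x
      by (intro has_grad_bounded_linear[OF w(1)] bounded_linear_Re bounded_linear_Im)+
  qed (use w z in \<open>auto intro!: continuous_intros\<close>)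
  then show "lamD S * (\<integral>x. (cmod (w x))\<^sup>2 \<partial>lS) \<le> (\<integral>x. (cmod (w1 x + \<i> * w2 x))\<^sup>2 \<partial>lS)"
    using s1(2) s2(2) z by (simp add: add.commute)
qed

context
  fixes A1 A2 B a11 a12 a21 a22 :: "pt \<Rightarrow> real" and h MA :: real
  assumes A: "\<And>x. x \<in> S \<Longrightarrow> has_grad A1 (a11 x) (a12 x) x" "\<And>x. x \<in> S \<Longrightarrow> has_grad A2 (a21 x) (a22 x) x"
    and ca: "continuous_on S a12" "continuous_on S a21" "continuous_on S B"
    and curlB: "\<And>x. x \<in> S \<Longrightarrow> B x = a21 x - a12 x"
    and bd: "\<And>x. x \<in> S \<Longrightarrow> \<bar>A1 x\<bar> \<le> MA" "\<And>x. x \<in> S \<Longrightarrow> \<bar>A2 x\<bar> \<le> MA" "\<And>x. x \<in> S \<Longrightarrow> \<bar>B x\<bar> \<le> MA"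
    and h: "h > 0"
begin

definition form :: "(pt \<Rightarrow> complex) \<Rightarrow> (pt \<Rightarrow> complex) \<Rightarrow> (pt \<Rightarrow> complex) \<Rightarrow> real" where
  "form u g1 g2 = (\<integral>x. (cmod (mom h A1 g1 u x))\<^sup>2 + (cmod (mom h A2 g2 u x))\<^sup>2 - h * B x * (cmod (u x))\<^sup>2 \<partial>lS)"

lemma cont_A: "continuous_on S A1" "continuous_on S A2"
  using A has_grad_isCont by (blast intro: continuous_at_imp_continuous_on)+

text \<open>The two integrands differ by the curl of
  \<open>(2 h\<^sup>2 a \<partial>\<^sub>1b - h A\<^sub>1 |u|\<^sup>2, 2 h\<^sup>2 a \<partial>\<^sub>2b - h A\<^sub>2 |u|\<^sup>2)\<close> for the test function \<open>u = a + \<i>b\<close>.\<close>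
lemma form_test:
  assumes "test_fun S phi"
  shows "form phi (pd1 phi) (pd2 phi) = (\<integral>x. (cmod (mom h A1 (pd1 phi) phi x + \<i> * mom h A2 (pd2 phi) phi x))\<^sup>2 \<partial>lS)"
    "integrable lS (\<lambda>x. (cmod (mom h A1 (pd1 phi) phi x + \<i> * mom h A2 (pd2 phi) phi x))\<^sup>2)"
proof -
  obtain b11 b12 b22 where b: "\<And>x. has_grad (pd1 phi) (b11 x) (b12 x) x" "\<And>x. has_grad (pd2 phi) (b12 x) (b22 x) x"
    "continuous_on UNIV b12" by (rule test_fun_mixed[OF assms]) blast
  obtain K where K: "compact K" "K \<subseteq> S" "\<And>x. x \<notin> K \<Longrightarrow> phi x = 0 \<and> pd1 phi x = 0 \<and> pd2 phi x = 0"
    by (rule test_fun_support[OF assms]) blast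
  note t = test_fun_smooth[OF assms]
  define q where "q x = Re (phi x) * Re (phi x) + Im (phi x) * Im (phi x)" for x
  define q1 where "q1 x = 2 * (Re (phi x) * Re (pd1 phi x) + Im (phi x) * Im (pd1 phi x))" for x
  define q2 where "q2 x = 2 * (Re (phi x) * Re (pd2 phi x) + Im (phi x) * Im (pd2 phi x))" for x
  note re = has_grad_bounded_linear[OF _ bounded_linear_Re] and im = has_grad_bounded_linear[OF _ bounded_linear_Im]
  have q: "has_grad q (q1 x) (q2 x) x" for x
    using has_grad_add[OF has_grad_mult[OF re[OF t(1)] re[OF t(1)]] has_grad_mult[OF im[OF t(1)] im[OF t(1)]], of x]
    unfolding q_def[abs_def] q1_def q2_def by (simp add: algebra_simps)
  have cs: "continuous_on S phi" "continuous_on S (pd1 phi)" "continuous_on S (pd2 phi)" "continuous_on S b12"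
    using t(2-4) b(3) by (auto intro: continuous_on_subset)
  define P2 where "P2 x = 2 * h\<^sup>2 * (Re (pd2 phi x) * Im (pd1 phi x) + Re (phi x) * Im (b12 x)) - h * (a12 x * q x + A1 x * q2 x)" for x
  define Q1 where "Q1 x = 2 * h\<^sup>2 * (Re (pd1 phi x) * Im (pd2 phi x) + Re (phi x) * Im (b12 x)) - h * (a21 x * q x + A2 x * q1 x)" for x
  define P where "P x = 2 * h\<^sup>2 * (Re (phi x) * Im (pd1 phi x)) - h * (A1 x * q x)" for x
  define Q where "Q x = 2 * h\<^sup>2 * (Re (phi x) * Im (pd2 phi x)) - h * (A2 x * q x)" for x
  have gP: "has_grad P (2 * h\<^sup>2 * (Re (pd1 phi x) * Im (pd1 phi x) + Re (phi x) * Im (b11 x)) - h * (a11 x * q x + A1 x * q1 x)) (P2 x) x" if x: "x \<in> S" for x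
    unfolding P_def[abs_def] P2_def by (intro has_grad_diff has_grad_cmult has_grad_mult re im t b q A x)
  have gQ: "has_grad Q (Q1 x) (2 * h\<^sup>2 * (Re (pd2 phi x) * Im (pd2 phi x) + Re (phi x) * Im (b22 x)) - h * (a22 x * q x + A2 x * q2 x)) x" if x: "x \<in> S" for x
    unfolding Q_def[abs_def] Q1_def by (intro has_grad_diff has_grad_cmult has_grad_mult re im t b q A x)
  have c: "continuous_on S P2" "continuous_on S Q1"
    unfolding P2_def[abs_def] Q1_def[abs_def] q_def q1_def q2_def
    by (intro continuous_intros cs ca cont_A)+
  have z: "P x = 0 \<and> Q x = 0" if "x \<notin> K" for x using K(3)[OF that] by (simp add: P_def Q_def q_def)
  have D: "integrable lS (\<lambda>x. Q1 x - P2 x)" "(\<integral>x. Q1 x - P2 x \<partial>lS) = 0"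
    using curl_integral_zero[OF S(1) K(1,2) z gP gQ c] by blast+
  note qs = test_fun_sq_int(1-3)[OF assms S(1)]
  have "sq_int lS (\<lambda>x. \<i> * mom h A2 (pd2 phi) phi x)"
    using mom_sq_int(1)[OF qs(3,1) cont_A(2) bd(2), of h] unfolding sq_int_def by (auto simp: norm_mult intro!: borel_measurable_times)
  from sq_int_add[OF mom_sq_int(1)[OF qs(2,1) cont_A(1) bd(1)] this]
  show i: "integrable lS (\<lambda>x. (cmod (mom h A1 (pd1 phi) phi x + \<i> * mom h A2 (pd2 phi) phi x))\<^sup>2)"
    by (rule sq_intD(2))
  have "form phi (pd1 phi) (pd2 phi) = (\<integral>x. (cmod (mom h A1 (pd1 phi) phi x + \<i> * mom h A2 (pd2 phi) phi x))\<^sup>2 + (Q1 x - P2 x) \<partial>lS)"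
    unfolding form_def
  proof (rule Bochner_Integration.integral_cong[OF refl])
    fix x assume "x \<in> space lS"
    then have e: "B x = a21 x - a12 x" using curlB[of x] by (simp add: space_lS)
    show "(cmod (mom h A1 (pd1 phi) phi x))\<^sup>2 + (cmod (mom h A2 (pd2 phi) phi x))\<^sup>2 - h * B x * (cmod (phi x))\<^sup>2 =
      (cmod (mom h A1 (pd1 phi) phi x + \<i> * mom h A2 (pd2 phi) phi x))\<^sup>2 + (Q1 x - P2 x)"
      unfolding e cmod_power2 mom_def Q1_def P2_def q_def q1_def q2_def
      by (simp add: power2_eq_square algebra_simps)
  qed
  then show "form phi (pd1 phi) (pd2 phi) = (\<integral>x. (cmod (mom h A1 (pd1 phi) phi x + \<i> * mom h A2 (pd2 phi) phi x))\<^sup>2 \<partial>lS)"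
    using i D by simp
qed

context
  fixes psi psi1 psi2 :: "pt \<Rightarrow> real" and g :: "pt \<Rightarrow> complex" and m M :: real
  assumes psi: "\<And>x. x \<in> S \<Longrightarrow> has_grad psi (psi1 x) (psi2 x) x" "continuous_on S psi1" "continuous_on S psi2"
    "\<And>x. x \<in> S \<Longrightarrow> m \<le> psi x" "\<And>x. x \<in> S \<Longrightarrow> psi x \<le> M"
    and g: "\<And>x. x \<in> S \<Longrightarrow> cmod (g x) = 1" "\<And>x. x \<in> S \<Longrightarrow>
      has_grad g (\<i> * of_real ((A1 x + psi2 x) / h) * g x) (\<i> * of_real ((A2 x - psi1 x) / h) * g x) x"
begin

text \<open>The lower bound \<open>m\<close> of \<open>psi\<close> enters through the norm of
  \<open>w\<close>, the upper bound \<open>M\<close> through its Wirtinger derivative, so the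
  exponent contains their difference.\<close>

lemma form_test_ge:
  assumes "test_fun S phi"
  shows "h\<^sup>2 * lamD S * exp (- 2 * (M - m) / h) * (\<integral>x. (cmod (phi x))\<^sup>2 \<partial>lS) \<le> form phi (pd1 phi) (pd2 phi)"
proof -
  obtain K where K: "compact K" "K \<subseteq> S" "\<And>x. x \<notin> K \<Longrightarrow> phi x = 0 \<and> pd1 phi x = 0 \<and> pd2 phi x = 0"
    by (rule test_fun_support[OF assms]) blast
  note t = test_fun_smooth[OF assms]
  define e where "e x = complex_of_real (exp (psi x / h))" for x
  define w where "w x = e x * (cnj (g x) * phi x)" for x
  \<comment> \<open>Product rule: exp(psi/h) contributes the gradient of \<open>psi\<close>, and the
    conjugate of \<open>g\<close> contributes -i E with E = (A1 + psi2, A2 - psi1), both divided by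
    h.\<close>
  define w1 where "w1 x = e x * cnj (g x) * (pd1 phi x + (of_real (psi1 x / h) - \<i> * of_real ((A1 x + psi2 x) / h)) * phi x)" for x
  define w2 where "w2 x = e x * cnj (g x) * (pd2 phi x + (of_real (psi2 x / h) - \<i> * of_real ((A2 x - psi1 x) / h)) * phi x)" for x
  define p where "p x = mom h A1 (pd1 phi) phi x + \<i> * mom h A2 (pd2 phi) phi x" for x
  let ?z = "\<lambda>f x. if x \<in> S then f x else (0::complex)"
  have gw: "has_grad w (w1 x) (w2 x) x" if x: "x \<in> S" for x
  proof -
    have "((\<lambda>s. complex_of_real (exp (s / h))) has_vector_derivative complex_of_real (exp (psi x / h) / h)) (at (psi x))"
      by (rule has_vector_derivative_of_real) (use h in \<open>auto intro!: derivative_eq_intros simp: has_real_derivative_iff_has_vector_derivative[symmetric]\<close>)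
    from has_grad_mult[OF has_grad_compose[OF psi(1)[OF x] this] has_grad_mult[OF has_grad_bounded_linear[OF g(2)[OF x] bounded_linear_cnj] t(1)]]
    show ?thesis unfolding w_def[abs_def] e_def w1_def w2_def
      by (simp add: algebra_simps scaleR_conv_of_real divide_inverse)
  qed
  have cont: "continuous_on S psi" "continuous_on S g" "continuous_on S phi" "continuous_on S (pd1 phi)" "continuous_on S (pd2 phi)"
    using psi(1) g(2) has_grad_isCont t(2-4) by (blast intro: continuous_at_imp_continuous_on continuous_on_subset)+
  have cw: "continuous_on S w1" "continuous_on S w2"
    using h unfolding w1_def[abs_def] w2_def[abs_def] e_def by (intro continuous_intros cont psi cont_A; simp)+
  have wz: "w x = 0" "w1 x = 0" "w2 x = 0" if "x \<notin> K" for x using K(3)[OF that] by (auto simp: w_def w1_def w2_def)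
  note Kc = compact_imp_closed[OF K(1)]
  have W: "lamD S * (\<integral>x. (cmod (?z w x))\<^sup>2 \<partial>lS) \<le> (\<integral>x. (cmod (?z w1 x + \<i> * ?z w2 x))\<^sup>2 \<partial>lS)"
    "integrable lS (\<lambda>x. (cmod (?z w x))\<^sup>2)" "integrable lS (\<lambda>x. (cmod (?z w1 x + \<i> * ?z w2 x))\<^sup>2)"
    by (rule wirtinger_complex[OF K(1,2) has_grad_extend_zero(1)[OF S(1) Kc K(2) wz(1) gw]
      continuous_on_extend_zero[OF S(1) Kc K(2) cw(1) wz(2)] continuous_on_extend_zero[OF S(1) Kc K(2) cw(2) wz(3)]]; use wz in simp)+
  have n1: "exp (2 * m / h) * (cmod (phi x))\<^sup>2 \<le> (cmod (?z w x))\<^sup>2" if "x \<in> space lS" for x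
  proof -
    have x: "x \<in> S" using that by (simp add: space_lS)
    have "(cmod (?z w x))\<^sup>2 = exp (2 * psi x / h) * (cmod (phi x))\<^sup>2"
      using x g(1)[OF x] by (simp add: w_def e_def norm_mult power_mult_distrib power2_eq_square exp_add[symmetric])
    then show ?thesis using psi(4)[OF x] h by (auto intro!: mult_right_mono divide_right_mono)
  qed
  have n2: "(cmod (?z w1 x + \<i> * ?z w2 x))\<^sup>2 \<le> exp (2 * M / h) / h\<^sup>2 * (cmod (p x))\<^sup>2" if "x \<in> space lS" for x
  proof -
    have x: "x \<in> S" using that by (simp add: space_lS)
    \<comment> \<open>The gradient of \<open>psi\<close> cancels against its rotated copy in E, so
      only the vector potential survives.\<close>
    have "?z w1 x + \<i> * ?z w2 x = e x * cnj (g x) * (\<i> * of_real (1 / h) * p x)"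
      using x h less_imp_neq[OF h] unfolding w1_def w2_def p_def mom_def by (simp add: field_simps)
    then have "(cmod (?z w1 x + \<i> * ?z w2 x))\<^sup>2 = exp (2 * psi x / h) / h\<^sup>2 * (cmod (p x))\<^sup>2"
      using g(1)[OF x] h by (simp add: e_def norm_mult norm_divide power_mult_distrib power2_eq_square exp_add[symmetric])
    then show ?thesis using psi(5)[OF x] h by (auto intro!: mult_right_mono divide_right_mono)
  qed
  have ip: "integrable lS (\<lambda>x. (cmod (p x))\<^sup>2)" "form phi (pd1 phi) (pd2 phi) = (\<integral>x. (cmod (p x))\<^sup>2 \<partial>lS)"
    unfolding p_def using form_test[OF assms] by auto
  have iphi: "integrable lS (\<lambda>x. (cmod (phi x))\<^sup>2)" using sq_intD(2)[OF test_fun_sq_int(1)[OF assms S(1)]] .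
  have 1: "exp (2 * m / h) * (\<integral>x. (cmod (phi x))\<^sup>2 \<partial>lS) \<le> (\<integral>x. (cmod (?z w x))\<^sup>2 \<partial>lS)"
    using integral_mono[OF _ W(2) n1] iphi by simp
  have 2: "(\<integral>x. (cmod (?z w1 x + \<i> * ?z w2 x))\<^sup>2 \<partial>lS) \<le> exp (2 * M / h) / h\<^sup>2 * (\<integral>x. (cmod (p x))\<^sup>2 \<partial>lS)"
    using integral_mono[OF W(3) _ n2] ip(1) by simp
  have "lamD S * (exp (2 * m / h) * (\<integral>x. (cmod (phi x))\<^sup>2 \<partial>lS)) \<le> lamD S * (\<integral>x. (cmod (?z w x))\<^sup>2 \<partial>lS)"
    by (rule mult_left_mono[OF 1 lamD_rayleigh(1)[OF S]])
  also note W(1)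
  also note 2
  finally have 3: "lamD S * (exp (2 * m / h) * (\<integral>x. (cmod (phi x))\<^sup>2 \<partial>lS)) \<le> exp (2 * M / h) / h\<^sup>2 * form phi (pd1 phi) (pd2 phi)"
    unfolding ip(2) .
  have "h\<^sup>2 * lamD S * exp (- 2 * (M - m) / h) * (\<integral>x. (cmod (phi x))\<^sup>2 \<partial>lS) =
      h\<^sup>2 * exp (- (2 * M / h)) * (lamD S * (exp (2 * m / h) * (\<integral>x. (cmod (phi x))\<^sup>2 \<partial>lS)))"
  proof -
    have "exp (- 2 * (M - m) / h) = exp (- (2 * M / h)) * exp (2 * m / h)"
      unfolding exp_add[symmetric] by (simp add: diff_divide_distrib right_diff_distrib)
    then show ?thesis by simp
  qed
  also have "\<dots> \<le> h\<^sup>2 * exp (- (2 * M / h)) * (exp (2 * M / h) / h\<^sup>2 * form phi (pd1 phi) (pd2 phi))"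
    by (rule mult_left_mono[OF 3]) simp
  also have "\<dots> = form phi (pd1 phi) (pd2 phi)" using h by (simp add: exp_minus)
  finally show ?thesis .
qed

text \<open>The vector potential and \<open>B\<close> are bounded on \<open>S\<close>, so both sides
  are continuous along the H^1 approximation by test functions.\<close>

lemma form_H10_ge:
  assumes "H10 S u g1 g2"
  shows "h\<^sup>2 * lamD S * exp (- 2 * (M - m) / h) * L2sq S u \<le> form u g1 g2"
proof -
  note [simp] = L2sq_restrict[OF S(1)]
  obtain phi :: "nat \<Rightarrow> pt \<Rightarrow> complex" where phi: "\<And>n. test_fun S (phi n)" "(\<lambda>n. \<integral>x. (norm (phi n x - u x))\<^sup>2 \<partial>lS) \<longlonglongrightarrow> 0"
    "(\<lambda>n. \<integral>x. (norm (pd1 (phi n) x - g1 x))\<^sup>2 \<partial>lS) \<longlonglongrightarrow> 0" "(\<lambda>n. \<integral>x. (norm (pd2 (phi n) x - g2 x))\<^sup>2 \<partial>lS) \<longlonglongrightarrow> 0"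
    using assms unfolding H10_def by auto
  have q: "sq_int lS u" "sq_int lS g1" "sq_int lS g2" using assms L2_sq_int[OF S(1)] unfolding H10_def by blast+
  note t = test_fun_sq_int(1-3)[OF phi(1) S(1)]
  have mom_lim: "(\<lambda>n. \<integral>x. 1 * (norm (mom h A (f n) (phi n) x))\<^sup>2 \<partial>lS) \<longlonglongrightarrow> (\<integral>x. 1 * (norm (mom h A f' u x))\<^sup>2 \<partial>lS)"
    if f: "\<And>n. sq_int lS (f n)" "sq_int lS f'" "(\<lambda>n. \<integral>x. (norm (f n x - f' x))\<^sup>2 \<partial>lS) \<longlonglongrightarrow> 0"
      and A: "continuous_on S A" "\<And>x. x \<in> S \<Longrightarrow> \<bar>A x\<bar> \<le> MA" for f f' A
  proof (rule sq_int_norm_tendsto(1)[where B=1])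
    show "sq_int lS (mom h A (f n) (phi n))" "sq_int lS (mom h A f' u)" for n
      using mom_sq_int(1)[OF f(1) t(1) A] mom_sq_int(1)[OF f(2) q(1) A] by auto
    have d: "mom h A (f n) (phi n) x - mom h A f' u x = mom h A (\<lambda>x. f n x - f' x) (\<lambda>x. phi n x - u x) x" for n x
      by (simp add: mom_def algebra_simps)
    show "(\<lambda>n. \<integral>x. (norm (mom h A (f n) (phi n) x - mom h A f' u x))\<^sup>2 \<partial>lS) \<longlonglongrightarrow> 0"
    proof (rule tendsto_sandwich[OF _ _ tendsto_const])
      show "(\<lambda>n. 2 * h\<^sup>2 * (\<integral>x. (norm (f n x - f' x))\<^sup>2 \<partial>lS) + 2 * MA\<^sup>2 * (\<integral>x. (norm (phi n x - u x))\<^sup>2 \<partial>lS)) \<longlonglongrightarrow> 0"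
        using tendsto_add[OF tendsto_mult[OF tendsto_const f(3)] tendsto_mult[OF tendsto_const phi(2)], of "2 * h\<^sup>2" "2 * MA\<^sup>2"] by simp
    qed (use mom_sq_int(2)[OF sq_int_diff[OF f(1,2)] sq_int_diff[OF t(1) q(1)] A] in \<open>auto simp: d\<close>)
  qed auto
  have split: "form v v1 v2 = (\<integral>x. 1 * (norm (mom h A1 v1 v x))\<^sup>2 \<partial>lS) + (\<integral>x. 1 * (norm (mom h A2 v2 v x))\<^sup>2 \<partial>lS) - h * (\<integral>x. B x * (norm (v x))\<^sup>2 \<partial>lS)"
    if v: "sq_int lS v" "sq_int lS v1" "sq_int lS v2" for v v1 v2
  proof -
    have "integrable lS (\<lambda>x. B x * (norm (v x))\<^sup>2)"
      by (rule sq_int_norm_tendsto(3)[of lS "\<lambda>_. v", OF v(1) v(1) _ cont_meas[OF ca(3)]]) (use bd(3) in \<open>auto simp: space_lS\<close>)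
    then show ?thesis unfolding form_def
      using sq_intD(2)[OF mom_sq_int(1)[OF v(2,1) cont_A(1) bd(1)]] sq_intD(2)[OF mom_sq_int(1)[OF v(3,1) cont_A(2) bd(2)]]
      by (simp add: mult.assoc)
  qed
  have lB: "(\<lambda>n. \<integral>x. B x * (norm (phi n x))\<^sup>2 \<partial>lS) \<longlonglongrightarrow> (\<integral>x. B x * (norm (u x))\<^sup>2 \<partial>lS)"
    by (rule sq_int_norm_tendsto(1)[OF t(1) q(1) phi(2) cont_meas[OF ca(3)]]) (use bd(3) in \<open>auto simp: space_lS\<close>)
  have lu: "(\<lambda>n. \<integral>x. 1 * (norm (phi n x))\<^sup>2 \<partial>lS) \<longlonglongrightarrow> (\<integral>x. 1 * (norm (u x))\<^sup>2 \<partial>lS)"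
    by (rule sq_int_norm_tendsto(1)[OF t(1) q(1) phi(2), where B=1]) auto
  have lf: "(\<lambda>n. form (phi n) (pd1 (phi n)) (pd2 (phi n))) \<longlonglongrightarrow> form u g1 g2"
    unfolding split[OF t] split[OF q]
    by (intro tendsto_intros mom_lim t q phi cont_A bd lB)
  show ?thesis unfolding L2sq_restrict[OF S(1)]
    by (rule tendsto_le[OF sequentially_bot lf tendsto_mult[OF tendsto_const lu[unfolded mult_1]]])
      (use form_test_ge[OF phi(1)] in simp)
qed

lemma lamP_ge:
  assumes "\<And>x. x \<in> S \<Longrightarrow> A1 x = fst (F x)" "\<And>x. x \<in> S \<Longrightarrow> A2 x = snd (F x)"
  shows "h\<^sup>2 * lamD S * exp (- 2 * (M - m) / h) \<le> lamP h F B S"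
  unfolding lamP_def
proof (rule cInf_greatest)
  \<comment> \<open>The infimum of an empty set of reals would carry no bound, so one admissible
    quotient is exhibited.\<close>
  obtain phi :: "pt \<Rightarrow> real" where phi: "test_fun S phi" "nrm S phi > 0" using nrm_pos_ex[OF S] by blast
  have "test_fun S (\<lambda>x. complex_of_real (phi x))" by (rule test_fun_bounded_linear[OF phi(1) bounded_linear_of_real])
  then have "H10 S (\<lambda>x. complex_of_real (phi x)) (pd1 (\<lambda>x. complex_of_real (phi x))) (pd2 (\<lambda>x. complex_of_real (phi x)))"
    by (rule test_fun_H10[OF _ S(1)])
  moreover have "L2sq S (\<lambda>x. complex_of_real (phi x)) \<noteq> 0"
    using phi(2) unfolding L2sq_restrict[OF S(1)] nrm_def[OF S] by simp
  ultimately show "{(LINT x:S|lborel.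
        (cmod (- \<i> * of_real h * g1 x - of_real (fst (F x)) * u x))\<^sup>2
      + (cmod (- \<i> * of_real h * g2 x - of_real (snd (F x)) * u x))\<^sup>2
      - h * B x * (cmod (u x))\<^sup>2) / L2sq S u
     | u g1 g2. H10 S (u :: pt \<Rightarrow> complex) g1 g2 \<and> L2sq S u \<noteq> 0} \<noteq> {}" by blast
next
  fix r assume "r \<in> {(LINT x:S|lborel.
        (cmod (- \<i> * of_real h * g1 x - of_real (fst (F x)) * u x))\<^sup>2
      + (cmod (- \<i> * of_real h * g2 x - of_real (snd (F x)) * u x))\<^sup>2
      - h * B x * (cmod (u x))\<^sup>2) / L2sq S u
     | u g1 g2. H10 S (u :: pt \<Rightarrow> complex) g1 g2 \<and> L2sq S u \<noteq> 0}"
  then obtain u g1 g2 where r: "r = (LINT x:S|lborel.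
        (cmod (- \<i> * of_real h * g1 x - of_real (fst (F x)) * u x))\<^sup>2
      + (cmod (- \<i> * of_real h * g2 x - of_real (snd (F x)) * u x))\<^sup>2
      - h * B x * (cmod (u x))\<^sup>2) / L2sq S u" and u: "H10 S u g1 g2" "L2sq S u \<noteq> 0" by blast
  have "L2sq S u \<ge> 0" unfolding L2sq_restrict[OF S(1)] by simp
  then have pos: "L2sq S u > 0" using u(2) by simp
  have "r = form u g1 g2 / L2sq S u"
    unfolding r form_def mom_def set_lint_restrict[OF S(1)]
    by (intro arg_cong2[where f="(/)"] Bochner_Integration.integral_cong refl) (simp add: space_lS assms)
  then show "h\<^sup>2 * lamD S * exp (- 2 * (M - m) / h) \<le> r"
    using form_H10_ge[OF u(1)] pos by (simp add: pos_le_divide_eq)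
qed

end

end

end

section \<open>The lower bound\<close>

text \<open>A positive second derivative would make f' positive just to the right of the critical
  point x, and f larger than f(x) there.\<close>

lemma second_derivative_nonpos:
  fixes f f' :: "real \<Rightarrow> real"
  assumes "\<delta> > 0" "\<And>s. \<bar>s - x\<bar> < \<delta> \<Longrightarrow> (f has_real_derivative f' s) (at s)" "\<And>s. \<bar>s - x\<bar> < \<delta> \<Longrightarrow> f s \<le> f x"
    "(f' has_real_derivative l) (at x)"
  shows "l \<le> 0"
proof (rule ccontr)
  assume "\<not> l \<le> 0"
  then have "l > 0" by simp
  from DERIV_pos_inc_right[OF assms(4) this] obtain d where d: "d > 0" "\<And>h. 0 < h \<Longrightarrow> h < d \<Longrightarrow> f' x < f' (x + h)" by blast
  have "f' x = 0"
    by (rule DERIV_local_max[OF assms(2) assms(1)]) (use assms in \<open>auto simp: abs_minus_commute\<close>)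
  define y where "y = x + min d \<delta> / 2"
  have y: "x < y" "y - x < d" "y - x < \<delta>" using d(1) assms(1) by (auto simp: y_def min_def)
  have "(f has_real_derivative f' s) (at s)" if "x \<le> s" "s \<le> y" for s using assms(2)[of s] that y by simp
  from MVT2[OF y(1) this] obtain z where z: "x < z" "z < y" "f y - f x = (y - x) * f' z" by blast
  have "f' z > 0" using d(2)[of "z - x"] z y \<open>f' x = 0\<close> by simp
  then have "f y - f x > 0" using z y by simp
  moreover have "f y \<le> f x" using assms(3)[of y] y by simp
  ultimately show False by simp
qed

lemma circulation_cong:
  assumes "\<And>x. x \<in> frontier D \<Longrightarrow> F x = G x" shows "circulation D F = circulation D G"
proof -
  have "integral {0..1} (\<lambda>t. inner (F (gam t)) (vector_derivative gam (at t))) = integral {0..1} (\<lambda>t. inner (G (gam t)) (vector_derivative gam (at t)))"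
    if "ccw_param D gam" for gam
  proof (rule integral_cong)
    fix t :: real assume "t \<in> {0..1}"
    then have "gam t \<in> frontier D" using that unfolding ccw_param_def by blast
    then show "inner (F (gam t)) (vector_derivative gam (at t)) = inner (G (gam t)) (vector_derivative gam (at t))"
      using assms by simp
  qed
  then have "ccw_param D gam \<and> c = integral {0..1} (\<lambda>t. inner (F (gam t)) (vector_derivative gam (at t))) \<longleftrightarrow>
      ccw_param D gam \<and> c = integral {0..1} (\<lambda>t. inner (G (gam t)) (vector_derivative gam (at t)))" for c gam
    by (intro conj_cong refl) simp
  then show ?thesis unfolding circulation_def by (simp only:)
qed

lemma Cinf_second_derivatives:
  fixes f :: "pt \<Rightarrow> 'b::real_normed_vector"
  assumes "Cinf S T f" "open S"
  obtains f1 f2 f11 f12 f21 f22 where "continuous_on T f" "continuous_on T f1" "continuous_on T f2"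
    "continuous_on T f11" "continuous_on T f12" "continuous_on T f21" "continuous_on T f22"
    "\<And>x. x \<in> S \<Longrightarrow> has_grad f (f1 x) (f2 x) x" "\<And>x. x \<in> S \<Longrightarrow> has_grad f1 (f11 x) (f12 x) x"
    "\<And>x. x \<in> S \<Longrightarrow> has_grad f2 (f21 x) (f22 x) x"
    "\<And>x. x \<in> S \<Longrightarrow> pd1 (pd1 f) x = f11 x" "\<And>x. x \<in> S \<Longrightarrow> pd2 (pd2 f) x = f22 x"
proof -
  obtain f1 f2 where f: "continuous_on T f" "Cinf S T f1" "Cinf S T f2" "\<And>x. x \<in> S \<Longrightarrow> has_grad f (f1 x) (f2 x) x"
    by (rule CinfD[OF assms(1)]) blast
  obtain f11 f12 where g: "continuous_on T f1" "Cinf S T f11" "Cinf S T f12" "\<And>x. x \<in> S \<Longrightarrow> has_grad f1 (f11 x) (f12 x) x"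
    by (rule CinfD[OF f(2)]) blast
  obtain f21 f22 where k: "continuous_on T f2" "Cinf S T f21" "Cinf S T f22" "\<And>x. x \<in> S \<Longrightarrow> has_grad f2 (f21 x) (f22 x) x"
    by (rule CinfD[OF f(3)]) blast
  have e: "f1 y = pd1 f y" "f2 y = pd2 f y" if "y \<in> S" for y using has_grad_pd[OF f(4)[OF that]] by simp_all
  have "has_grad (pd1 f) (f11 x) (f12 x) x" "has_grad (pd2 f) (f21 x) (f22 x) x" if "x \<in> S" for x
    using has_grad_transform[OF g(4)[OF that] assms(2) that e(1)] has_grad_transform[OF k(4)[OF that] assms(2) that e(2)] by blast+
  then have "pd1 (pd1 f) x = f11 x" "pd2 (pd2 f) x = f22 x" if "x \<in> S" for x
    using that has_grad_pd by blast+
  moreover have "continuous_on T k" if "Cinf S T k" for k :: "pt \<Rightarrow> 'b" by (rule CinfD[OF that])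
  ultimately show ?thesis using f(1,4) g k by (intro that[of f1 f2 f11 f12 f21 f22]) blast+
qed

lemma C1cl_gradient:
  assumes "C1cl S f"
  obtains f1 f2 where "continuous_on (closure S) f" "continuous_on (closure S) f1" "continuous_on (closure S) f2"
    "\<And>x. x \<in> S \<Longrightarrow> has_grad f (f1 x) (f2 x) x"
proof -
  obtain f1 f2 where f: "continuous_on (closure S) f" "\<forall>x\<in>S. f differentiable (at x)" "continuous_on (closure S) f1"
    "continuous_on (closure S) f2" "\<forall>x\<in>S. pd1 f x = f1 x \<and> pd2 f x = f2 x" using assms unfolding C1cl_def by blast
  then have "has_grad f (f1 x) (f2 x) x" if "x \<in> S" for x using differentiable_has_grad[of f x] that by auto
  then show ?thesis using that f by blast
qed

section \<open>Logarithmic potentials\<close>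

lemma sqn_pos: "x \<noteq> y \<Longrightarrow> sqn (x - y) > 0" by (simp add: sqn_norm)

text \<open>ln |x - a| through the squared distance, followed by its derivatives. It is harmonic, so
  the remaining pure second derivative is \<open>- logr11\<close>.\<close>

definition logr :: "pt \<Rightarrow> pt \<Rightarrow> real" where "logr a x = ln (sqn (x - a)) / 2"
definition logr1 :: "pt \<Rightarrow> pt \<Rightarrow> real" where "logr1 a x = fst (x - a) / sqn (x - a)"
definition logr2 :: "pt \<Rightarrow> pt \<Rightarrow> real" where "logr2 a x = snd (x - a) / sqn (x - a)"
definition logr11 :: "pt \<Rightarrow> pt \<Rightarrow> real" where
  "logr11 a x = (snd (x - a) * snd (x - a) - fst (x - a) * fst (x - a)) / (sqn (x - a))\<^sup>2"
definition logr12 :: "pt \<Rightarrow> pt \<Rightarrow> real" where "logr12 a x = - 2 * fst (x - a) * snd (x - a) / (sqn (x - a))\<^sup>2"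

lemma has_grad_logr:
  assumes "x \<noteq> a"
  shows "has_grad (logr a) (logr1 a x) (logr2 a x) x" "has_grad (logr1 a) (logr11 a x) (logr12 a x) x"
    "has_grad (logr2 a) (logr12 a x) (- logr11 a x) x"
proof -
  note p = sqn_pos[OF assms]
  have shift: "has_grad (\<lambda>x. f (x - a)) c d x" if "has_grad f c d (x - a)" for f :: "pt \<Rightarrow> real" and c d
    using has_grad_scale_shift[of f c d 1 x a] that by simp
  note q = shift[OF has_grad_sqn]
  have l: "((\<lambda>s. ln s / 2) has_vector_derivative 1 / (2 * sqn (x - a))) (at (sqn (x - a)))"
    "((\<lambda>s. 1 / s) has_vector_derivative - 1 / (sqn (x - a))\<^sup>2) (at (sqn (x - a)))"
    using p by (auto intro!: derivative_eq_intros simp: has_real_derivative_iff_has_vector_derivative[symmetric] power2_eq_square)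
  have half: "(2 * c) *\<^sub>R (1 / (2 * s)) = c / s" for c s :: real by simp
  show "has_grad (logr a) (logr1 a x) (logr2 a x) x"
    using has_grad_compose[OF q l(1)] unfolding half logr_def[abs_def] logr1_def logr2_def .
  have eq: "c / s - c' * (2 * d) / s\<^sup>2 = (c * s - c' * (2 * d)) / s\<^sup>2" if "s > 0" for c c' d s :: real
    using that by (simp add: field_simps power2_eq_square)
  have alg: "(1 * (1 / sqn (x - a)) + fst (x - a) * ((2 * fst (x - a)) *\<^sub>R (- 1 / (sqn (x - a))\<^sup>2))) = logr11 a x"
    "(0 * (1 / sqn (x - a)) + fst (x - a) * ((2 * snd (x - a)) *\<^sub>R (- 1 / (sqn (x - a))\<^sup>2))) = logr12 a x"
    "(0 * (1 / sqn (x - a)) + snd (x - a) * ((2 * fst (x - a)) *\<^sub>R (- 1 / (sqn (x - a))\<^sup>2))) = logr12 a x"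
    "(1 * (1 / sqn (x - a)) + snd (x - a) * ((2 * snd (x - a)) *\<^sub>R (- 1 / (sqn (x - a))\<^sup>2))) = - logr11 a x"
    using p eq[OF p, of 1] unfolding logr11_def logr12_def
    by (simp_all add: divide_simps) (simp_all add: sqn_def power2_eq_square algebra_simps)
  have "has_grad (\<lambda>x. fst (x - a) * (1 / sqn (x - a))) (logr11 a x) (logr12 a x) x"
    "has_grad (\<lambda>x. snd (x - a) * (1 / sqn (x - a))) (logr12 a x) (- logr11 a x) x"
    using has_grad_mult[OF shift[OF has_grad_fst] has_grad_compose[OF q l(2)]]
      has_grad_mult[OF shift[OF has_grad_snd] has_grad_compose[OF q l(2)]] unfolding alg by simp_all
  then show "has_grad (logr1 a) (logr11 a x) (logr12 a x) x" "has_grad (logr2 a) (logr12 a x) (- logr11 a x) x"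
    unfolding logr1_def[abs_def] logr2_def[abs_def] by simp_all
qed

lemma logr_cont:
  assumes "a \<notin> X"
  shows "continuous_on X (logr a)" "continuous_on X (logr1 a)" "continuous_on X (logr2 a)" "continuous_on X (logr11 a)"
proof -
  have p: "sqn (x - a) > 0" if "x \<in> X" for x using sqn_pos[of x a] assms that by metis
  have ne: "sqn (x - a) \<noteq> 0" if "x \<in> X" for x using p[OF that] by simp
  have c: "continuous_on X (\<lambda>x. sqn (x - a))" unfolding sqn_def by (intro continuous_intros)
  show "continuous_on X (logr a)" "continuous_on X (logr1 a)" "continuous_on X (logr2 a)" "continuous_on X (logr11 a)"
    unfolding logr_def[abs_def] logr1_def[abs_def] logr2_def[abs_def] logr11_def[abs_def]
    using ne by (auto intro!: continuous_intros c)
qed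

locale magnetic_domain = holed_domain Om0 Om Hs for Om0 Om :: "pt set" and Hs :: "'k::finite \<Rightarrow> pt set" +
  fixes B psi0 :: "pt \<Rightarrow> real"
  assumes Bsm: "Cinf Om (closure Om) B" and psm: "Cinf Om (closure Om) psi0"
    and lap: "\<And>x. x \<in> Om \<Longrightarrow> lap psi0 x = B x" and bdry: "\<And>x. x \<in> frontier Om \<Longrightarrow> psi0 x = 0"
begin

text \<open>The index type of the holes is inhabited, so there is a pushed boundary curve.\<close>

lemma Om_nonempty: "Om \<noteq> {}"
proof -
  obtain gam v V V' w s0 where c: "collar_data (undefined :: 'k) gam v V V' w s0" using collar_data_ex by blast
  then have "gam 0 + (s0 / 2) *\<^sub>R V 0 \<in> Om" unfolding collar_data_def by auto
  then show ?thesis by blast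
qed

lemma compact_closure_Om: "compact (closure Om)" using bounded_Om by (simp add: compact_closure)

lemma bound_ex:
  fixes f :: "pt \<Rightarrow> real"
  assumes "continuous_on (closure Om) f" obtains M where "M > 0" "\<And>x. x \<in> closure Om \<Longrightarrow> \<bar>f x\<bar> \<le> M"
  using compact_imp_bounded[OF compact_continuous_image[OF assms compact_closure_Om]]
  unfolding bounded_pos by auto

lemma hole_off: "x \<in> Hs j \<Longrightarrow> x \<notin> closure Om"
proof -
  have "open (Hs j)" using DH[of j] by (simp add: smooth_sc_domain_def)
  moreover have "Hs j \<inter> Om = {}" unfolding Om using closure_subset by blast
  ultimately show "x \<in> Hs j \<Longrightarrow> x \<notin> closure Om" using open_Int_closure_eq_empty by blast
qed

definition ctr :: "'k \<Rightarrow> pt" where "ctr j = (SOME x. x \<in> Hs j)"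

lemma ctr: "ctr j \<in> Hs j"
  unfolding ctr_def by (rule someI_ex) (use DH[of j] in \<open>auto simp: smooth_sc_domain_def\<close>)

lemma ctr_off: "ctr j \<notin> closure Om" using hole_off[OF ctr] .

lemma ctr_ne: "x \<in> Om \<Longrightarrow> x \<noteq> ctr j" using ctr_off closure_subset by blast

lemma circulation_lincomb:
  assumes E: "continuous_on (closure Om) E1" "continuous_on (closure Om) E2" "continuous_on (closure Om) F1" "continuous_on (closure Om) F2"
  shows "circulation (Hs j) (\<lambda>x. (E1 x + c * F1 x, E2 x + c * F2 x)) =
    circulation (Hs j) (\<lambda>x. (E1 x, E2 x)) + c * circulation (Hs j) (\<lambda>x. (F1 x, F2 x))"
proof -
  obtain gam v V V' w s0 where cd: "collar_data j gam v V V' w s0" using collar_data_ex by blast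
  then have g: "gam ` {0..1} \<subseteq> closure Om" and dg: "\<And>t. (gam has_vector_derivative v t) (at t)" and cv: "continuous_on {0..1} v"
    using frontier_sub[of j] unfolding collar_data_def ccw_param_def by (auto intro: continuous_on_subset)
  have cg: "continuous_on {0..1} gam"
    using dg has_vector_derivative_continuous by (blast intro: continuous_at_imp_continuous_on)
  have i: "(\<lambda>t. e1 (gam t) * fst (v t) + e2 (gam t) * snd (v t)) integrable_on {0..1}"
    if "continuous_on (closure Om) e1" "continuous_on (closure Om) e2" for e1 e2 :: "pt \<Rightarrow> real"
    by (intro integrable_continuous_interval continuous_intros continuous_on_compose2[OF that(1) cg g] continuous_on_compose2[OF that(2) cg g] cv)
  have "integral {0..1} (\<lambda>t. (E1 (gam t) * fst (v t) + E2 (gam t) * snd (v t)) + c * (F1 (gam t) * fst (v t) + F2 (gam t) * snd (v t))) =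
    line_int E1 E2 gam v + c * line_int F1 F2 gam v"
    unfolding line_int_def using integral_add[OF i[OF E(1,2)] integrable_on_cmult_left[OF i[OF E(3,4)], of c]] by simp
  then have "line_int (\<lambda>x. E1 x + c * F1 x) (\<lambda>x. E2 x + c * F2 x) gam v = line_int E1 E2 gam v + c * line_int F1 F2 gam v"
    unfolding line_int_def by (simp add: algebra_simps)
  moreover have "continuous_on (closure Om) (\<lambda>x. E1 x + c * F1 x)" "continuous_on (closure Om) (\<lambda>x. E2 x + c * F2 x)"
    by (intro continuous_intros E)+
  ultimately show ?thesis using circulation_collar[OF cd] E by simp
qed

lemma circulation_sum:
  assumes E: "continuous_on (closure Om) E1" "continuous_on (closure Om) E2"
    "\<And>i. continuous_on (closure Om) (F1 i)" "\<And>i. continuous_on (closure Om) (F2 i)"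
  shows "circulation (Hs j) (\<lambda>x. (E1 x + (\<Sum>i\<in>I. c i * F1 i x), E2 x + (\<Sum>i\<in>I. c i * F2 i x))) =
    circulation (Hs j) (\<lambda>x. (E1 x, E2 x)) + (\<Sum>i\<in>I. c i * circulation (Hs j) (\<lambda>x. (F1 i x, F2 i x)))"
proof (induction I rule: infinite_finite_induct)
  case (insert a I)
  have c: "continuous_on (closure Om) (\<lambda>x. E1 x + (\<Sum>i\<in>I. c i * F1 i x))" "continuous_on (closure Om) (\<lambda>x. E2 x + (\<Sum>i\<in>I. c i * F2 i x))"
    by (intro continuous_intros E)+
  show ?case using circulation_lincomb[OF c E(3)[of a] E(4)[of a], of j "c a"] insert by (simp add: algebra_simps)
qed auto

text \<open>The rotated gradient of ln |x - a| is the angular form around a, so its circulation is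
  the angle integral recorded in \<open>collar_data\<close>.\<close>

lemma circulation_logr:
  "\<exists>w::real. w * w = 1 \<and> (\<forall>l. circulation (Hs j) (\<lambda>x. (- logr2 (ctr l) x, logr1 (ctr l) x)) = (if l = j then 2 * pi * w else 0))"
proof -
  obtain gam v V V' w s0 where cd: "collar_data j gam v V V' w s0" using collar_data_ex by blast
  have "circulation (Hs j) (\<lambda>x. (- logr2 (ctr l) x, logr1 (ctr l) x)) = (if l = j then 2 * pi * w else 0)" for l
  proof -
    have "circulation (Hs j) (\<lambda>x. (- logr2 (ctr l) x, logr1 (ctr l) x)) = line_int (\<lambda>x. - logr2 (ctr l) x) (logr1 (ctr l)) gam v"
      by (rule circulation_collar[OF cd]) (intro continuous_intros logr_cont ctr_off)+
    also have "\<dots> = ang_int gam v (ctr l)"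
      unfolding line_int_def ang_int_def logr1_def logr2_def
      by (intro integral_cong) (simp add: algebra_simps diff_divide_distrib add_divide_distrib)
    also have "\<dots> = (if l = j then 2 * pi * w else 0)" using cd ctr[of l] unfolding collar_data_def by blast
    finally show ?thesis .
  qed
  moreover have "w * w = 1" using cd by (simp add: collar_data_def)
  then have "real_of_int w * real_of_int w = 1" by (metis of_int_1 of_int_mult)
  ultimately show ?thesis by blast
qed

text \<open>\<open>cgrad\<close> is a limit from within \<open>Om\<close>. Boundary points of a hole
  are limit points of \<open>Om\<close>, so the limit is unique and equals the continuous extension
  of the gradient.\<close>

lemma Phi0_eq:
  assumes G: "continuous_on (closure Om) G1" "continuous_on (closure Om) G2" "\<And>x. x \<in> Om \<Longrightarrow> has_grad psi0 (G1 x) (G2 x) x"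
  shows "Phi0 Om Hs psi0 $ j = circulation (Hs j) (\<lambda>x. (- G2 x, G1 x))"
proof -
  have "cgrad Om psi0 x = (G1 x, G2 x)" if x: "x \<in> frontier (Hs j)" for x
  proof -
    have xc: "x \<in> closure Om" using frontier_sub x by blast
    have "x \<notin> Om" using x unfolding Om frontier_def by blast
    then have "x islimpt Om" using xc by (simp add: closure_def)
    then have nt: "\<not> trivial_limit (at x within Om)" by (simp add: trivial_limit_within)
    have "((\<lambda>y. (G1 y, G2 y)) \<longlongrightarrow> (G1 x, G2 x)) (at x within Om)"
      by (rule tendsto_Pair[OF tendsto_within_subset[OF bspec[OF G(1)[unfolded continuous_on_def] xc] closure_subset]
        tendsto_within_subset[OF bspec[OF G(2)[unfolded continuous_on_def] xc] closure_subset]])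
    then have "((\<lambda>y. (pd1 psi0 y, pd2 psi0 y)) \<longlongrightarrow> (G1 x, G2 x)) (at x within Om)"
      by (subst Lim_cong_within[OF refl refl refl, of x Om _ "\<lambda>y. (G1 y, G2 y)"]) (use has_grad_pd[OF G(3)] in auto)
    then show ?thesis unfolding cgrad_def by (rule tendsto_Lim[OF nt])
  qed
  then show ?thesis unfolding Phi0_def by (simp cong: circulation_cong)
qed

end

section \<open>Assembling the estimate\<close>

context magnetic_domain
begin

lemma psi0_cont: "continuous_on (closure Om) psi0"
  by (rule Cinf_second_derivatives[OF psm open_Om])

lemma psi0_bdd: "bdd_above (psi0 ` Om)" "bdd_below (psi0 ` Om)"
proof -
  obtain M where "\<And>x. x \<in> closure Om \<Longrightarrow> \<bar>psi0 x\<bar> \<le> M" by (rule bound_ex[OF psi0_cont]) blast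
  then have "\<bar>psi0 x\<bar> \<le> M" if "x \<in> Om" for x using that closure_subset by blast
  then have "psi0 x \<le> M" "- M \<le> psi0 x" if "x \<in> Om" for x using that by (simp_all add: abs_le_iff minus_le_iff)
  then show "bdd_above (psi0 ` Om)" "bdd_below (psi0 ` Om)" unfolding bdd_above_def bdd_below_def by blast+
qed

text \<open>The logarithmic correction moves the circulations of \<open>E\<close> from \<Phi> - Phi0
  to y - Phi0, which lies in 2 pi h Z^k. Its size is at most k L dist(\<Phi>, y), so it adds at most
  twice this to the oscillation.\<close>

lemma lamP_ge_lattice:
  assumes A: "C1field Om F" and curl: "\<And>x. x \<in> Om \<Longrightarrow> curl F x = B x" and circ: "\<And>j. circulation (Hs j) F = \<Phi> $ j"
    and h: "h > 0" and L: "\<And>j x. x \<in> closure Om \<Longrightarrow> \<bar>logr (ctr j) x\<bar> \<le> L"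
    and y: "y \<in> latt (Phi0 Om Hs psi0) h"
  shows "h\<^sup>2 * lamD Om * exp (- 2 * (osc Om psi0 + 2 * (L * real CARD('k) * dist \<Phi> y)) / h) \<le> lamP h F B Om"
proof -
  have sub: "\<And>f. continuous_on (closure Om) f \<Longrightarrow> continuous_on Om f" for f :: "pt \<Rightarrow> real"
    using closure_subset continuous_on_subset by blast
  have cl: "C1cl Om (\<lambda>x. fst (F x))" "C1cl Om (\<lambda>x. snd (F x))" using A by (auto simp: C1field_def)
  obtain a11 a12 where A1: "continuous_on (closure Om) (\<lambda>x. fst (F x))" "continuous_on (closure Om) a12"
    "\<And>x. x \<in> Om \<Longrightarrow> has_grad (\<lambda>x. fst (F x)) (a11 x) (a12 x) x"
    by (rule C1cl_gradient[OF cl(1)]) blast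
  obtain a21 a22 where A2: "continuous_on (closure Om) (\<lambda>x. snd (F x))" "continuous_on (closure Om) a21"
    "\<And>x. x \<in> Om \<Longrightarrow> has_grad (\<lambda>x. snd (F x)) (a21 x) (a22 x) x"
    by (rule C1cl_gradient[OF cl(2)]) blast
  have Bc: "continuous_on (closure Om) B" by (rule Cinf_second_derivatives[OF Bsm open_Om])
  have cB: "B x = a21 x - a12 x" if "x \<in> Om" for x
    using curl[OF that] has_grad_pd[OF A1(3)[OF that]] has_grad_pd[OF A2(3)[OF that]] unfolding curl_def by simp
  obtain G1 G2 G11 G12 G21 G22 where G: "continuous_on (closure Om) psi0" "continuous_on (closure Om) G1" "continuous_on (closure Om) G2"
    "continuous_on (closure Om) G22"
    "\<And>x. x \<in> Om \<Longrightarrow> has_grad psi0 (G1 x) (G2 x) x" "\<And>x. x \<in> Om \<Longrightarrow> has_grad G1 (G11 x) (G12 x) x"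
    "\<And>x. x \<in> Om \<Longrightarrow> has_grad G2 (G21 x) (G22 x) x"
    "\<And>x. x \<in> Om \<Longrightarrow> pd1 (pd1 psi0) x = G11 x" "\<And>x. x \<in> Om \<Longrightarrow> pd2 (pd2 psi0) x = G22 x"
    by (rule Cinf_second_derivatives[OF psm open_Om]) blast
  have GB: "B x = G11 x + G22 x" if "x \<in> Om" for x using lap[OF that] G(8,9)[OF that] unfolding lap_def by simp
  obtain w :: "'k \<Rightarrow> real" where w: "\<And>j. w j * w j = 1"
    "\<And>j l. circulation (Hs j) (\<lambda>x. (- logr2 (ctr l) x, logr1 (ctr l) x)) = (if l = j then 2 * pi * w j else 0)"
    using circulation_logr by metis
  obtain v :: "real ^ 'k" where v: "y = Phi0 Om Hs psi0 + v" "\<And>j. \<exists>n::int. v $ j = 2 * pi * h * of_int n"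
    using y unfolding latt_def by blast
  define e where "e j = \<Phi> $ j - y $ j" for j
  \<comment> \<open>The multiple \<open>c j\<close> of the logarithm at \<open>ctr j\<close> has
    circulation 2 pi w j c j around hole j; since w j * w j = 1, this equals the defect
    \<open>e j\<close>.\<close>
  define c where "c j = w j * e j / (2 * pi)" for j
  define psi where "psi x = psi0 x + (\<Sum>j\<in>UNIV. c j * logr (ctr j) x)" for x
  define psi1 where "psi1 x = G1 x + (\<Sum>j\<in>UNIV. c j * logr1 (ctr j) x)" for x
  define psi2 where "psi2 x = G2 x + (\<Sum>j\<in>UNIV. c j * logr2 (ctr j) x)" for x
  have gpsi: "has_grad psi (psi1 x) (psi2 x) x"
    "has_grad psi1 (G11 x + (\<Sum>j\<in>UNIV. c j * logr11 (ctr j) x)) (G12 x + (\<Sum>j\<in>UNIV. c j * logr12 (ctr j) x)) x"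
    "has_grad psi2 (G21 x + (\<Sum>j\<in>UNIV. c j * logr12 (ctr j) x)) (G22 x + (\<Sum>j\<in>UNIV. c j * - logr11 (ctr j) x)) x" if x: "x \<in> Om" for x
    unfolding psi_def[abs_def] psi1_def[abs_def] psi2_def[abs_def]
    by (intro has_grad_add has_grad_sum has_grad_cmult G x has_grad_logr ctr_ne)+
  have cpsi: "continuous_on (closure Om) psi1" "continuous_on (closure Om) psi2"
    unfolding psi1_def[abs_def] psi2_def[abs_def] by (intro continuous_intros G logr_cont ctr_off)+
  define E1 where "E1 x = fst (F x) + psi2 x" for x
  define E2 where "E2 x = snd (F x) - psi1 x" for x
  define b12 where "b12 x = a12 x + (G22 x + (\<Sum>j\<in>UNIV. c j * - logr11 (ctr j) x))" for x
  have gE: "has_grad E1 (a11 x + (G21 x + (\<Sum>j\<in>UNIV. c j * logr12 (ctr j) x))) (b12 x) x"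
    "has_grad E2 (b12 x) (a22 x - (G12 x + (\<Sum>j\<in>UNIV. c j * logr12 (ctr j) x))) x" if x: "x \<in> Om" for x
  proof -
    \<comment> \<open>curl A = B = \<Delta>psi, the logarithms being harmonic: this is the equality
      of the cross derivatives of \<open>E\<close>.\<close>
    have "b12 x = a21 x - (G11 x + (\<Sum>j\<in>UNIV. c j * logr11 (ctr j) x))"
      using GB[OF x] cB[OF x] by (simp add: b12_def sum_negf)
    then show "has_grad E2 (b12 x) (a22 x - (G12 x + (\<Sum>j\<in>UNIV. c j * logr12 (ctr j) x))) x"
      using has_grad_diff[OF A2(3)[OF x] gpsi(2)[OF x]] unfolding E2_def[abs_def] by simp
    show "has_grad E1 (a11 x + (G21 x + (\<Sum>j\<in>UNIV. c j * logr12 (ctr j) x))) (b12 x) x"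
      using has_grad_add[OF A1(3)[OF x] gpsi(3)[OF x]] unfolding E1_def[abs_def] b12_def .
  qed
  have cb: "continuous_on Om b12"
    unfolding b12_def[abs_def] by (intro continuous_intros sub[OF A1(2)] sub[OF G(4)] sub[OF logr_cont(4)] ctr_off)
  have cE: "continuous_on (closure Om) E1" "continuous_on (closure Om) E2"
    unfolding E1_def[abs_def] E2_def[abs_def] by (intro continuous_intros A1 A2 cpsi)+
  have circE: "\<exists>n::int. circulation (Hs l) (\<lambda>x. (E1 x, E2 x)) = 2 * pi * h * n" for l
  proof -
    have "circulation (Hs l) (\<lambda>x. (E1 x, E2 x)) =
      circulation (Hs l) (\<lambda>x. ((fst (F x) + (-1) * - G2 x) + (\<Sum>j\<in>UNIV. (- c j) * - logr2 (ctr j) x),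
        (snd (F x) + (-1) * G1 x) + (\<Sum>j\<in>UNIV. (- c j) * logr1 (ctr j) x)))"
      by (rule arg_cong[where f="circulation (Hs l)"])
        (simp add: fun_eq_iff E1_def E2_def psi1_def psi2_def sum_negf)
    also have "\<dots> = circulation (Hs l) (\<lambda>x. (fst (F x) + (-1) * - G2 x, snd (F x) + (-1) * G1 x)) +
        (\<Sum>j\<in>UNIV. (- c j) * circulation (Hs l) (\<lambda>x. (- logr2 (ctr j) x, logr1 (ctr j) x)))"
      by (rule circulation_sum) (intro continuous_intros A1 A2 G logr_cont ctr_off)+
    also have "circulation (Hs l) (\<lambda>x. (fst (F x) + (-1) * - G2 x, snd (F x) + (-1) * G1 x)) =
        circulation (Hs l) (\<lambda>x. (fst (F x), snd (F x))) + (-1) * circulation (Hs l) (\<lambda>x. (- G2 x, G1 x))"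
      by (rule circulation_lincomb) (intro continuous_intros A1 A2 G)+
    also have "\<dots> = \<Phi> $ l - Phi0 Om Hs psi0 $ l"
      using circ[of l] Phi0_eq[OF G(2,3,5), of l] by simp
    also have "(\<Sum>j\<in>UNIV. (- c j) * circulation (Hs l) (\<lambda>x. (- logr2 (ctr j) x, logr1 (ctr j) x))) = - e l"
    proof -
      have "c l * (2 * pi * w l) = (w l * w l) * e l" by (simp add: c_def)
      then have "c l * (2 * pi * w l) = e l" unfolding w(1) by simp
      then show ?thesis unfolding w(2) by (simp add: if_distrib[of "\<lambda>u. _ * u"] cong: if_cong)
    qed
    finally have "circulation (Hs l) (\<lambda>x. (E1 x, E2 x)) = v $ l" by (simp add: e_def v(1))
    then show ?thesis using v(2)[of l] by simp
  qed
  obtain g where g: "\<And>x. x \<in> Om \<Longrightarrow> cmod (g x) = 1"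
    "\<And>x. x \<in> Om \<Longrightarrow> has_grad g (\<i> * of_real (E1 x / h) * g x) (\<i> * of_real (E2 x / h) * g x) x"
    by (rule gauge[OF gE cb cE h circE]) auto
  define D where "D = L * real CARD('k) * dist \<Phi> y"
  have osc1: "\<bar>psi x - psi0 x\<bar> \<le> D" if x: "x \<in> Om" for x
  proof -
    have "\<bar>c j * logr (ctr j) x\<bar> \<le> dist \<Phi> y * L" for j
    proof -
      have "\<bar>w j\<bar> = 1" using w(1)[of j] abs_square_eq_1[of "w j"] by (simp add: power2_eq_square)
      then have "\<bar>c j\<bar> = \<bar>e j\<bar> / (2 * pi)" by (simp add: c_def abs_mult)
      also have "\<dots> \<le> \<bar>e j\<bar> / 1" using pi_gt3 by (intro divide_left_mono) auto
      also have "\<bar>e j\<bar> / 1 \<le> dist \<Phi> y" using component_le_norm_cart[of "\<Phi> - y" j] by (simp add: e_def dist_norm)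
      finally have "\<bar>c j\<bar> \<le> dist \<Phi> y" .
      moreover have "\<bar>logr (ctr j) x\<bar> \<le> L" using L x closure_subset by blast
      ultimately show ?thesis unfolding abs_mult by (intro mult_mono) auto
    qed
    then have "\<bar>\<Sum>j\<in>UNIV. c j * logr (ctr j) x\<bar> \<le> (\<Sum>j\<in>(UNIV :: 'k set). dist \<Phi> y * L)"
      by (intro order_trans[OF sum_abs] sum_mono)
    then show ?thesis by (simp add: psi_def D_def mult.commute mult.left_commute)
  qed
  let ?m = "(INF x\<in>Om. psi0 x) - D" and ?M = "(SUP x\<in>Om. psi0 x) + D"
  have psib: "?m \<le> psi x" "psi x \<le> ?M" if x: "x \<in> Om" for x
    using osc1[OF x] cINF_lower[OF psi0_bdd(2) x] cSUP_upper[OF x psi0_bdd(1)] by linarith+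
  obtain M1 where M1: "\<And>x. x \<in> closure Om \<Longrightarrow> \<bar>fst (F x)\<bar> \<le> M1" by (rule bound_ex[OF A1(1)]) blast
  obtain M2 where M2: "\<And>x. x \<in> closure Om \<Longrightarrow> \<bar>snd (F x)\<bar> \<le> M2" by (rule bound_ex[OF A2(1)]) blast
  obtain M3 where M3: "\<And>x. x \<in> closure Om \<Longrightarrow> \<bar>B x\<bar> \<le> M3" by (rule bound_ex[OF Bc]) blast
  define MA where "MA = max M1 (max M2 M3)"
  have MA: "\<bar>fst (F x)\<bar> \<le> MA" "\<bar>snd (F x)\<bar> \<le> MA" "\<bar>B x\<bar> \<le> MA" if "x \<in> Om" for x
    using M1[of x] M2[of x] M3[of x] that closure_subset[of Om] unfolding MA_def by fastforce+
  have "h\<^sup>2 * lamD Om * exp (- 2 * (?M - ?m) / h) \<le> lamP h F B Om"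
    by (rule lamP_ge[OF open_Om bounded_Om Om_nonempty A1(3) A2(3) sub[OF A1(2)] sub[OF A2(2)] sub[OF Bc] cB MA h
      gpsi(1) sub[OF cpsi(1)] sub[OF cpsi(2)] psib g(1) g(2)[unfolded E1_def E2_def] refl refl])
  moreover have "?M - ?m = osc Om psi0 + 2 * (L * real CARD('k) * dist \<Phi> y)" by (simp add: osc_def D_def)
  ultimately show ?thesis by (simp only:)
qed

lemma lamP_lower_bound:
  obtains C where "C > 0" "\<And>\<Phi> F h. C1field Om F \<Longrightarrow> (\<And>x. x \<in> Om \<Longrightarrow> curl F x = B x) \<Longrightarrow>
    (\<And>j. circulation (Hs j) F = \<Phi> $ j) \<Longrightarrow> h > 0 \<Longrightarrow>
    h\<^sup>2 * lamD Om * exp (- (C / h) * infdist \<Phi> (latt (Phi0 Om Hs psi0) h)) * exp (- 2 * osc Om psi0 / h) \<le> lamP h F B Om"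
proof -
  have "\<exists>M>0. \<forall>x\<in>closure Om. \<bar>logr (ctr j) x\<bar> \<le> M" for j
    by (rule bound_ex[OF logr_cont(1)[OF ctr_off]]) blast
  then obtain M where M: "\<And>j. M j > 0" "\<And>j x. x \<in> closure Om \<Longrightarrow> \<bar>logr (ctr j) x\<bar> \<le> M j" by metis
  \<comment> \<open>The sum of positive bounds dominates each of them and serves all holes at
    once.\<close>
  define L where "L = (\<Sum>j\<in>UNIV. M j)"
  have M_le: "M j \<le> L" for j
    unfolding L_def by (rule member_le_sum) (use M(1) less_imp_le in auto)
  have L: "L > 0" "\<And>j x. x \<in> closure Om \<Longrightarrow> \<bar>logr (ctr j) x\<bar> \<le> L"
    using M_le M order_trans less_le_trans by blast+
  \<comment> \<open>A factor 2 from the exponent and a factor 2 from the correction acting in both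
    directions.\<close>
  define C where "C = 4 * (L * real CARD('k))"
  have "C > 0" using L(1) by (simp add: C_def)
  moreover have "h\<^sup>2 * lamD Om * exp (- (C / h) * infdist \<Phi> (latt (Phi0 Om Hs psi0) h)) * exp (- 2 * osc Om psi0 / h) \<le> lamP h F B Om"
    if A: "C1field Om F" "\<And>x. x \<in> Om \<Longrightarrow> curl F x = B x" "\<And>j. circulation (Hs j) F = \<Phi> $ j" and h: "h > 0" for \<Phi> F h
  proof -
    let ?X = "latt (Phi0 Om Hs psi0) h"
    let ?f = "\<lambda>d. h\<^sup>2 * lamD Om * exp (- (C / h) * d) * exp (- 2 * osc Om psi0 / h)"
    have "Phi0 Om Hs psi0 + 0 \<in> ?X" unfolding latt_def by (intro CollectI exI[of _ 0] conjI refl allI exI[of _ "0::int"]) simp_all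
    then have ne: "?X \<noteq> {}" by blast
    \<comment> \<open>Strictly above the infimum a lattice point is at hand; letting d decrease to
      the distance afterwards avoids a minimising lattice point.\<close>
    have le: "?f d \<le> lamP h F B Om" if d: "d > infdist \<Phi> ?X" for d
    proof -
      have "(INF y\<in>?X. dist \<Phi> y) < d" using d ne by (simp add: infdist_notempty)
      then obtain y where y: "y \<in> ?X" "dist \<Phi> y < d" by (subst (asm) cINF_less_iff) (use ne in auto)
      have "?f d \<le> ?f (dist \<Phi> y)"
        using y(2) h \<open>C > 0\<close> lamD_rayleigh(1)[OF open_Om bounded_Om Om_nonempty]
        by (intro mult_right_mono mult_left_mono) (auto intro!: mult_left_mono divide_right_mono)
      also have "\<dots> = h\<^sup>2 * lamD Om * exp (- 2 * (osc Om psi0 + 2 * (L * real CARD('k) * dist \<Phi> y)) / h)"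
        unfolding mult.assoc exp_add[symmetric] C_def by (simp add: add_divide_distrib diff_divide_distrib algebra_simps)
      also have "\<dots> \<le> lamP h F B Om" by (rule lamP_ge_lattice[OF A h L(2) y(1)])
      finally show ?thesis .
    qed
    have "(\<lambda>n. infdist \<Phi> ?X + inverse (real (Suc n))) \<longlonglongrightarrow> infdist \<Phi> ?X + 0"
      by (intro tendsto_intros LIMSEQ_inverse_real_of_nat)
    then have "(\<lambda>n. ?f (infdist \<Phi> ?X + inverse (real (Suc n)))) \<longlonglongrightarrow> ?f (infdist \<Phi> ?X + 0)"
      by (intro tendsto_mult[OF tendsto_mult[OF tendsto_const tendsto_exp[OF tendsto_mult[OF tendsto_const]]] tendsto_const])
    then have "?f (infdist \<Phi> ?X + 0) \<le> lamP h F B Om"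
      by (rule LIMSEQ_le_const2) (use le in auto)
    then show ?thesis by simp
  qed
  ultimately show ?thesis by (rule that)
qed

text \<open>A positive maximum would be interior because of the boundary values; there both pure
  second derivatives are nonpositive, against \<Delta>psi0 = B > 0.\<close>

lemma psi0_nonpos:
  assumes B: "\<And>x. x \<in> Om \<Longrightarrow> B x > 0" and x: "x \<in> Om"
  shows "psi0 x \<le> 0"
proof (rule ccontr)
  assume "\<not> psi0 x \<le> 0"
  obtain z where z: "z \<in> closure Om" "\<And>y. y \<in> closure Om \<Longrightarrow> psi0 y \<le> psi0 z"
    using continuous_attains_sup[OF compact_closure_Om _ psi0_cont] Om_nonempty closure_subset by blast
  have "psi0 z > 0" using z(2)[of x] x closure_subset \<open>\<not> psi0 x \<le> 0\<close> by fastforce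
  then have zO: "z \<in> Om" using bdry[of z] z(1) open_Om by (auto simp: frontier_def interior_open)
  obtain G1 G2 G11 G12 G21 G22 where
    G: "\<And>x. x \<in> Om \<Longrightarrow> has_grad psi0 (G1 x) (G2 x) x" "\<And>x. x \<in> Om \<Longrightarrow> has_grad G1 (G11 x) (G12 x) x"
    "\<And>x. x \<in> Om \<Longrightarrow> has_grad G2 (G21 x) (G22 x) x"
    "\<And>x. x \<in> Om \<Longrightarrow> pd1 (pd1 psi0) x = G11 x" "\<And>x. x \<in> Om \<Longrightarrow> pd2 (pd2 psi0) x = G22 x"
    by (rule Cinf_second_derivatives[OF psm open_Om]) blast
  obtain \<delta> where \<delta>: "\<delta> > 0" "ball z \<delta> \<subseteq> Om" using open_Om zO open_contains_ball by blast
  obtain p q where pq: "z = (p, q)" by (cases z)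
  have in1: "(s, q) \<in> Om" if "\<bar>s - p\<bar> < \<delta>" for s
    using \<delta>(2) that by (auto simp: pq subset_iff dist_Pair_Pair dist_real_def abs_minus_commute)
  have in2: "(p, s) \<in> Om" if "\<bar>s - q\<bar> < \<delta>" for s
    using \<delta>(2) that by (auto simp: pq subset_iff dist_Pair_Pair dist_real_def abs_minus_commute)
  have le: "psi0 y \<le> psi0 (p, q)" if "y \<in> Om" for y using z(2)[of y] that closure_subset pq by blast
  note r = has_real_derivative_iff_has_vector_derivative
  have "G11 (p, q) \<le> 0"
    by (rule second_derivative_nonpos[OF \<delta>(1), of p "\<lambda>s. psi0 (s, q)" "\<lambda>s. G1 (s, q)"])
      (use zO pq in \<open>auto simp: r intro!: has_grad_slice1 G in1 le\<close>)
  moreover have "G22 (p, q) \<le> 0"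
    by (rule second_derivative_nonpos[OF \<delta>(1), of q "\<lambda>s. psi0 (p, s)" "\<lambda>s. G2 (p, s)"])
      (use zO pq in \<open>auto simp: r intro!: has_grad_slice2 G in2 le\<close>)
  ultimately have "B z \<le> 0" using lap[OF zO] G(4,5)[OF zO] pq by (simp add: lap_def)
  then show False using B[OF zO] by simp
qed

lemma osc_le:
  assumes "\<And>x. x \<in> Om \<Longrightarrow> B x > 0" shows "osc Om psi0 \<le> - (INF x\<in>Om. psi0 x)"
  using cSUP_least[OF Om_nonempty psi0_nonpos[OF assms]] by (simp add: osc_def)

end

theorem theorem5p2:
  fixes Om0 Om :: "pt set" and Hs :: "'k::finite \<Rightarrow> pt set"
    and B psi0 :: "pt \<Rightarrow> real"
  assumes "smooth_sc_domain Om0"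
    and "\<forall>j. smooth_sc_domain (Hs j)"
    and "\<forall>i j. i \<noteq> j \<longrightarrow> closure (Hs i) \<inter> closure (Hs j) = {}"
    and "\<forall>j. closure (Hs j) \<subseteq> Om0"
    and "Om = Om0 - (\<Union>j. closure (Hs j))"
    and "connected Om"
    and "Cinf Om (closure Om) B"
    and "Cinf Om (closure Om) psi0"
    and "\<forall>x\<in>Om. lap psi0 x = B x"
    and "\<forall>x\<in>frontier Om. psi0 x = 0"
  shows "\<exists>C>0.
     (\<forall>(\<Phi>::real ^ 'k) A h. C1field Om A \<and> (\<forall>x\<in>Om. curl A x = B x) \<and>
        (\<forall>j. circulation (Hs j) A = \<Phi> $ j) \<and> h > 0 \<longrightarrow>
        lamP h A B Om \<ge> h\<^sup>2 * lamD Om * exp (- (C / h) * infdist \<Phi> (latt (Phi0 Om Hs psi0) h))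
                         * exp (- 2 * osc Om psi0 / h)) \<and>
     ((\<forall>x\<in>Om. B x > 0) \<longrightarrow>
      (\<forall>(\<Phi>::real ^ 'k) A h. C1field Om A \<and> (\<forall>x\<in>Om. curl A x = B x) \<and>
        (\<forall>j. circulation (Hs j) A = \<Phi> $ j) \<and> h > 0 \<longrightarrow>
        lamP h A B Om \<ge> h\<^sup>2 * lamD Om * exp (- (C / h) * infdist \<Phi> (latt (Phi0 Om Hs psi0) h))
                         * exp (2 * (INF x\<in>Om. psi0 x) / h)))"
proof -
  interpret magnetic_domain Om0 Om Hs B psi0
    by unfold_locales (use assms in blast)+
  obtain C where C: "C > 0" "\<And>\<Phi> F h. C1field Om F \<Longrightarrow> (\<And>x. x \<in> Om \<Longrightarrow> curl F x = B x) \<Longrightarrow>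
    (\<And>j. circulation (Hs j) F = \<Phi> $ j) \<Longrightarrow> h > 0 \<Longrightarrow>
    h\<^sup>2 * lamD Om * exp (- (C / h) * infdist \<Phi> (latt (Phi0 Om Hs psi0) h)) * exp (- 2 * osc Om psi0 / h) \<le> lamP h F B Om"
    by (rule lamP_lower_bound) blast
  have nn: "h\<^sup>2 * lamD Om * exp (- (C / h) * d) \<ge> 0" for h d
    using lamD_rayleigh(1)[OF open_Om bounded_Om Om_nonempty] by simp
  \<comment> \<open>By \<open>osc_le\<close> the second bound is the weaker one, so the same
    constant serves both.\<close>
  have e: "exp (2 * (INF x\<in>Om. psi0 x) / h) \<le> exp (- 2 * osc Om psi0 / h)" if "\<forall>x\<in>Om. B x > 0" "h > 0" for h
    using osc_le that divide_right_mono[of "2 * (INF x\<in>Om. psi0 x)" "- 2 * osc Om psi0" h] by simp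
  show ?thesis
  proof (intro exI[of _ C] conjI C(1) allI impI; elim conjE)
    fix \<Phi> :: "real ^ 'k" and A and h :: real
    assume *: "C1field Om A" "\<forall>x\<in>Om. curl A x = B x" "\<forall>j. circulation (Hs j) A = \<Phi> $ j" "h > 0"
    show bound: "h\<^sup>2 * lamD Om * exp (- (C / h) * infdist \<Phi> (latt (Phi0 Om Hs psi0) h)) * exp (- 2 * osc Om psi0 / h) \<le> lamP h A B Om"
      by (rule C(2)) (use * in blast)+
    assume "\<forall>x\<in>Om. B x > 0"
    then show "h\<^sup>2 * lamD Om * exp (- (C / h) * infdist \<Phi> (latt (Phi0 Om Hs psi0) h)) * exp (2 * (INF x\<in>Om. psi0 x) / h) \<le> lamP h A B Om"
      using order_trans[OF mult_left_mono[OF e nn] bound] *(4) by blast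
  qed
qed

end
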